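(* Let $\{X_n\}_{n\ge 0}$ be a Markov chain on $\mathbb T$ admitting a stationary probability measure $\mu$, equivalent to Lebesgue measure, with transfer operator $\mathcal P_\mu$, such that: (i) there is $\bar\gamma\in(0,1)$ with $\|\mathcal P_\mu(\phi)\|_{L^2(\mu)}\le\bar\gamma\|\phi\|_{L^2(\mu)}$ for all $\phi\in L^2(\mu)$ with $\int_{\mathbb T}\phi\,d\mu=0$; (ii) $\mathcal P_\mu:L^2(\mu)\to W^{1,2}(\mu)$ is bounded, i.e. for every $\phi\in L^2(\mu)$ the function $\mathcal P_\mu(\phi)$ has a weak derivative $\mathcal P_\mu(\phi)'$ with $\|\mathcal P_\mu(\phi)'\|_{L^2(\mu)}\le C_r\|\phi\|_{L^2(\mu)}$, for some $C_r>0$. Let $\mathcal P_{\mu,N}$ be the $N$-fold tensor product of $\mathcal P_\mu$, let $\{H_N\}_N$ be a sequence of measurable sets $H_N\subset\mathbb T^N$ with $\mu_N(H_N)\to0$ as $N\to\infty$, and let $\mathcal P_{\mu,H_N}(\phi)=\mathcal P_{\mu,N}(\phi\,1_{\mathbb T^N\setminus H_N})$. Then there exist $N_0\in\mathbb N$ and $D_0>0$ independent of $N$ such that, for all $N\ge N_0$, the process of $N$ independent copies of $\{X_n\}_{n\ge0}$ conditioned on never entering $H_N$ has a quasi-stationary density $\psi_N$ satisfying $$\|\psi_N-1\|_{W^{1,2}(\mu_N)}\le D_0\sqrt{\mu_N(H_N)} ,$$ and its associated eigenvalue $\lambda_N$ satisfies $$|\lambda_N-1|\le(1+D_0)\,\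mu_N(H_N).$$
   Context: $\mathbb T$ is the unit circle (one-dimensional torus). A Markov chain on $\mathbb T$ with transition kernel $p(x,\cdot)$ acts on finite measures by $\bar p(\nu)(A)=\int_{\mathbb T}p(x,A)\,d\nu(x)$; a stationary measure is a probability measure $\mu$ with $\bar p(\mu)=\mu$. The transfer operator with respect to a stationary measure $\mu$ is $\mathcal P_\mu:L^1(\mu)\to L^1(\mu)$, $\mathcal P_\mu(\phi)=\frac{d\,\bar p(\phi\,d\mu)}{d\mu}$. For $N\ge1$, $\mu_N=\mu\otimes\cdots\otimes\mu$ ($N$ factors), and $\mathcal P_{\mu,N}$ is the unique bounded linear operator with $\mathcal P_{\mu,N}(\otimes_{i=1}^N\phi_i)=\otimes_{i=1}^N\mathcal P_\mu(\phi_i)$ for all $\phi_i\in L^1(\mu)$; it is the transfer operator, with respect to $\mu_N$, of $N$ independent copies of the chain. A quasi-stationary density for the process of $N$ independent copies conditioned on never entering $H_N$ is a probability density $\psi_N$ with respect to $\mu_N$ ($\psi_N\ge0$, $\int\psi_N\,d\mu_N=1$) which is an eigenfunction of $\mathcal P_{\mu,H_N}$ with an eigenvalue $\lambda_N>0$ (its associated eigenvalue): $\mathcal P_{\mu,H_N}\psi_N=\lambda_N\psi_N$. Sobolev spaces: $W^{1,2}(\mu)=\{\phi\in L^2(\mu):\phi'\in L^2(\mu)\}$ with $\phi'$ the weak derivative and norm $\|\phi\|_{L^2(\mu)}+\|\phi'\|_{L^2(\mu)}$; $W^{1,2}(\mu_N)=\{\phi\in L^2(\mu_N):|\nabla\phi|\in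 L^2(\mu_N)\}$ with $\nabla\phi$ the weak gradient and norm $\|\phi\|_{W^{1,2}(\mu_N)}=\|\phi\|_{L^2(\mu_N)}+\|\,|\nabla\phi|\,\|_{L^2(\mu_N)}$. Weak derivatives are in the usual sense (with respect to Lebesgue measure). *)

theory Defs
  imports "HOL-Probability.Probability"
begin

section \<open>The circle and the torus\<close>

text \<open>
  The circle is represented by its fundamental domain \<open>[0,1)\<close>, with coordinate in
  \<open>\<real>/\<int>\<close>. A point of the \<open>N\<close>-torus is an extensional function on \<open>{..<N}\<close> with values in
  \<open>[0,1)\<close>. The measure below serves both as Borel space and as Lebesgue measure.
\<close>

definition circle :: "real measure" where
  "circle = restrict_space lborel {0..<1}"

definition torus :: "nat \<Rightarrow> (nat \<Rightarrow> real) measure" where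
  "torus N = PiM {..<N} (\<lambda>_. circle)"

definition power_measure :: "real measure \<Rightarrow> nat \<Rightarrow> (nat \<Rightarrow> real) measure" where
  "power_measure \<mu> N = PiM {..<N} (\<lambda>_. \<mu>)"


section \<open>The space \<open>L\<^sup>2\<close>\<close>

text \<open>Elements of \<open>L\<^sup>1\<close> and \<open>L\<^sup>2\<close> are represented by functions, not by classes.\<close>

definition L2 :: "'a measure \<Rightarrow> ('a \<Rightarrow> real) set" where
  "L2 M = {f \<in> borel_measurable M. integrable M (\<lambda>x. (f x)\<^sup>2)}"

definition L2_norm :: "'a measure \<Rightarrow> ('a \<Rightarrow> real) \<Rightarrow> real" where
  "L2_norm M f = sqrt (\<integral>x. (f x)\<^sup>2 \<partial>M)"


section \<open>Stationary measures and transfer operators\<close>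

text \<open>
  For a kernel \<open>p\<close> and a measure \<open>\<nu>\<close>, the measure \<open>A \<mapsto> \<integral> p(x,A) d\<nu>(x)\<close> is \<open>\<nu> \<bind> p\<close>.
\<close>

definition stationary :: "(real \<Rightarrow> real measure) \<Rightarrow> real measure \<Rightarrow> bool" where
  "stationary p \<mu> \<longleftrightarrow> prob_space \<mu> \<and> sets \<mu> = sets circle \<and> \<mu> \<bind> p = \<mu>"

text \<open>
  The density of the image of the signed measure \<open>\<phi> d\<mu>\<close>; since the library's measures are
  nonnegative, it is computed from the positive and the negative part of \<open>\<phi>\<close>.
\<close>

definition transfer_op ::
  "(real \<Rightarrow> real measure) \<Rightarrow> real measure \<Rightarrow> (real \<Rightarrow> real) \<Rightarrow> real \<Rightarrow> real" where
  "transfer_op p \<mu> \<phi> x =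
     enn2real (RN_deriv \<mu> (density \<mu> (\<lambda>y. ennreal (\<phi> y)) \<bind> p) x) -
     enn2real (RN_deriv \<mu> (density \<mu> (\<lambda>y. ennreal (- \<phi> y)) \<bind> p) x)"

definition bounded_linear_L1 :: "'a measure \<Rightarrow> (('a \<Rightarrow> real) \<Rightarrow> 'a \<Rightarrow> real) \<Rightarrow> bool" where
  "bounded_linear_L1 M Q \<longleftrightarrow>
     (\<forall>\<phi>. integrable M \<phi> \<longrightarrow> integrable M (Q \<phi>)) \<and>
     (\<forall>\<phi> \<psi> a b. integrable M \<phi> \<longrightarrow> integrable M \<psi> \<longrightarrow>
        (AE x in M. Q (\<lambda>y. a * \<phi> y + b * \<psi> y) x = a * Q \<phi> x + b * Q \<psi> x)) \<and>
     (\<exists>C. \<forall>\<phi>. integrable M \<phi> \<longrightarrow> (\<integral>x. \<bar>Q \<phi> x\<bar> \<partial>M) \<le> C * (\<integral>x. \<bar>\<phi> x\<bar> \<partial>M))"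

definition is_tensor_power ::
  "real measure \<Rightarrow> ((real \<Rightarrow> real) \<Rightarrow> real \<Rightarrow> real) \<Rightarrow> nat \<Rightarrow>
   (((nat \<Rightarrow> real) \<Rightarrow> real) \<Rightarrow> (nat \<Rightarrow> real) \<Rightarrow> real) \<Rightarrow> bool" where
  "is_tensor_power \<mu> P N Q \<longleftrightarrow>
     bounded_linear_L1 (power_measure \<mu> N) Q \<and>
     (\<forall>\<phi>. (\<forall>i<N. integrable \<mu> (\<phi> i)) \<longrightarrow>
        (AE x in power_measure \<mu> N.
           Q (\<lambda>y. \<Prod>i<N. \<phi> i (y i)) x = (\<Prod>i<N. P (\<phi> i) (x i))))"

text \<open>The tensor power is unique only up to null sets, hence a choice and not \<open>THE\<close>.\<close>

definition tensor_power ::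
  "real measure \<Rightarrow> ((real \<Rightarrow> real) \<Rightarrow> real \<Rightarrow> real) \<Rightarrow> nat \<Rightarrow>
   ((nat \<Rightarrow> real) \<Rightarrow> real) \<Rightarrow> (nat \<Rightarrow> real) \<Rightarrow> real" where
  "tensor_power \<mu> P N = (SOME Q. is_tensor_power \<mu> P N Q)"

definition transfer_op_N ::
  "(real \<Rightarrow> real measure) \<Rightarrow> real measure \<Rightarrow> nat \<Rightarrow>
   ((nat \<Rightarrow> real) \<Rightarrow> real) \<Rightarrow> (nat \<Rightarrow> real) \<Rightarrow> real" where
  "transfer_op_N p \<mu> N = tensor_power \<mu> (transfer_op p \<mu>) N"

definition transfer_op_hole ::
  "(real \<Rightarrow> real measure) \<Rightarrow> real measure \<Rightarrow> nat \<Rightarrow> (nat \<Rightarrow> real) set \<Rightarrow>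
   ((nat \<Rightarrow> real) \<Rightarrow> real) \<Rightarrow> (nat \<Rightarrow> real) \<Rightarrow> real" where
  "transfer_op_hole p \<mu> N H \<phi> =
     transfer_op_N p \<mu> N (\<lambda>x. \<phi> x * indicator (space (torus N) - H) x)"

definition quasi_stationary_density ::
  "(real \<Rightarrow> real measure) \<Rightarrow> real measure \<Rightarrow> nat \<Rightarrow> (nat \<Rightarrow> real) set \<Rightarrow>
   ((nat \<Rightarrow> real) \<Rightarrow> real) \<Rightarrow> real \<Rightarrow> bool" where
  "quasi_stationary_density p \<mu> N H \<psi> l \<longleftrightarrow>
     integrable (power_measure \<mu> N) \<psi> \<and>
     (AE x in power_measure \<mu> N. \<psi> x \<ge> 0) \<and>
     (\<integral>x. \<psi> x \<partial>power_measure \<mu> N) = 1 \<and>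
     l > 0 \<and>
     (AE x in power_measure \<mu> N. transfer_op_hole p \<mu> N H \<psi> x = l * \<psi> x)"


section \<open>Weak derivatives and Sobolev spaces\<close>

text \<open>
  Test functions on the circle are the smooth 1-periodic functions on the line. The two
  integrability conditions are local integrability on the circle, which is compact.
\<close>

definition test_function1 :: "(real \<Rightarrow> real) \<Rightarrow> bool" where
  "test_function1 \<tau> \<longleftrightarrow>
     (\<forall>n. ((deriv ^^ n) \<tau>) differentiable_on UNIV) \<and> (\<forall>x. \<tau> (x + 1) = \<tau> x)"

definition has_weak_deriv :: "(real \<Rightarrow> real) \<Rightarrow> (real \<Rightarrow> real) \<Rightarrow> bool" where
  "has_weak_deriv f g \<longleftrightarrow>
     integrable circle f \<and> integrable circle g \<and>
     (\<forall>\<tau>. test_function1 \<tau> \<longrightarrow>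
        (\<integral>x. f x * deriv \<tau> x \<partial>circle) = - (\<integral>x. g x * \<tau> x \<partial>circle))"

definition partial_deriv ::
  "nat \<Rightarrow> ((nat \<Rightarrow> real) \<Rightarrow> real) \<Rightarrow> (nat \<Rightarrow> real) \<Rightarrow> real" where
  "partial_deriv i f x = deriv (\<lambda>t. f (x(i := t))) (x i)"

text \<open>
  \<open>extensional {..<N}\<close> plays the role of \<open>\<real>\<^sup>N\<close>. A function is smooth iff its iterated partial
  derivatives of all orders exist and are continuous.
\<close>

definition smooth_fun :: "nat \<Rightarrow> ((nat \<Rightarrow> real) \<Rightarrow> real) \<Rightarrow> bool" where
  "smooth_fun N \<tau> \<longleftrightarrow>
     (\<forall>is. set is \<subseteq> {..<N} \<longrightarrow>
        continuous_on (extensional {..<N}) (foldr partial_deriv is \<tau>) \<and>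
        (\<forall>x\<in>extensional {..<N}. \<forall>i<N.
           (\<lambda>t. foldr partial_deriv is \<tau> (x(i := t))) differentiable (at (x i))))"

definition test_function :: "nat \<Rightarrow> ((nat \<Rightarrow> real) \<Rightarrow> real) \<Rightarrow> bool" where
  "test_function N \<tau> \<longleftrightarrow>
     smooth_fun N \<tau> \<and> (\<forall>x\<in>extensional {..<N}. \<forall>i<N. \<tau> (x(i := x i + 1)) = \<tau> x)"

definition has_weak_gradient ::
  "nat \<Rightarrow> ((nat \<Rightarrow> real) \<Rightarrow> real) \<Rightarrow> (nat \<Rightarrow> (nat \<Rightarrow> real) \<Rightarrow> real) \<Rightarrow> bool" where
  "has_weak_gradient N f g \<longleftrightarrow>
     integrable (torus N) f \<and>
     (\<forall>i<N. integrable (torus N) (g i) \<and>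
        (\<forall>\<tau>. test_function N \<tau> \<longrightarrow>
           (\<integral>x. f x * partial_deriv i \<tau> x \<partial>torus N) = - (\<integral>x. g i x * \<tau> x \<partial>torus N)))"

text \<open>The weak gradient is unique only up to null sets, which do not affect the norm below.\<close>

definition weak_gradient ::
  "nat \<Rightarrow> ((nat \<Rightarrow> real) \<Rightarrow> real) \<Rightarrow> nat \<Rightarrow> (nat \<Rightarrow> real) \<Rightarrow> real" where
  "weak_gradient N f = (SOME g. has_weak_gradient N f g)"

definition gradient_norm :: "nat \<Rightarrow> ((nat \<Rightarrow> real) \<Rightarrow> real) \<Rightarrow> (nat \<Rightarrow> real) \<Rightarrow> real" where
  "gradient_norm N f x = L2_set (\<lambda>i. weak_gradient N f i x) {..<N}"

definition W12 :: "real measure \<Rightarrow> nat \<Rightarrow> ((nat \<Rightarrow> real) \<Rightarrow> real) set" where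
  "W12 \<mu> N = {f \<in> L2 (power_measure \<mu> N).
     (\<exists>g. has_weak_gradient N f g) \<and> gradient_norm N f \<in> L2 (power_measure \<mu> N)}"

definition W12_norm :: "real measure \<Rightarrow> nat \<Rightarrow> ((nat \<Rightarrow> real) \<Rightarrow> real) \<Rightarrow> real" where
  "W12_norm \<mu> N f =
     L2_norm (power_measure \<mu> N) f + L2_norm (power_measure \<mu> N) (gradient_norm N f)"

end

(* Write P for the transfer operator of one chain, T for that of N copies, g for the gap of P.  The
   bounds on T are proved on finite sums u of tensor products and extended by density.  There the
   norms of u and T u are quadratic forms in Schur products of Gram matrices.  If G_i, R_i, E_i are
   the Gram matrices of the i-th factors, of their images under P and of their means, then the gap
   says R_i <= g^2 (G_i - E_i) + E_i, and Schur products preserve this order.  This gives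
   |T u|^2 <= g^2 |u|^2 + (1 - g^2) (mean of u)^2.  For the gradient, the smoothing of P bounds the
   Gram matrix of the derivatives in the i-th factor by C^2 (G_i - E_i), which is at most
   C^2 / (1 - g^2) (G_i - R_i); since the sum over i of (G_i - R_i) times the R_l with l /= i is at
   most the product of the G_i, |grad T u|^2 <= C^2 / (1 - g^2) |u|^2, uniformly in N.  As the density
   of mu need not be bounded below, passing to the limit in the definition of the weak gradient
   also uses bounds with respect to Lebesgue measure; these may depend on N.

   With 1' the indicator of the complement of the hole H and h = mu_N(H), the quasi-stationary
   density is the fixed point of u -> T (u 1') / (integral of u 1'), which for small h contracts the
   probability densities in the L^2 ball of radius c sqrt h about the constant 1.  The density u
   satisfies u - 1 = T w / l with w centered and |w| <= (c + 1) sqrt h, so the gradient bound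
   applies to it. *)

theory Submission
  imports Defs
begin

section \<open>Square-integrable functions\<close>

text \<open>The hypotheses bound derivatives in \<open>L2 \<mu>\<close>, while weak gradients are
  tested against Lebesgue measure. For one factor each derivative is Lebesgue integrable, but no
  bound comes with it; completeness of \<open>L2 \<mu>\<close> supplies one
  (\<open>D_bounded_L1\<close>). In dimension one this yields a sup bound for
  \<open>P \<phi>\<close>, hence boundedness of P from \<open>L2 \<mu>\<close> to
  \<open>L2 circle\<close>, which passes to tensors at the price of a factor per coordinate. These
  bounds only identify limits. The two topologies are never compared in norm: they meet in almost
  everywhere convergence, since both measures have the same null sets.

  The operator \<open>T N\<close> is a choice, known through its values on products and its L1
  bound. Positivity and conservation of mass come from identifying it with the transfer operator of
  the product kernel.

  The constant c = 2 / (1 - \<gamma>) is dictated by the fixed point: on the ball of radius c * sqrt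
  h one step produces a deviation of at most \<gamma> (c + 1) sqrt h divided by the surviving mass.
  With this c, \<gamma> (c + 1) = c - 2 + \<gamma> < c - 1, and the slack absorbs a mass slightly
  below 1.\<close>

lemma L2_measurable [measurable_dest]: "f \<in> L2 M \<Longrightarrow> f \<in> borel_measurable M"
  by (simp add: L2_def)

lemma L2_square_integrable: "f \<in> L2 M \<Longrightarrow> integrable M (\<lambda>x. (f x)\<^sup>2)"
  by (simp add: L2_def)

lemma L2I: "f \<in> borel_measurable M \<Longrightarrow> integrable M (\<lambda>x. (f x)\<^sup>2) \<Longrightarrow> f \<in> L2 M"
  by (simp add: L2_def)

lemma L2_mult_integrable:
  assumes "f \<in> L2 M" "g \<in> L2 M"
  shows "integrable M (\<lambda>x. f x * g x)"
proof (rule Bochner_Integration.integrable_bound)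
  show "integrable M (\<lambda>x. (f x)\<^sup>2 + (g x)\<^sup>2)"
    using assms by (simp add: L2_square_integrable)
  show "AE x in M. norm (f x * g x) \<le> norm ((f x)\<^sup>2 + (g x)\<^sup>2)"
  proof (intro AE_I2)
    fix x
    have "2 * (\<bar>f x\<bar> * \<bar>g x\<bar>) \<le> (f x)\<^sup>2 + (g x)\<^sup>2"
      using sum_squares_bound[of "\<bar>f x\<bar>" "\<bar>g x\<bar>"] by simp
    moreover have "0 \<le> \<bar>f x\<bar> * \<bar>g x\<bar>" by simp
    ultimately have "\<bar>f x\<bar> * \<bar>g x\<bar> \<le> (f x)\<^sup>2 + (g x)\<^sup>2" by linarith
    then show "norm (f x * g x) \<le> norm ((f x)\<^sup>2 + (g x)\<^sup>2)"
      by (simp add: abs_mult)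
  qed
qed (use assms in \<open>auto simp: L2_def\<close>)

lemma L2_add: "f \<in> L2 M \<Longrightarrow> g \<in> L2 M \<Longrightarrow> (\<lambda>x. f x + g x) \<in> L2 M"
  using L2_mult_integrable[of f M g]
  by (auto intro!: L2I simp: power2_sum L2_square_integrable L2_measurable mult.assoc)

lemma L2_cmult: "f \<in> L2 M \<Longrightarrow> (\<lambda>x. c * f x) \<in> L2 M"
  by (auto intro!: L2I simp: power_mult_distrib L2_square_integrable L2_measurable)

lemma L2_diff: "f \<in> L2 M \<Longrightarrow> g \<in> L2 M \<Longrightarrow> (\<lambda>x. f x - g x) \<in> L2 M"
  using L2_add[of f M "\<lambda>x. (-1) * g x"] L2_cmult[of g M "-1"] by simp

lemma L2_zero [simp]: "(\<lambda>x. 0) \<in> L2 M"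
  by (simp add: L2_def)

lemma L2_sum: "(\<And>i. i \<in> I \<Longrightarrow> f i \<in> L2 M) \<Longrightarrow> (\<lambda>x. \<Sum>i\<in>I. f i x) \<in> L2 M"
  by (induction I rule: infinite_finite_induct) (auto intro: L2_add)

lemma L2_const: "finite_measure M \<Longrightarrow> (\<lambda>x. c) \<in> L2 M"
  by (intro L2I) (auto simp: finite_measure.integrable_const)

lemma L2_cong_AE:
  assumes "f \<in> L2 M" "g \<in> borel_measurable M" "AE x in M. f x = g x"
  shows "g \<in> L2 M" "L2_norm M g = L2_norm M f"
proof -
  have [measurable]: "f \<in> borel_measurable M" using assms(1) by (rule L2_measurable)
  note [measurable] = assms(2)
  show "g \<in> L2 M"
    using L2_square_integrable[OF assms(1)] assms(3)
    by (intro L2I) (auto elim!: integrable_cong_AE_imp)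
  show "L2_norm M g = L2_norm M f"
    unfolding L2_norm_def using assms(3) by (auto intro!: arg_cong[where f=sqrt] integral_cong_AE)
qed

lemma L2_bounded_mult:
  assumes "f \<in> L2 M" "g \<in> borel_measurable M" "\<And>x. x \<in> space M \<Longrightarrow> \<bar>g x\<bar> \<le> 1"
  shows "(\<lambda>x. f x * g x) \<in> L2 M" "L2_norm M (\<lambda>x. f x * g x) \<le> L2_norm M f"
proof -
  have [measurable]: "f \<in> borel_measurable M" using assms(1) by (rule L2_measurable)
  note [measurable] = assms(2)
  have *: "(f x * g x)\<^sup>2 \<le> (f x)\<^sup>2" if "x \<in> space M" for x
  proof -
    have "(g x)\<^sup>2 \<le> 1" using assms(3)[OF that] by (simp add: abs_square_le_1)
    then show ?thesis
      using mult_left_mono[of "(g x)\<^sup>2" 1 "(f x)\<^sup>2"] by (simp add: power_mult_distrib)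
  qed
  show 1: "(\<lambda>x. f x * g x) \<in> L2 M"
    by (intro L2I, measurable)
       (rule Bochner_Integration.integrable_bound[OF L2_square_integrable[OF assms(1)]], measurable, use * in auto)
  show "L2_norm M (\<lambda>x. f x * g x) \<le> L2_norm M f"
    unfolding L2_norm_def using * L2_square_integrable[OF 1] L2_square_integrable[OF assms(1)]
    by (intro real_sqrt_le_mono integral_mono) auto
qed

lemma L2_norm_nonneg [simp]: "0 \<le> L2_norm M f"
  by (simp add: L2_norm_def)

lemma L2_norm_power2: "(L2_norm M f)\<^sup>2 = (\<integral>x. (f x)\<^sup>2 \<partial>M)"
  by (simp add: L2_norm_def)

lemma L2_norm_le_iff: "0 \<le> c \<Longrightarrow> L2_norm M f \<le> c \<longleftrightarrow> (\<integral>x. (f x)\<^sup>2 \<partial>M) \<le> c\<^sup>2"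
  by (metis L2_norm_nonneg L2_norm_power2 power2_le_imp_le power_mono)

lemma L2_norm_cmult: "L2_norm M (\<lambda>x. c * f x) = \<bar>c\<bar> * L2_norm M f"
  by (simp add: L2_norm_def power_mult_distrib real_sqrt_mult)

lemma L2_norm_minus_commute: "L2_norm M (\<lambda>x. f x - g x) = L2_norm M (\<lambda>x. g x - f x)"
  by (simp add: L2_norm_def power2_commute)

text \<open>The integral of (s f + t g)^2 is a nonnegative quadratic form in s and t. Keeping both
  variables allows the choice s = -b, t = a, which gives a (a c - b^2) without any division.\<close>

lemma L2_Cauchy_Schwarz:
  assumes "f \<in> L2 M" "g \<in> L2 M"
  shows "\<bar>\<integral>x. f x * g x \<partial>M\<bar> \<le> L2_norm M f * L2_norm M g"
proof -
  define a b c where "a = (\<integral>x. (f x)\<^sup>2 \<partial>M)" "b = (\<integral>x. f x * g x \<partial>M)" "c = (\<integral>x. (g x)\<^sup>2 \<partial>M)"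
  have pos: "0 \<le> a" "0 \<le> c" by (auto simp: a_b_c_def)
  have quad: "0 \<le> a * s\<^sup>2 + 2 * b * s * t + c * t\<^sup>2" for s t
  proof -
    have "0 \<le> (\<integral>x. (s * f x + t * g x)\<^sup>2 \<partial>M)" by simp
    also have "(\<lambda>x. (s * f x + t * g x)\<^sup>2) =
        (\<lambda>x. s\<^sup>2 * (f x)\<^sup>2 + t\<^sup>2 * (g x)\<^sup>2 + (2 * s * t) * (f x * g x))"
      by (auto simp: power2_eq_square algebra_simps)
    also have "(\<integral>x. s\<^sup>2 * (f x)\<^sup>2 + t\<^sup>2 * (g x)\<^sup>2 + (2 * s * t) * (f x * g x) \<partial>M) =
        a * s\<^sup>2 + 2 * b * s * t + c * t\<^sup>2"
      using assms L2_mult_integrable[OF assms] by (simp add: L2_square_integrable a_b_c_def)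
    finally show ?thesis .
  qed
  have "b\<^sup>2 \<le> a * c"
  proof (cases "a = 0")
    case True
    have "b = 0"
    proof (rule ccontr)
      assume "b \<noteq> 0"
      \<comment> \<open>With a = 0 the form is affine in s, and this s gives it the value -1 at t =
        1.\<close>
      have "0 \<le> 2 * b * (-(c+1)/(2*b)) * 1 + c * 1\<^sup>2"
        using quad[of "-(c+1)/(2*b)" 1] True by simp
      with \<open>b \<noteq> 0\<close> show False by simp
    qed
    then show ?thesis using True by simp
  next
    case False
    then have "a > 0" using pos by simp
    have "0 \<le> a * (-b)\<^sup>2 + 2 * b * (-b) * a + c * a\<^sup>2" using quad[of "-b" a] .
    also have "\<dots> = a * (a * c - b\<^sup>2)" by (simp add: power2_eq_square algebra_simps)
    finally show ?thesis using \<open>a > 0\<close> by (simp add: zero_le_mult_iff)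
  qed
  then have "sqrt (b\<^sup>2) \<le> sqrt (a * c)" by (rule real_sqrt_le_mono)
  then show ?thesis
    by (simp add: L2_norm_def a_b_c_def real_sqrt_mult)
qed

lemma L2_norm_triangle:
  assumes "f \<in> L2 M" "g \<in> L2 M"
  shows "L2_norm M (\<lambda>x. f x + g x) \<le> L2_norm M f + L2_norm M g"
proof -
  have "(\<integral>x. (f x + g x)\<^sup>2 \<partial>M) = (\<integral>x. (f x)\<^sup>2 + (g x)\<^sup>2 + 2 * (f x * g x) \<partial>M)"
    by (simp add: power2_sum mult.assoc)
  also have "\<dots> = (L2_norm M f)\<^sup>2 + (L2_norm M g)\<^sup>2 + 2 * (\<integral>x. f x * g x \<partial>M)"
    using assms L2_mult_integrable[OF assms] by (simp add: L2_square_integrable L2_norm_power2)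
  also have "\<dots> \<le> (L2_norm M f + L2_norm M g)\<^sup>2"
    using L2_Cauchy_Schwarz[OF assms] by (simp add: power2_sum)
  finally show ?thesis by (simp add: L2_norm_le_iff)
qed

lemma L2_norm_diff_triangle:
  assumes "f \<in> L2 M" "g \<in> L2 M" "h \<in> L2 M"
  shows "L2_norm M (\<lambda>x. f x - h x) \<le> L2_norm M (\<lambda>x. f x - g x) + L2_norm M (\<lambda>x. g x - h x)"
  using L2_norm_triangle[OF L2_diff[OF assms(1,2)] L2_diff[OF assms(2,3)]] by simp

lemma L2_norm_le_add_diff:
  assumes "f \<in> L2 M" "g \<in> L2 M"
  shows "L2_norm M f \<le> L2_norm M g + L2_norm M (\<lambda>x. f x - g x)"
  using L2_norm_triangle[OF assms(2) L2_diff[OF assms]] by simp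

context prob_space
begin

lemma L2_integrable: "f \<in> L2 M \<Longrightarrow> integrable M f"
  using L2_mult_integrable[of f M "\<lambda>_. 1"] L2_const[of M 1] finite_measure_axioms by simp

lemma L2_abs_integral_le: "f \<in> L2 M \<Longrightarrow> (\<integral>x. \<bar>f x\<bar> \<partial>M) \<le> L2_norm M f"
proof -
  assume f: "f \<in> L2 M"
  have "(\<lambda>x. \<bar>f x\<bar>) \<in> L2 M" using f by (auto simp: L2_def)
  from L2_Cauchy_Schwarz[OF this L2_const[of M 1]]
  show ?thesis using finite_measure_axioms by (simp add: L2_norm_def prob_space)
qed

lemma L2_integral_le: "f \<in> L2 M \<Longrightarrow> \<bar>\<integral>x. f x \<partial>M\<bar> \<le> L2_norm M f"
  using L2_abs_integral_le[of f] integral_abs_bound[of M f] by linarith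

lemma L2_centered_square:
  assumes "f \<in> L2 M"
  shows "(\<integral>x. (f x - (\<integral>y. f y \<partial>M))\<^sup>2 \<partial>M) = (\<integral>x. (f x)\<^sup>2 \<partial>M) - (\<integral>x. f x \<partial>M)\<^sup>2"
proof -
  let ?m = "\<integral>y. f y \<partial>M"
  have "(\<integral>x. (f x - ?m)\<^sup>2 \<partial>M) = (\<integral>x. (f x)\<^sup>2 + ?m\<^sup>2 - (2 * ?m) * f x \<partial>M)"
    by (simp add: power2_diff mult_ac)
  also have "\<dots> = (\<integral>x. (f x)\<^sup>2 \<partial>M) + ?m\<^sup>2 - (2 * ?m) * ?m"
    using L2_integrable[OF assms] L2_square_integrable[OF assms] by (simp add: prob_space)
  finally show ?thesis by (simp add: power2_eq_square)
qed

end

text \<open>Integrability of the limit is part of the conclusion, and the bounds \<open>c n\<close>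
  may vary with n: approximation errors are kept in \<open>c n\<close> and disappear in the limit
  b.\<close>

lemma integral_Fatou_bound:
  fixes u :: "nat \<Rightarrow> 'a \<Rightarrow> real"
  assumes u: "\<And>n. integrable M (u n)" "\<And>n x. 0 \<le> u n x"
    and v: "v \<in> borel_measurable M" "AE x in M. (\<lambda>n. u n x) \<longlonglongrightarrow> v x"
    and c: "\<And>n. (\<integral>x. u n x \<partial>M) \<le> c n" "c \<longlonglongrightarrow> b"
  shows "integrable M v" "(\<integral>x. v x \<partial>M) \<le> b"
proof -
  note [measurable] = v(1)
  have [measurable]: "\<And>n. u n \<in> borel_measurable M" using u(1) by auto
  have c0: "0 \<le> c n" for n
    using c(1)[of n] Bochner_Integration.integral_nonneg[of M "u n"] u(2) by (meson order_trans)
  have b0: "0 \<le> b" using c0 by (intro LIMSEQ_le_const[OF c(2)]) auto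
  have "AE x in M. 0 \<le> v x"
    using v(2) by eventually_elim (use u(2) in \<open>auto intro: LIMSEQ_le_const\<close>)
  have "(\<integral>\<^sup>+x. ennreal (v x) \<partial>M) = (\<integral>\<^sup>+x. liminf (\<lambda>n. ennreal (u n x)) \<partial>M)"
    using v(2)
    by (intro nn_integral_cong_AE) (auto elim!: eventually_mono intro!: lim_imp_Liminf[symmetric] tendsto_ennrealI)
  also have "\<dots> \<le> liminf (\<lambda>n. \<integral>\<^sup>+x. ennreal (u n x) \<partial>M)"
    by (rule nn_integral_liminf) auto
  also have "\<dots> \<le> liminf (\<lambda>n. ennreal (c n))"
    by (intro Liminf_mono always_eventually allI)
       (subst nn_integral_eq_integral, use u c(1) in \<open>auto intro!: ennreal_leI\<close>)
  also have "\<dots> = ennreal b"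
    by (intro lim_imp_Liminf tendsto_ennrealI c) auto
  finally have *: "(\<integral>\<^sup>+x. ennreal (v x) \<partial>M) \<le> ennreal b" .
  show int: "integrable M v"
    using * \<open>AE x in M. 0 \<le> v x\<close>
    by (intro integrableI_nonneg) (auto simp: le_less_trans[OF _ ennreal_less_top])
  have "ennreal (\<integral>x. v x \<partial>M) \<le> ennreal b"
    using * nn_integral_eq_integral[OF int \<open>AE x in M. 0 \<le> v x\<close>] by simp
  then show "(\<integral>x. v x \<partial>M) \<le> b" using b0 by simp
qed

text \<open>Riesz-Fischer argument. Summable increments produce one function that is both the almost
  everywhere limit and the L1 limit; having both is what later allows limits for different measures
  to be compared.\<close>

lemma L1_limit:
  fixes f :: "nat \<Rightarrow> 'a \<Rightarrow> real"
  assumes f: "\<And>n. integrable M (f n)"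
    and a: "\<And>n. (\<integral>x. \<bar>f (Suc n) x - f n x\<bar> \<partial>M) \<le> a n" "summable a"
  shows "\<exists>g. integrable M g \<and> (AE x in M. (\<lambda>n. f n x) \<longlonglongrightarrow> g x) \<and>
           (\<lambda>n. \<integral>x. \<bar>f n x - g x\<bar> \<partial>M) \<longlonglongrightarrow> 0"
proof -
  define d where "d n x = f (Suc n) x - f n x" for n x
  have [measurable]: "\<And>n. f n \<in> borel_measurable M" using f by auto
  have d: "integrable M (d n)" for n unfolding d_def using f by simp
  then have [measurable]: "\<And>n. d n \<in> borel_measurable M" by auto
  have sd: "summable (\<lambda>n. \<integral>x. norm (d n x) \<partial>M)"
    using a by (intro summable_comparison_test'[OF a(2), of 0]) (auto simp: d_def)
  have "(\<integral>\<^sup>+x. (\<Sum>n. ennreal (norm (d n x))) \<partial>M) = (\<Sum>n. \<integral>\<^sup>+x. ennreal (norm (d n x)) \<partial>M)"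
    by (rule nn_integral_suminf) auto
  also have "\<dots> = (\<Sum>n. ennreal (\<integral>x. norm (d n x) \<partial>M))"
    by (intro suminf_cong nn_integral_eq_integral) (use d in auto)
  also have "\<dots> < \<infinity>"
    by (subst suminf_ennreal2[OF _ sd]) auto
  finally have fin: "(\<integral>\<^sup>+x. (\<Sum>n. ennreal (norm (d n x))) \<partial>M) \<noteq> \<infinity>" by simp
  have AEs: "AE x in M. summable (\<lambda>n. norm (d n x))"
  proof -
    have "AE x in M. (\<Sum>n. ennreal (norm (d n x))) \<noteq> \<infinity>"
      by (rule nn_integral_noteq_infinite[OF _ fin]) measurable
    then show ?thesis
    proof eventually_elim
      case (elim x)
      show ?case by (rule summable_suminf_not_top) (use elim in auto)
    qed
  qed
  have int_s: "integrable M (\<lambda>x. \<Sum>n. norm (d n x))"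
    by (rule integrable_suminf) (use d AEs sd in auto)
  define g where "g x = f 0 x + (\<Sum>n. d n x)" for x
  have int_g: "integrable M g"
    unfolding g_def
    by (intro Bochner_Integration.integrable_add f integrable_suminf) (use d AEs sd in auto)
  have [measurable]: "g \<in> borel_measurable M" using int_g by auto
  have tel: "f n x = f 0 x + (\<Sum>k<n. d k x)" for n x
    by (induction n) (auto simp: d_def)
  have conv: "AE x in M. (\<lambda>n. f n x) \<longlonglongrightarrow> g x"
    using AEs
  proof eventually_elim
    case (elim x)
    have "(\<lambda>n. f 0 x + (\<Sum>k<n. d k x)) \<longlonglongrightarrow> g x"
      unfolding g_def
      by (intro tendsto_add tendsto_const summable_LIMSEQ summable_norm_cancel[OF elim])
    then show ?case by (simp only: tel[symmetric])
  qed
  \<comment> \<open>The difference g - f n is the tail of the series of increments, so the full sum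
    of absolute increments dominates it for all n at once.\<close>
  have bnd: "AE x in M. norm \<bar>f n x - g x\<bar> \<le> (\<Sum>n. norm (d n x))" for n
    using AEs
  proof eventually_elim
    case (elim x)
    have "g x - f n x = (\<Sum>k. d (k + n) x)"
      using suminf_split_initial_segment[OF summable_norm_cancel[OF elim], of n] tel[of n x]
      unfolding g_def by linarith
    then have "norm \<bar>f n x - g x\<bar> = norm (\<Sum>k. d (k + n) x)"
      by (simp add: abs_minus_commute)
    also have "\<dots> \<le> (\<Sum>k. norm (d (k + n) x))"
      by (intro summable_norm) (use summable_iff_shift[of "\<lambda>k. norm (d k x)" n] elim in simp)
    also have "\<dots> \<le> (\<Sum>k. norm (d k x))"
      using suminf_split_initial_segment[OF elim, of n] sum_nonneg[of "{..<n}" "\<lambda>k. norm (d k x)"] by simp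
    finally show ?case .
  qed
  have "(\<lambda>n. \<integral>x. \<bar>f n x - g x\<bar> \<partial>M) \<longlonglongrightarrow> (\<integral>x. 0 \<partial>M)"
  proof (rule integral_dominated_convergence[where w="\<lambda>x. \<Sum>n. norm (d n x)"])
    show "AE x in M. (\<lambda>n. \<bar>f n x - g x\<bar>) \<longlonglongrightarrow> 0"
      using conv by eventually_elim (simp add: tendsto_rabs_zero_iff LIM_zero_iff)
  qed (use int_s bnd in auto)
  with int_g conv show ?thesis by auto
qed

lemma L1_limit_AE_unique:
  assumes f: "\<And>n. integrable M (f n)" and g: "integrable M g" "integrable M h"
    and lim: "(\<lambda>n. \<integral>x. \<bar>f n x - g x\<bar> \<partial>M) \<longlonglongrightarrow> 0" "(\<lambda>n. \<integral>x. \<bar>f n x - h x\<bar> \<partial>M) \<longlonglongrightarrow> (0::real)"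
  shows "AE x in M. g x = h x"
proof -
  have "(\<integral>x. \<bar>g x - h x\<bar> \<partial>M) \<le> 0"
  proof (rule LIMSEQ_le_const[OF tendsto_add[OF lim, simplified]], intro exI allI impI)
    fix n
    have "(\<integral>x. \<bar>g x - h x\<bar> \<partial>M) \<le> (\<integral>x. \<bar>f n x - g x\<bar> + \<bar>f n x - h x\<bar> \<partial>M)"
      using f g by (intro integral_mono) auto
    also have "\<dots> = (\<integral>x. \<bar>f n x - g x\<bar> \<partial>M) + (\<integral>x. \<bar>f n x - h x\<bar> \<partial>M)"
      using f g by simp
    finally show "(\<integral>x. \<bar>g x - h x\<bar> \<partial>M) \<le> (\<integral>x. \<bar>f n x - g x\<bar> \<partial>M) + (\<integral>x. \<bar>f n x - h x\<bar> \<partial>M)" .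
  qed
  moreover have "0 \<le> (\<integral>x. \<bar>g x - h x\<bar> \<partial>M)" by simp
  ultimately have "(\<integral>x. \<bar>g x - h x\<bar> \<partial>M) = 0" by linarith
  then show ?thesis
    using integral_nonneg_eq_0_iff_AE[of M "\<lambda>x. \<bar>g x - h x\<bar>"] g by simp
qed

text \<open>Besides a limit, the tail of the series of the \<open>a k\<close> is returned as a rate.
  The gliding hump argument and the fixed point iteration both use this rate.\<close>

lemma (in prob_space) L2_complete:
  assumes f: "\<And>n. f n \<in> L2 M"
    and a: "\<And>n. L2_norm M (\<lambda>x. f (Suc n) x - f n x) \<le> a n" "summable a"
  shows "\<exists>g\<in>L2 M. (AE x in M. (\<lambda>n. f n x) \<longlonglongrightarrow> g x) \<and>
           (\<forall>n. L2_norm M (\<lambda>x. f n x - g x) \<le> (\<Sum>k. a (k + n)))"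
proof -
  have [measurable]: "\<And>n. f n \<in> borel_measurable M" using f by (auto simp: L2_def)
  have a0: "0 \<le> a n" for n using a(1)[of n] L2_norm_nonneg order_trans by blast
  have sa: "summable (\<lambda>k. a (k + n))" for n using a(2) by (simp add: summable_iff_shift)
  obtain g where g: "integrable M g" "AE x in M. (\<lambda>n. f n x) \<longlonglongrightarrow> g x"
    using L1_limit[of M f a] L2_integrable[OF f] a L2_abs_integral_le[OF L2_diff[OF f f]]
    by (meson order_trans)
  have [measurable]: "g \<in> borel_measurable M" using g by auto
  have tail: "L2_norm M (\<lambda>x. f n x - f (m + n) x) \<le> (\<Sum>k. a (k + n))" for n m
  proof -
    have "L2_norm M (\<lambda>x. f n x - f (m + n) x) \<le> (\<Sum>k<m. a (k + n))"
    proof (induction m)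
      case 0 show ?case by (simp add: L2_norm_def)
    next
      case (Suc m)
      have "L2_norm M (\<lambda>x. f n x - f (Suc m + n) x) \<le>
          L2_norm M (\<lambda>x. f n x - f (m + n) x) + L2_norm M (\<lambda>x. f (m + n) x - f (Suc m + n) x)"
        by (intro L2_norm_diff_triangle f)
      also have "L2_norm M (\<lambda>x. f (m + n) x - f (Suc m + n) x) \<le> a (m + n)"
        using a(1)[of "m + n"] L2_norm_minus_commute[of M "f (m+n)" "f (Suc m + n)"] by simp
      finally show ?case using Suc by simp
    qed
    also have "\<dots> \<le> (\<Sum>k. a (k + n))"
      by (intro sum_le_suminf sa) (auto simp: a0)
    finally show ?thesis .
  qed
  \<comment> \<open>For fixed n, Fatou's lemma in m turns the bound on f n - f (m + n) into one on f
    n - g. Membership of g in \<open>L2 M\<close> then follows from n = 0.\<close>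
  have main: "integrable M (\<lambda>x. (f n x - g x)\<^sup>2)" "(\<integral>x. (f n x - g x)\<^sup>2 \<partial>M) \<le> (\<Sum>k. a (k + n))\<^sup>2" for n
  proof -
    note F = integral_Fatou_bound[where u="\<lambda>m x. (f n x - f (m + n) x)\<^sup>2" and v="\<lambda>x. (f n x - g x)\<^sup>2"
        and c="\<lambda>_. (\<Sum>k. a (k + n))\<^sup>2" and b="(\<Sum>k. a (k + n))\<^sup>2" and M=M]
    have 1: "AE x in M. (\<lambda>m. (f n x - f (m + n) x)\<^sup>2) \<longlonglongrightarrow> (f n x - g x)\<^sup>2"
      using g(2) by eventually_elim (intro tendsto_intros LIMSEQ_ignore_initial_segment)
    have 2: "(\<integral>x. (f n x - f (m + n) x)\<^sup>2 \<partial>M) \<le> (\<Sum>k. a (k + n))\<^sup>2" for m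
      using tail[of n m] by (subst (asm) L2_norm_le_iff) (auto intro!: suminf_nonneg sa a0)
    show "integrable M (\<lambda>x. (f n x - g x)\<^sup>2)"
      by (rule F(1)) (use 1 2 L2_square_integrable[OF L2_diff[OF f f]] in auto)
    show "(\<integral>x. (f n x - g x)\<^sup>2 \<partial>M) \<le> (\<Sum>k. a (k + n))\<^sup>2"
      by (rule F(2)) (use 1 2 L2_square_integrable[OF L2_diff[OF f f]] in auto)
  qed
  have "(\<lambda>x. f 0 x - g x) \<in> L2 M" using main(1)[of 0] by (intro L2I) auto
  from L2_diff[OF f[of 0] this] have "g \<in> L2 M" by simp
  moreover have "L2_norm M (\<lambda>x. f n x - g x) \<le> (\<Sum>k. a (k + n))" for n
    using main(2)[of n] by (subst L2_norm_le_iff) (auto intro!: suminf_nonneg sa a0)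
  ultimately show ?thesis using g(2) by blast
qed


section \<open>Transfer operators of stationary kernels\<close>

text \<open>Since \<open>ennreal\<close> truncates negative reals to 0, the densities
  \<open>ennreal (h x)\<close> and \<open>ennreal (- h x)\<close> of the difference h are its
  positive and negative parts. They define finite measures that agree on a pi-system containing the
  whole space, hence everywhere; so both parts coincide and h vanishes almost everywhere.\<close>

lemma integrable_AE_eq_generator:
  fixes f g :: "'a \<Rightarrow> real"
  assumes E: "Int_stable E" "E \<subseteq> Pow (space M)" "sets M = sigma_sets (space M) E" "space M \<in> E"
    and M: "sigma_finite_measure M"
    and f: "integrable M f" and g: "integrable M g"
    and eq: "\<And>A. A \<in> E \<Longrightarrow> (\<integral>x. f x * indicator A x \<partial>M) = (\<integral>x. g x * indicator A x \<partial>M)"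
  shows "AE x in M. f x = g x"
proof -
  define h where "h x = f x - g x" for x
  have h: "integrable M h" using f g by (simp add: h_def[abs_def])
  then have [measurable]: "h \<in> borel_measurable M" by auto
  have fin: "(\<integral>\<^sup>+x. ennreal (u x) * indicator A x \<partial>M) = ennreal (\<integral>x. max 0 (u x) * indicator A x \<partial>M)"
    "integrable M (\<lambda>x. max 0 (u x) * indicator A x)"
    if "A \<in> sets M" "integrable M u" for A and u :: "'a \<Rightarrow> real"
  proof -
    show int: "integrable M (\<lambda>x. max 0 (u x) * indicator A x)"
      using that by (intro integrable_real_mult_indicator) auto
    have "(\<integral>\<^sup>+x. ennreal (u x) * indicator A x \<partial>M) = (\<integral>\<^sup>+x. ennreal (max 0 (u x) * indicator A x) \<partial>M)"
      by (intro nn_integral_cong) (auto simp: indicator_def max_def ennreal_neg)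
    also have "\<dots> = ennreal (\<integral>x. max 0 (u x) * indicator A x \<partial>M)"
      using int by (intro nn_integral_eq_integral) auto
    finally show "(\<integral>\<^sup>+x. ennreal (u x) * indicator A x \<partial>M) = ennreal (\<integral>x. max 0 (u x) * indicator A x \<partial>M)" .
  qed
  have "density M (\<lambda>x. ennreal (h x)) = density M (\<lambda>x. ennreal (- h x))"
  proof (rule measure_eqI_generator_eq[OF E(1,2)])
    fix A assume A: "A \<in> E"
    then have [measurable]: "A \<in> sets M" using E(3) by auto
    have "(\<integral>x. max 0 (h x) * indicator A x \<partial>M) - (\<integral>x. max 0 (- h x) * indicator A x \<partial>M) =
        (\<integral>x. max 0 (h x) * indicator A x - max 0 (- h x) * indicator A x \<partial>M)"
      using fin(2)[of A h] fin(2)[of A "\<lambda>x. - h x"] h by simp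
    also have "\<dots> = (\<integral>x. f x * indicator A x - g x * indicator A x \<partial>M)"
      by (intro Bochner_Integration.integral_cong) (auto simp: h_def indicator_def)
    also have "\<dots> = 0"
      using eq[OF A] integrable_real_mult_indicator[OF \<open>A \<in> sets M\<close> f] integrable_real_mult_indicator[OF \<open>A \<in> sets M\<close> g]
      by simp
    finally have "(\<integral>x. max 0 (h x) * indicator A x \<partial>M) = (\<integral>x. max 0 (- h x) * indicator A x \<partial>M)" by simp
    then show "emeasure (density M (\<lambda>x. ennreal (h x))) A = emeasure (density M (\<lambda>x. ennreal (- h x))) A"
      using h by (simp add: emeasure_density fin(1))
  next
    show "range (\<lambda>_::nat. space M) \<subseteq> E" using E(4) by auto
    show "emeasure (density M (\<lambda>x. ennreal (h x))) (space M) \<noteq> \<infinity>"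
      using fin(1)[OF sets.top h] by (subst emeasure_density) auto
  qed (use E(3) in auto)
  moreover have "finite_measure (density M (\<lambda>x. ennreal (h x)))"
    using fin(1)[OF sets.top h] by (intro finite_measureI, subst space_density, subst emeasure_density) auto
  ultimately have "AE x in M. ennreal (h x) = ennreal (- h x)"
    by (subst (asm) sigma_finite_density_unique) (auto simp: finite_measure.sigma_finite_measure)
  then show ?thesis
  proof eventually_elim
    case (elim x)
    then have "h x = 0"
      by (cases "0 \<le> h x") (auto simp: ennreal_neg)
    then show ?case by (simp add: h_def)
  qed
qed

lemma integrable_AE_eq_sets:
  fixes f g :: "'a \<Rightarrow> real"
  assumes "sigma_finite_measure M" "integrable M f" "integrable M g"
    and "\<And>A. A \<in> sets M \<Longrightarrow> (\<integral>x. f x * indicator A x \<partial>M) = (\<integral>x. g x * indicator A x \<partial>M)"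
  shows "AE x in M. f x = g x"
  by (rule integrable_AE_eq_generator[of "sets M"])
     (use assms in \<open>auto simp: sets.Int_stable sets.space_closed sets.sigma_sets_eq\<close>)

lemma integrable_AE_eq_boxes:
  fixes f g :: "('i \<Rightarrow> 'a) \<Rightarrow> real"
  assumes I: "finite I" and M: "\<And>i. prob_space (M i)"
    and "integrable (PiM I M) f" "integrable (PiM I M) g"
    and eq: "\<And>A. (\<And>i. i \<in> I \<Longrightarrow> A i \<in> sets (M i)) \<Longrightarrow>
      (\<integral>x. f x * (\<Prod>i\<in>I. indicator (A i) (x i)) \<partial>PiM I M) = (\<integral>x. g x * (\<Prod>i\<in>I. indicator (A i) (x i)) \<partial>PiM I M)"
  shows "AE x in PiM I M. f x = g x"
proof (rule integrable_AE_eq_generator[of "prod_algebra I M"])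
  interpret prob_space "PiM I M" by (intro prob_space_PiM M)
  show "sigma_finite_measure (PiM I M)" by unfold_locales
  show "space (PiM I M) \<in> prod_algebra I M"
    using I by (auto simp: prod_algebra_eq_finite space_PiM)
  fix A assume "A \<in> prod_algebra I M"
  then obtain X where A: "A = PiE I X" and X: "\<And>i. i \<in> I \<Longrightarrow> X i \<in> sets (M i)"
    using I by (auto simp: prod_algebra_eq_finite)
  have *: "indicator A x = (\<Prod>i\<in>I. indicator (X i) (x i) :: real)" if "x \<in> space (PiM I M)" for x
    using that I by (auto simp: A space_PiM PiE_iff indicator_def prod_zero_iff intro!: prod.neutral[symmetric])
  show "(\<integral>x. f x * indicator A x \<partial>PiM I M) = (\<integral>x. g x * indicator A x \<partial>PiM I M)"
    using eq[of X] X by (simp add: * cong: Bochner_Integration.integral_cong)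
qed (use assms prod_algebra_sets_into_space[of I M] in \<open>auto simp: Int_stable_prod_algebra sets_PiM space_PiM\<close>)

section \<open>The transfer operator of a stationary kernel on an arbitrary probability
  space\<close>

text \<open>The formula of \<open>transfer_op\<close> at an arbitrary type, so that one theory
  covers the chain on the circle and the product kernel on the torus.\<close>

definition transfer :: "('a \<Rightarrow> 'a measure) \<Rightarrow> 'a measure \<Rightarrow> ('a \<Rightarrow> real) \<Rightarrow> 'a \<Rightarrow> real" where
  "transfer \<kappa> M f x =
     enn2real (RN_deriv M (density M (\<lambda>y. ennreal (f y)) \<bind> \<kappa>) x) -
     enn2real (RN_deriv M (density M (\<lambda>y. ennreal (- f y)) \<bind> \<kappa>) x)"

lemma transfer_op_eq: "transfer_op p \<mu> = transfer p \<mu>"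
  by (intro ext) (simp add: transfer_op_def transfer_def)

locale stationary_kernel = prob_space M for M :: "'a measure" +
  fixes \<kappa> :: "'a \<Rightarrow> 'a measure"
  assumes kernel [measurable]: "\<kappa> \<in> M \<rightarrow>\<^sub>M prob_algebra M"
    and stationary: "M \<bind> \<kappa> = M"
begin

lemma kernel_prob: "x \<in> space M \<Longrightarrow> prob_space (\<kappa> x)" "x \<in> space M \<Longrightarrow> sets (\<kappa> x) = sets M"
  using measurable_space[OF kernel] by (auto simp: space_prob_algebra)

lemma measure_kernel_measurable [measurable]:
  "A \<in> sets M \<Longrightarrow> (\<lambda>y. measure (\<kappa> y) A) \<in> borel_measurable M"
  by (rule measurable_compose[OF kernel measurable_measure_prob_algebra])

lemma emeasure_kernel: "x \<in> space M \<Longrightarrow> emeasure (\<kappa> x) A = ennreal (measure (\<kappa> x) A)"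
  by (intro finite_measure.emeasure_eq_measure) (auto dest: kernel_prob(1) simp: prob_space.finite_measure)

lemma kernel_le_1: "x \<in> space M \<Longrightarrow> measure (\<kappa> x) A \<le> 1"
  by (intro prob_space.prob_le_1 kernel_prob)

lemma kernel_space: "x \<in> space M \<Longrightarrow> measure (\<kappa> x) (space M) = 1"
  using kernel_prob[of x] sets_eq_imp_space_eq prob_space.prob_space by metis

text \<open>The factor \<open>max 0 (f y)\<close> records the truncation by \<open>ennreal\<close>;
  the integrand is brought to the form \<open>ennreal\<close> of a real so that it can become a
  Bochner integral.\<close>

lemma emeasure_density_bind:
  assumes [measurable]: "f \<in> borel_measurable M" and A: "A \<in> sets M"
  shows "emeasure (density M (\<lambda>y. ennreal (f y)) \<bind> \<kappa>) A = (\<integral>\<^sup>+y. ennreal (max 0 (f y) * measure (\<kappa> y) A) \<partial>M)"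
proof -
  note [measurable] = A
  have "emeasure (density M (\<lambda>y. ennreal (f y)) \<bind> \<kappa>) A = (\<integral>\<^sup>+y. emeasure (\<kappa> y) A \<partial>density M (\<lambda>y. ennreal (f y)))"
    using measurable_prob_algebraD[OF kernel] not_empty A by (intro emeasure_bind) auto
  also have "\<dots> = (\<integral>\<^sup>+y. ennreal (f y) * emeasure (\<kappa> y) A \<partial>M)"
    using measurable_compose[OF measurable_prob_algebraD[OF kernel] measurable_emeasure_subprob_algebra[OF A]]
    by (intro nn_integral_density) auto
  also have "\<dots> = (\<integral>\<^sup>+y. ennreal (max 0 (f y) * measure (\<kappa> y) A) \<partial>M)"
    by (intro nn_integral_cong) (auto simp: emeasure_kernel ennreal_mult'' max_def ennreal_neg)
  finally show ?thesis .
qed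

lemma integral_kernel: "A \<in> sets M \<Longrightarrow> (\<integral>y. measure (\<kappa> y) A \<partial>M) = measure M A"
proof -
  assume A [measurable]: "A \<in> sets M"
  have "emeasure M A = (\<integral>\<^sup>+y. emeasure (\<kappa> y) A \<partial>M)"
    using emeasure_bind[OF not_empty measurable_prob_algebraD[OF kernel] A] by (simp add: stationary)
  also have "\<dots> = (\<integral>\<^sup>+y. ennreal (measure (\<kappa> y) A) \<partial>M)"
    by (intro nn_integral_cong emeasure_kernel)
  also have "\<dots> = ennreal (\<integral>y. measure (\<kappa> y) A \<partial>M)"
    using kernel_le_1 by (intro nn_integral_eq_integral integrable_const_bound[where B=1]) auto
  finally show ?thesis by (simp add: emeasure_eq_measure)
qed

lemma integrable_mult_kernel:
  assumes "integrable M f" "A \<in> sets M"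
  shows "integrable M (\<lambda>y. f y * measure (\<kappa> y) A)"
proof (rule Bochner_Integration.integrable_bound[OF assms(1)])
  show "AE y in M. norm (f y * measure (\<kappa> y) A) \<le> norm (f y)"
    by (intro AE_I2) (auto simp: abs_mult intro!: mult_left_le kernel_le_1)
qed (use assms in measurable)

text \<open>Two facts make \<open>RN_deriv\<close> meaningful: stationarity makes the image measure
  absolutely continuous, and its finite total mass makes the derivative finite almost everywhere, so
  that \<open>enn2real\<close> loses nothing.\<close>

lemma transfer_part:
  assumes f: "integrable M f"
  defines "R \<equiv> \<lambda>x. enn2real (RN_deriv M (density M (\<lambda>y. ennreal (f y)) \<bind> \<kappa>) x)"
  shows "integrable M R" "A \<in> sets M \<Longrightarrow> (\<integral>x. R x * indicator A x \<partial>M) = (\<integral>y. max 0 (f y) * measure (\<kappa> y) A \<partial>M)"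
proof -
  have [measurable]: "f \<in> borel_measurable M" using f by auto
  let ?\<nu> = "density M (\<lambda>y. ennreal (f y)) \<bind> \<kappa>"
  have sets: "sets ?\<nu> = sets M"
    using not_empty kernel_prob by (intro sets_bind) auto
  have ac: "absolutely_continuous M ?\<nu>"
    unfolding absolutely_continuous_def
  proof
    fix A assume A: "A \<in> null_sets M"
    then have [measurable]: "A \<in> sets M" by auto
    \<comment> \<open>By stationarity the average of the mass that the kernel gives to A is the mass
      of A, here 0. So almost every y gives A no mass, whatever density is put on M.\<close>
    have "(\<integral>y. measure (\<kappa> y) A \<partial>M) = 0"
      using A by (simp add: integral_kernel measure_eq_0_null_sets)
    then have "AE y in M. measure (\<kappa> y) A = 0"
      by (subst (asm) integral_nonneg_eq_0_iff_AE)
         (use kernel_le_1 in \<open>auto intro!: integrable_const_bound[where B=1]\<close>)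
    then have "(\<integral>\<^sup>+y. ennreal (max 0 (f y) * measure (\<kappa> y) A) \<partial>M) = 0"
      by (subst nn_integral_0_iff_AE) auto
    then show "A \<in> null_sets ?\<nu>"
      using A by (auto simp: null_sets_def emeasure_density_bind sets)
  qed
  have R: "density M (RN_deriv M ?\<nu>) = ?\<nu>" by (rule density_RN_deriv[OF ac sets])
  have nn: "(\<integral>\<^sup>+x. RN_deriv M ?\<nu> x * indicator A x \<partial>M) = ennreal (\<integral>y. max 0 (f y) * measure (\<kappa> y) A \<partial>M)"
    if A: "A \<in> sets M" for A
  proof -
    have "(\<integral>\<^sup>+x. RN_deriv M ?\<nu> x * indicator A x \<partial>M) = emeasure ?\<nu> A"
      using A by (subst (2) R[symmetric]) (simp add: emeasure_density)
    also have "\<dots> = (\<integral>\<^sup>+y. ennreal (max 0 (f y) * measure (\<kappa> y) A) \<partial>M)"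
      using A by (simp add: emeasure_density_bind)
    also have "\<dots> = ennreal (\<integral>y. max 0 (f y) * measure (\<kappa> y) A \<partial>M)"
      using A f by (intro nn_integral_eq_integral integrable_mult_kernel) auto
    finally show ?thesis .
  qed
  have fin: "AE x in M. RN_deriv M ?\<nu> x \<noteq> \<infinity>"
    using nn[OF sets.top] by (intro nn_integral_noteq_infinite) (auto simp: cong: nn_integral_cong)
  have nnR: "(\<integral>\<^sup>+x. ennreal (R x * indicator A x) \<partial>M) = ennreal (\<integral>y. max 0 (f y) * measure (\<kappa> y) A \<partial>M)"
    if "A \<in> sets M" for A
    unfolding nn[OF that, symmetric]
    by (intro nn_integral_cong_AE) (use fin in eventually_elim, auto simp: R_def indicator_def ennreal_enn2real_if)
  have [measurable]: "R \<in> borel_measurable M" unfolding R_def by measurable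
  have Rnn: "0 \<le> R x" for x by (simp add: R_def)
  have "(\<integral>\<^sup>+x. ennreal (R x) \<partial>M) = (\<integral>\<^sup>+x. ennreal (R x * indicator (space M) x) \<partial>M)"
    by (intro nn_integral_cong) auto
  then show "integrable M R"
    using nnR[OF sets.top] by (intro integrableI_nonneg) (auto simp: Rnn)
  assume A: "A \<in> sets M"
  then show "(\<integral>x. R x * indicator A x \<partial>M) = (\<integral>y. max 0 (f y) * measure (\<kappa> y) A \<partial>M)"
    using nnR[OF A] by (subst integral_eq_nn_integral) (auto simp: Rnn)
qed

lemma transfer_integrable: "integrable M f \<Longrightarrow> integrable M (transfer \<kappa> M f)"
  unfolding transfer_def[abs_def]
  using transfer_part(1)[of f] transfer_part(1)[of "\<lambda>x. - f x"] by simp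

text \<open>The adjoint relation that characterizes the operator. Linearity, the L1 bound,
  conservation of the integral and positivity are all obtained below by testing it on suitable sets
  A; the Radon-Nikodym derivatives are not unfolded again.\<close>

lemma transfer_dual:
  assumes f: "integrable M f" and A: "A \<in> sets M"
  shows "(\<integral>x. transfer \<kappa> M f x * indicator A x \<partial>M) = (\<integral>y. f y * measure (\<kappa> y) A \<partial>M)"
proof -
  let ?R = "\<lambda>f x. enn2real (RN_deriv M (density M (\<lambda>y. ennreal (f y)) \<bind> \<kappa>) x)"
  have int: "integrable M (?R f)" "integrable M (?R (\<lambda>x. - f x))"
    using transfer_part(1)[of f] transfer_part(1)[of "\<lambda>x. - f x"] f by auto
  have "(\<integral>x. transfer \<kappa> M f x * indicator A x \<partial>M) =
      (\<integral>x. ?R f x * indicator A x - ?R (\<lambda>x. - f x) x * indicator A x \<partial>M)"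
    by (simp add: transfer_def left_diff_distrib)
  also have "\<dots> = (\<integral>x. ?R f x * indicator A x \<partial>M) - (\<integral>x. ?R (\<lambda>x. - f x) x * indicator A x \<partial>M)"
    using int A by (intro Bochner_Integration.integral_diff integrable_real_mult_indicator) auto
  also have "\<dots> = (\<integral>y. max 0 (f y) * measure (\<kappa> y) A \<partial>M) - (\<integral>y. max 0 (- f y) * measure (\<kappa> y) A \<partial>M)"
    using transfer_part(2)[of f A] transfer_part(2)[of "\<lambda>x. - f x" A] f A by simp
  also have "\<dots> = (\<integral>y. max 0 (f y) * measure (\<kappa> y) A - max 0 (- f y) * measure (\<kappa> y) A \<partial>M)"
    using f A by (intro Bochner_Integration.integral_diff[symmetric] integrable_mult_kernel) auto
  also have "\<dots> = (\<integral>y. f y * measure (\<kappa> y) A \<partial>M)"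
    by (intro Bochner_Integration.integral_cong) (auto simp: max_def)
  finally show ?thesis .
qed

lemma transfer_AE_eqI:
  assumes "integrable M f" "integrable M g"
    and "\<And>A. A \<in> sets M \<Longrightarrow> (\<integral>y. f y * measure (\<kappa> y) A \<partial>M) = (\<integral>x. g x * indicator A x \<partial>M)"
  shows "AE x in M. transfer \<kappa> M f x = g x"
proof (rule integrable_AE_eq_sets)
  show "sigma_finite_measure M" by unfold_locales
qed (use assms in \<open>auto simp: transfer_integrable transfer_dual\<close>)

lemma transfer_linear:
  assumes f: "integrable M f" and g: "integrable M g"
  shows "AE x in M. transfer \<kappa> M (\<lambda>y. a * f y + b * g y) x = a * transfer \<kappa> M f x + b * transfer \<kappa> M g x"
proof (rule transfer_AE_eqI)
  fix A assume A: "A \<in> sets M"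
  have "(\<integral>y. (a * f y + b * g y) * measure (\<kappa> y) A \<partial>M) =
      a * (\<integral>y. f y * measure (\<kappa> y) A \<partial>M) + b * (\<integral>y. g y * measure (\<kappa> y) A \<partial>M)"
    using integrable_mult_kernel[OF f A] integrable_mult_kernel[OF g A]
    by (simp add: distrib_right mult.assoc)
  also have "\<dots> = (\<integral>x. (a * transfer \<kappa> M f x + b * transfer \<kappa> M g x) * indicator A x \<partial>M)"
    using transfer_dual[OF f A] transfer_dual[OF g A]
      integrable_real_mult_indicator[OF A transfer_integrable[OF f]]
      integrable_real_mult_indicator[OF A transfer_integrable[OF g]]
    by (simp add: distrib_right mult.assoc)
  finally show "(\<integral>y. (a * f y + b * g y) * measure (\<kappa> y) A \<partial>M) =
      (\<integral>x. (a * transfer \<kappa> M f x + b * transfer \<kappa> M g x) * indicator A x \<partial>M)" .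
qed (use assms transfer_integrable in auto)

text \<open>The space is split by the sign of the image. The dual relation turns the two integrals
  into f y times the difference of the masses that the kernel gives to two complementary sets, and
  this difference is at most 1 in absolute value.\<close>

lemma transfer_L1:
  assumes f: "integrable M f"
  shows "(\<integral>x. \<bar>transfer \<kappa> M f x\<bar> \<partial>M) \<le> (\<integral>x. \<bar>f x\<bar> \<partial>M)"
proof -
  have tf: "integrable M (transfer \<kappa> M f)" by (rule transfer_integrable[OF f])
  then have [measurable]: "transfer \<kappa> M f \<in> borel_measurable M" by auto
  have [measurable]: "f \<in> borel_measurable M" using f by auto
  define A where "A = {x \<in> space M. 0 \<le> transfer \<kappa> M f x}"
  define B where "B = space M - A"
  have AB [measurable]: "A \<in> sets M" "B \<in> sets M" by (auto simp: A_def B_def)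
  have "(\<integral>x. \<bar>transfer \<kappa> M f x\<bar> \<partial>M) =
      (\<integral>x. transfer \<kappa> M f x * indicator A x - transfer \<kappa> M f x * indicator B x \<partial>M)"
    by (intro Bochner_Integration.integral_cong) (auto simp: A_def B_def indicator_def)
  also have "\<dots> = (\<integral>x. transfer \<kappa> M f x * indicator A x \<partial>M) - (\<integral>x. transfer \<kappa> M f x * indicator B x \<partial>M)"
    using tf by (intro Bochner_Integration.integral_diff integrable_real_mult_indicator) auto
  also have "\<dots> = (\<integral>y. f y * measure (\<kappa> y) A - f y * measure (\<kappa> y) B \<partial>M)"
    using f integrable_mult_kernel[OF f AB(1)] integrable_mult_kernel[OF f AB(2)] by (simp add: transfer_dual)
  also have "\<dots> \<le> (\<integral>x. \<bar>f x\<bar> \<partial>M)"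
  proof (rule integral_mono)
    fix y assume y: "y \<in> space M"
    interpret K: prob_space "\<kappa> y" by (rule kernel_prob[OF y])
    have [simp]: "space (\<kappa> y) = space M" using kernel_prob(2)[OF y] by (rule sets_eq_imp_space_eq)
    have "K.prob B = 1 - K.prob A"
      unfolding B_def using K.prob_compl[of A] kernel_prob(2)[OF y] by simp
    then have "\<bar>K.prob A - K.prob B\<bar> \<le> 1"
      using K.prob_le_1[of A] measure_nonneg[of "\<kappa> y" A] by linarith
    then have "\<bar>f y\<bar> * \<bar>K.prob A - K.prob B\<bar> \<le> \<bar>f y\<bar> * 1" by (intro mult_left_mono) auto
    then show "f y * measure (\<kappa> y) A - f y * measure (\<kappa> y) B \<le> \<bar>f y\<bar>"
      by (metis (no_types, opaque_lifting) abs_ge_self abs_mult mult.right_neutral order_trans right_diff_distrib)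
  qed (use f integrable_mult_kernel[OF f] in auto)
  finally show ?thesis .
qed

lemma bounded_linear_L1_transfer: "bounded_linear_L1 M (transfer \<kappa> M)"
  unfolding bounded_linear_L1_def
  using transfer_integrable transfer_linear transfer_L1
  by (auto intro!: exI[of _ 1])

lemma transfer_integral: "integrable M f \<Longrightarrow> (\<integral>x. transfer \<kappa> M f x \<partial>M) = (\<integral>x. f x \<partial>M)"
  using transfer_dual[of f "space M"]
  by (simp add: kernel_space cong: Bochner_Integration.integral_cong)

lemma transfer_const: "AE x in M. transfer \<kappa> M (\<lambda>_. c) x = c"
  by (rule transfer_AE_eqI) (auto simp: integral_kernel)

text \<open>Tested on the set where the image is negative: the dual relation makes the integral over
  this set nonnegative, so the set is null.\<close>

lemma transfer_nonneg:
  assumes f: "integrable M f" and nn: "AE x in M. 0 \<le> f x"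
  shows "AE x in M. 0 \<le> transfer \<kappa> M f x"
proof -
  have [measurable]: "transfer \<kappa> M f \<in> borel_measurable M" using transfer_integrable[OF f] by auto
  define A where "A = {x \<in> space M. transfer \<kappa> M f x < 0}"
  have A [measurable]: "A \<in> sets M" by (simp add: A_def)
  have "0 \<le> (\<integral>y. f y * measure (\<kappa> y) A \<partial>M)"
    by (rule integral_nonneg_AE) (use nn in eventually_elim, auto)
  then have "(\<integral>x. - (transfer \<kappa> M f x * indicator A x) \<partial>M) \<le> 0"
    using transfer_dual[OF f A] by simp
  moreover have nn2: "0 \<le> - (transfer \<kappa> M f x * indicator A x)" for x
    by (auto simp: A_def indicator_def)
  moreover have int: "integrable M (\<lambda>x. - (transfer \<kappa> M f x * indicator A x))"
    using integrable_real_mult_indicator[OF A transfer_integrable[OF f]] by simp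
  ultimately have "(\<integral>x. - (transfer \<kappa> M f x * indicator A x) \<partial>M) = 0"
    by (intro antisym Bochner_Integration.integral_nonneg) auto
  then have "AE x in M. - (transfer \<kappa> M f x * indicator A x) = 0"
    using integral_nonneg_eq_0_iff_AE[OF int] nn2 by auto
  then show ?thesis
    using AE_space by eventually_elim (auto simp: A_def indicator_def not_less split: if_splits)
qed

end

section \<open>The product of finitely many copies of a stationary kernel\<close>

context
  fixes p :: "'a \<Rightarrow> 'a measure" and \<mu> :: "'a measure" and I :: "'i set"
  assumes sk: "stationary_kernel \<mu> p" and I: "finite I"
begin

interpretation K: stationary_kernel \<mu> p by (rule sk)

interpretation PP: product_sigma_finite "\<lambda>_. \<mu>" by unfold_locales

lemma product_kernel_prob: "y \<in> space (PiM I (\<lambda>_. \<mu>)) \<Longrightarrow> prob_space (PiM I (\<lambda>i. p (y i)))"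
  by (intro prob_space_PiM K.kernel_prob) (auto simp: space_PiM)

lemma product_kernel_sets: "y \<in> space (PiM I (\<lambda>_. \<mu>)) \<Longrightarrow> sets (PiM I (\<lambda>i. p (y i))) = sets (PiM I (\<lambda>_. \<mu>))"
  by (intro sets_PiM_cong K.kernel_prob) (auto simp: space_PiM)

lemma emeasure_product_kernel:
  assumes y: "y \<in> space (PiM I (\<lambda>_. \<mu>))" and A: "\<And>i. i \<in> I \<Longrightarrow> A i \<in> sets \<mu>"
  shows "emeasure (PiM I (\<lambda>i. p (y i))) (PiE I A) = (\<Prod>i\<in>I. emeasure (p (y i)) (A i))"
proof -
  have yi: "y i \<in> space \<mu>" if "i \<in> I" for i using y that by (auto simp: space_PiM)
  have "prod_emb I (\<lambda>i. p (y i)) I (PiE I A) = PiE I A"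
  proof (rule prod_emb_PiE_same_index)
    fix i assume "i \<in> I"
    then show "A i \<subseteq> space (p (y i))"
      using A[THEN sets.sets_into_space, of i] sets_eq_imp_space_eq[OF K.kernel_prob(2)[OF yi[of i]]] by simp
  qed
  moreover have "emeasure (PiM I (\<lambda>i. p (y i))) (prod_emb I (\<lambda>i. p (y i)) I (PiE I A)) = (\<Prod>i\<in>I. emeasure (p (y i)) (A i))"
    using I yi K.kernel_prob A by (intro emeasure_PiM_emb) auto
  ultimately show ?thesis by simp
qed

lemma measure_product_kernel:
  assumes y: "y \<in> space (PiM I (\<lambda>_. \<mu>))" and A: "\<And>i. i \<in> I \<Longrightarrow> A i \<in> sets \<mu>"
  shows "measure (PiM I (\<lambda>i. p (y i))) (PiE I A) = (\<Prod>i\<in>I. measure (p (y i)) (A i))"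
proof -
  have "emeasure (PiM I (\<lambda>i. p (y i))) (PiE I A) = (\<Prod>i\<in>I. emeasure (p (y i)) (A i))"
    by (rule emeasure_product_kernel[OF y A])
  also have "\<dots> = (\<Prod>i\<in>I. ennreal (measure (p (y i)) (A i)))"
    using y by (intro prod.cong refl K.emeasure_kernel) (auto simp: space_PiM)
  also have "\<dots> = ennreal (\<Prod>i\<in>I. measure (p (y i)) (A i))"
    by (intro prod_ennreal) auto
  finally show ?thesis by (simp add: measure_def prod_nonneg)
qed

text \<open>Measurability in y and stationarity are checked on measurable boxes, an
  intersection-stable generator: there the product kernel is a finite product of numbers, each
  depending on one coordinate of y, and its integral factors.\<close>

lemma stationary_kernel_product: "stationary_kernel (PiM I (\<lambda>_. \<mu>)) (\<lambda>y. PiM I (\<lambda>i. p (y i)))"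
proof (intro stationary_kernel.intro stationary_kernel_axioms.intro)
  show P: "prob_space (PiM I (\<lambda>_. \<mu>))" by (intro prob_space_PiM K.prob_space_axioms)
  have box_measurable: "(\<lambda>y. emeasure (PiM I (\<lambda>i. p (y i))) (PiE I A)) \<in> borel_measurable (PiM I (\<lambda>_. \<mu>))"
    if A: "\<And>i. i \<in> I \<Longrightarrow> A i \<in> sets \<mu>" for A
  proof -
    have "(\<lambda>y. \<Prod>i\<in>I. emeasure (p (y i)) (A i)) \<in> borel_measurable (PiM I (\<lambda>_. \<mu>))"
    proof (intro borel_measurable_prod_ennreal)
      fix i assume i: "i \<in> I"
      have "(\<lambda>y. emeasure (p y) (A i)) \<in> borel_measurable \<mu>"
        by (rule measurable_compose[OF measurable_prob_algebraD[OF K.kernel] measurable_emeasure_subprob_algebra[OF A[OF i]]])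
      from measurable_compose[OF measurable_component_singleton[OF i] this]
      show "(\<lambda>y. emeasure (p (y i)) (A i)) \<in> borel_measurable (PiM I (\<lambda>_. \<mu>))" .
    qed
    then show ?thesis
      by (subst measurable_cong[OF emeasure_product_kernel[OF _ A]]) auto
  qed
  show meas: "(\<lambda>y. PiM I (\<lambda>i. p (y i))) \<in> PiM I (\<lambda>_. \<mu>) \<rightarrow>\<^sub>M prob_algebra (PiM I (\<lambda>_. \<mu>))"
  proof (rule measurable_prob_algebra_generated[OF sets_PiM Int_stable_prod_algebra prod_algebra_sets_into_space])
    fix A assume "A \<in> prod_algebra I (\<lambda>_. \<mu>)"
    then obtain X where "A = PiE I X" and "\<And>i. i \<in> I \<Longrightarrow> X i \<in> sets \<mu>"
      using I by (auto simp: prod_algebra_eq_finite)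
    then show "(\<lambda>y. emeasure (PiM I (\<lambda>i. p (y i))) A) \<in> borel_measurable (PiM I (\<lambda>_. \<mu>))"
      using box_measurable by simp
  qed (fact product_kernel_prob, fact product_kernel_sets)
  show "PiM I (\<lambda>_. \<mu>) \<bind> (\<lambda>y. PiM I (\<lambda>i. p (y i))) = PiM I (\<lambda>_. \<mu>)"
  proof (rule PP.PiM_eqI[OF I])
    show "sets (PiM I (\<lambda>_. \<mu>) \<bind> (\<lambda>y. PiM I (\<lambda>i. p (y i)))) = sets (PiM I (\<lambda>_. \<mu>))"
      using prob_space.not_empty[OF P] product_kernel_sets by (intro sets_bind) auto
    fix A assume A: "\<And>i. i \<in> I \<Longrightarrow> A i \<in> sets \<mu>"
    have box: "PiE I A \<in> sets (PiM I (\<lambda>_. \<mu>))" using I A by (intro sets_PiM_I_finite) auto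
    have "emeasure (PiM I (\<lambda>_. \<mu>) \<bind> (\<lambda>y. PiM I (\<lambda>i. p (y i)))) (PiE I A) =
        (\<integral>\<^sup>+y. emeasure (PiM I (\<lambda>i. p (y i))) (PiE I A) \<partial>PiM I (\<lambda>_. \<mu>))"
      by (rule emeasure_bind[OF prob_space.not_empty[OF P] measurable_prob_algebraD[OF meas] box])
    also have "\<dots> = (\<integral>\<^sup>+y. (\<Prod>i\<in>I. emeasure (p (y i)) (A i)) \<partial>PiM I (\<lambda>_. \<mu>))"
      by (intro nn_integral_cong emeasure_product_kernel A)
    also have "\<dots> = (\<Prod>i\<in>I. \<integral>\<^sup>+y. emeasure (p y) (A i) \<partial>\<mu>)"
      using measurable_compose[OF measurable_prob_algebraD[OF K.kernel] measurable_emeasure_subprob_algebra[OF A]]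
      by (intro PP.product_nn_integral_prod[OF I]) auto
    also have "\<dots> = (\<Prod>i\<in>I. emeasure \<mu> (A i))"
    proof (rule prod.cong[OF refl])
      fix i assume "i \<in> I"
      show "(\<integral>\<^sup>+y. emeasure (p y) (A i) \<partial>\<mu>) = emeasure \<mu> (A i)"
        using emeasure_bind[OF K.not_empty measurable_prob_algebraD[OF K.kernel] A[OF \<open>i \<in> I\<close>]]
        by (simp add: K.stationary)
    qed
    finally show "emeasure (PiM I (\<lambda>_. \<mu>) \<bind> (\<lambda>y. PiM I (\<lambda>i. p (y i)))) (PiE I A) = (\<Prod>i\<in>I. emeasure \<mu> (A i))" .
  qed
qed

interpretation KN: stationary_kernel "PiM I (\<lambda>_. \<mu>)" "\<lambda>y. PiM I (\<lambda>i. p (y i))"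
  by (rule stationary_kernel_product)

text \<open>It suffices to test on boxes. There the dual relation of the product kernel factors by
  Fubini into the dual relations of the single kernels.\<close>

lemma transfer_product:
  assumes \<phi>: "\<And>i. i \<in> I \<Longrightarrow> integrable \<mu> (\<phi> i)"
  shows "AE x in PiM I (\<lambda>_. \<mu>).
    transfer (\<lambda>y. PiM I (\<lambda>i. p (y i))) (PiM I (\<lambda>_. \<mu>)) (\<lambda>y. \<Prod>i\<in>I. \<phi> i (y i)) x = (\<Prod>i\<in>I. transfer p \<mu> (\<phi> i) (x i))"
proof (rule integrable_AE_eq_boxes[OF I K.prob_space_axioms])
  have int: "integrable (PiM I (\<lambda>_. \<mu>)) (\<lambda>y. \<Prod>i\<in>I. \<phi> i (y i))"
    using \<phi> by (intro PP.product_integrable_prod I)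
  then show "integrable (PiM I (\<lambda>_. \<mu>)) (transfer (\<lambda>y. PiM I (\<lambda>i. p (y i))) (PiM I (\<lambda>_. \<mu>)) (\<lambda>y. \<Prod>i\<in>I. \<phi> i (y i)))"
    by (rule KN.transfer_integrable)
  show "integrable (PiM I (\<lambda>_. \<mu>)) (\<lambda>x. \<Prod>i\<in>I. transfer p \<mu> (\<phi> i) (x i))"
    using \<phi> by (intro PP.product_integrable_prod I K.transfer_integrable)
  fix A assume A: "\<And>i. i \<in> I \<Longrightarrow> A i \<in> sets \<mu>"
  have ind: "(\<Prod>i\<in>I. indicator (A i) (x i)) = (indicator (PiE I A) x :: real)" if "x \<in> space (PiM I (\<lambda>_. \<mu>))" for x
    using that I by (auto simp: space_PiM PiE_iff indicator_def prod_zero_iff intro!: prod.neutral)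
  have "(\<integral>x. transfer (\<lambda>y. PiM I (\<lambda>i. p (y i))) (PiM I (\<lambda>_. \<mu>)) (\<lambda>y. \<Prod>i\<in>I. \<phi> i (y i)) x * (\<Prod>i\<in>I. indicator (A i) (x i)) \<partial>PiM I (\<lambda>_. \<mu>)) =
      (\<integral>x. transfer (\<lambda>y. PiM I (\<lambda>i. p (y i))) (PiM I (\<lambda>_. \<mu>)) (\<lambda>y. \<Prod>i\<in>I. \<phi> i (y i)) x * indicator (PiE I A) x \<partial>PiM I (\<lambda>_. \<mu>))"
    by (intro Bochner_Integration.integral_cong) (auto simp: ind)
  also have "\<dots> = (\<integral>y. (\<Prod>i\<in>I. \<phi> i (y i)) * measure (PiM I (\<lambda>i. p (y i))) (PiE I A) \<partial>PiM I (\<lambda>_. \<mu>))"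
    using A by (intro KN.transfer_dual int sets_PiM_I_finite I) auto
  also have "\<dots> = (\<integral>y. (\<Prod>i\<in>I. \<phi> i (y i) * measure (p (y i)) (A i)) \<partial>PiM I (\<lambda>_. \<mu>))"
    using A by (intro Bochner_Integration.integral_cong) (auto simp: measure_product_kernel prod.distrib)
  also have "\<dots> = (\<Prod>i\<in>I. \<integral>y. \<phi> i y * measure (p y) (A i) \<partial>\<mu>)"
    using \<phi> A by (intro PP.product_integral_prod I K.integrable_mult_kernel)
  also have "\<dots> = (\<Prod>i\<in>I. \<integral>x. transfer p \<mu> (\<phi> i) x * indicator (A i) x \<partial>\<mu>)"
    using \<phi> A by (intro prod.cong) (auto simp: K.transfer_dual)
  also have "\<dots> = (\<integral>x. (\<Prod>i\<in>I. transfer p \<mu> (\<phi> i) (x i) * indicator (A i) (x i)) \<partial>PiM I (\<lambda>_. \<mu>))"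
    using \<phi> A by (intro PP.product_integral_prod[symmetric] I integrable_real_mult_indicator K.transfer_integrable)
  finally show "(\<integral>x. transfer (\<lambda>y. PiM I (\<lambda>i. p (y i))) (PiM I (\<lambda>_. \<mu>)) (\<lambda>y. \<Prod>i\<in>I. \<phi> i (y i)) x * (\<Prod>i\<in>I. indicator (A i) (x i)) \<partial>PiM I (\<lambda>_. \<mu>)) =
      (\<integral>x. (\<Prod>i\<in>I. transfer p \<mu> (\<phi> i) (x i)) * (\<Prod>i\<in>I. indicator (A i) (x i)) \<partial>PiM I (\<lambda>_. \<mu>))"
    by (simp add: prod.distrib)
qed

end

section \<open>Uniqueness of the tensor power up to null sets\<close>

text \<open>Operators act on functions, and \<open>bounded_linear_L1\<close> does not speak of
  almost everywhere equal arguments; their images agree because the L1 bound applies to the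
  difference f - g.\<close>

lemma bounded_linear_L1_cong:
  assumes Q: "bounded_linear_L1 M Q" and f: "integrable M f" and g: "integrable M g" and eq: "AE x in M. f x = g x"
  shows "AE x in M. Q f x = Q g x"
proof -
  obtain C where C: "\<And>\<phi>. integrable M \<phi> \<Longrightarrow> (\<integral>x. \<bar>Q \<phi> x\<bar> \<partial>M) \<le> C * (\<integral>x. \<bar>\<phi> x\<bar> \<partial>M)"
    using Q by (auto simp: bounded_linear_L1_def)
  define h where "h y = 1 * f y + (-1) * g y" for y
  have h: "integrable M h" using f g by (simp add: h_def[abs_def])
  have [measurable]: "f \<in> borel_measurable M" "g \<in> borel_measurable M" using f g by auto
  have "(\<integral>x. \<bar>h x\<bar> \<partial>M) = (\<integral>x. 0 \<partial>M)"
    by (rule integral_cong_AE) (use eq in \<open>auto simp: h_def[abs_def]\<close>)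
  then have "(\<integral>x. \<bar>Q h x\<bar> \<partial>M) = 0"
    using C[OF h] by (intro antisym) auto
  then have "AE x in M. Q h x = 0"
    using integral_nonneg_eq_0_iff_AE[of M "\<lambda>x. \<bar>Q h x\<bar>"] Q h by (auto simp: bounded_linear_L1_def)
  moreover have "AE x in M. Q h x = 1 * Q f x + (-1) * Q g x"
    using Q f g unfolding bounded_linear_L1_def h_def[abs_def] by blast
  ultimately show ?thesis by eventually_elim simp
qed

lemma bounded_linear_L1_eq_limit:
  assumes Q: "bounded_linear_L1 M Q" and Q': "bounded_linear_L1 M Q'"
    and f: "\<And>n::nat. integrable M (f n)" and g: "integrable M g"
    and eq: "\<And>n. AE x in M. Q (f n) x = Q' (f n) x"
    and lim: "(\<lambda>n. \<integral>x. \<bar>f n x - g x\<bar> \<partial>M) \<longlonglongrightarrow> 0"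
  shows "AE x in M. Q g x = Q' g x"
proof -
  have *: "(\<lambda>n. \<integral>x. \<bar>R (f n) x - R g x\<bar> \<partial>M) \<longlonglongrightarrow> 0" if R: "bounded_linear_L1 M R" for R
  proof -
    obtain C where C: "\<And>\<phi>. integrable M \<phi> \<Longrightarrow> (\<integral>x. \<bar>R \<phi> x\<bar> \<partial>M) \<le> C * (\<integral>x. \<bar>\<phi> x\<bar> \<partial>M)"
      using R by (auto simp: bounded_linear_L1_def)
    have [measurable]: "R h \<in> borel_measurable M" if "integrable M h" for h
      using R that by (auto simp: bounded_linear_L1_def)
    note [measurable] = this[OF g] this[OF f]
    have "(\<integral>x. \<bar>R (f n) x - R g x\<bar> \<partial>M) \<le> C * (\<integral>x. \<bar>f n x - g x\<bar> \<partial>M)" for n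
    proof -
      have i: "integrable M (\<lambda>y. f n y - g y)" using f g by simp
      have [measurable]: "R (\<lambda>y. f n y - g y) \<in> borel_measurable M"
        using R i by (auto simp: bounded_linear_L1_def)
      have "AE x in M. R (\<lambda>y. 1 * f n y + (-1) * g y) x = 1 * R (f n) x + (-1) * R g x"
        using R f g unfolding bounded_linear_L1_def by blast
      then have "AE x in M. R (\<lambda>y. f n y - g y) x = R (f n) x - R g x" by simp
      then have "(\<integral>x. \<bar>R (f n) x - R g x\<bar> \<partial>M) = (\<integral>x. \<bar>R (\<lambda>y. f n y - g y) x\<bar> \<partial>M)"
        by (intro integral_cong_AE) auto
      also have "\<dots> \<le> C * (\<integral>x. \<bar>f n x - g x\<bar> \<partial>M)"
        using C[OF i] .
      finally show ?thesis .
    qed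
    then show ?thesis
      by (intro tendsto_sandwich[OF _ _ tendsto_const tendsto_mult_right_zero[OF lim, of C]] always_eventually allI)
         auto
  qed
  have i: "integrable M (Q h)" "integrable M (Q' h)" if "integrable M h" for h
    using Q Q' that by (auto simp: bounded_linear_L1_def)
  have [measurable]: "Q g \<in> borel_measurable M" "Q' g \<in> borel_measurable M"
    "Q (f n) \<in> borel_measurable M" "Q' (f n) \<in> borel_measurable M" for n
    using i[OF g] i[OF f] by auto
  have "(\<integral>x. \<bar>Q (f n) x - Q' g x\<bar> \<partial>M) = (\<integral>x. \<bar>Q' (f n) x - Q' g x\<bar> \<partial>M)" for n
    by (rule integral_cong_AE) (use eq[of n] in auto)
  with *[OF Q'] have "(\<lambda>n. \<integral>x. \<bar>Q (f n) x - Q' g x\<bar> \<partial>M) \<longlonglongrightarrow> 0" by simp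
  from L1_limit_AE_unique[OF i(1)[OF f] i(1)[OF g] i(2)[OF g] *[OF Q] this]
  show ?thesis .
qed

text \<open>The sets on whose indicators the two operators agree form a Dynkin system: complements
  use linearity, countable disjoint unions use continuity in L1. Simple functions and L1 limits then
  reach every integrable f.\<close>

lemma bounded_linear_L1_eq_generator:
  fixes Q :: "('a \<Rightarrow> real) \<Rightarrow> 'a \<Rightarrow> real"
  assumes E: "Int_stable E" "E \<subseteq> Pow (space M)" "sets M = sigma_sets (space M) E" "space M \<in> E"
    and M: "finite_measure M"
    and Q: "bounded_linear_L1 M Q" and Q': "bounded_linear_L1 M Q'"
    and eq: "\<And>A. A \<in> E \<Longrightarrow> AE x in M. Q (indicator A) x = Q' (indicator A) x"
    and f: "integrable M f"
  shows "AE x in M. Q f x = Q' f x"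
proof -
  interpret finite_measure M by (rule M)
  have lin: "AE x in M. R (\<lambda>y. a * u y + b * v y) x = a * R u x + b * R v x"
    if "bounded_linear_L1 M R" "integrable M u" "integrable M v" for R u v a b
    using that unfolding bounded_linear_L1_def by blast
  have comb: "AE x in M. Q (\<lambda>y. a * u y + b * v y) x = Q' (\<lambda>y. a * u y + b * v y) x"
    if "integrable M u" "integrable M v" "AE x in M. Q u x = Q' u x" "AE x in M. Q v x = Q' v x" for u v a b
    using lin[OF Q that(1,2), of a b] lin[OF Q' that(1,2), of a b] that(3,4) by eventually_elim simp
  have ind: "integrable M (indicator A :: 'a \<Rightarrow> real)" if "A \<in> sets M" for A
    using that by (simp add: integrable_indicator_iff less_top[symmetric])
  have sets_eq: "AE x in M. Q (indicator A) x = Q' (indicator A) x" if "A \<in> sets M" for A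
  proof -
    have "A \<in> sigma_sets (space M) E" using that E(3) by simp
    with E(1,2) show ?thesis
    proof (induction rule: sigma_sets_induct_disjoint)
      case (basic A) then show ?case by (rule eq)
    next
      case empty
      have "AE x in M. Q (\<lambda>y. 0 * (0::real) + 0 * 0) x = Q' (\<lambda>y. 0 * (0::real) + 0 * 0) x"
        using lin[OF Q, of "\<lambda>_. 0" "\<lambda>_. 0" 0 0] lin[OF Q', of "\<lambda>_. 0" "\<lambda>_. 0" 0 0] by auto
      then show ?case by (simp add: indicator_def[abs_def])
    next
      case (compl A)
      have A: "A \<in> sets M" using compl E(3) by simp
      have i: "integrable M (\<lambda>y. 1 * indicator (space M) y + (-1) * indicator A y :: real)"
        by (intro Bochner_Integration.integrable_add Bochner_Integration.integrable_mult_right ind A sets.top)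
      have c: "AE y in M. (indicator (space M - A) y :: real) = 1 * indicator (space M) y + (-1) * indicator A y"
        by (intro AE_I2) (auto simp: indicator_def)
      have "space M - A \<in> sets M" using A by auto
      from bounded_linear_L1_cong[OF Q ind[OF this] i c] bounded_linear_L1_cong[OF Q' ind[OF this] i c]
        comb[OF ind[OF sets.top] ind[OF A] eq[OF E(4)] compl(2), of 1 "-1"]
      show ?case by eventually_elim simp
    next
      case (union A)
      have A: "A i \<in> sets M" for i using union(2) E(3) by auto
      define f where "f n = (\<lambda>y. \<Sum>k<n. indicator (A k) y :: real)" for n
      have f: "integrable M (f n)" for n unfolding f_def using ind[OF A] by auto
      have feq: "AE x in M. Q (f n) x = Q' (f n) x" for n
      proof (induction n)
        case 0
        have "AE x in M. Q (\<lambda>y. 0 * (0::real) + 0 * 0) x = Q' (\<lambda>y. 0 * (0::real) + 0 * 0) x"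
          using lin[OF Q, of "\<lambda>_. 0" "\<lambda>_. 0" 0 0] lin[OF Q', of "\<lambda>_. 0" "\<lambda>_. 0" 0 0] by auto
        then show ?case by (simp add: f_def)
      next
        case (Suc n)
        show ?case
          using comb[OF f ind[OF A] Suc union(3)[of n], of 1 1] by (simp add: f_def)
      qed
      have fU: "f n y = indicator (\<Union>k<n. A k) y" for n y
        unfolding f_def using union(1) by (subst indicator_UN_disjoint) (auto simp: disjoint_family_on_def)
      have U: "(\<Union>i. A i) \<in> sets M" using A by auto
      have "(\<lambda>n. \<integral>x. \<bar>f n x - indicator (\<Union>i. A i) x\<bar> \<partial>M) \<longlonglongrightarrow> (\<integral>x. 0 \<partial>M)"
      proof (rule integral_dominated_convergence[where w="\<lambda>_. 1"])
        show "AE x in M. (\<lambda>n. \<bar>f n x - indicator (\<Union>i. A i) x\<bar>) \<longlonglongrightarrow> 0"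
        proof (intro AE_I2)
          fix x
          have "(\<lambda>n. indicator (\<Union>k<n. A k) x :: real) \<longlonglongrightarrow> indicator (\<Union>i. A i) x"
            by (rule LIMSEQ_indicator_UN)
          then show "(\<lambda>n. \<bar>f n x - indicator (\<Union>i. A i) x\<bar>) \<longlonglongrightarrow> 0"
            by (simp add: fU tendsto_rabs_zero_iff LIM_zero)
        qed
        show "AE x in M. norm \<bar>f n x - indicator (\<Union>i. A i) x\<bar> \<le> 1" for n
          by (intro AE_I2) (auto simp: fU indicator_def)
      qed (use f ind[OF U] in auto)
      then have "(\<lambda>n. \<integral>x. \<bar>f n x - indicator (\<Union>i. A i) x\<bar> \<partial>M) \<longlonglongrightarrow> 0" by simp
      from bounded_linear_L1_eq_limit[OF Q Q' f ind[OF U] feq this] show ?case .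
    qed
  qed
  show ?thesis
    using f
  proof (induction f rule: integrable_induct)
    case (base A c)
    show ?case
      using comb[OF ind[OF base(1)] ind[OF base(1)] sets_eq[OF base(1)] sets_eq[OF base(1)], of c 0]
      by (simp add: mult.commute)
  next
    case (add f g)
    show ?case using comb[OF add(1,2,3,4), of 1 1] by simp
  next
    case (lim f s)
    have "(\<lambda>n. \<integral>x. \<bar>s n x - f x\<bar> \<partial>M) \<longlonglongrightarrow> (\<integral>x. 0 \<partial>M)"
    \<comment> \<open>The induction rule provides |s n| <= 2 |f|, hence |s n - f| <= 3 |f|.\<close>
    proof (rule integral_dominated_convergence[where w="\<lambda>x. 3 * \<bar>f x\<bar>"])
      show "AE x in M. (\<lambda>n. \<bar>s n x - f x\<bar>) \<longlonglongrightarrow> 0"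
        using lim(2) by (intro AE_I2) (simp add: tendsto_rabs_zero_iff LIM_zero)
      show "AE x in M. norm \<bar>s n x - f x\<bar> \<le> 3 * \<bar>f x\<bar>" for n
      proof (intro AE_I2)
        fix x assume "x \<in> space M"
        from lim(3)[OF this, of n] have "\<bar>s n x\<bar> \<le> 2 * \<bar>f x\<bar>" by simp
        then show "norm \<bar>s n x - f x\<bar> \<le> 3 * \<bar>f x\<bar>" by (simp add: abs_diff_le_iff) linarith
      qed
    qed (use lim(1,4) in auto)
    then have "(\<lambda>n. \<integral>x. \<bar>s n x - f x\<bar> \<partial>M) \<longlonglongrightarrow> 0" by simp
    from bounded_linear_L1_eq_limit[OF Q Q' lim(1) lim(4) lim(5) this] show ?case .
  qed
qed

text \<open>The transfer operator of the product kernel witnesses that a tensor power exists, and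
  uniqueness on indicators of boxes then pins down the chosen one. This carries positivity and
  conservation of the integral over to \<open>transfer_op_N\<close>.\<close>

lemma tensor_power_eq_transfer:
  assumes sk: "stationary_kernel \<mu> p" and f: "integrable (power_measure \<mu> N) f"
  shows "is_tensor_power \<mu> (transfer_op p \<mu>) N (transfer_op_N p \<mu> N)"
    and "AE x in power_measure \<mu> N. transfer_op_N p \<mu> N f x =
      transfer (\<lambda>y. PiM {..<N} (\<lambda>i. p (y i))) (power_measure \<mu> N) f x"
proof -
  interpret K: stationary_kernel \<mu> p by (rule sk)
  let ?M = "power_measure \<mu> N" and ?T = "transfer (\<lambda>y. PiM {..<N} (\<lambda>i. p (y i))) (power_measure \<mu> N)"
  interpret KN: stationary_kernel ?M "\<lambda>y. PiM {..<N} (\<lambda>i. p (y i))"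
    unfolding power_measure_def by (rule stationary_kernel_product[OF sk]) simp
  have T: "is_tensor_power \<mu> (transfer_op p \<mu>) N ?T"
    unfolding is_tensor_power_def
    using KN.bounded_linear_L1_transfer transfer_product[OF sk, of "{..<N}"]
    unfolding power_measure_def transfer_op_eq by auto
  show Q: "is_tensor_power \<mu> (transfer_op p \<mu>) N (transfer_op_N p \<mu> N)"
    unfolding transfer_op_N_def tensor_power_def by (rule someI[of "is_tensor_power \<mu> (transfer_op p \<mu>) N", OF T])
  have bl: "bounded_linear_L1 ?M (transfer_op_N p \<mu> N)" "bounded_linear_L1 ?M ?T"
    using Q T by (simp_all add: is_tensor_power_def)
  show "AE x in ?M. transfer_op_N p \<mu> N f x = ?T f x"
  proof (rule bounded_linear_L1_eq_generator[where E="prod_algebra {..<N} (\<lambda>_. \<mu>)" and M="?M"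
        and Q="transfer_op_N p \<mu> N" and Q'="?T" and f=f, OF Int_stable_prod_algebra _ _ _ _ bl _ f])
    fix A assume "A \<in> prod_algebra {..<N} (\<lambda>_. \<mu>)"
    then obtain X where A: "A = PiE {..<N} X" and X: "\<And>i. i < N \<Longrightarrow> X i \<in> sets \<mu>"
      unfolding prod_algebra_eq_finite[OF finite_lessThan] by blast
    have Am: "A \<in> sets ?M" using X by (auto simp: A power_measure_def intro!: sets_PiM_I_finite)
    have i1: "integrable ?M (indicator A :: _ \<Rightarrow> real)"
    proof (rule integrable_real_indicator[OF Am])
      show "emeasure ?M A < \<infinity>" using KN.emeasure_finite[of A] by (simp add: less_top[symmetric])
    qed
    have eqA: "indicator A x = (\<Prod>i<N. indicator (X i) (x i) :: real)" if "x \<in> space ?M" for x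
      using that by (auto simp: A power_measure_def space_PiM PiE_iff indicator_def prod_zero_iff intro!: prod.neutral[symmetric])
    then have ae: "AE x in ?M. indicator A x = (\<Prod>i<N. indicator (X i) (x i) :: real)" by simp
    have i2: "integrable ?M (\<lambda>x. \<Prod>i<N. indicator (X i) (x i) :: real)"
      using i1 by (subst Bochner_Integration.integrable_cong[OF refl eqA[symmetric]])
    have iX: "\<forall>i<N. integrable \<mu> (indicator (X i) :: _ \<Rightarrow> real)"
      using X by (simp add: integrable_indicator_iff less_top[symmetric])
    have tensor: "AE x in ?M. R (\<lambda>y. \<Prod>i<N. indicator (X i) (y i)) x = (\<Prod>i<N. transfer_op p \<mu> (indicator (X i)) (x i))"
      if "is_tensor_power \<mu> (transfer_op p \<mu>) N R" for R
      using that[unfolded is_tensor_power_def, THEN conjunct2, THEN spec, of "\<lambda>i. indicator (X i)"] iX by (rule mp)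
    from bounded_linear_L1_cong[OF bl(1) i1 i2 ae] bounded_linear_L1_cong[OF bl(2) i1 i2 ae] tensor[OF Q] tensor[OF T]
    show "AE x in ?M. transfer_op_N p \<mu> N (indicator A) x = ?T (indicator A) x"
      by eventually_elim simp
  next
    show "prod_algebra {..<N} (\<lambda>_. \<mu>) \<subseteq> Pow (space ?M)"
      using prod_algebra_sets_into_space[of "{..<N}" "\<lambda>_. \<mu>"] by (simp add: power_measure_def space_PiM)
    show "sets ?M = sigma_sets (space ?M) (prod_algebra {..<N} (\<lambda>_. \<mu>))"
      by (simp add: power_measure_def sets_PiM space_PiM)
    show "space ?M \<in> prod_algebra {..<N} (\<lambda>_. \<mu>)"
      by (auto simp: prod_algebra_eq_finite power_measure_def space_PiM)
    show "finite_measure ?M" by (rule KN.finite_measure_axioms)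
  qed
qed


section \<open>Weak derivatives on the circle\<close>

text \<open>Real polynomials on the complex plane composed with \<open>cis\<close> are the
  trigonometric polynomials. They are closed under differentiation, which makes them smooth at once,
  and Stone-Weierstrass makes them dense. They serve as test functions whenever a function has to be
  determined by testing.\<close>

lemma real_polynomial_circle_deriv:
  assumes "real_polynomial_function q"
  shows "\<exists>q'. real_polynomial_function q' \<and>
    (\<forall>t. ((\<lambda>t. q (cis (2 * pi * t))) has_real_derivative q' (cis (2 * pi * t))) (at t))"
  using assms
proof induction
  case (linear h)
  define q' where "q' z = h (2 * pi * \<i> * z)" for z
  have "bounded_linear q'"
    unfolding q'_def by (intro bounded_linear_compose[OF linear] bounded_linear_mult_right)
  moreover have "((\<lambda>t. h (cis (2 * pi * t))) has_real_derivative q' (cis (2 * pi * t))) (at t)" for t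
  proof -
    have "((\<lambda>t. cis (2 * pi * t)) has_derivative (\<lambda>s. (2 * pi * s) *\<^sub>R (\<i> * cis (2 * pi * t)))) (at t)"
      by (auto intro!: derivative_eq_intros)
    then have "((\<lambda>t. h (cis (2 * pi * t))) has_derivative (\<lambda>s. h ((2 * pi * s) *\<^sub>R (\<i> * cis (2 * pi * t))))) (at t)"
      by (rule bounded_linear.has_derivative[OF linear])
    also have "(\<lambda>s. h ((2 * pi * s) *\<^sub>R (\<i> * cis (2 * pi * t)))) = (*) (q' (cis (2 * pi * t)))"
    proof
      fix s
      have "h ((2 * pi * s) *\<^sub>R (\<i> * cis (2 * pi * t))) = h (s *\<^sub>R (2 * pi * \<i> * cis (2 * pi * t)))"
        by (simp add: scaleR_conv_of_real mult_ac)
      also have "\<dots> = s *\<^sub>R h (2 * pi * \<i> * cis (2 * pi * t))"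
        using linear by (simp add: bounded_linear.axioms(1) linear_scale)
      finally show "h ((2 * pi * s) *\<^sub>R (\<i> * cis (2 * pi * t))) = q' (cis (2 * pi * t)) * s"
        by (simp add: q'_def mult.commute)
    qed
    finally show ?thesis by (simp add: has_field_derivative_def)
  qed
  ultimately show ?case by blast
next
  case (const c)
  show ?case by (intro exI[of _ "\<lambda>_. 0"]) auto
next
  case (add f g)
  then obtain f' g' where "real_polynomial_function f'" "real_polynomial_function g'"
    "\<forall>t. ((\<lambda>t. f (cis (2 * pi * t))) has_real_derivative f' (cis (2 * pi * t))) (at t)"
    "\<forall>t. ((\<lambda>t. g (cis (2 * pi * t))) has_real_derivative g' (cis (2 * pi * t))) (at t)" by blast
  then show ?case
    by (intro exI[of _ "\<lambda>z. f' z + g' z"]) (auto intro: DERIV_add)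
next
  case (mult f g)
  then obtain f' g' where "real_polynomial_function f'" "real_polynomial_function g'"
    "\<forall>t. ((\<lambda>t. f (cis (2 * pi * t))) has_real_derivative f' (cis (2 * pi * t))) (at t)"
    "\<forall>t. ((\<lambda>t. g (cis (2 * pi * t))) has_real_derivative g' (cis (2 * pi * t))) (at t)" by blast
  then show ?case using mult(1,2)
    by (intro exI[of _ "\<lambda>z. f' z * g z + g' z * f z"]) (auto intro: DERIV_mult)
qed

lemma real_polynomial_circle_test_function:
  assumes "real_polynomial_function q"
  shows "test_function1 (\<lambda>t. q (cis (2 * pi * t)))"
  unfolding test_function1_def
proof (intro conjI allI)
  have *: "\<exists>q'. real_polynomial_function q' \<and> (deriv ^^ n) (\<lambda>t. q (cis (2 * pi * t))) = (\<lambda>t. q' (cis (2 * pi * t)))" for n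
  proof (induction n)
    case 0 show ?case using assms by (auto intro!: exI[of _ q])
  next
    case (Suc n)
    then obtain q' where q': "real_polynomial_function q'" "(deriv ^^ n) (\<lambda>t. q (cis (2 * pi * t))) = (\<lambda>t. q' (cis (2 * pi * t)))"
      by blast
    obtain r where r: "real_polynomial_function r"
      "\<And>t. ((\<lambda>t. q' (cis (2 * pi * t))) has_real_derivative r (cis (2 * pi * t))) (at t)"
      using real_polynomial_circle_deriv[OF q'(1)] by blast
    have "deriv (\<lambda>t. q' (cis (2 * pi * t))) = (\<lambda>t. r (cis (2 * pi * t)))"
      by (intro ext DERIV_imp_deriv r(2))
    then show ?case using q'(2) r(1) by auto
  qed
  fix n
  obtain q' where q': "real_polynomial_function q'" "(deriv ^^ n) (\<lambda>t. q (cis (2 * pi * t))) = (\<lambda>t. q' (cis (2 * pi * t)))"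
    using * by blast
  show "(deriv ^^ n) (\<lambda>t. q (cis (2 * pi * t))) differentiable_on UNIV"
    unfolding q'(2) differentiable_on_def
    using real_polynomial_circle_deriv[OF q'(1)]
    by (meson real_differentiable_def)
next
  fix t
  have "cis (2 * pi * (t + 1)) = cis (2 * pi * t) * cis (2 * pi)"
    by (simp add: cis_mult distrib_left del: cis_2pi)
  then show "q (cis (2 * pi * (t + 1))) = q (cis (2 * pi * t))" by simp
qed

lemma cis_inj_circle:
  assumes "s \<in> {0..<1}" "t \<in> {0..<1}" "cis (2 * pi * s) = cis (2 * pi * t)"
  shows "s = t"
proof -
  have "sin (2 * pi * s) = sin (2 * pi * t) \<and> cos (2 * pi * s) = cos (2 * pi * t)"
    using assms(3) by (simp add: complex_eq_iff)
  then obtain n :: int where "2 * pi * s = 2 * pi * t + 2 * pi * n"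
    unfolding sin_cos_eq_iff by blast
  then have "2 * pi * (s - t - n) = 0" by (simp add: algebra_simps)
  then have n: "s - t = n" by simp
  then have "\<bar>real_of_int n\<bar> < 1" using assms(1,2) by auto
  then have "n = 0" by linarith
  then show ?thesis using n by simp
qed

text \<open>The tents \<open>F n\<close> decrease to the indicator of the image L of K on the unit
  circle, and Stone-Weierstrass replaces each by a trigonometric polynomial up to 1 / (n + 1). The
  uniform bound 2 = 1 + 1 is there for dominated convergence.\<close>

lemma indicator_limit_test_functions:
  assumes K: "compact K" "K \<subseteq> {0..<1}"
  shows "\<exists>q. (\<forall>n. real_polynomial_function (q n)) \<and> (\<forall>n t. \<bar>q n (cis (2 * pi * t))\<bar> \<le> 2) \<and>
    (\<forall>t\<in>{0..<1}. (\<lambda>n::nat. q n (cis (2 * pi * t))) \<longlonglongrightarrow> indicator K t)"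
proof (cases "K = {}")
  case True
  then show ?thesis by (intro exI[of _ "\<lambda>_ _. 0"]) auto
next
  case False
  define L where "L = (\<lambda>t. cis (2 * pi * t)) ` K"
  have "compact L" unfolding L_def
    by (intro compact_continuous_image K continuous_intros)
  then have L: "closed L" by (rule compact_imp_closed)
  have L0: "L \<noteq> {}" using False by (simp add: L_def)
  define F where "F n z = max 0 (1 - real n * infdist z L)" for n z
  have F01: "0 \<le> F n z" "F n z \<le> 1" for n z by (auto simp: F_def infdist_nonneg)
  have "\<exists>q. real_polynomial_function q \<and> (\<forall>z\<in>sphere 0 1. \<bar>F n z - q z\<bar> < 1 / real (Suc n))" for n
  proof -
    have "continuous_on (sphere 0 1) (F n)" unfolding F_def by (intro continuous_intros)
    moreover have "0 < 1 / real (Suc n)" by simp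
    ultimately obtain g where "real_polynomial_function g" "\<And>z. z \<in> sphere 0 1 \<Longrightarrow> \<bar>F n z - g z\<bar> < 1 / real (Suc n)"
      using Stone_Weierstrass_real_polynomial_function[OF compact_sphere] by blast
    then show ?thesis by (intro exI[of _ g] conjI ballI)
  qed
  then obtain q where q: "\<And>n. real_polynomial_function (q n)"
    "\<And>n z. z \<in> sphere 0 1 \<Longrightarrow> \<bar>F n z - q n z\<bar> < 1 / real (Suc n)" by metis
  have qe: "\<bar>F n (cis (2 * pi * t)) - q n (cis (2 * pi * t))\<bar> < 1 / real (Suc n)" for n t
    by (rule q(2)) (simp add: norm_cis)
  have "\<bar>q n (cis (2 * pi * t))\<bar> \<le> 2" for n t
  proof -
    have "1 / real (Suc n) \<le> 1" by simp
    then show ?thesis using qe[of n t] F01[where z="cis (2 * pi * t)" and n=n] by linarith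
  qed
  moreover have "(\<lambda>n. q n (cis (2 * pi * t))) \<longlonglongrightarrow> indicator K t" if t: "t \<in> {0..<1}" for t
  proof -
    have "(\<lambda>n. F n (cis (2 * pi * t))) \<longlonglongrightarrow> indicator K t"
    proof (cases "t \<in> K")
      case True
      then have "infdist (cis (2 * pi * t)) L = 0" by (auto simp: L_def)
      then show ?thesis using True by (simp add: F_def)
    next
      case False
      \<comment> \<open>Injectivity of the parametrization on the fundamental domain: a parameter
        outside K is not sent into L, hence lies at positive distance from this closed set.\<close>
      have "cis (2 * pi * t) \<notin> L"
        using False cis_inj_circle[OF t] K(2) by (auto simp: L_def)
      then have c: "infdist (cis (2 * pi * t)) L > 0"
        using in_closed_iff_infdist_zero[OF L L0] infdist_nonneg[of "cis (2 * pi * t)" L] by (metis less_eq_real_def)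
      then have "eventually (\<lambda>n. real n * infdist (cis (2 * pi * t)) L > 1) sequentially"
      proof -
        obtain m :: nat where m: "1 / infdist (cis (2 * pi * t)) L < real m" using reals_Archimedean2 by blast
        show ?thesis
          using eventually_ge_at_top[of m]
        proof eventually_elim
          case (elim n)
          then have "1 / infdist (cis (2 * pi * t)) L < real n" using m by linarith
          then show ?case using c by (simp add: divide_less_eq)
        qed
      qed
      then have "eventually (\<lambda>n. F n (cis (2 * pi * t)) = 0) sequentially"
        by eventually_elim (simp add: F_def)
      then show ?thesis using False by (simp add: tendsto_eventually)
    qed
    moreover have "(\<lambda>n. F n (cis (2 * pi * t)) - q n (cis (2 * pi * t))) \<longlonglongrightarrow> 0"
    proof (rule Lim_null_comparison)
      show "(\<lambda>n. 1 / real (Suc n)) \<longlonglongrightarrow> 0" using LIMSEQ_inverse_real_of_nat by (simp add: inverse_eq_divide)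
      show "\<forall>\<^sub>F n in sequentially. norm (F n (cis (2 * pi * t)) - q n (cis (2 * pi * t))) \<le> 1 / real (Suc n)"
        using qe[of _ t] by (intro always_eventually) (auto intro: less_imp_le)
    qed
    ultimately have "(\<lambda>n. F n (cis (2 * pi * t)) - (F n (cis (2 * pi * t)) - q n (cis (2 * pi * t)))) \<longlonglongrightarrow> indicator K t - 0"
      by (intro tendsto_diff)
    then show ?thesis by simp
  qed
  ultimately show ?thesis using q(1) by blast
qed

lemma space_circle [simp]: "space circle = {0..<1}"
  by (simp add: circle_def space_restrict_space)

lemma sets_circle: "sets circle = {A \<in> sets borel. A \<subseteq> {0..<1}}"
  by (auto simp: circle_def sets_restrict_space_iff subset_eq)

lemma prob_space_circle: "prob_space circle"
  unfolding circle_def by (intro prob_space_restrict_space) auto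

interpretation circle: prob_space circle by (rule prob_space_circle)

lemma measure_circle_space [simp]: "measure circle {0..<1} = 1"
  using circle.prob_space by simp

lemma borel_measurable_circle: "f \<in> borel_measurable borel \<Longrightarrow> f \<in> borel_measurable circle"
  by (simp add: circle_def measurable_restrict_space1)

lemma test_function1_cont:
  assumes "test_function1 \<tau>"
  shows "continuous_on A \<tau>" "continuous_on A (deriv \<tau>)" "(\<tau> has_real_derivative deriv \<tau> x) (at x)"
proof -
  have 0: "\<tau> differentiable_on UNIV" "deriv \<tau> differentiable_on UNIV"
    using assms[unfolded test_function1_def, THEN conjunct1, rule_format, of 0]
      assms[unfolded test_function1_def, THEN conjunct1, rule_format, of 1] by auto
  show "continuous_on A \<tau>" "continuous_on A (deriv \<tau>)"
    using 0 differentiable_imp_continuous_on continuous_on_subset by blast+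
  show "(\<tau> has_real_derivative deriv \<tau> x) (at x)"
    using 0(1) by (intro DERIV_deriv_iff_real_differentiable[THEN iffD2]) (simp add: differentiable_on_def)
qed

lemma continuous_circle_bounded:
  fixes h :: "real \<Rightarrow> real"
  assumes "continuous_on UNIV h"
  shows "h \<in> borel_measurable circle" "\<exists>B. \<forall>x\<in>{0..<1}. \<bar>h x\<bar> \<le> B"
proof -
  show "h \<in> borel_measurable circle"
    using assms by (intro borel_measurable_circle borel_measurable_continuous_onI)
  have "compact (h ` {0..1})"
    using assms by (intro compact_continuous_image continuous_on_subset[OF assms]) auto
  then obtain B where "\<And>y. y \<in> h ` {0..1} \<Longrightarrow> norm y \<le> B"
    using compact_imp_bounded bounded_iff by metis
  then show "\<exists>B. \<forall>x\<in>{0..<1}. \<bar>h x\<bar> \<le> B" by (intro exI[of _ B]) auto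
qed

lemma integrable_circle_mult_continuous:
  fixes f h :: "real \<Rightarrow> real"
  assumes f: "integrable circle f" and h: "continuous_on UNIV h"
  shows "integrable circle (\<lambda>x. f x * h x)"
proof -
  obtain B where B: "\<forall>x\<in>{0..<1}. \<bar>h x\<bar> \<le> B" using continuous_circle_bounded(2)[OF h] by blast
  note [measurable] = borel_measurable_integrable[OF f] continuous_circle_bounded(1)[OF h]
  show ?thesis
  proof (rule Bochner_Integration.integrable_bound)
    show "integrable circle (\<lambda>x. B * f x)" using f by simp
    show "AE x in circle. norm (f x * h x) \<le> norm (B * f x)"
    proof (intro AE_I2)
      fix x assume "x \<in> space circle"
      then have "\<bar>h x\<bar> \<le> B" using B by simp
      then have "\<bar>h x\<bar> * \<bar>f x\<bar> \<le> \<bar>B\<bar> * \<bar>f x\<bar>" by (intro mult_right_mono) auto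
      then show "norm (f x * h x) \<le> norm (B * f x)" by (simp add: abs_mult mult.commute[of "\<bar>f x\<bar>"])
    qed
  qed auto
qed

lemma integral_indicator_circle_limit:
  assumes f: "integrable circle f"
    and q: "\<And>n. real_polynomial_function (q n)" "\<And>n t. \<bar>q n (cis (2 * pi * t))\<bar> \<le> 2"
      "\<And>t. t \<in> {0..<1} \<Longrightarrow> (\<lambda>n::nat. q n (cis (2 * pi * t))) \<longlonglongrightarrow> g t"
  shows "(\<lambda>n. \<integral>t. f t * q n (cis (2 * pi * t)) \<partial>circle) \<longlonglongrightarrow> (\<integral>t. f t * g t \<partial>circle)"
    and "g \<in> borel_measurable circle"
proof -
  note [measurable] = borel_measurable_integrable[OF f]
  have [measurable]: "(\<lambda>t. q n (cis (2 * pi * t))) \<in> borel_measurable circle" for n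
    by (rule continuous_circle_bounded(1)[OF test_function1_cont(1)[OF real_polynomial_circle_test_function[OF q(1)[of n]]]])
  show [measurable]: "g \<in> borel_measurable circle"
    by (rule borel_measurable_LIMSEQ_real[OF q(3)]) auto
  show "(\<lambda>n. \<integral>t. f t * q n (cis (2 * pi * t)) \<partial>circle) \<longlonglongrightarrow> (\<integral>t. f t * g t \<partial>circle)"
  proof (rule integral_dominated_convergence[where w="\<lambda>t. 2 * \<bar>f t\<bar>"])
    show "AE t in circle. (\<lambda>n. f t * q n (cis (2 * pi * t))) \<longlonglongrightarrow> f t * g t"
      by (intro AE_I2 tendsto_mult tendsto_const q(3)) simp
    show "AE t in circle. norm (f t * q n (cis (2 * pi * t))) \<le> 2 * \<bar>f t\<bar>" for n
    proof (intro AE_I2)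
      fix t
      have "\<bar>f t\<bar> * \<bar>q n (cis (2 * pi * t))\<bar> \<le> \<bar>f t\<bar> * 2" by (intro mult_left_mono q(2)) auto
      then show "norm (f t * q n (cis (2 * pi * t))) \<le> 2 * \<bar>f t\<bar>" by (simp add: abs_mult)
    qed
  qed (use f in auto)
qed

text \<open>Compact generators are chosen so that \<open>indicator_limit_test_functions\<close>
  applies to them. The whole circle, represented by a half-open interval, is not compact in this
  form and is added separately; its indicator is approximated by the constant 1.\<close>

lemma compact_interval_generates_circle:
  "Int_stable ({{0..c} |c. 0 \<le> c \<and> c < 1} \<union> {{0..<1::real}})"
  "sets circle = sigma_sets {0..<1} ({{0..c} |c. 0 \<le> c \<and> c < 1} \<union> {{0..<1}})" (is "_ = sigma_sets _ ?E")
proof -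
  have mm: "{0..c} \<inter> {0..d} = {0..min c d}" "{0..c} \<inter> {0..<1} = {0..c}" if "c < 1" for c d :: real
    using that by auto
  show "Int_stable ?E"
  proof (rule Int_stableI)
    fix A B assume "A \<in> ?E" "B \<in> ?E"
    then consider "A = {0..<1}" "B = {0..<1}" | c where "A = {0..c}" "B = {0..<1}" "0 \<le> c" "c < 1"
      | c where "B = {0..c}" "A = {0..<1}" "0 \<le> c" "c < 1"
      | c d where "A = {0..c}" "B = {0..d}" "0 \<le> c" "c < 1" "0 \<le> d" "d < 1" by auto
    then show "A \<inter> B \<in> ?E"
    proof cases
      case 1 then show ?thesis by simp
    next
      case 2 then have "A \<inter> B = {0..c}" by auto
      then show ?thesis using 2 by auto
    next
      case 3 then have "A \<inter> B = {0..c}" by auto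
      then show ?thesis using 3 by auto
    next
      case 4 then have "A \<inter> B = {0..min c d}" by auto
      moreover have "0 \<le> min c d" "min c d < 1" using 4 by auto
      ultimately show ?thesis by blast
    qed
  qed
  have E: "?E \<subseteq> Pow {0..<1}" by auto
  interpret S: sigma_algebra "{0..<1}" "sigma_sets {0..<1} ?E" by (rule sigma_algebra_sigma_sets[OF E])
  have atMost: "{0..<1} \<inter> {..a} \<in> sigma_sets {0..<1} ?E" for a :: real
  proof -
    consider "a < 0" | "0 \<le> a" "a < 1" | "1 \<le> a" by linarith
    then show ?thesis
    proof cases
      case 1 then have "{0..<1} \<inter> {..a} = {}" by auto
      then show ?thesis by (simp add: sigma_sets.Empty)
    next
      case 2 then have "{0..<1} \<inter> {..a} = {0..a}" by auto
      then show ?thesis using 2 by (intro sigma_sets.Basic) auto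
    next
      case 3 then have "{0..<1} \<inter> {..a} = {0..<1}" by auto
      then show ?thesis by simp
    qed
  qed
  show "sets circle = sigma_sets {0..<1} ?E"
  proof
    have id: "(\<lambda>x. x) \<in> sigma {0..<1} ?E \<rightarrow>\<^sub>M borel"
      by (rule borel_measurableI_le) (use atMost E in \<open>auto simp: Int_def conj_commute\<close>)
    show "sets circle \<subseteq> sigma_sets {0..<1} ?E"
    proof
      fix A assume A: "A \<in> sets circle"
      then have "A \<in> sets borel" "A \<subseteq> {0..<1}" by (auto simp: sets_circle)
      with measurable_sets[OF id, of A] E show "A \<in> sigma_sets {0..<1} ?E"
        by (simp add: Int_absorb2)
    qed
    show "sigma_sets {0..<1} ?E \<subseteq> sets circle"
    proof -
      have "?E \<subseteq> sets circle" by (auto simp: sets_circle)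
      from sets.sigma_sets_subset[OF this] show ?thesis by simp
    qed
  qed
qed

lemma circle_generator_limit:
  assumes "A \<in> {{0..c} |c. 0 \<le> c \<and> c < 1} \<union> {{0..<1::real}}"
  shows "\<exists>q. (\<forall>n. real_polynomial_function (q n)) \<and> (\<forall>n t. \<bar>q n (cis (2 * pi * t))\<bar> \<le> 2) \<and>
    (\<forall>t\<in>{0..<1}. (\<lambda>n::nat. q n (cis (2 * pi * t))) \<longlonglongrightarrow> indicator A t)"
proof (cases "A = {0..<1}")
  case True
  then show ?thesis by (intro exI[of _ "\<lambda>_ _. 1"]) auto
next
  case False
  then show ?thesis using assms by (intro indicator_limit_test_functions) auto
qed

lemma weak_deriv_unique:
  assumes "has_weak_deriv f g" "has_weak_deriv f h"
  shows "AE x in circle. g x = h x"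
proof (rule integrable_AE_eq_generator[OF compact_interval_generates_circle(1)])
  show int: "integrable circle g" "integrable circle h"
    using assms by (auto simp: has_weak_deriv_def)
  fix A assume A: "A \<in> {{0..c} |c. 0 \<le> c \<and> c < 1} \<union> {{0..<1::real}}"
  obtain q where q: "\<And>n. real_polynomial_function (q n)" "\<And>n t. \<bar>q n (cis (2 * pi * t))\<bar> \<le> 2"
    "\<And>t. t \<in> {0..<1} \<Longrightarrow> (\<lambda>n::nat. q n (cis (2 * pi * t))) \<longlonglongrightarrow> (indicator A t :: real)"
    using circle_generator_limit[OF A] by blast
  have "(\<integral>t. g t * q n (cis (2 * pi * t)) \<partial>circle) = (\<integral>t. h t * q n (cis (2 * pi * t)) \<partial>circle)" for n
    using assms real_polynomial_circle_test_function[OF q(1)[of n]] unfolding has_weak_deriv_def by fastforce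
  then show "(\<integral>t. g t * indicator A t \<partial>circle) = (\<integral>t. h t * indicator A t \<partial>circle)"
    using integral_indicator_circle_limit(1)[OF int(1) q] integral_indicator_circle_limit(1)[OF int(2) q]
    by (simp add: LIMSEQ_unique)
next
  show "sigma_finite_measure circle" by unfold_locales
qed (use compact_interval_generates_circle(2) in auto)

lemma has_weak_deriv_linear:
  assumes "has_weak_deriv f g" "has_weak_deriv f' g'"
  shows "has_weak_deriv (\<lambda>x. a * f x + b * f' x) (\<lambda>x. a * g x + b * g' x)"
proof -
  have int: "integrable circle f" "integrable circle g" "integrable circle f'" "integrable circle g'"
    using assms by (auto simp: has_weak_deriv_def)
  show ?thesis
    unfolding has_weak_deriv_def
  proof (intro conjI allI impI)
    fix \<tau> assume \<tau>: "test_function1 \<tau>"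
    note c = test_function1_cont(1,2)[OF \<tau>, of UNIV]
    note i = int[THEN integrable_circle_mult_continuous[OF _ c(1)]] int[THEN integrable_circle_mult_continuous[OF _ c(2)]]
    have "(\<integral>x. (a * f x + b * f' x) * deriv \<tau> x \<partial>circle) = a * (\<integral>x. f x * deriv \<tau> x \<partial>circle) + b * (\<integral>x. f' x * deriv \<tau> x \<partial>circle)"
      using i by (simp add: distrib_right mult.assoc)
    also have "\<dots> = a * (- (\<integral>x. g x * \<tau> x \<partial>circle)) + b * (- (\<integral>x. g' x * \<tau> x \<partial>circle))"
      using assms \<tau> by (simp add: has_weak_deriv_def)
    also have "\<dots> = - (\<integral>x. (a * g x + b * g' x) * \<tau> x \<partial>circle)"
      using i by (simp add: distrib_right mult.assoc)
    finally show "(\<integral>x. (a * f x + b * f' x) * deriv \<tau> x \<partial>circle) = - (\<integral>x. (a * g x + b * g' x) * \<tau> x \<partial>circle)" .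
  qed (use int in auto)
qed

lemma has_weak_deriv_cong:
  assumes "has_weak_deriv f g" "f' \<in> borel_measurable circle" "AE x in circle. f x = f' x"
  shows "has_weak_deriv f' g"
proof -
  have int: "integrable circle f" "integrable circle g" using assms by (auto simp: has_weak_deriv_def)
  have [measurable]: "f \<in> borel_measurable circle" "f' \<in> borel_measurable circle" using int assms by auto
  show ?thesis
    unfolding has_weak_deriv_def
  proof (intro conjI allI impI)
    show "integrable circle f'" by (rule integrable_cong_AE_imp[OF int(1) assms(2,3)])
    fix \<tau> assume \<tau>: "test_function1 \<tau>"
    have [measurable]: "deriv \<tau> \<in> borel_measurable circle"
      using test_function1_cont(2)[OF \<tau>] by (rule continuous_circle_bounded)
    have "(\<integral>x. f' x * deriv \<tau> x \<partial>circle) = (\<integral>x. f x * deriv \<tau> x \<partial>circle)"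
      by (rule integral_cong_AE) (use assms(3) in auto)
    then show "(\<integral>x. f' x * deriv \<tau> x \<partial>circle) = - (\<integral>x. g x * \<tau> x \<partial>circle)"
      using assms(1) \<tau> by (simp add: has_weak_deriv_def)
  qed (rule int(2))
qed


section \<open>Pointwise control of a function on the circle by its weak derivative\<close>

lemma integral_circle_interval:
  fixes h :: "real \<Rightarrow> real"
  assumes "continuous_on UNIV h"
  shows "(\<integral>x. h x \<partial>circle) = (LBINT x=0..1. h x)"
proof -
  have "(\<integral>x. h x \<partial>circle) = (LBINT x:{0..<1}. h x)"
    unfolding circle_def set_lebesgue_integral_def by (subst integral_restrict_space) auto
  also have "\<dots> = (LBINT x=0..1. h x)"
    using interval_integral_Ico[of 0 1 h] by (simp add: zero_ereal_def one_ereal_def)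
  finally show ?thesis .
qed

lemma test_function1_diff_const:
  assumes "test_function1 \<tau>"
  shows "test_function1 (\<lambda>x. \<tau> x - c)"
proof -
  have d: "deriv (\<lambda>x. \<tau> x - c) = deriv \<tau>"
  proof
    fix x
    show "deriv (\<lambda>x. \<tau> x - c) x = deriv \<tau> x"
      by (rule DERIV_imp_deriv) (auto intro!: derivative_eq_intros test_function1_cont(3)[OF assms])
  qed
  have it: "(deriv ^^ Suc n) (\<lambda>x. \<tau> x - c) = (deriv ^^ Suc n) \<tau>" for n
    by (simp add: funpow_Suc_right d del: funpow.simps)
  show ?thesis
    unfolding test_function1_def
  proof (intro conjI allI)
    fix n
    show "(deriv ^^ n) (\<lambda>x. \<tau> x - c) differentiable_on UNIV"
    proof (cases n)
      case 0
      then show ?thesis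
        using assms[unfolded test_function1_def, THEN conjunct1, rule_format, of 0] by simp
    next
      case (Suc m)
      show ?thesis
        unfolding Suc it using assms by (simp only: test_function1_def)
    qed
  qed (use assms in \<open>simp add: test_function1_def\<close>)
qed

text \<open>A primitive of a periodic function is periodic when the mean vanishes; normalized to 0
  at 0, it is bounded on the fundamental domain by the L1 norm of the integrand.\<close>

lemma test_function1_antiderivative:
  assumes \<tau>: "test_function1 \<tau>" and mean: "(\<integral>x. \<tau> x \<partial>circle) = 0"
  shows "\<exists>\<theta>. test_function1 \<theta> \<and> deriv \<theta> = \<tau> \<and> (\<forall>x\<in>{0..<1}. \<bar>\<theta> x\<bar> \<le> (\<integral>x. \<bar>\<tau> x\<bar> \<partial>circle))"
proof -
  have cont: "continuous_on UNIV \<tau>" by (rule test_function1_cont(1)[OF \<tau>])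
  then have "isCont \<tau> x" for x by (simp add: continuous_on_eq_continuous_at)
  then obtain F where F: "\<And>x. (F has_vector_derivative \<tau> x) (at x)"
    using einterval_antiderivative[of "-\<infinity>" "\<infinity>" \<tau>] by auto
  define \<theta> where "\<theta> x = F x - F 0" for x
  have d: "(\<theta> has_real_derivative \<tau> x) (at x)" for x
    using F[of x] unfolding \<theta>_def by (auto intro!: derivative_eq_intros simp: has_real_derivative_iff_has_vector_derivative)
  have FTC: "(LBINT t=a..b. \<tau> t) = \<theta> b - \<theta> a" for a b
  proof (rule interval_integral_FTC_finite)
    show "continuous_on {min a b..max a b} \<tau>" using cont continuous_on_subset by blast
    show "(\<theta> has_vector_derivative \<tau> x) (at x within {min a b..max a b})" for x
      using d[of x] by (auto simp: has_real_derivative_iff_has_vector_derivative intro: has_vector_derivative_at_within)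
  qed
  \<comment> \<open>Here the vanishing mean is used. The function \<theta> (x + 1) - \<theta> x has
    derivative 0 by periodicity of \<tau>, so it is constantly \<theta> 1 - \<theta> 0 = 0.\<close>
  have "\<theta> 1 = 0"
    using FTC[of 0 1] mean integral_circle_interval[OF cont] by (simp add: \<theta>_def zero_ereal_def one_ereal_def)
  have per: "\<tau> (x + 1) = \<tau> x" for x using \<tau> by (simp add: test_function1_def)
  have "((\<lambda>x. \<theta> (x + 1) - \<theta> x) has_real_derivative 0) (at x)" for x
  proof -
    have "((\<lambda>x. \<theta> (x + 1)) has_real_derivative \<tau> (x + 1)) (at x)"
      using d[of "x + 1"] by (subst DERIV_shift[symmetric]) (simp add: add.commute)
    then show ?thesis using d[of x] per[of x] by (auto intro!: derivative_eq_intros)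
  qed
  then have "\<theta> (x + 1) - \<theta> x = \<theta> (0 + 1) - \<theta> 0" for x
    using DERIV_isconst_all[of "\<lambda>x. \<theta> (x + 1) - \<theta> x"] by blast
  then have per': "\<theta> (x + 1) = \<theta> x" for x using \<open>\<theta> 1 = 0\<close> by (simp add: \<theta>_def)
  have deriv: "deriv \<theta> = \<tau>" by (intro ext DERIV_imp_deriv d)
  have "(deriv ^^ n) \<theta> differentiable_on UNIV" for n
  proof (cases n)
    case 0
    then show ?thesis using d by (auto simp: differentiable_on_def real_differentiable_def)
  next
    case (Suc m)
    then have "(deriv ^^ n) \<theta> = (deriv ^^ m) \<tau>" by (simp add: funpow_Suc_right deriv del: funpow.simps)
    then show ?thesis using \<tau> by (simp add: test_function1_def)
  qed
  then have test: "test_function1 \<theta>" using per' by (simp add: test_function1_def)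
  have "\<bar>\<theta> x\<bar> \<le> (\<integral>x. \<bar>\<tau> x\<bar> \<partial>circle)" if x: "x \<in> {0..<1}" for x
  proof -
    have "\<theta> x = (LBINT t=0..x. \<tau> t)" using FTC[of 0 x] by (simp add: \<theta>_def zero_ereal_def)
    also have "\<dots> = (LBINT t:{0..x}. \<tau> t)"
      using x interval_integral_Icc[of 0 x \<tau>] by (simp add: zero_ereal_def)
    finally have "\<bar>\<theta> x\<bar> \<le> (LINT t|lborel. \<bar>indicator {0..x} t *\<^sub>R \<tau> t\<bar>)"
      unfolding set_lebesgue_integral_def by (simp only: integral_abs_bound)
    also have "\<dots> = (LINT t|lborel. \<bar>\<tau> t\<bar> * indicator {0..x} t)"
      by (intro Bochner_Integration.integral_cong) (auto simp: indicator_def)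
    also have "\<dots> \<le> (LINT t|lborel. \<bar>\<tau> t\<bar> * indicator {0..<1} t)"
    proof (rule integral_mono)
      have c: "continuous_on UNIV (\<lambda>t. \<bar>\<tau> t\<bar>)" using cont by (intro continuous_intros)
      have i: "set_integrable lborel {a..b} (\<lambda>t. \<bar>\<tau> t\<bar>)" for a b
        using c continuous_on_subset by (intro borel_integrable_atLeastAtMost') blast
      show "integrable lborel (\<lambda>t. \<bar>\<tau> t\<bar> * indicator {0..x} t)"
        using i[of 0 x] by (simp add: set_integrable_def mult.commute)
      have "set_integrable lborel {0..<1} (\<lambda>t. \<bar>\<tau> t\<bar>)"
        by (rule set_integrable_subset[OF i[of 0 1]]) auto
      then show "integrable lborel (\<lambda>t. \<bar>\<tau> t\<bar> * indicator {0..<1} t)"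
        by (simp add: set_integrable_def mult.commute)
      show "\<bar>\<tau> t\<bar> * indicator {0..x} t \<le> \<bar>\<tau> t\<bar> * indicator {0..<1} t" for t
        using x by (auto simp: indicator_def)
    qed
    also have "\<dots> = (\<integral>x. \<bar>\<tau> x\<bar> \<partial>circle)"
      unfolding circle_def by (subst integral_restrict_space) (auto simp: mult.commute)
    finally show ?thesis .
  qed
  with test deriv show ?thesis by blast
qed

text \<open>Dual form of a one-dimensional Poincare inequality. Subtracting the mean of f amounts to
  subtracting the mean m of \<tau>, and \<tau> - m is the derivative of a test function \<theta>,
  against which g can be tested. The factor 2 arises because |m| is bounded by the L1 norm of
  \<tau>.\<close>

lemma weak_deriv_test_bound:
  assumes w: "has_weak_deriv f g" and \<tau>: "test_function1 \<tau>"
  shows "\<bar>\<integral>x. (f x - (\<integral>y. f y \<partial>circle)) * \<tau> x \<partial>circle\<bar> \<le> 2 * (\<integral>x. \<bar>g x\<bar> \<partial>circle) * (\<integral>x. \<bar>\<tau> x\<bar> \<partial>circle)"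
proof -
  define m where "m = (\<integral>x. \<tau> x \<partial>circle)"
  define c where "c = (\<integral>x. f x \<partial>circle)"
  have cont: "continuous_on UNIV \<tau>" by (rule test_function1_cont(1)[OF \<tau>])
  have int: "integrable circle f" "integrable circle g" using w by (auto simp: has_weak_deriv_def)
  have i\<tau>: "integrable circle \<tau>"
    using integrable_circle_mult_continuous[of "\<lambda>_. 1" \<tau>, OF _ cont] by simp
  have if\<tau>: "integrable circle (\<lambda>x. f x * \<tau> x)" by (rule integrable_circle_mult_continuous[OF int(1) cont])
  have "(\<integral>x. \<tau> x - m \<partial>circle) = 0" using i\<tau> by (simp add: m_def circle.prob_space)
  from test_function1_antiderivative[OF test_function1_diff_const[OF \<tau>] this]
  obtain \<theta> where \<theta>: "test_function1 \<theta>" "deriv \<theta> = (\<lambda>x. \<tau> x - m)"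
    "\<And>x. x \<in> {0..<1} \<Longrightarrow> \<bar>\<theta> x\<bar> \<le> (\<integral>x. \<bar>\<tau> x - m\<bar> \<partial>circle)" by blast
  have "(\<integral>x. \<bar>\<tau> x - m\<bar> \<partial>circle) \<le> (\<integral>x. \<bar>\<tau> x\<bar> + \<bar>m\<bar> \<partial>circle)"
    using i\<tau> by (intro integral_mono) auto
  also have "\<dots> = (\<integral>x. \<bar>\<tau> x\<bar> \<partial>circle) + \<bar>m\<bar>" using i\<tau> by (simp add: circle.prob_space)
  also have "\<bar>m\<bar> \<le> (\<integral>x. \<bar>\<tau> x\<bar> \<partial>circle)" unfolding m_def by (rule integral_abs_bound)
  finally have b: "(\<integral>x. \<bar>\<tau> x - m\<bar> \<partial>circle) \<le> 2 * (\<integral>x. \<bar>\<tau> x\<bar> \<partial>circle)" by simp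
  have "(\<integral>x. (f x - c) * \<tau> x \<partial>circle) = (\<integral>x. f x * \<tau> x \<partial>circle) - c * m"
    using i\<tau> if\<tau> by (simp add: left_diff_distrib m_def)
  also have "\<dots> = (\<integral>x. f x * deriv \<theta> x \<partial>circle)"
    using if\<tau> int by (simp add: \<theta>(2) right_diff_distrib c_def)
  also have "\<dots> = - (\<integral>x. g x * \<theta> x \<partial>circle)"
    using w \<theta>(1) by (simp add: has_weak_deriv_def)
  finally have "\<bar>\<integral>x. (f x - c) * \<tau> x \<partial>circle\<bar> \<le> (\<integral>x. \<bar>g x * \<theta> x\<bar> \<partial>circle)"
    using integral_abs_bound[of circle "\<lambda>x. g x * \<theta> x"] by simp
  also have "\<dots> \<le> (\<integral>x. 2 * (\<integral>x. \<bar>\<tau> x\<bar> \<partial>circle) * \<bar>g x\<bar> \<partial>circle)"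
  proof (rule integral_mono)
    show "integrable circle (\<lambda>x. \<bar>g x * \<theta> x\<bar>)"
      using integrable_circle_mult_continuous[OF int(2) test_function1_cont(1)[OF \<theta>(1)]] by simp
    fix x assume "x \<in> space circle"
    then have "\<bar>\<theta> x\<bar> \<le> 2 * (\<integral>x. \<bar>\<tau> x\<bar> \<partial>circle)" using \<theta>(3)[of x] b by simp
    then show "\<bar>g x * \<theta> x\<bar> \<le> 2 * (\<integral>x. \<bar>\<tau> x\<bar> \<partial>circle) * \<bar>g x\<bar>"
      by (simp add: abs_mult mult.commute[of "\<bar>g x\<bar>"] mult_right_mono)
  qed (use int in simp)
  finally show ?thesis by (simp add: c_def mult_ac)
qed

text \<open>If the set where the bound fails had positive measure, so would a compact subset K of
  it. Testing against trigonometric polynomials that approximate the indicator of K contradicts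
  \<open>weak_deriv_test_bound\<close>, because their L1 norms tend to the measure of K.\<close>

lemma weak_deriv_one_sided_bound:
  assumes w: "has_weak_deriv f g"
  shows "AE x in circle. f x - (\<integral>y. f y \<partial>circle) \<le> 2 * (\<integral>y. \<bar>g y\<bar> \<partial>circle)"
proof (rule ccontr)
  assume neg: "\<not> ?thesis"
  define c where "c = (\<integral>x. f x \<partial>circle)"
  define k where "k = 2 * (\<integral>x. \<bar>g x\<bar> \<partial>circle)"
  have int: "integrable circle f" "integrable circle g" using w by (auto simp: has_weak_deriv_def)
  note [measurable] = borel_measurable_integrable[OF int(1)]
  define A where "A = {x \<in> space circle. k < f x - c}"
  have A: "A \<in> sets circle" unfolding A_def by measurable
  have A': "A \<in> sets borel" "A \<subseteq> {0..<1}" using A by (auto simp: sets_circle)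
  have eA: "emeasure circle B = emeasure lborel B" if "B \<subseteq> {0..<1}" for B
    unfolding circle_def using that by (subst emeasure_restrict_space) auto
  have "emeasure circle A \<noteq> 0"
  proof
    assume "emeasure circle A = 0"
    then have "A \<in> null_sets circle" using A by auto
    then have "AE x in circle. x \<notin> A" by (rule AE_not_in)
    then have "AE x in circle. f x - c \<le> k"
      using AE_space by eventually_elim (auto simp: A_def)
    with neg show False by (simp add: c_def k_def)
  qed
  then have pos: "0 < emeasure circle A" by (simp add: zero_less_iff_neq_zero)
  \<comment> \<open>\<open>inner_regular\<close> concerns finite Borel measures on the whole line;
    M' extends the measure of the circle by zero outside the fundamental domain.\<close>
  define M' where "M' = density lborel (indicator {0..<1::real})"
  have eM': "emeasure M' B = emeasure lborel B" if "B \<in> sets borel" "B \<subseteq> {0..<1}" for B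
  proof -
    have "emeasure M' B = (\<integral>\<^sup>+x. indicator {0..<1} x * indicator B x \<partial>lborel)"
      using that by (simp add: M'_def emeasure_density)
    also have "\<dots> = (\<integral>\<^sup>+x. indicator B x \<partial>lborel)"
      using that by (intro nn_integral_cong) (auto simp: indicator_def)
    finally show ?thesis using that by simp
  qed
  have "emeasure M' (space M') \<noteq> \<infinity>"
    by (simp add: M'_def emeasure_density)
  from inner_regular[OF _ this A'(1)] have "0 < (SUP K \<in> {K. K \<subseteq> A \<and> compact K}. emeasure M' K)"
    using pos eA[OF A'(2)] eM'[OF A'] by (simp add: M'_def)
  then obtain K where K: "K \<subseteq> A" "compact K" "0 < emeasure M' K"
    by (auto simp: less_SUP_iff)
  have K': "K \<subseteq> {0..<1}" "K \<in> sets borel" using K A' borel_closed[OF compact_imp_closed[OF K(2)]] by auto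
  then have Kc: "K \<in> sets circle" by (simp add: sets_circle)
  have posK: "0 < measure circle K"
    using K(3) unfolding eM'[OF K'(2,1)] eA[OF K'(1), symmetric] circle.emeasure_eq_measure by simp
  obtain q where q: "\<And>n. real_polynomial_function (q n)" "\<And>n t. \<bar>q n (cis (2 * pi * t))\<bar> \<le> 2"
    "\<And>t. t \<in> {0..<1} \<Longrightarrow> (\<lambda>n::nat. q n (cis (2 * pi * t))) \<longlonglongrightarrow> (indicator K t :: real)"
    using indicator_limit_test_functions[OF K(2) K'(1)] by blast
  have ifc: "integrable circle (\<lambda>x. f x - c)" using int by simp
  have lim1: "(\<lambda>n. \<integral>t. (f t - c) * q n (cis (2 * pi * t)) \<partial>circle) \<longlonglongrightarrow> (\<integral>t. (f t - c) * indicator K t \<partial>circle)"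
    by (rule integral_indicator_circle_limit(1)[OF ifc q])
  have lim2: "(\<lambda>n. \<integral>t. \<bar>q n (cis (2 * pi * t))\<bar> \<partial>circle) \<longlonglongrightarrow> (\<integral>t. indicator K t \<partial>circle)"
  proof (rule integral_dominated_convergence[where w="\<lambda>_. 2"])
    show "AE t in circle. (\<lambda>n. \<bar>q n (cis (2 * pi * t))\<bar>) \<longlonglongrightarrow> indicator K t"
    proof (intro AE_I2)
      fix t assume "t \<in> space circle"
      then have "(\<lambda>n. \<bar>q n (cis (2 * pi * t))\<bar>) \<longlonglongrightarrow> \<bar>indicator K t\<bar>"
        by (intro tendsto_rabs q(3)) simp
      then show "(\<lambda>n. \<bar>q n (cis (2 * pi * t))\<bar>) \<longlonglongrightarrow> indicator K t" by simp
    qed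
    have m: "(\<lambda>t. q n (cis (2 * pi * t))) \<in> borel_measurable circle" for n
      by (rule continuous_circle_bounded(1)[OF test_function1_cont(1)[OF real_polynomial_circle_test_function[OF q(1)[of n]]]])
    show "(\<lambda>t. \<bar>q n (cis (2 * pi * t))\<bar>) \<in> borel_measurable circle" for n
      using m[of n] by simp
  qed (use Kc q(2) in auto)
  have "(\<integral>t. (f t - c) * indicator K t \<partial>circle) \<le> k * (\<integral>t. indicator K t \<partial>circle)"
  proof (rule LIMSEQ_le[OF lim1 tendsto_mult_left[OF lim2]], intro exI allI impI)
    fix n
    have "\<bar>\<integral>t. (f t - c) * q n (cis (2 * pi * t)) \<partial>circle\<bar> \<le> k * (\<integral>t. \<bar>q n (cis (2 * pi * t))\<bar> \<partial>circle)"
      unfolding c_def k_def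
      by (rule weak_deriv_test_bound[OF w real_polynomial_circle_test_function[OF q(1)[of n]]])
    then show "(\<integral>t. (f t - c) * q n (cis (2 * pi * t)) \<partial>circle) \<le> k * (\<integral>t. \<bar>q n (cis (2 * pi * t))\<bar> \<partial>circle)"
      by linarith
  qed
  then have le: "(\<integral>t. (f t - c) * indicator K t - k * indicator K t \<partial>circle) \<le> 0"
    using integrable_real_mult_indicator[OF Kc ifc] Kc by (simp add: circle.emeasure_eq_measure)
  have i: "integrable circle (\<lambda>t. (f t - c) * indicator K t - k * indicator K t)"
    using integrable_real_mult_indicator[OF Kc ifc] Kc by (simp add: circle.emeasure_eq_measure)
  have nn: "0 \<le> (f t - c) * indicator K t - k * indicator K t" for t
    using K(1) by (auto simp: indicator_def A_def)
  have "(\<integral>t. (f t - c) * indicator K t - k * indicator K t \<partial>circle) = 0"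
    using le nn by (intro antisym Bochner_Integration.integral_nonneg) auto
  then have "AE t in circle. (f t - c) * indicator K t - k * indicator K t = 0"
    using integral_nonneg_eq_0_iff_AE[OF i] nn by auto
  then have "AE t in circle. t \<notin> K"
    by eventually_elim (use K(1) in \<open>auto simp: A_def\<close>)
  then have "measure circle K = 0"
    by (intro measure_eq_0_null_sets AE_iff_null_sets[OF Kc, THEN iffD2])
  then show False using posK by simp
qed

lemma weak_deriv_bound:
  assumes w: "has_weak_deriv f g"
  shows "AE x in circle. \<bar>f x - (\<integral>y. f y \<partial>circle)\<bar> \<le> 2 * (\<integral>y. \<bar>g y\<bar> \<partial>circle)"
proof -
  have "has_weak_deriv (\<lambda>x. (-1) * f x + 0 * f x) (\<lambda>x. (-1) * g x + 0 * g x)"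
    by (rule has_weak_deriv_linear[OF w w])
  from weak_deriv_one_sided_bound[OF this] weak_deriv_one_sided_bound[OF w]
  show ?thesis by eventually_elim auto
qed


section \<open>Weak gradients on the torus\<close>

interpretation circles: product_sigma_finite "\<lambda>_. circle"
  by unfold_locales

lemma prob_space_torus: "prob_space (torus N)"
  unfolding torus_def by (intro prob_space_PiM prob_space_circle)

lemma space_torus: "space (torus N) = {..<N} \<rightarrow>\<^sub>E {0..<1}"
  by (simp add: torus_def space_PiM)

lemma torus_component_measurable [measurable]: "i < N \<Longrightarrow> (\<lambda>x. x i) \<in> torus N \<rightarrow>\<^sub>M circle"
  unfolding torus_def by (rule measurable_component_singleton) simp

text \<open>Written in the shape of the generator that \<open>sets_PiM_sigma\<close> produces, with
  one set of the circle's generator in each coordinate.\<close>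

definition torus_boxes :: "nat \<Rightarrow> (nat \<Rightarrow> real) set set" where
  "torus_boxes N = (\<lambda>A. {f \<in> {..<N} \<rightarrow>\<^sub>E {0..<1}. \<forall>i\<in>{..<N}. f i \<in> A i}) `
     ({..<N} \<rightarrow> {{0..c} |c. 0 \<le> c \<and> c < 1} \<union> {{0..<1}})"

lemma torus_boxes_generate:
  "Int_stable (torus_boxes N)" "torus_boxes N \<subseteq> Pow (space (torus N))"
  "sets (torus N) = sigma_sets (space (torus N)) (torus_boxes N)" "space (torus N) \<in> torus_boxes N"
proof -
  let ?E = "{{0..c} |c. 0 \<le> c \<and> c < 1} \<union> {{0..<1::real}}"
  show "Int_stable (torus_boxes N)"
  proof (rule Int_stableI)
    fix X Y assume "X \<in> torus_boxes N" "Y \<in> torus_boxes N"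
    then obtain A B where A: "A \<in> Pi {..<N} (\<lambda>_. ?E)" "X = {f \<in> {..<N} \<rightarrow>\<^sub>E {0..<1}. \<forall>i\<in>{..<N}. f i \<in> A i}"
      and B: "B \<in> Pi {..<N} (\<lambda>_. ?E)" "Y = {f \<in> {..<N} \<rightarrow>\<^sub>E {0..<1}. \<forall>i\<in>{..<N}. f i \<in> B i}"
      unfolding torus_boxes_def by (elim imageE)
    have "(\<lambda>i. A i \<inter> B i) \<in> Pi {..<N} (\<lambda>_. ?E)"
    proof (rule Pi_I)
      fix i assume i: "i \<in> {..<N}"
      show "A i \<inter> B i \<in> ?E"
        by (rule Int_stableD[OF compact_interval_generates_circle(1) funcset_mem[OF A(1) i] funcset_mem[OF B(1) i]])
    qed
    moreover have "X \<inter> Y = {f \<in> {..<N} \<rightarrow>\<^sub>E {0..<1}. \<forall>i\<in>{..<N}. f i \<in> A i \<inter> B i}"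
      unfolding A(2) B(2) by auto
    ultimately show "X \<inter> Y \<in> torus_boxes N"
      unfolding torus_boxes_def by (intro image_eqI)
  qed
  show "torus_boxes N \<subseteq> Pow (space (torus N))"
    unfolding torus_boxes_def space_torus by (rule image_subsetI) simp
  have "sets (torus N) = sets (PiM {..<N} (\<lambda>_. sigma {0..<1} ?E))"
    unfolding torus_def using compact_interval_generates_circle(2)
    by (intro sets_PiM_cong refl) (auto simp: sets_measure_of_conv)
  also have "\<dots> = sets (sigma ({..<N} \<rightarrow>\<^sub>E {0..<1}) {{f\<in>{..<N} \<rightarrow>\<^sub>E {0..<1}. \<forall>i\<in>j. f i \<in> A i} |A j.
      j \<in> {{..<N}} \<and> A \<in> Pi j (\<lambda>_. ?E)})"
  proof (rule sets_PiM_sigma)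
    show "\<exists>S\<subseteq>?E. countable S \<and> {0..<1} = \<Union> S" for i
      by (intro exI[of _ "{{0..<1}}"]) auto
  qed auto
  also have "{{f\<in>{..<N} \<rightarrow>\<^sub>E {0..<1}. \<forall>i\<in>j. f i \<in> A i} |A j. j \<in> {{..<N}} \<and> A \<in> Pi j (\<lambda>_. ?E)} = torus_boxes N"
  proof (intro set_eqI iffI)
    fix Z assume "Z \<in> {{f\<in>{..<N} \<rightarrow>\<^sub>E {0..<1}. \<forall>i\<in>j. f i \<in> A i} |A j. j \<in> {{..<N}} \<and> A \<in> Pi j (\<lambda>_. ?E)}"
    then show "Z \<in> torus_boxes N"
      unfolding torus_boxes_def by (elim CollectE exE conjE singletonE, hypsubst) (rule imageI)
  next
    fix Z assume "Z \<in> torus_boxes N"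
    then show "Z \<in> {{f\<in>{..<N} \<rightarrow>\<^sub>E {0..<1}. \<forall>i\<in>j. f i \<in> A i} |A j. j \<in> {{..<N}} \<and> A \<in> Pi j (\<lambda>_. ?E)}"
      unfolding torus_boxes_def by (elim imageE, hypsubst) (intro CollectI exI conjI, rule refl, rule singletonI, assumption)
  qed
  also have "sets (sigma ({..<N} \<rightarrow>\<^sub>E {0..<1}) (torus_boxes N)) = sigma_sets (space (torus N)) (torus_boxes N)"
    using \<open>torus_boxes N \<subseteq> Pow (space (torus N))\<close> by (simp add: space_torus)
  finally show "sets (torus N) = sigma_sets (space (torus N)) (torus_boxes N)" .
  have S: "space (torus N) = {f \<in> {..<N} \<rightarrow>\<^sub>E {0..<1}. \<forall>i\<in>{..<N}. f i \<in> {0..<1}}"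
  proof (intro set_eqI iffI)
    fix f assume "f \<in> space (torus N)"
    then show "f \<in> {f \<in> {..<N} \<rightarrow>\<^sub>E {0..<1}. \<forall>i\<in>{..<N}. f i \<in> {0..<1}}"
      using PiE_mem[of f "{..<N}" "\<lambda>_. {0..<1}"] unfolding space_torus by blast
  qed (simp add: space_torus)
  show "space (torus N) \<in> torus_boxes N"
    unfolding torus_boxes_def by (rule image_eqI[where x="\<lambda>_. {0..<1}"], fact S) simp
qed

lemma partial_deriv_prod:
  assumes i: "i < N" and d: "\<And>t. ((f i) has_real_derivative f' t) (at t)"
  shows "((\<lambda>t. \<Prod>j<N. f j ((x(i := t)) j)) has_real_derivative (\<Prod>j<N. (f(i := f')) j ((x(i := s)) j))) (at s)"
    and "partial_deriv i (\<lambda>x. \<Prod>j<N. f j (x j)) = (\<lambda>x. \<Prod>j<N. (f(i := f')) j (x j))"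
proof -
  have split: "(\<Prod>j<N. h j (y j)) = h i (y i) * (\<Prod>j\<in>{..<N} - {i}. h j (y j))" for h :: "nat \<Rightarrow> 'b \<Rightarrow> real" and y
    using i by (intro prod.remove) auto
  show *: "((\<lambda>t. \<Prod>j<N. f j ((x(i := t)) j)) has_real_derivative (\<Prod>j<N. (f(i := f')) j ((x(i := s)) j))) (at s)" for x s
  proof -
    have "((\<lambda>t. f i t * (\<Prod>j\<in>{..<N} - {i}. f j (x j))) has_real_derivative f' s * (\<Prod>j\<in>{..<N} - {i}. f j (x j))) (at s)"
      by (rule DERIV_cmult_right[OF d])
    moreover have "(\<Prod>j<N. f j ((x(i := t)) j)) = f i t * (\<Prod>j\<in>{..<N} - {i}. f j (x j))" for t
      unfolding split[of f] by (auto intro!: prod.cong)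
    moreover have "(\<Prod>j<N. (f(i := f')) j ((x(i := s)) j)) = f' s * (\<Prod>j\<in>{..<N} - {i}. f j (x j))"
      unfolding split[of "f(i := f')"] by (auto intro!: prod.cong)
    ultimately show ?thesis by simp
  qed
  show "partial_deriv i (\<lambda>x. \<Prod>j<N. f j (x j)) = (\<lambda>x. \<Prod>j<N. (f(i := f')) j (x j))"
  proof
    fix x :: "nat \<Rightarrow> real"
    show "partial_deriv i (\<lambda>x. \<Prod>j<N. f j (x j)) x = (\<Prod>j<N. (f(i := f')) j (x j))"
      unfolding partial_deriv_def using DERIV_imp_deriv[OF *[of x "x i"]] by simp
  qed
qed

text \<open>A partial derivative replaces one factor by another trigonometric polynomial, so
  iterated derivatives remain products of this kind; smoothness follows by induction on the list of
  indices.\<close>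

lemma test_function_product:
  assumes q: "\<And>i. real_polynomial_function (q i)"
  shows "test_function N (\<lambda>x. \<Prod>i<N. q i (cis (2 * pi * x i)))"
proof -
  have *: "\<exists>r. (\<forall>i. real_polynomial_function (r i)) \<and>
      foldr partial_deriv is (\<lambda>x. \<Prod>i<N. q i (cis (2 * pi * x i))) = (\<lambda>x. \<Prod>i<N. r i (cis (2 * pi * x i)))"
    if "set is \<subseteq> {..<N}" for "is"
    using that
  proof (induction "is")
    case Nil
    then show ?case using q by (intro exI[of _ q]) auto
  next
    case (Cons i "is")
    then obtain r where r: "\<And>i. real_polynomial_function (r i)"
      "foldr partial_deriv is (\<lambda>x. \<Prod>i<N. q i (cis (2 * pi * x i))) = (\<lambda>x. \<Prod>i<N. r i (cis (2 * pi * x i)))"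
      by auto
    obtain r' where r': "real_polynomial_function r'"
      "\<And>t. ((\<lambda>t. r i (cis (2 * pi * t))) has_real_derivative r' (cis (2 * pi * t))) (at t)"
      using real_polynomial_circle_deriv[OF r(1)] by blast
    have "partial_deriv i (\<lambda>x. \<Prod>j<N. r j (cis (2 * pi * x j))) = (\<lambda>x. \<Prod>j<N. (r(i := r')) j (cis (2 * pi * x j)))"
      using partial_deriv_prod(2)[of i N "\<lambda>j t. r j (cis (2 * pi * t))" "\<lambda>t. r' (cis (2 * pi * t))"] r'(2) Cons(2)
      by (auto simp: fun_eq_iff fun_upd_def if_distrib[where f="\<lambda>g. g _"] intro!: prod.cong)
    then show ?case using r r'(1)
      by (intro exI[of _ "r(i := r')"]) auto
  qed
  show ?thesis
    unfolding test_function_def smooth_fun_def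
  proof (intro conjI allI impI ballI)
    fix "is" assume "set is \<subseteq> {..<N}"
    from *[OF this] obtain r where r: "\<And>i. real_polynomial_function (r i)"
      "foldr partial_deriv is (\<lambda>x. \<Prod>i<N. q i (cis (2 * pi * x i))) = (\<lambda>x. \<Prod>i<N. r i (cis (2 * pi * x i)))"
      by auto
    have "continuous_on UNIV (\<lambda>x. r i (cis (2 * pi * x i)))" for i
    proof -
      have "continuous_on UNIV (r i)"
        using r(1)[of i] continuous_on_polymonial_function real_polynomial_function_eq by blast
      moreover have "continuous_on UNIV (\<lambda>x::nat \<Rightarrow> real. cis (2 * pi * x i))"
        by (intro continuous_intros) simp
      ultimately show ?thesis
        using continuous_on_compose2[of UNIV "r i" UNIV "\<lambda>x. cis (2 * pi * x i)"] by simp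
    qed
    then have "continuous_on UNIV (\<lambda>x. \<Prod>i<N. r i (cis (2 * pi * x i)))"
      by (intro continuous_on_prod)
    then show "continuous_on (extensional {..<N}) (foldr partial_deriv is (\<lambda>x. \<Prod>i<N. q i (cis (2 * pi * x i))))"
      unfolding r(2) by (rule continuous_on_subset[OF _ subset_UNIV])
    fix x :: "nat \<Rightarrow> real" and i assume i: "i < N"
    obtain r' where r': "real_polynomial_function r'"
      "\<And>t. ((\<lambda>t. r i (cis (2 * pi * t))) has_real_derivative r' (cis (2 * pi * t))) (at t)"
      using real_polynomial_circle_deriv[OF r(1)] by blast
    show "(\<lambda>t. foldr partial_deriv is (\<lambda>x. \<Prod>i<N. q i (cis (2 * pi * x i))) (x(i := t))) differentiable at (x i)"
      unfolding r(2) real_differentiable_def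
      by (rule exI, rule partial_deriv_prod(1)[OF i, of "\<lambda>j t. r j (cis (2 * pi * t))", OF r'(2)])
  next
    fix x :: "nat \<Rightarrow> real" and i assume "i < N"
    have "cis (2 * pi * (x i + 1)) = cis (2 * pi * x i)"
      by (simp add: cis_mult[symmetric] distrib_left del: cis_mult)
    then show "(\<Prod>j<N. q j (cis (2 * pi * (x(i := x i + 1)) j))) = (\<Prod>j<N. q j (cis (2 * pi * x j)))"
      by (intro prod.cong) auto
  qed
qed

text \<open>As on the circle, with products of one-dimensional approximations of indicators. Their
  bound 2^N is harmless for dominated convergence because N is fixed.\<close>

lemma integrable_torus_AE_eq:
  assumes g: "integrable (torus N) g" and h: "integrable (torus N) h"
    and eq: "\<And>\<tau>. test_function N \<tau> \<Longrightarrow> (\<integral>x. g x * \<tau> x \<partial>torus N) = (\<integral>x. h x * \<tau> x \<partial>torus N)"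
  shows "AE x in torus N. g x = h x"
proof (rule integrable_AE_eq_generator[OF torus_boxes_generate _ g h])
  interpret prob_space "torus N" by (rule prob_space_torus)
  show "sigma_finite_measure (torus N)" by unfold_locales
  let ?E = "{{0..c} |c. 0 \<le> c \<and> c < 1} \<union> {{0..<1::real}}"
  fix X assume "X \<in> torus_boxes N"
  then obtain A where A: "A \<in> Pi {..<N} (\<lambda>_. ?E)" "X = {f \<in> {..<N} \<rightarrow>\<^sub>E {0..<1}. \<forall>i\<in>{..<N}. f i \<in> A i}"
    unfolding torus_boxes_def by (elim imageE)
  \<comment> \<open>Stated for every index i, with a dummy for i >= N, so that the choice yields a
    total family.\<close>
  have "\<exists>q. (\<forall>n. real_polynomial_function (q n)) \<and> (\<forall>n t. \<bar>q n (cis (2 * pi * t))\<bar> \<le> 2) \<and>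
    (\<forall>t\<in>{0..<1}. i < N \<longrightarrow> (\<lambda>n::nat. q n (cis (2 * pi * t))) \<longlonglongrightarrow> indicator (A i) t)" for i
  proof (cases "i < N")
    case True
    then have "A i \<in> ?E" using A(1) by blast
    from circle_generator_limit[OF this] show ?thesis using True by blast
  next
    case False
    then show ?thesis by (intro exI[of _ "\<lambda>_ _. 0"]) auto
  qed
  then obtain q where q: "\<And>i n. real_polynomial_function (q i n)" "\<And>i n t. \<bar>q i n (cis (2 * pi * t))\<bar> \<le> 2"
    "\<And>i t. t \<in> {0..<1} \<Longrightarrow> i < N \<Longrightarrow> (\<lambda>n::nat. q i n (cis (2 * pi * t))) \<longlonglongrightarrow> indicator (A i) t"
    by metis
  have qm: "(\<lambda>t. q i n (cis (2 * pi * t))) \<in> borel_measurable circle" for i n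
    by (rule continuous_circle_bounded(1)[OF test_function1_cont(1)[OF real_polynomial_circle_test_function[OF q(1)[of i n]]]])
  have [measurable]: "(\<lambda>x. \<Prod>i<N. q i n (cis (2 * pi * x i))) \<in> borel_measurable (torus N)" for n
    by (intro borel_measurable_prod measurable_compose[OF torus_component_measurable qm]) simp
  have X: "X \<in> sets (torus N)"
    using \<open>X \<in> torus_boxes N\<close> torus_boxes_generate(3)[of N] by (simp add: sigma_sets.Basic)
  have lim: "(\<lambda>n. \<integral>x. f x * (\<Prod>i<N. q i n (cis (2 * pi * x i))) \<partial>torus N) \<longlonglongrightarrow> (\<integral>x. f x * indicator X x \<partial>torus N)"
    if f: "integrable (torus N) f" for f
  proof -
    note [measurable] = borel_measurable_integrable[OF f] X
    show ?thesis
    proof (rule integral_dominated_convergence[where w="\<lambda>x. 2 ^ N * \<bar>f x\<bar>"])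
      show "AE x in torus N. (\<lambda>n. f x * (\<Prod>i<N. q i n (cis (2 * pi * x i)))) \<longlonglongrightarrow> f x * indicator X x"
      proof (intro AE_I2 tendsto_mult tendsto_const)
        fix x assume x: "x \<in> space (torus N)"
        have "(\<lambda>n. \<Prod>i<N. q i n (cis (2 * pi * x i))) \<longlonglongrightarrow> (\<Prod>i<N. indicator (A i) (x i))"
          using x by (intro tendsto_prod q(3)) (auto simp: space_torus PiE_iff)
        moreover have "(\<Prod>i<N. indicator (A i) (x i)) = (indicator X x :: real)"
          using x by (auto simp: A(2) space_torus indicator_def prod_zero_iff intro!: prod.neutral)
        ultimately show "(\<lambda>n. \<Prod>i<N. q i n (cis (2 * pi * x i))) \<longlonglongrightarrow> indicator X x" by simp
      qed
      show "AE x in torus N. norm (f x * (\<Prod>i<N. q i n (cis (2 * pi * x i)))) \<le> 2 ^ N * \<bar>f x\<bar>" for n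
      proof (intro AE_I2)
        fix x
        have "(\<Prod>i<N. \<bar>q i n (cis (2 * pi * x i))\<bar>) \<le> (\<Prod>i<N. 2)"
          using q(2) by (intro prod_mono) auto
        then have "\<bar>f x\<bar> * (\<Prod>i<N. \<bar>q i n (cis (2 * pi * x i))\<bar>) \<le> \<bar>f x\<bar> * 2 ^ N"
          by (intro mult_left_mono) auto
        then show "norm (f x * (\<Prod>i<N. q i n (cis (2 * pi * x i)))) \<le> 2 ^ N * \<bar>f x\<bar>"
          by (simp add: abs_mult abs_prod mult.commute[of "\<bar>f x\<bar>"])
      qed
    qed (use f in auto)
  qed
  have "(\<integral>x. g x * (\<Prod>i<N. q i n (cis (2 * pi * x i))) \<partial>torus N) = (\<integral>x. h x * (\<Prod>i<N. q i n (cis (2 * pi * x i))) \<partial>torus N)" for n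
    by (rule eq[OF test_function_product[OF q(1)]])
  then show "(\<integral>x. g x * indicator X x \<partial>torus N) = (\<integral>x. h x * indicator X x \<partial>torus N)"
    using lim[OF g] lim[OF h] by (simp add: LIMSEQ_unique)
qed

lemma weak_gradient_unique:
  assumes "has_weak_gradient N f g" "has_weak_gradient N f h" "i < N"
  shows "AE x in torus N. g i x = h i x"
proof (rule integrable_torus_AE_eq)
  fix \<tau> assume \<tau>: "test_function N \<tau>"
  have "(\<integral>x. f x * partial_deriv i \<tau> x \<partial>torus N) = - (\<integral>x. g i x * \<tau> x \<partial>torus N)"
    using assms(1,3) \<tau> unfolding has_weak_gradient_def by simp
  moreover have "(\<integral>x. f x * partial_deriv i \<tau> x \<partial>torus N) = - (\<integral>x. h i x * \<tau> x \<partial>torus N)"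
    using assms(2,3) \<tau> unfolding has_weak_gradient_def by simp
  ultimately show "(\<integral>x. g i x * \<tau> x \<partial>torus N) = (\<integral>x. h i x * \<tau> x \<partial>torus N)" by simp
qed (use assms in \<open>auto simp: has_weak_gradient_def\<close>)

text \<open>Continuity on \<open>extensional {..<N}\<close>, which stands for N-dimensional space,
  gives no bound by itself. The fundamental domain, however, lies in a product C of unit intervals,
  with the single point \<open>undefined\<close> in the coordinates from N on, and C is compact by
  Tychonoff.\<close>

lemma continuous_torus_bounded:
  fixes h :: "(nat \<Rightarrow> real) \<Rightarrow> real"
  assumes h: "continuous_on (extensional {..<N}) h"
  shows "h \<in> borel_measurable (torus N)" "\<exists>B. \<forall>x\<in>space (torus N). \<bar>h x\<bar> \<le> B"
proof -
  define C where "C = PiE UNIV (\<lambda>i. if i < N then {0..1} else {undefined::real})"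
  have "compactin (product_topology (\<lambda>_. euclidean) UNIV) C"
    unfolding C_def compactin_PiE by auto
  then have C: "compact C"
    using euclidean_product_topology[where 'b=real] by (metis compactin_euclidean_iff)
  have CE: "C \<subseteq> extensional {..<N}"
    by (auto simp: C_def extensional_def PiE_iff split: if_splits)
  have TC: "space (torus N) \<subseteq> C"
  proof (rule subsetI)
    fix x assume x: "x \<in> space (torus N)"
    have "x i \<in> (if i < N then {0..1} else {undefined})" for i
    proof (cases "i < N")
      case True
      then have "x i \<in> {0..<1}" using x unfolding space_torus by (intro PiE_mem[OF x[unfolded space_torus]]) simp
      then show ?thesis using True by simp
    next
      case False
      then have "x i = undefined" by (intro PiE_arb[OF x[unfolded space_torus]]) simp
      then show ?thesis using False by simp
    qed
    then show "x \<in> C" by (simp add: C_def PiE_UNIV_domain)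
  qed
  have "compact (h ` C)"
    by (intro compact_continuous_image continuous_on_subset[OF h CE] C)
  then obtain B where "\<And>y. y \<in> h ` C \<Longrightarrow> norm y \<le> B"
    using compact_imp_bounded bounded_iff by metis
  then show "\<exists>B. \<forall>x\<in>space (torus N). \<bar>h x\<bar> \<le> B" using TC by (intro exI[of _ B]) auto
  \<comment> \<open>The Borel sets of the function space refer to all coordinates. Those from N on
    are constantly \<open>undefined\<close> on the torus, so the identity is measurable coordinate
    by coordinate.\<close>
  have "(\<lambda>x. x) \<in> torus N \<rightarrow>\<^sub>M borel"
  proof (rule measurable_coordinatewise_then_product)
    fix i
    show "(\<lambda>x. x i) \<in> borel_measurable (torus N)"
    proof (cases "i < N")
      case True
      have "(\<lambda>x::real. x) \<in> borel_measurable circle" by (rule borel_measurable_circle) simp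
      from measurable_compose[OF torus_component_measurable[OF True] this] show ?thesis .
    next
      case False
      then have "x i = undefined" if "x \<in> space (torus N)" for x
        by (intro PiE_arb[OF that[unfolded space_torus]]) simp
      then show ?thesis by (subst measurable_cong[where g="\<lambda>_. undefined"]) auto
    qed
  qed
  then have id: "(\<lambda>x. x) \<in> torus N \<rightarrow>\<^sub>M restrict_space borel (extensional {..<N})"
    using TC CE by (intro measurable_restrict_space2) auto
  have "h \<in> borel_measurable (restrict_space borel (extensional {..<N}))"
    by (rule borel_measurable_continuous_on_restrict[OF h])
  from measurable_compose[OF id this] show "h \<in> borel_measurable (torus N)" .
qed

lemma test_function_cont:
  assumes "test_function N \<tau>" "i < N"
  shows "continuous_on (extensional {..<N}) \<tau>" "continuous_on (extensional {..<N}) (partial_deriv i \<tau>)"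
proof -
  have s: "continuous_on (extensional {..<N}) (foldr partial_deriv is \<tau>)" if "set is \<subseteq> {..<N}" for "is"
    using assms(1) that by (auto simp: test_function_def smooth_fun_def)
  show "continuous_on (extensional {..<N}) \<tau>" "continuous_on (extensional {..<N}) (partial_deriv i \<tau>)"
    using s[of "[]"] s[of "[i]"] assms(2) by auto
qed

lemma integrable_torus_mult_continuous:
  fixes f h :: "(nat \<Rightarrow> real) \<Rightarrow> real"
  assumes f: "integrable (torus N) f" and h: "continuous_on (extensional {..<N}) h"
  shows "integrable (torus N) (\<lambda>x. f x * h x)"
proof -
  obtain B where B: "\<forall>x\<in>space (torus N). \<bar>h x\<bar> \<le> B" using continuous_torus_bounded(2)[OF h] by blast
  note [measurable] = borel_measurable_integrable[OF f] continuous_torus_bounded(1)[OF h]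
  show ?thesis
  proof (rule Bochner_Integration.integrable_bound)
    show "integrable (torus N) (\<lambda>x. B * f x)" using f by simp
    show "AE x in torus N. norm (f x * h x) \<le> norm (B * f x)"
    proof (intro AE_I2)
      fix x assume "x \<in> space (torus N)"
      then have "\<bar>h x\<bar> \<le> \<bar>B\<bar>" using B by force
      then have "\<bar>h x\<bar> * \<bar>f x\<bar> \<le> \<bar>B\<bar> * \<bar>f x\<bar>" by (intro mult_right_mono) auto
      then show "norm (f x * h x) \<le> norm (B * f x)" by (simp add: abs_mult mult.commute[of "\<bar>f x\<bar>"])
    qed
  qed auto
qed

text \<open>The iterated derivatives of the slice are iterated i-th partial derivatives of \<tau>.
  This reduces weak gradients of tensors to weak derivatives on the circle.\<close>

lemma test_function_slice:
  assumes \<tau>: "test_function N \<tau>" and x: "x \<in> extensional {..<N}" and i: "i < N"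
  shows "test_function1 (\<lambda>t. \<tau> (x(i := t)))" "deriv (\<lambda>t. \<tau> (x(i := t))) s = partial_deriv i \<tau> (x(i := s))"
proof -
  have xe: "x(i := t) \<in> extensional {..<N}" for t
    unfolding extensional_def using extensional_arb[OF x] i by (intro CollectI allI impI) (metis fun_upd_other lessThan_iff)
  have d: "deriv (\<lambda>t. g (x(i := t))) s = partial_deriv i g (x(i := s))" for g s
    by (simp add: partial_deriv_def)
  then show "deriv (\<lambda>t. \<tau> (x(i := t))) s = partial_deriv i \<tau> (x(i := s))" .
  have it: "(deriv ^^ n) (\<lambda>t. \<tau> (x(i := t))) = (\<lambda>t. (foldr partial_deriv (replicate n i) \<tau>) (x(i := t)))" for n
  proof (induction n)
    case (Suc n)
    have "(deriv ^^ Suc n) (\<lambda>t. \<tau> (x(i := t))) = deriv (\<lambda>t. (foldr partial_deriv (replicate n i) \<tau>) (x(i := t)))"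
      by (simp only: funpow.simps o_apply Suc.IH)
    also have "\<dots> = (\<lambda>t. (foldr partial_deriv (replicate (Suc n) i) \<tau>) (x(i := t)))"
      by (rule ext, subst d) (simp only: replicate.simps foldr.simps o_apply)
    finally show ?case .
  qed simp
  show "test_function1 (\<lambda>t. \<tau> (x(i := t)))"
    unfolding test_function1_def
  proof (intro conjI allI)
    fix n
    have "set (replicate n i) \<subseteq> {..<N}" using i by auto
    then have "(\<lambda>t. foldr partial_deriv (replicate n i) \<tau> ((x(i := s))(i := t))) differentiable (at ((x(i := s)) i))" for s
      using \<tau> xe[of s] i unfolding test_function_def smooth_fun_def by blast
    then show "(deriv ^^ n) (\<lambda>t. \<tau> (x(i := t))) differentiable_on UNIV"
      unfolding it by (simp add: differentiable_on_def)
  next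
    fix t
    have "\<tau> ((x(i := t))(i := (x(i := t)) i + 1)) = \<tau> (x(i := t))"
      using \<tau> xe[of t] i unfolding test_function_def by blast
    then show "\<tau> (x(i := t + 1)) = \<tau> (x(i := t))" by simp
  qed
qed

lemma prod_upd_split:
  fixes f :: "nat \<Rightarrow> 'b \<Rightarrow> 'c::comm_monoid_mult"
  assumes "i < N"
  shows "(\<Prod>l<N. f l ((x(i := t)) l)) = f i t * (\<Prod>l\<in>{..<N} - {i}. f l (x l))"
proof -
  have "(\<Prod>l<N. f l ((x(i := t)) l)) = f i ((x(i := t)) i) * (\<Prod>l\<in>{..<N} - {i}. f l ((x(i := t)) l))"
    using assms by (intro prod.remove) auto
  also have "(\<Prod>l\<in>{..<N} - {i}. f l ((x(i := t)) l)) = (\<Prod>l\<in>{..<N} - {i}. f l (x l))"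
    by (intro prod.cong) auto
  finally show ?thesis by simp
qed

lemma integral_torus_slice:
  fixes F :: "(nat \<Rightarrow> real) \<Rightarrow> real"
  assumes F: "integrable (torus N) F" and i: "i < N"
  shows "(\<integral>x. F x \<partial>torus N) = (\<integral>x. (\<integral>t. F (x(i := t)) \<partial>circle) \<partial>PiM ({..<N} - {i}) (\<lambda>_. circle))"
proof -
  have ins: "insert i ({..<N} - {i}) = {..<N}" using i by auto
  show ?thesis
    using circles.product_integral_insert[of "{..<N} - {i}" i F] F unfolding ins torus_def by simp
qed

text \<open>By Fubini coordinate i is integrated first. On the slice the other factors are a
  constant, and the one-dimensional weak derivative is tested against the slice of \<tau>.\<close>

lemma has_weak_gradient_tensor:
  assumes f: "\<And>i. i < N \<Longrightarrow> has_weak_deriv (f i) (g i)"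
  shows "has_weak_gradient N (\<lambda>x. \<Prod>l<N. f l (x l)) (\<lambda>i x. \<Prod>l<N. (f(i := g i)) l (x l))"
proof -
  have int: "integrable circle (f i)" "integrable circle (g i)" if "i < N" for i
    using f[OF that] by (auto simp: has_weak_deriv_def)
  have intf: "integrable (torus N) (\<lambda>x. \<Prod>l<N. f l (x l))"
    unfolding torus_def by (rule circles.product_integrable_prod) (auto intro: int)
  have ig: "integrable (torus N) (\<lambda>x. \<Prod>l<N. (f(i := g i)) l (x l))" for i
    unfolding torus_def by (rule circles.product_integrable_prod) (auto intro: int)
  show ?thesis
    unfolding has_weak_gradient_def
  proof (intro conjI allI impI)
    fix i \<tau> assume i: "i < N" and \<tau>: "test_function N \<tau>"
    note c = test_function_cont[OF \<tau> i]
    let ?P = "PiM ({..<N} - {i}) (\<lambda>_. circle)"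
    have "(\<integral>x. (\<Prod>l<N. f l (x l)) * partial_deriv i \<tau> x \<partial>torus N) =
        (\<integral>x. (\<integral>t. (\<Prod>l<N. f l ((x(i := t)) l)) * partial_deriv i \<tau> (x(i := t)) \<partial>circle) \<partial>?P)"
      by (rule integral_torus_slice[OF integrable_torus_mult_continuous[OF intf c(2)] i])
    also have "\<dots> = (\<integral>x. - (\<integral>t. (\<Prod>l<N. (f(i := g i)) l ((x(i := t)) l)) * \<tau> (x(i := t)) \<partial>circle) \<partial>?P)"
    proof (rule Bochner_Integration.integral_cong[OF refl])
      fix x assume "x \<in> space ?P"
      then have "x \<in> extensional ({..<N} - {i})" by (simp add: space_PiM PiE_iff)
      then have x: "x \<in> extensional {..<N}" by (rule extensional_subset) auto
      note s = test_function_slice[OF \<tau> x i]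
      let ?c = "\<Prod>l\<in>{..<N} - {i}. f l (x l)"
      have c': "(\<Prod>l\<in>{..<N} - {i}. (f(i := g i)) l (x l)) = ?c" by (intro prod.cong) auto
      have "(\<integral>t. (\<Prod>l<N. f l ((x(i := t)) l)) * partial_deriv i \<tau> (x(i := t)) \<partial>circle) =
          (\<integral>t. ?c * (f i t * deriv (\<lambda>t. \<tau> (x(i := t))) t) \<partial>circle)"
        by (simp only: prod_upd_split[OF i] s(2) mult_ac)
      also have "\<dots> = ?c * (- (\<integral>t. g i t * \<tau> (x(i := t)) \<partial>circle))"
        using f[OF i] s(1) by (simp add: has_weak_deriv_def)
      also have "\<dots> = - (\<integral>t. ?c * (g i t * \<tau> (x(i := t))) \<partial>circle)" by simp
      also have "\<dots> = - (\<integral>t. (\<Prod>l<N. (f(i := g i)) l ((x(i := t)) l)) * \<tau> (x(i := t)) \<partial>circle)"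
        unfolding prod_upd_split[OF i] c' by (simp add: mult_ac)
      finally show "(\<integral>t. (\<Prod>l<N. f l ((x(i := t)) l)) * partial_deriv i \<tau> (x(i := t)) \<partial>circle) =
          - (\<integral>t. (\<Prod>l<N. (f(i := g i)) l ((x(i := t)) l)) * \<tau> (x(i := t)) \<partial>circle)" .
    qed
    also have "\<dots> = - (\<integral>x. (\<Prod>l<N. (f(i := g i)) l (x l)) * \<tau> x \<partial>torus N)"
      using integral_torus_slice[OF integrable_torus_mult_continuous[OF ig[of i] c(1)] i] by simp
    finally show "(\<integral>x. (\<Prod>l<N. f l (x l)) * partial_deriv i \<tau> x \<partial>torus N) =
        - (\<integral>x. (\<Prod>l<N. (f(i := g i)) l (x l)) * \<tau> x \<partial>torus N)" .
  qed (use intf ig in auto)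
qed

lemma has_weak_gradient_linear:
  assumes "has_weak_gradient N f g" "has_weak_gradient N f' g'"
  shows "has_weak_gradient N (\<lambda>x. a * f x + b * f' x) (\<lambda>i x. a * g i x + b * g' i x)"
proof -
  have int: "integrable (torus N) f" "integrable (torus N) f'"
    using assms by (auto simp: has_weak_gradient_def)
  show ?thesis
    unfolding has_weak_gradient_def
  proof (intro conjI allI impI)
    fix i assume i: "i < N"
    have intg: "integrable (torus N) (g i)" "integrable (torus N) (g' i)"
      using assms i by (auto simp: has_weak_gradient_def)
    then show "integrable (torus N) (\<lambda>x. a * g i x + b * g' i x)" by simp
    fix \<tau> assume \<tau>: "test_function N \<tau>"
    note c = test_function_cont[OF \<tau> i]
    note j = intg[THEN integrable_torus_mult_continuous[OF _ c(1)]] int[THEN integrable_torus_mult_continuous[OF _ c(2)]]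
    have "(\<integral>x. (a * f x + b * f' x) * partial_deriv i \<tau> x \<partial>torus N) =
        a * (\<integral>x. f x * partial_deriv i \<tau> x \<partial>torus N) + b * (\<integral>x. f' x * partial_deriv i \<tau> x \<partial>torus N)"
      using j by (simp add: distrib_right mult.assoc)
    also have "\<dots> = a * (- (\<integral>x. g i x * \<tau> x \<partial>torus N)) + b * (- (\<integral>x. g' i x * \<tau> x \<partial>torus N))"
      using assms \<tau> i by (simp add: has_weak_gradient_def)
    also have "\<dots> = - (\<integral>x. (a * g i x + b * g' i x) * \<tau> x \<partial>torus N)"
      using j by (simp add: distrib_right mult.assoc)
    finally show "(\<integral>x. (a * f x + b * f' x) * partial_deriv i \<tau> x \<partial>torus N) = - (\<integral>x. (a * g i x + b * g' i x) * \<tau> x \<partial>torus N)" .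
  qed (use int in auto)
qed

lemma has_weak_gradient_zero: "has_weak_gradient N (\<lambda>_. 0) (\<lambda>_ _. 0)"
  by (simp add: has_weak_gradient_def)

lemma has_weak_gradient_sum:
  assumes "\<And>j. j < (m::nat) \<Longrightarrow> has_weak_gradient N (f j) (g j)"
  shows "has_weak_gradient N (\<lambda>x. \<Sum>j<m. f j x) (\<lambda>i x. \<Sum>j<m. g j i x)"
  using assms
proof (induction m)
  case 0
  then show ?case by (simp add: has_weak_gradient_zero)
next
  case (Suc m)
  from has_weak_gradient_linear[OF Suc.IH Suc.prems[of m], of 1 1] Suc.prems
  show ?case by simp
qed

lemma has_weak_gradient_cong:
  assumes w: "has_weak_gradient N f g" and f': "f' \<in> borel_measurable (torus N)" and ae: "AE x in torus N. f x = f' x"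
  shows "has_weak_gradient N f' g"
proof -
  have int: "integrable (torus N) f" using w by (auto simp: has_weak_gradient_def)
  note [measurable] = borel_measurable_integrable[OF int] f'
  have int': "integrable (torus N) f'"
    by (rule integrable_cong_AE_imp[OF int f' ae])
  show ?thesis
    unfolding has_weak_gradient_def
  proof (intro conjI allI impI int')
    fix i \<tau> assume i: "i < N" and \<tau>: "test_function N \<tau>"
    note [measurable] = continuous_torus_bounded(1)[OF test_function_cont(2)[OF \<tau> i]]
    have "(\<integral>x. f' x * partial_deriv i \<tau> x \<partial>torus N) = (\<integral>x. f x * partial_deriv i \<tau> x \<partial>torus N)"
      by (rule integral_cong_AE) (use ae in auto)
    then show "(\<integral>x. f' x * partial_deriv i \<tau> x \<partial>torus N) = - (\<integral>x. g i x * \<tau> x \<partial>torus N)"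
      using w i \<tau> by (simp add: has_weak_gradient_def)
  qed (use w in \<open>auto simp: has_weak_gradient_def\<close>)
qed

lemma integral_mult_bounded_limit:
  fixes f :: "nat \<Rightarrow> 'a \<Rightarrow> real"
  assumes f: "\<And>n. integrable M (\<lambda>x. f n x * h x)" "integrable M (\<lambda>x. g x * h x)"
    and i: "\<And>n. integrable M (\<lambda>x. f n x - g x)"
    and B: "\<And>x. x \<in> space M \<Longrightarrow> \<bar>h x\<bar> \<le> B"
    and lim: "(\<lambda>n. \<integral>x. \<bar>f n x - g x\<bar> \<partial>M) \<longlonglongrightarrow> 0"
  shows "(\<lambda>n. \<integral>x. f n x * h x \<partial>M) \<longlonglongrightarrow> (\<integral>x. g x * h x \<partial>M)"
proof -
  have "\<bar>(\<integral>x. f n x * h x \<partial>M) - (\<integral>x. g x * h x \<partial>M)\<bar> \<le> B * (\<integral>x. \<bar>f n x - g x\<bar> \<partial>M)" for n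
  proof -
    have j: "integrable M (\<lambda>x. (f n x - g x) * h x)" using f by (simp add: left_diff_distrib)
    have "\<bar>(\<integral>x. f n x * h x \<partial>M) - (\<integral>x. g x * h x \<partial>M)\<bar> = \<bar>\<integral>x. (f n x - g x) * h x \<partial>M\<bar>"
      using f by (simp add: left_diff_distrib)
    also have "\<dots> \<le> (\<integral>x. \<bar>(f n x - g x) * h x\<bar> \<partial>M)" by (rule integral_abs_bound)
    also have "\<dots> \<le> (\<integral>x. B * \<bar>f n x - g x\<bar> \<partial>M)"
    proof (rule integral_mono)
      fix x assume "x \<in> space M"
      then show "\<bar>(f n x - g x) * h x\<bar> \<le> B * \<bar>f n x - g x\<bar>"
        using B by (simp add: abs_mult mult.commute[of "\<bar>f n x - g x\<bar>"] mult_right_mono)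
    qed (use j i in auto)
    finally show ?thesis by simp
  qed
  then have "(\<lambda>n. (\<integral>x. f n x * h x \<partial>M) - (\<integral>x. g x * h x \<partial>M)) \<longlonglongrightarrow> 0"
    by (intro Lim_null_comparison[OF _ tendsto_mult_right_zero[OF lim, of B]] always_eventually allI) simp
  then show ?thesis by (simp add: LIM_zero_iff)
qed

text \<open>Test functions and their partial derivatives are bounded on the torus, so convergence in
  L1 of Lebesgue measure, of the functions and of the gradients, preserves the defining
  identity.\<close>

lemma has_weak_gradient_limit:
  assumes w: "\<And>n. has_weak_gradient N (f n) (g n)"
    and F: "integrable (torus N) F" and G: "\<And>i. i < N \<Longrightarrow> integrable (torus N) (G i)"
    and limF: "(\<lambda>n. \<integral>x. \<bar>f n x - F x\<bar> \<partial>torus N) \<longlonglongrightarrow> 0"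
    and limG: "\<And>i. i < N \<Longrightarrow> (\<lambda>n. \<integral>x. \<bar>g n i x - G i x\<bar> \<partial>torus N) \<longlonglongrightarrow> 0"
  shows "has_weak_gradient N F G"
  unfolding has_weak_gradient_def
proof (intro conjI allI impI F G)
  fix i \<tau> assume i: "i < N" and \<tau>: "test_function N \<tau>"
  have intf: "integrable (torus N) (f n)" and intg: "integrable (torus N) (g n i)" for n
    using w[of n] i by (auto simp: has_weak_gradient_def)
  note c = test_function_cont[OF \<tau> i]
  obtain B B' where B: "\<And>x. x \<in> space (torus N) \<Longrightarrow> \<bar>\<tau> x\<bar> \<le> B" "\<And>x. x \<in> space (torus N) \<Longrightarrow> \<bar>partial_deriv i \<tau> x\<bar> \<le> B'"
    using continuous_torus_bounded(2)[OF c(1)] continuous_torus_bounded(2)[OF c(2)] by blast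
  have "(\<lambda>n. \<integral>x. f n x * partial_deriv i \<tau> x \<partial>torus N) \<longlonglongrightarrow> (\<integral>x. F x * partial_deriv i \<tau> x \<partial>torus N)"
    by (rule integral_mult_bounded_limit[OF _ _ _ B(2) limF])
       (use intf F integrable_torus_mult_continuous[OF _ c(2)] in auto)
  moreover have "(\<lambda>n. - (\<integral>x. g n i x * \<tau> x \<partial>torus N)) \<longlonglongrightarrow> - (\<integral>x. G i x * \<tau> x \<partial>torus N)"
    by (intro tendsto_minus, rule integral_mult_bounded_limit[OF _ _ _ B(1) limG[OF i]])
       (use intg G[OF i] integrable_torus_mult_continuous[OF _ c(1)] in auto)
  moreover have "(\<integral>x. f n x * partial_deriv i \<tau> x \<partial>torus N) = - (\<integral>x. g n i x * \<tau> x \<partial>torus N)" for n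
    using w[of n] i \<tau> by (simp add: has_weak_gradient_def)
  ultimately show "(\<integral>x. F x * partial_deriv i \<tau> x \<partial>torus N) = - (\<integral>x. G i x * \<tau> x \<partial>torus N)"
    by (simp add: LIMSEQ_unique)
qed


section \<open>Schur products and finite sums of tensors\<close>

text \<open>Throughout, \<open>psd m (\<lambda>j k. L j k - K j k)\<close> plays the role of the
  order K <= L between matrices.\<close>

definition psd :: "nat \<Rightarrow> (nat \<Rightarrow> nat \<Rightarrow> real) \<Rightarrow> bool" where
  "psd m K \<longleftrightarrow> (\<forall>c. 0 \<le> (\<Sum>j<m. \<Sum>k<m. c j * c k * K j k))"

text \<open>Multipliers of the order: entrywise multiplication by K preserves positivity. Closure
  under products is then immediate, and Gram matrices are verified directly in
  \<open>schur_psd_gram\<close>.\<close>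

definition schur_psd :: "nat \<Rightarrow> (nat \<Rightarrow> nat \<Rightarrow> real) \<Rightarrow> bool" where
  "schur_psd m K \<longleftrightarrow> (\<forall>L. psd m L \<longrightarrow> psd m (\<lambda>j k. K j k * L j k))"

lemma psd_cong: "psd m K \<Longrightarrow> (\<And>j k. j < m \<Longrightarrow> k < m \<Longrightarrow> K j k = L j k) \<Longrightarrow> psd m L"
  unfolding psd_def by (metis (no_types, lifting) lessThan_iff sum.cong)

lemma psd_add: "psd m K \<Longrightarrow> psd m L \<Longrightarrow> psd m (\<lambda>j k. K j k + L j k)"
  unfolding psd_def by (simp add: distrib_left sum.distrib add_nonneg_nonneg)

lemma psd_cmult:
  assumes "psd m K" "0 \<le> a"
  shows "psd m (\<lambda>j k. a * K j k)"
  unfolding psd_def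
proof
  fix c :: "nat \<Rightarrow> real"
  have "0 \<le> a * (\<Sum>j<m. \<Sum>k<m. c j * c k * K j k)" using assms by (simp add: psd_def)
  then show "0 \<le> (\<Sum>j<m. \<Sum>k<m. c j * c k * (a * K j k))"
    by (simp add: sum_distrib_left mult_ac)
qed

lemma psd_trans: "psd m (\<lambda>j k. L j k - K j k) \<Longrightarrow> psd m (\<lambda>j k. R j k - L j k) \<Longrightarrow> psd m (\<lambda>j k. R j k - K j k)"
  by (drule (1) psd_add) (simp add: algebra_simps)

lemma schur_psdD: "schur_psd m K \<Longrightarrow> psd m L \<Longrightarrow> psd m (\<lambda>j k. K j k * L j k)"
  by (simp add: schur_psd_def)

lemma schur_psd_mono:
  "schur_psd m S \<Longrightarrow> psd m (\<lambda>j k. L j k - K j k) \<Longrightarrow> psd m (\<lambda>j k. S j k * L j k - S j k * K j k)"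
  by (drule (1) schur_psdD) (simp add: right_diff_distrib)

lemma schur_psd_mult: "schur_psd m K \<Longrightarrow> schur_psd m L \<Longrightarrow> schur_psd m (\<lambda>j k. K j k * L j k)"
  unfolding schur_psd_def by (simp add: mult.assoc)

lemma schur_psd_add: "schur_psd m K \<Longrightarrow> schur_psd m L \<Longrightarrow> schur_psd m (\<lambda>j k. K j k + L j k)"
  unfolding schur_psd_def by (simp add: distrib_right psd_add)

lemma schur_psd_one: "schur_psd m (\<lambda>_ _. 1)"
  by (simp add: schur_psd_def)

lemma schur_psd_zero: "schur_psd m (\<lambda>_ _. 0)"
  by (simp add: schur_psd_def psd_def)

lemma schur_psd_prod: "(\<And>i. i \<in> I \<Longrightarrow> schur_psd m (K i)) \<Longrightarrow> schur_psd m (\<lambda>j k. \<Prod>i\<in>I. K i j k)"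
  by (induction I rule: infinite_finite_induct) (auto simp: schur_psd_one intro: schur_psd_mult)

text \<open>The factors \<open>a j\<close> and \<open>a k\<close> are absorbed into the coefficients
  of the quadratic form.\<close>

lemma schur_psd_rank1: "schur_psd m (\<lambda>j k. a j * a k)"
  unfolding schur_psd_def psd_def
proof (intro allI impI)
  fix L :: "nat \<Rightarrow> nat \<Rightarrow> real" and c :: "nat \<Rightarrow> real"
  assume "\<forall>c. 0 \<le> (\<Sum>j<m. \<Sum>k<m. c j * c k * L j k)"
  from this[rule_format, of "\<lambda>j. c j * a j"]
  show "0 \<le> (\<Sum>j<m. \<Sum>k<m. c j * c k * (a j * a k * L j k))" by (simp add: mult_ac)
qed

lemma schur_psd_imp_psd: "schur_psd m K \<Longrightarrow> psd m K"
proof -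
  assume K: "schur_psd m K"
  have "psd m (\<lambda>_ _. 1)"
    unfolding psd_def by (simp add: sum_product[symmetric])
  from schur_psdD[OF K this] show ?thesis by simp
qed

text \<open>For fixed x the entries \<open>f j x * f k x\<close> form a multiplier of rank one;
  integration over x preserves nonnegativity.\<close>

lemma schur_psd_gram:
  assumes f: "\<And>j. j < m \<Longrightarrow> f j \<in> L2 M"
  shows "schur_psd m (\<lambda>j k. \<integral>x. f j x * f k x \<partial>M)"
  unfolding schur_psd_def psd_def
proof (intro allI impI)
  fix L :: "nat \<Rightarrow> nat \<Rightarrow> real" and c :: "nat \<Rightarrow> real"
  assume L: "\<forall>c. 0 \<le> (\<Sum>j<m. \<Sum>k<m. c j * c k * L j k)"
  have "0 \<le> (\<integral>x. (\<Sum>j<m. \<Sum>k<m. (c j * f j x) * (c k * f k x) * L j k) \<partial>M)"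
  proof (intro Bochner_Integration.integral_nonneg)
    fix x
    show "0 \<le> (\<Sum>j<m. \<Sum>k<m. (c j * f j x) * (c k * f k x) * L j k)"
      using L[rule_format, of "\<lambda>j. c j * f j x"] by simp
  qed
  also have "\<dots> = (\<integral>x. (\<Sum>j<m. \<Sum>k<m. c j * c k * L j k * (f j x * f k x)) \<partial>M)"
    by (simp add: mult_ac)
  also have "\<dots> = (\<Sum>j<m. \<Sum>k<m. c j * c k * L j k * (\<integral>x. f j x * f k x \<partial>M))"
    using L2_mult_integrable[OF f f]
    by (subst Bochner_Integration.integral_sum, force)+ (auto intro!: sum.cong)
  finally show "0 \<le> (\<Sum>j<m. \<Sum>k<m. c j * c k * ((\<integral>x. f j x * f k x \<partial>M) * L j k))"
    by (simp add: mult_ac)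
qed

text \<open>The factors are exchanged one at a time. Each exchange is multiplied by factors of both
  families, which is why both consist of multipliers.\<close>

lemma psd_prod_mono:
  assumes "finite I" "\<And>i. i \<in> I \<Longrightarrow> schur_psd m (K i)" "\<And>i. i \<in> I \<Longrightarrow> schur_psd m (L i)"
    "\<And>i. i \<in> I \<Longrightarrow> psd m (\<lambda>j k. L i j k - K i j k)"
  shows "psd m (\<lambda>j k. (\<Prod>i\<in>I. L i j k) - (\<Prod>i\<in>I. K i j k))"
  using assms
proof (induction I)
  case empty
  then show ?case by (simp add: psd_def)
next
  case (insert i I)
  have 1: "psd m (\<lambda>j k. L i j k * (\<Prod>i\<in>I. L i j k) - L i j k * (\<Prod>i\<in>I. K i j k))"
    using insert by (intro schur_psd_mono) auto
  have "psd m (\<lambda>j k. (\<Prod>i\<in>I. K i j k) * L i j k - (\<Prod>i\<in>I. K i j k) * K i j k)"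
    using insert by (intro schur_psd_mono schur_psd_prod) auto
  then have 2: "psd m (\<lambda>j k. L i j k * (\<Prod>i\<in>I. K i j k) - K i j k * (\<Prod>i\<in>I. K i j k))"
    by (simp add: mult.commute)
  show ?case using psd_trans[OF 2 1] insert(1,2) by simp
qed

text \<open>The constant a survives products, which makes the spectral gap independent of N. In the
  induction step let P, G, E be the products so far and P_i, G_i, E_i the new factors. Then P_i P <=
  (a (G_i - E_i) + E_i) P. The part with a (G_i - E_i) is enlarged by P <= G, the part with E_i by
  the induction hypothesis; the terms a E_i G cancel, and a G_i G + (1 - a) E_i E remains.\<close>

lemma psd_prod_gap:
  assumes "finite I" and a: "0 \<le> a" "a \<le> 1"
    and "\<And>i. i \<in> I \<Longrightarrow> schur_psd m (P i)" "\<And>i. i \<in> I \<Longrightarrow> schur_psd m (G i)" "\<And>i. i \<in> I \<Longrightarrow> schur_psd m (E i)"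
    and "\<And>i. i \<in> I \<Longrightarrow> schur_psd m (\<lambda>j k. G i j k - E i j k)"
    and "\<And>i. i \<in> I \<Longrightarrow> psd m (\<lambda>j k. (a * (G i j k - E i j k) + E i j k) - P i j k)"
  shows "psd m (\<lambda>j k. (a * (\<Prod>i\<in>I. G i j k) + (1 - a) * (\<Prod>i\<in>I. E i j k)) - (\<Prod>i\<in>I. P i j k))"
  using assms
proof (induction I)
  case empty
  then show ?case by (simp add: psd_def)
next
  case (insert i I)
  let ?P = "\<lambda>j k. \<Prod>i\<in>I. P i j k" and ?G = "\<lambda>j k. \<Prod>i\<in>I. G i j k" and ?E = "\<lambda>j k. \<Prod>i\<in>I. E i j k"
  have sP: "schur_psd m ?P" using insert by (intro schur_psd_prod) auto
  \<comment> \<open>The hypothesis on a single factor contains the plain contraction, because a (G -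
    E) + E <= G for a <= 1.\<close>
  have PG: "psd m (\<lambda>j k. G l j k - P l j k)" if "l \<in> I" for l
  proof -
    have 1: "psd m (\<lambda>j k. (1 - a) * (G l j k - E l j k))"
      using insert that a by (intro psd_cmult schur_psd_imp_psd) auto
    have 2: "psd m (\<lambda>j k. (a * (G l j k - E l j k) + E l j k) - P l j k)"
      using insert that by auto
    show ?thesis using psd_add[OF 1 2] by (simp add: algebra_simps)
  qed
  have 1: "psd m (\<lambda>j k. ?P j k * (a * (G i j k - E i j k) + E i j k) - ?P j k * P i j k)"
    using insert by (intro schur_psd_mono sP) auto
  have "psd m (\<lambda>j k. ?G j k - ?P j k)"
    using insert PG by (intro psd_prod_mono) auto
  then have "psd m (\<lambda>j k. (G i j k - E i j k) * ?G j k - (G i j k - E i j k) * ?P j k)"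
    using insert by (intro schur_psd_mono) auto
  then have 2: "psd m (\<lambda>j k. a * ((G i j k - E i j k) * ?G j k - (G i j k - E i j k) * ?P j k))"
    using a by (intro psd_cmult)
  have 3: "psd m (\<lambda>j k. E i j k * (a * ?G j k + (1 - a) * ?E j k) - E i j k * ?P j k)"
    using insert by (intro schur_psd_mono) auto
  from psd_add[OF psd_add[OF 1 2] 3] insert(1,2) show ?case
    by (simp add: algebra_simps)
qed

text \<open>With P and G the products so far, G_n G - P_n P = G_n (G - P) + (G_n - P_n) P. The
  induction hypothesis gives a multiple of G_n S from the first term, S being the sum so far.
  Passing from G_n S to P_n S requires S to be a multiplier, so this property is carried through the
  induction.\<close>

lemma psd_prod_telescope:
  fixes n :: nat
  assumes a: "0 \<le> a" "a \<le> 1"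
    and P: "\<And>i. i < n \<Longrightarrow> schur_psd m (P i)" and G: "\<And>i. i < n \<Longrightarrow> schur_psd m (G i)"
    and W: "\<And>i. i < n \<Longrightarrow> schur_psd m (W i)"
    and PG: "\<And>i. i < n \<Longrightarrow> psd m (\<lambda>j k. G i j k - P i j k)"
    and WG: "\<And>i. i < n \<Longrightarrow> psd m (\<lambda>j k. (G i j k - P i j k) - a * W i j k)"
  shows "schur_psd m (\<lambda>j k. \<Sum>i<n. W i j k * (\<Prod>l\<in>{..<n} - {i}. P l j k)) \<and>
    psd m (\<lambda>j k. ((\<Prod>l<n. G l j k) - (\<Prod>l<n. P l j k)) - a * (\<Sum>i<n. W i j k * (\<Prod>l\<in>{..<n} - {i}. P l j k)))"
  using P G W PG WG
proof (induction n)
  case 0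
  then show ?case by (simp add: psd_def schur_psd_zero)
next
  case (Suc n)
  define S where "S j k = (\<Sum>i<n. W i j k * (\<Prod>l\<in>{..<n} - {i}. P l j k))" for j k
  have IH: "schur_psd m S" "psd m (\<lambda>j k. ((\<Prod>l<n. G l j k) - (\<Prod>l<n. P l j k)) - a * S j k)"
    using Suc.IH Suc.prems unfolding S_def by auto
  have eq: "(\<Sum>i<Suc n. W i j k * (\<Prod>l\<in>{..<Suc n} - {i}. P l j k)) = P n j k * S j k + W n j k * (\<Prod>l<n. P l j k)" for j k
  proof -
    have "(\<Prod>l\<in>{..<Suc n} - {i}. P l j k) = P n j k * (\<Prod>l\<in>{..<n} - {i}. P l j k)" if "i < n" for i
    proof -
      have "{..<Suc n} - {i} = insert n ({..<n} - {i})" using that by auto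
      then show ?thesis by simp
    qed
    moreover have "{..<Suc n} - {n} = {..<n}" by auto
    ultimately show ?thesis by (simp add: S_def sum_distrib_left mult_ac)
  qed
  have sP: "schur_psd m (\<lambda>j k. \<Prod>l<n. P l j k)" using Suc.prems by (intro schur_psd_prod) auto
  have "schur_psd m (\<lambda>j k. P n j k * S j k + W n j k * (\<Prod>l<n. P l j k))"
    using Suc.prems IH(1) sP by (intro schur_psd_add schur_psd_mult) auto
  moreover have "psd m (\<lambda>j k. ((\<Prod>l<Suc n. G l j k) - (\<Prod>l<Suc n. P l j k)) - a * (P n j k * S j k + W n j k * (\<Prod>l<n. P l j k)))"
  proof -
    have 1: "psd m (\<lambda>j k. a * (S j k * G n j k - S j k * P n j k))"
      using Suc.prems IH(1) a by (intro psd_cmult schur_psd_mono) auto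
    have 2: "psd m (\<lambda>j k. G n j k * ((\<Prod>l<n. G l j k) - (\<Prod>l<n. P l j k)) - G n j k * (a * S j k))"
      using Suc.prems IH(2) by (intro schur_psd_mono) auto
    have 3: "psd m (\<lambda>j k. (\<Prod>l<n. P l j k) * (G n j k - P n j k) - (\<Prod>l<n. P l j k) * (a * W n j k))"
      using Suc.prems by (intro schur_psd_mono sP) auto
    from psd_add[OF psd_add[OF 1 2] 3] show ?thesis
      by (simp add: algebra_simps)
  qed
  ultimately show ?case unfolding eq by simp
qed

section \<open>Finite sums of tensors, their integrals and norms\<close>

definition tensor_sum :: "nat \<Rightarrow> nat \<Rightarrow> (nat \<Rightarrow> real) \<Rightarrow> (nat \<Rightarrow> nat \<Rightarrow> 'a \<Rightarrow> real) \<Rightarrow> (nat \<Rightarrow> 'a) \<Rightarrow> real" where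
  "tensor_sum N m c \<phi> x = (\<Sum>j<m. c j * (\<Prod>l<N. \<phi> j l (x l)))"

lemma tensor_sum_integral:
  assumes \<nu>: "\<And>l. prob_space (\<nu> l)" and \<phi>: "\<And>j l. j < m \<Longrightarrow> l < N \<Longrightarrow> integrable (\<nu> l) (\<phi> j l)"
  shows "integrable (PiM {..<N} \<nu>) (tensor_sum N m c \<phi>)"
    and "(\<integral>x. tensor_sum N m c \<phi> x \<partial>PiM {..<N} \<nu>) = (\<Sum>j<m. c j * (\<Prod>l<N. \<integral>x. \<phi> j l x \<partial>\<nu> l))"
proof -
  interpret product_sigma_finite \<nu>
    using \<nu> by (intro product_sigma_finite.intro) (simp add: prob_space_imp_sigma_finite)
  have i: "integrable (PiM {..<N} \<nu>) (\<lambda>x. \<Prod>l<N. \<phi> j l (x l))" if "j < m" for j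
    using that by (intro product_integrable_prod \<phi>) auto
  then show "integrable (PiM {..<N} \<nu>) (tensor_sum N m c \<phi>)"
    unfolding tensor_sum_def[abs_def] by (intro Bochner_Integration.integrable_sum integrable_mult_right) auto
  have "(\<integral>x. tensor_sum N m c \<phi> x \<partial>PiM {..<N} \<nu>) = (\<Sum>j<m. \<integral>x. c j * (\<Prod>l<N. \<phi> j l (x l)) \<partial>PiM {..<N} \<nu>)"
    unfolding tensor_sum_def using i by (intro Bochner_Integration.integral_sum integrable_mult_right) auto
  also have "\<dots> = (\<Sum>j<m. c j * (\<Prod>l<N. \<integral>x. \<phi> j l x \<partial>\<nu> l))"
  proof (intro sum.cong refl)
    fix j assume "j \<in> {..<m}"
    then have "(\<integral>x. (\<Prod>l<N. \<phi> j l (x l)) \<partial>PiM {..<N} \<nu>) = (\<Prod>l<N. \<integral>x. \<phi> j l x \<partial>\<nu> l)"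
      using \<phi> by (intro product_integral_prod) auto
    then show "(\<integral>x. c j * (\<Prod>l<N. \<phi> j l (x l)) \<partial>PiM {..<N} \<nu>) = c j * (\<Prod>l<N. \<integral>x. \<phi> j l x \<partial>\<nu> l)"
      by simp
  qed
  finally show "(\<integral>x. tensor_sum N m c \<phi> x \<partial>PiM {..<N} \<nu>) = (\<Sum>j<m. c j * (\<Prod>l<N. \<integral>x. \<phi> j l x \<partial>\<nu> l))" .
qed

text \<open>The coefficients \<open>K j k\<close> and the index set I are general because
  \<open>V_L1\<close> integrates over all coordinates but one, with the Gram matrix of the remaining
  coordinate inside K.\<close>

lemma tensor_sum_square:
  assumes \<nu>: "\<And>l. prob_space (\<nu> l)" and I: "finite I" and \<phi>: "\<And>j l. j < m \<Longrightarrow> l \<in> I \<Longrightarrow> \<phi> j l \<in> L2 (\<nu> l)"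
  shows "integrable (PiM I \<nu>) (\<lambda>x. \<Sum>j<m. \<Sum>k<m. K j k * ((\<Prod>l\<in>I. \<phi> j l (x l)) * (\<Prod>l\<in>I. \<phi> k l (x l))))"
    and "(\<integral>x. (\<Sum>j<m. \<Sum>k<m. K j k * ((\<Prod>l\<in>I. \<phi> j l (x l)) * (\<Prod>l\<in>I. \<phi> k l (x l)))) \<partial>PiM I \<nu>) =
      (\<Sum>j<m. \<Sum>k<m. K j k * (\<Prod>l\<in>I. \<integral>x. \<phi> j l x * \<phi> k l x \<partial>\<nu> l))"
proof -
  interpret product_sigma_finite \<nu>
    using \<nu> by (intro product_sigma_finite.intro) (simp add: prob_space_imp_sigma_finite)
  have i: "integrable (PiM I \<nu>) (\<lambda>x. K j k * ((\<Prod>l\<in>I. \<phi> j l (x l)) * (\<Prod>l\<in>I. \<phi> k l (x l))))"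
    and e: "(\<integral>x. K j k * ((\<Prod>l\<in>I. \<phi> j l (x l)) * (\<Prod>l\<in>I. \<phi> k l (x l))) \<partial>PiM I \<nu>) = K j k * (\<Prod>l\<in>I. \<integral>x. \<phi> j l x * \<phi> k l x \<partial>\<nu> l)"
    if "j < m" "k < m" for j k
  proof -
    have il: "\<And>l. l \<in> I \<Longrightarrow> integrable (\<nu> l) (\<lambda>x. \<phi> j l x * \<phi> k l x)" using that by (intro L2_mult_integrable \<phi>)
    show "integrable (PiM I \<nu>) (\<lambda>x. K j k * ((\<Prod>l\<in>I. \<phi> j l (x l)) * (\<Prod>l\<in>I. \<phi> k l (x l))))"
      using product_integrable_prod[OF I il] by (simp add: prod.distrib)
    show "(\<integral>x. K j k * ((\<Prod>l\<in>I. \<phi> j l (x l)) * (\<Prod>l\<in>I. \<phi> k l (x l))) \<partial>PiM I \<nu>) = K j k * (\<Prod>l\<in>I. \<integral>x. \<phi> j l x * \<phi> k l x \<partial>\<nu> l)"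
      using product_integral_prod[OF I il] by (simp add: prod.distrib)
  qed
  show "integrable (PiM I \<nu>) (\<lambda>x. \<Sum>j<m. \<Sum>k<m. K j k * ((\<Prod>l\<in>I. \<phi> j l (x l)) * (\<Prod>l\<in>I. \<phi> k l (x l))))"
    by (intro Bochner_Integration.integrable_sum i) auto
  have "(\<integral>x. (\<Sum>j<m. \<Sum>k<m. K j k * ((\<Prod>l\<in>I. \<phi> j l (x l)) * (\<Prod>l\<in>I. \<phi> k l (x l)))) \<partial>PiM I \<nu>) =
      (\<Sum>j<m. \<integral>x. (\<Sum>k<m. K j k * ((\<Prod>l\<in>I. \<phi> j l (x l)) * (\<Prod>l\<in>I. \<phi> k l (x l)))) \<partial>PiM I \<nu>)"
    by (intro Bochner_Integration.integral_sum Bochner_Integration.integrable_sum i) auto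
  also have "\<dots> = (\<Sum>j<m. \<Sum>k<m. \<integral>x. K j k * ((\<Prod>l\<in>I. \<phi> j l (x l)) * (\<Prod>l\<in>I. \<phi> k l (x l))) \<partial>PiM I \<nu>)"
    by (intro sum.cong refl Bochner_Integration.integral_sum i) auto
  also have "\<dots> = (\<Sum>j<m. \<Sum>k<m. K j k * (\<Prod>l\<in>I. \<integral>x. \<phi> j l x * \<phi> k l x \<partial>\<nu> l))"
    by (intro sum.cong refl e) auto
  finally show "(\<integral>x. (\<Sum>j<m. \<Sum>k<m. K j k * ((\<Prod>l\<in>I. \<phi> j l (x l)) * (\<Prod>l\<in>I. \<phi> k l (x l)))) \<partial>PiM I \<nu>) =
      (\<Sum>j<m. \<Sum>k<m. K j k * (\<Prod>l\<in>I. \<integral>x. \<phi> j l x * \<phi> k l x \<partial>\<nu> l))" .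
qed

lemma tensor_sum_L2:
  assumes \<nu>: "\<And>l. prob_space (\<nu> l)" and \<phi>: "\<And>j l. j < m \<Longrightarrow> l < N \<Longrightarrow> \<phi> j l \<in> L2 (\<nu> l)"
  shows "tensor_sum N m c \<phi> \<in> L2 (PiM {..<N} \<nu>)"
    and "(L2_norm (PiM {..<N} \<nu>) (tensor_sum N m c \<phi>))\<^sup>2 = (\<Sum>j<m. \<Sum>k<m. c j * c k * (\<Prod>l<N. \<integral>x. \<phi> j l x * \<phi> k l x \<partial>\<nu> l))"
proof -
  have sq: "(tensor_sum N m c \<phi> x)\<^sup>2 = (\<Sum>j<m. \<Sum>k<m. c j * c k * ((\<Prod>l<N. \<phi> j l (x l)) * (\<Prod>l<N. \<phi> k l (x l))))" for x
    by (simp add: tensor_sum_def power2_eq_square sum_product mult_ac)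
  note t = tensor_sum_square[where \<nu>=\<nu> and I="{..<N}" and m=m and \<phi>=\<phi> and K="\<lambda>j k. c j * c k", OF \<nu> finite_lessThan]
  have "integrable (PiM {..<N} \<nu>) (tensor_sum N m c \<phi>)"
    using \<phi> prob_space.L2_integrable[OF \<nu>] by (intro tensor_sum_integral(1) \<nu>) auto
  then show "tensor_sum N m c \<phi> \<in> L2 (PiM {..<N} \<nu>)"
    using t(1) \<phi> by (intro L2I) (auto simp: sq)
  show "(L2_norm (PiM {..<N} \<nu>) (tensor_sum N m c \<phi>))\<^sup>2 = (\<Sum>j<m. \<Sum>k<m. c j * c k * (\<Prod>l<N. \<integral>x. \<phi> j l x * \<phi> k l x \<partial>\<nu> l))"
    unfolding L2_norm_power2 sq using t(2) \<phi> by simp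
qed

text \<open>The two lists of terms are concatenated and the scalars move into the
  coefficients.\<close>

lemma tensor_sum_lin:
  "a * tensor_sum N m c \<phi> x + b * tensor_sum N m' c' \<phi>' x =
   tensor_sum N (m + m') (\<lambda>j. if j < m then a * c j else b * c' (j - m)) (\<lambda>j. if j < m then \<phi> j else \<phi>' (j - m)) x"
proof -
  have split: "(\<Sum>j<m + m'. h j) = (\<Sum>j<m. h j) + (\<Sum>j<m'. h (m + j))" for h :: "nat \<Rightarrow> real"
    by (induction m') (auto simp: add.assoc)
  show ?thesis
    unfolding tensor_sum_def split by (simp add: sum_distrib_left mult_ac)
qed

section \<open>Density of finite sums of tensors in \<open>L2\<close>\<close>

definition tensor_approx :: "(nat \<Rightarrow> 'a measure) \<Rightarrow> nat \<Rightarrow> ((nat \<Rightarrow> 'a) \<Rightarrow> real) \<Rightarrow> bool" where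
  "tensor_approx \<nu> N f \<longleftrightarrow> f \<in> L2 (PiM {..<N} \<nu>) \<and> (\<forall>\<epsilon>>0. \<exists>m c \<phi>. (\<forall>j l. l < N \<longrightarrow> \<phi> j l \<in> L2 (\<nu> l)) \<and>
      L2_norm (PiM {..<N} \<nu>) (\<lambda>x. f x - tensor_sum N m c \<phi> x) \<le> \<epsilon>)"

context
  fixes \<nu> :: "nat \<Rightarrow> 'a measure" and N :: nat
  assumes \<nu>: "\<And>l. prob_space (\<nu> l)"
begin

interpretation PM: prob_space "PiM {..<N} \<nu>" by (intro prob_space_PiM \<nu>)

lemma tensor_approx_limit:
  assumes f: "f \<in> L2 (PiM {..<N} \<nu>)"
    and ex: "\<And>\<epsilon>. 0 < \<epsilon> \<Longrightarrow> \<exists>g. tensor_approx \<nu> N g \<and> L2_norm (PiM {..<N} \<nu>) (\<lambda>x. f x - g x) \<le> \<epsilon>"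
  shows "tensor_approx \<nu> N f"
  unfolding tensor_approx_def
proof (intro conjI f allI impI)
  fix \<epsilon> :: real assume "0 < \<epsilon>"
  then have e2: "0 < \<epsilon> / 2" by simp
  from ex[OF this] obtain g where g: "tensor_approx \<nu> N g" "L2_norm (PiM {..<N} \<nu>) (\<lambda>x. f x - g x) \<le> \<epsilon> / 2" by blast
  from g(1) e2 obtain m c \<phi> where \<phi>: "\<forall>j l. l < N \<longrightarrow> \<phi> j l \<in> L2 (\<nu> l)"
    "L2_norm (PiM {..<N} \<nu>) (\<lambda>x. g x - tensor_sum N m c \<phi> x) \<le> \<epsilon> / 2" unfolding tensor_approx_def by metis
  have "L2_norm (PiM {..<N} \<nu>) (\<lambda>x. f x - tensor_sum N m c \<phi> x) \<le>
      L2_norm (PiM {..<N} \<nu>) (\<lambda>x. f x - g x) + L2_norm (PiM {..<N} \<nu>) (\<lambda>x. g x - tensor_sum N m c \<phi> x)"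
    using f g(1) \<phi>(1) by (intro L2_norm_diff_triangle tensor_sum_L2(1) \<nu>) (auto simp: tensor_approx_def)
  also have "\<dots> \<le> \<epsilon>" using g(2) \<phi>(2) by simp
  finally show "\<exists>m c \<phi>. (\<forall>j l. l < N \<longrightarrow> \<phi> j l \<in> L2 (\<nu> l)) \<and> L2_norm (PiM {..<N} \<nu>) (\<lambda>x. f x - tensor_sum N m c \<phi> x) \<le> \<epsilon>"
    using \<phi>(1) by blast
qed

lemma tensor_approx_tensor_sum:
  assumes "\<And>j l. l < N \<Longrightarrow> \<phi> j l \<in> L2 (\<nu> l)"
  shows "tensor_approx \<nu> N (tensor_sum N m c \<phi>)"
  unfolding tensor_approx_def
proof (intro conjI allI impI)
  show "tensor_sum N m c \<phi> \<in> L2 (PiM {..<N} \<nu>)" by (intro tensor_sum_L2(1) \<nu> assms)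
  fix \<epsilon> :: real assume "0 < \<epsilon>"
  then show "\<exists>m' c' \<phi>'. (\<forall>j l. l < N \<longrightarrow> \<phi>' j l \<in> L2 (\<nu> l)) \<and> L2_norm (PiM {..<N} \<nu>) (\<lambda>x. tensor_sum N m c \<phi> x - tensor_sum N m' c' \<phi>' x) \<le> \<epsilon>"
    using assms by (intro exI[of _ m] exI[of _ c] exI[of _ \<phi>]) (auto simp: L2_norm_def)
qed

lemma tensor_approx_lin:
  assumes f: "tensor_approx \<nu> N f" and g: "tensor_approx \<nu> N g"
  shows "tensor_approx \<nu> N (\<lambda>x. a * f x + b * g x)"
  unfolding tensor_approx_def
proof (intro conjI allI impI)
  have L: "f \<in> L2 (PiM {..<N} \<nu>)" "g \<in> L2 (PiM {..<N} \<nu>)" using f g by (auto simp: tensor_approx_def)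
  then show "(\<lambda>x. a * f x + b * g x) \<in> L2 (PiM {..<N} \<nu>)" by (intro L2_add L2_cmult)
  fix \<epsilon> :: real assume \<epsilon>: "0 < \<epsilon>"
  define \<delta> where "\<delta> = \<epsilon> / (\<bar>a\<bar> + \<bar>b\<bar> + 1)"
  have d: "0 < \<delta>" using \<epsilon> by (auto simp: \<delta>_def intro!: divide_pos_pos)
  obtain m c \<phi> where 1: "\<forall>j l. l < N \<longrightarrow> \<phi> j l \<in> L2 (\<nu> l)" "L2_norm (PiM {..<N} \<nu>) (\<lambda>x. f x - tensor_sum N m c \<phi> x) \<le> \<delta>"
    using f d unfolding tensor_approx_def by metis
  obtain m' c' \<phi>' where 2: "\<forall>j l. l < N \<longrightarrow> \<phi>' j l \<in> L2 (\<nu> l)" "L2_norm (PiM {..<N} \<nu>) (\<lambda>x. g x - tensor_sum N m' c' \<phi>' x) \<le> \<delta>"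
    using g d unfolding tensor_approx_def by metis
  let ?t = "tensor_sum N (m + m') (\<lambda>j. if j < m then a * c j else b * c' (j - m)) (\<lambda>j. if j < m then \<phi> j else \<phi>' (j - m))"
  have "L2_norm (PiM {..<N} \<nu>) (\<lambda>x. (a * f x + b * g x) - ?t x) =
      L2_norm (PiM {..<N} \<nu>) (\<lambda>x. a * (f x - tensor_sum N m c \<phi> x) + b * (g x - tensor_sum N m' c' \<phi>' x))"
    unfolding tensor_sum_lin[symmetric] by (simp add: algebra_simps)
  also have "\<dots> \<le> \<bar>a\<bar> * L2_norm (PiM {..<N} \<nu>) (\<lambda>x. f x - tensor_sum N m c \<phi> x) + \<bar>b\<bar> * L2_norm (PiM {..<N} \<nu>) (\<lambda>x. g x - tensor_sum N m' c' \<phi>' x)"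
    unfolding L2_norm_cmult[symmetric] using 1 2 L
    by (intro L2_norm_triangle L2_cmult L2_diff tensor_sum_L2(1) \<nu>) auto
  also have "\<dots> \<le> \<bar>a\<bar> * \<delta> + \<bar>b\<bar> * \<delta>" using 1 2 by (intro add_mono mult_left_mono) auto
  also have "\<dots> \<le> (\<bar>a\<bar> + \<bar>b\<bar> + 1) * \<delta>" using d by (simp add: distrib_right)
  also have "\<dots> = \<epsilon>"
  proof -
    have "\<bar>a\<bar> + \<bar>b\<bar> + 1 \<noteq> 0" by linarith
    then show ?thesis by (simp add: \<delta>_def)
  qed
  finally show "\<exists>m c \<phi>. (\<forall>j l. l < N \<longrightarrow> \<phi> j l \<in> L2 (\<nu> l)) \<and> L2_norm (PiM {..<N} \<nu>) (\<lambda>x. (a * f x + b * g x) - tensor_sum N m c \<phi> x) \<le> \<epsilon>"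
    using 1 2 by (intro exI[of _ "m + m'"] exI conjI) auto
qed

lemma tensor_approx_cong:
  assumes "tensor_approx \<nu> N f" "\<And>x. x \<in> space (PiM {..<N} \<nu>) \<Longrightarrow> f x = g x"
  shows "tensor_approx \<nu> N g"
proof (rule tensor_approx_limit)
  have f: "f \<in> L2 (PiM {..<N} \<nu>)" using assms(1) by (simp add: tensor_approx_def)
  have "g \<in> borel_measurable (PiM {..<N} \<nu>)"
    using L2_measurable[OF f] assms(2) by (subst measurable_cong[where g=f]) auto
  then show "g \<in> L2 (PiM {..<N} \<nu>)"
    by (intro L2_cong_AE(1)[OF f]) (use assms(2) in auto)
  fix \<epsilon> :: real assume "0 < \<epsilon>"
  have "L2_norm (PiM {..<N} \<nu>) (\<lambda>x. g x - f x) = sqrt (\<integral>x. 0 \<partial>PiM {..<N} \<nu>)"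
    unfolding L2_norm_def by (intro arg_cong[where f=sqrt] Bochner_Integration.integral_cong) (auto simp: assms(2))
  then show "\<exists>h. tensor_approx \<nu> N h \<and> L2_norm (PiM {..<N} \<nu>) (\<lambda>x. g x - h x) \<le> \<epsilon>"
    using assms(1) \<open>0 < \<epsilon>\<close> by (intro exI[of _ f]) auto
qed

lemma indicator_L2: "A \<in> sets (PiM {..<N} \<nu>) \<Longrightarrow> indicator A \<in> L2 (PiM {..<N} \<nu>)"
proof (rule L2I)
  assume A: "A \<in> sets (PiM {..<N} \<nu>)"
  then show "indicator A \<in> borel_measurable (PiM {..<N} \<nu>)" by simp
  have "(\<lambda>x. (indicator A x :: real)\<^sup>2) = indicator A" by (auto simp: fun_eq_iff indicator_def)
  then show "integrable (PiM {..<N} \<nu>) (\<lambda>x. (indicator A x :: real)\<^sup>2)"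
    using A by (simp add: PM.emeasure_eq_measure)
qed

text \<open>Dynkin induction: indicators of boxes are single tensors, complements and finite
  disjoint unions are linear combinations, and countable disjoint unions are limits in L2.\<close>

lemma tensor_approx_indicator:
  assumes "A \<in> sets (PiM {..<N} \<nu>)"
  shows "tensor_approx \<nu> N (indicator A)"
proof -
  have box: "tensor_approx \<nu> N (indicator A)" if A0: "A \<in> prod_algebra {..<N} \<nu>" for A
  proof -
    obtain X where A: "A = PiE {..<N} X" and X': "X \<in> Pi {..<N} (\<lambda>i. sets (\<nu> i))"
      using A0 unfolding prod_algebra_eq_finite[OF finite_lessThan] by (elim CollectE exE conjE)
    have X: "X i \<in> sets (\<nu> i)" if "i < N" for i using X' that by (auto dest: Pi_mem)
    have "tensor_approx \<nu> N (tensor_sum N 1 (\<lambda>_. 1) (\<lambda>_ l. indicator (X l)))"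
    proof (rule tensor_approx_tensor_sum)
      fix l assume l: "l < N"
      interpret prob_space "\<nu> l" by (rule \<nu>)
      have "(\<lambda>x. (indicator (X l) x :: real)\<^sup>2) = indicator (X l)" by (auto simp: fun_eq_iff indicator_def)
      then show "indicator (X l) \<in> L2 (\<nu> l)"
        using X[OF l] by (intro L2I) (auto simp: emeasure_eq_measure)
    qed
    then show ?thesis
      by (rule tensor_approx_cong)
         (auto simp: tensor_sum_def A space_PiM PiE_iff indicator_def prod_zero_iff intro!: prod.neutral)
  qed
  have "A \<in> sigma_sets (\<Pi>\<^sub>E i\<in>{..<N}. space (\<nu> i)) (prod_algebra {..<N} \<nu>)" using assms by (simp add: sets_PiM)
  with Int_stable_prod_algebra prod_algebra_sets_into_space show ?thesis
  proof (induction rule: sigma_sets_induct_disjoint)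
    case (basic A) then show ?case by (rule box)
  next
    case empty
    have "tensor_approx \<nu> N (tensor_sum N 0 (\<lambda>_. 0) (\<lambda>_ _ _. 0))" by (rule tensor_approx_tensor_sum) simp
    then show ?case by (rule tensor_approx_cong) (simp add: tensor_sum_def)
  next
    case (compl A)
    have "tensor_approx \<nu> N (indicator (PiE {..<N} (\<lambda>i. space (\<nu> i))))"
      by (rule box) (auto simp: prod_algebra_eq_finite)
    from tensor_approx_lin[OF this compl(2), of 1 "-1"] show ?case
      by (rule tensor_approx_cong) (auto simp: indicator_def space_PiM)
  next
    case (union A)
    have A: "A i \<in> sets (PiM {..<N} \<nu>)" for i using union(2) by (auto simp: sets_PiM)
    have fin: "tensor_approx \<nu> N (indicator (\<Union>k<n. A k))" for n
    proof (induction n)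
      case 0
      have "tensor_approx \<nu> N (tensor_sum N 0 (\<lambda>_. 0) (\<lambda>_ _ _. 0))" by (rule tensor_approx_tensor_sum) simp
      then show ?case by (rule tensor_approx_cong) (simp add: tensor_sum_def)
    next
      case (Suc n)
      have disj: "(\<Union>k<n. A k) \<inter> A n = {}"
      proof -
        have "A k \<inter> A n = {}" if "k < n" for k
          using union(1) that unfolding disjoint_family_on_def by simp
        then show ?thesis by blast
      qed
      have "(\<Union>k<Suc n. A k) = (\<Union>k<n. A k) \<union> A n" unfolding lessThan_Suc by blast
      then have ind: "indicator (\<Union>k<n. A k) x + indicator (A n) x = (indicator (\<Union>k<Suc n. A k) x :: real)" for x
        by (simp only: indicator_disj_union[OF disj])
      from tensor_approx_lin[OF Suc union(3)[of n], of 1 1] show ?case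
        by (rule tensor_approx_cong) (simp only: mult_1 ind)
    qed
    have U: "(\<Union>i. A i) \<in> sets (PiM {..<N} \<nu>)" using A by auto
    have lim: "(\<lambda>n. \<integral>x. (indicator (\<Union>i. A i) x - indicator (\<Union>k<n. A k) x :: real)\<^sup>2 \<partial>PiM {..<N} \<nu>) \<longlonglongrightarrow> (\<integral>x. 0 \<partial>PiM {..<N} \<nu>)"
    proof (rule integral_dominated_convergence[where w="\<lambda>_. 1"])
      show "AE x in PiM {..<N} \<nu>. (\<lambda>n. (indicator (\<Union>i. A i) x - indicator (\<Union>k<n. A k) x)\<^sup>2) \<longlonglongrightarrow> (0::real)"
      proof (intro AE_I2)
        fix x
        have "(\<lambda>n. (indicator (\<Union>i. A i) x - indicator (\<Union>k<n. A k) x)\<^sup>2) \<longlonglongrightarrow> (indicator (\<Union>i. A i) x - indicator (\<Union>i. A i) x :: real)\<^sup>2"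
          by (intro tendsto_intros LIMSEQ_indicator_UN)
        then show "(\<lambda>n. (indicator (\<Union>i. A i) x - indicator (\<Union>k<n. A k) x)\<^sup>2) \<longlonglongrightarrow> (0::real)" by simp
      qed
      show "AE x in PiM {..<N} \<nu>. norm ((indicator (\<Union>i. A i) x - indicator (\<Union>k<n. A k) x)\<^sup>2 :: real) \<le> 1" for n
        by (intro AE_I2) (auto simp: indicator_def)
    qed (use A U in auto)
    show ?case
    proof (rule tensor_approx_limit[OF indicator_L2[OF U]])
      fix \<epsilon> :: real assume \<epsilon>: "0 < \<epsilon>"
      then have "0 < \<epsilon>\<^sup>2" by simp
      from order_tendstoD(2)[OF lim[simplified] this] obtain n
        where "(\<integral>x. (indicator (\<Union>i. A i) x - indicator (\<Union>k<n. A k) x :: real)\<^sup>2 \<partial>PiM {..<N} \<nu>) < \<epsilon>\<^sup>2"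
        by (auto simp: eventually_sequentially)
      then have "L2_norm (PiM {..<N} \<nu>) (\<lambda>x. indicator (\<Union>i. A i) x - indicator (\<Union>k<n. A k) x) \<le> \<epsilon>"
        using \<epsilon> by (subst L2_norm_le_iff) auto
      with fin[of n] show "\<exists>g. tensor_approx \<nu> N g \<and> L2_norm (PiM {..<N} \<nu>) (\<lambda>x. indicator (\<Union>i. A i) x - g x) \<le> \<epsilon>"
        by blast
    qed
  qed
qed

text \<open>Simple functions dominated by 2 |f| converge to f pointwise, hence in L2 by dominated
  convergence with the majorant (3 f)^2.\<close>

lemma tensor_approx_L2:
  assumes f: "f \<in> L2 (PiM {..<N} \<nu>)"
  shows "tensor_approx \<nu> N f"
proof -
  note [measurable] = L2_measurable[OF f]
  have sum: "tensor_approx \<nu> N (\<lambda>x. \<Sum>y\<in>Y. y * indicator (B y) x)"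
    if "finite Y" "\<And>y. B y \<in> sets (PiM {..<N} \<nu>)" for Y :: "real set" and B
    using that(1)
  proof induction
    case empty
    have "tensor_approx \<nu> N (tensor_sum N 0 (\<lambda>_. 0) (\<lambda>_ _ _. 0))" by (rule tensor_approx_tensor_sum) simp
    then show ?case by (rule tensor_approx_cong) (simp add: tensor_sum_def)
  next
    case (insert y Y)
    from tensor_approx_lin[OF tensor_approx_indicator[OF that(2)[of y]] insert(3), of y 1]
    show ?case
      by (rule tensor_approx_cong) (simp only: sum.insert[OF insert(1,2)] mult_1)
  qed
  obtain s where s: "\<And>i. simple_function (PiM {..<N} \<nu>) (s i)"
    "\<And>x. x \<in> space (PiM {..<N} \<nu>) \<Longrightarrow> (\<lambda>i. s i x) \<longlonglongrightarrow> f x"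
    "\<And>i x. x \<in> space (PiM {..<N} \<nu>) \<Longrightarrow> \<bar>s i x\<bar> \<le> 2 * \<bar>f x\<bar>"
    using borel_measurable_implies_sequence_metric[OF L2_measurable[OF f], of 0]
    unfolding dist_real_def diff_0_right by blast
  have [measurable]: "s i \<in> borel_measurable (PiM {..<N} \<nu>)" for i using s(1) by (rule borel_measurable_simple_function)
  have approx: "tensor_approx \<nu> N (s i)" for i
  proof -
    have "tensor_approx \<nu> N (\<lambda>x. \<Sum>y\<in>s i ` space (PiM {..<N} \<nu>). y * indicator (s i -` {y} \<inter> space (PiM {..<N} \<nu>)) x)"
      using s(1)[of i] by (intro sum) (auto simp: simple_function_def)
    then show ?thesis
    proof (rule tensor_approx_cong)
      fix x assume x: "x \<in> space (PiM {..<N} \<nu>)"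
      have "(\<Sum>y\<in>s i ` space (PiM {..<N} \<nu>). y * indicator (s i -` {y} \<inter> space (PiM {..<N} \<nu>)) x) =
          (\<Sum>y\<in>s i ` space (PiM {..<N} \<nu>). if y = s i x then y else 0)"
        using x by (intro sum.cong) (auto simp: indicator_def)
      also have "\<dots> = s i x" using x s(1)[of i] by (simp add: simple_function_def)
      finally show "(\<Sum>y\<in>s i ` space (PiM {..<N} \<nu>). y * indicator (s i -` {y} \<inter> space (PiM {..<N} \<nu>)) x) = s i x" .
    qed
  qed
  have lim: "(\<lambda>n. \<integral>x. (f x - s n x)\<^sup>2 \<partial>PiM {..<N} \<nu>) \<longlonglongrightarrow> (\<integral>x. 0 \<partial>PiM {..<N} \<nu>)"
  proof (rule integral_dominated_convergence[where w="\<lambda>x. 9 * (f x)\<^sup>2"])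
    show "AE x in PiM {..<N} \<nu>. (\<lambda>n. (f x - s n x)\<^sup>2) \<longlonglongrightarrow> 0"
    proof (intro AE_I2)
      fix x assume "x \<in> space (PiM {..<N} \<nu>)"
      then have "(\<lambda>n. (f x - s n x)\<^sup>2) \<longlonglongrightarrow> (f x - f x)\<^sup>2" by (intro tendsto_intros s(2))
      then show "(\<lambda>n. (f x - s n x)\<^sup>2) \<longlonglongrightarrow> 0" by simp
    qed
    show "AE x in PiM {..<N} \<nu>. norm ((f x - s n x)\<^sup>2) \<le> 9 * (f x)\<^sup>2" for n
    proof (intro AE_I2)
      fix x assume "x \<in> space (PiM {..<N} \<nu>)"
      from s(3)[OF this, of n] have "\<bar>f x - s n x\<bar> \<le> 3 * \<bar>f x\<bar>" by linarith
      from power_mono[OF this abs_ge_zero, of 2] have "(f x - s n x)\<^sup>2 \<le> (3 * f x)\<^sup>2"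
        by (simp add: power_mult_distrib)
      then show "norm ((f x - s n x)\<^sup>2) \<le> 9 * (f x)\<^sup>2" by (simp add: power_mult_distrib)
    qed
  qed (use L2_square_integrable[OF f] in auto)
  show ?thesis
  proof (rule tensor_approx_limit[OF f])
    fix \<epsilon> :: real assume \<epsilon>: "0 < \<epsilon>"
    then have "0 < \<epsilon>\<^sup>2" by simp
    from order_tendstoD(2)[OF lim[simplified] this] obtain n
      where "(\<integral>x. (f x - s n x)\<^sup>2 \<partial>PiM {..<N} \<nu>) < \<epsilon>\<^sup>2"
      by (auto simp: eventually_sequentially)
    then have "L2_norm (PiM {..<N} \<nu>) (\<lambda>x. f x - s n x) \<le> \<epsilon>"
      using \<epsilon> by (subst L2_norm_le_iff) auto
    with approx[of n] show "\<exists>g. tensor_approx \<nu> N g \<and> L2_norm (PiM {..<N} \<nu>) (\<lambda>x. f x - g x) \<le> \<epsilon>"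
      by blast
  qed
qed

end


section \<open>The one-dimensional chain\<close>

locale smoothing_chain = stationary_kernel \<mu> p for p :: "real \<Rightarrow> real measure" and \<mu> :: "real measure" +
  fixes \<gamma> C :: real
  assumes sets_mu: "sets \<mu> = sets circle"
    and ac: "absolutely_continuous circle \<mu>" "absolutely_continuous \<mu> circle"
    and gamma: "0 < \<gamma>" "\<gamma> < 1"
    and gap: "\<And>\<phi>. \<phi> \<in> L2 \<mu> \<Longrightarrow> (\<integral>x. \<phi> x \<partial>\<mu>) = 0 \<Longrightarrow> L2_norm \<mu> (transfer p \<mu> \<phi>) \<le> \<gamma> * L2_norm \<mu> \<phi>"
    and C_pos: "0 < C"
    and transfer_L2: "\<And>\<phi>. \<phi> \<in> L2 \<mu> \<Longrightarrow> transfer p \<mu> \<phi> \<in> L2 \<mu>"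
    and regular: "\<And>\<phi>. \<phi> \<in> L2 \<mu> \<Longrightarrow>
      \<exists>g. has_weak_deriv (transfer p \<mu> \<phi>) g \<and> g \<in> L2 \<mu> \<and> L2_norm \<mu> g \<le> C * L2_norm \<mu> \<phi>"
begin

abbreviation "P \<equiv> transfer p \<mu>"

text \<open>A chosen weak derivative. Since weak derivatives are unique almost everywhere, D is
  linear almost everywhere (\<open>D_linear\<close>), which the quadratic forms below rely
  on.\<close>

definition D :: "(real \<Rightarrow> real) \<Rightarrow> real \<Rightarrow> real" where
  "D \<phi> = (SOME g. has_weak_deriv (P \<phi>) g \<and> g \<in> L2 \<mu> \<and> L2_norm \<mu> g \<le> C * L2_norm \<mu> \<phi>)"

lemma D:
  assumes "\<phi> \<in> L2 \<mu>"
  shows "has_weak_deriv (P \<phi>) (D \<phi>)" "D \<phi> \<in> L2 \<mu>" "L2_norm \<mu> (D \<phi>) \<le> C * L2_norm \<mu> \<phi>"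
  using someI_ex[OF regular[OF assms]] unfolding D_def by auto

lemma D_integrable: "\<phi> \<in> L2 \<mu> \<Longrightarrow> integrable circle (D \<phi>)"
  using D(1) by (auto simp: has_weak_deriv_def)

lemma P_integrable_circle: "\<phi> \<in> L2 \<mu> \<Longrightarrow> integrable circle (P \<phi>)"
  using D(1) by (auto simp: has_weak_deriv_def)

lemma AE_mu_iff: "(AE x in \<mu>. Q x) \<longleftrightarrow> (AE x in circle. Q x)"
  using absolutely_continuous_AE[OF sets_mu[symmetric] ac(2), of Q] absolutely_continuous_AE[OF sets_mu ac(1), of Q] by blast

lemma finite_mu: "finite_measure \<mu>" by unfold_locales

lemmas const_L2 = L2_const[OF finite_mu]

lemma P_linear:
  assumes "\<phi> \<in> L2 \<mu>" "\<psi> \<in> L2 \<mu>"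
  shows "AE x in \<mu>. P (\<lambda>y. a * \<phi> y + b * \<psi> y) x = a * P \<phi> x + b * P \<psi> x"
  by (intro transfer_linear L2_integrable assms)

lemma D_linear:
  assumes "\<phi> \<in> L2 \<mu>" "\<psi> \<in> L2 \<mu>"
  shows "AE x in circle. D (\<lambda>y. a * \<phi> y + b * \<psi> y) x = a * D \<phi> x + b * D \<psi> x"
proof (rule weak_deriv_unique)
  have L: "(\<lambda>y. a * \<phi> y + b * \<psi> y) \<in> L2 \<mu>" using assms by (intro L2_add L2_cmult)
  show "has_weak_deriv (P (\<lambda>y. a * \<phi> y + b * \<psi> y)) (D (\<lambda>y. a * \<phi> y + b * \<psi> y))" by (rule D(1)[OF L])
  show "has_weak_deriv (P (\<lambda>y. a * \<phi> y + b * \<psi> y)) (\<lambda>x. a * D \<phi> x + b * D \<psi> x)"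
  proof (rule has_weak_deriv_cong[OF has_weak_deriv_linear[OF D(1)[OF assms(1)] D(1)[OF assms(2)]]])
    show "P (\<lambda>y. a * \<phi> y + b * \<psi> y) \<in> borel_measurable circle"
      using P_integrable_circle[OF L] by (rule borel_measurable_integrable)
    show "AE x in circle. a * P \<phi> x + b * P \<psi> x = P (\<lambda>y. a * \<phi> y + b * \<psi> y) x"
      using P_linear[OF assms, of a b] unfolding AE_mu_iff by eventually_elim simp
  qed
qed

lemma linear_combination:
  assumes lin: "\<And>\<phi> \<psi> a b. \<phi> \<in> L2 \<mu> \<Longrightarrow> \<psi> \<in> L2 \<mu> \<Longrightarrow> AE x in circle. T (\<lambda>y. a * \<phi> y + b * \<psi> y) x = a * T \<phi> x + b * T \<psi> x"
    and \<phi>: "\<And>j. j < m \<Longrightarrow> \<phi> j \<in> L2 \<mu>"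
  shows "AE x in circle. T (\<lambda>y. \<Sum>j<m. c j * \<phi> j y) x = (\<Sum>j<(m::nat). c j * T (\<phi> j) x)"
  using \<phi>
proof (induction m)
  case 0
  show ?case using lin[of "\<lambda>_. 0" "\<lambda>_. 0" 0 0] by simp
next
  case (Suc m)
  have L: "(\<lambda>y. \<Sum>j<m. c j * \<phi> j y) \<in> L2 \<mu>" using Suc.prems by (intro L2_sum L2_cmult) auto
  have IH: "AE x in circle. T (\<lambda>y. \<Sum>j<m. c j * \<phi> j y) x = (\<Sum>j<m. c j * T (\<phi> j) x)" using Suc by simp
  from lin[OF L Suc.prems[of m], of 1 "c m"] IH show ?case
    by (auto elim!: eventually_elim2)
qed

lemma P_sum:
  assumes "\<And>j. j < m \<Longrightarrow> \<phi> j \<in> L2 \<mu>"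
  shows "AE x in circle. P (\<lambda>y. \<Sum>j<m. c j * \<phi> j y) x = (\<Sum>j<(m::nat). c j * P (\<phi> j) x)"
  by (rule linear_combination[OF _ assms]) (use P_linear in \<open>auto simp: AE_mu_iff\<close>)

lemma D_sum:
  assumes "\<And>j. j < m \<Longrightarrow> \<phi> j \<in> L2 \<mu>"
  shows "AE x in circle. D (\<lambda>y. \<Sum>j<m. c j * \<phi> j y) x = (\<Sum>j<(m::nat). c j * D (\<phi> j) x)"
  by (rule linear_combination[OF D_linear assms])

text \<open>The function is split into its mean and a centered part. P fixes constants and preserves
  the mean, so the cross term vanishes and the gap acts on the centered part alone. In this
  quadratic form the gap becomes a relation between Gram matrices.\<close>

lemma P_square:
  assumes \<phi>: "\<phi> \<in> L2 \<mu>"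
  shows "(\<integral>x. (P \<phi> x)\<^sup>2 \<partial>\<mu>) \<le> \<gamma>\<^sup>2 * ((\<integral>x. (\<phi> x)\<^sup>2 \<partial>\<mu>) - (\<integral>x. \<phi> x \<partial>\<mu>)\<^sup>2) + (\<integral>x. \<phi> x \<partial>\<mu>)\<^sup>2"
proof -
  define m where "m = (\<integral>x. \<phi> x \<partial>\<mu>)"
  \<comment> \<open>Spelled as a linear combination of \<phi> and the constant function 1, so that
    \<open>P_linear\<close> applies as it stands.\<close>
  define \<phi>0 where "\<phi>0 x = 1 * \<phi> x + (- m) * 1" for x
  have L0: "\<phi>0 \<in> L2 \<mu>" unfolding \<phi>0_def[abs_def] by (intro L2_add L2_cmult \<phi> const_L2)
  have m0: "(\<integral>x. \<phi>0 x \<partial>\<mu>) = 0" using L2_integrable[OF \<phi>] by (simp add: \<phi>0_def m_def prob_space)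
  have "AE x in \<mu>. P \<phi>0 x = 1 * P \<phi> x + (- m) * P (\<lambda>_. 1) x"
    unfolding \<phi>0_def[abs_def] by (intro P_linear \<phi> const_L2)
  then have ae: "AE x in \<mu>. P \<phi> x = P \<phi>0 x + m"
    using transfer_const[of 1] by eventually_elim simp
  have LP: "P \<phi>0 \<in> L2 \<mu>" "P \<phi> \<in> L2 \<mu>" by (intro transfer_L2 L0 \<phi>)+
  note [measurable] = LP[THEN L2_measurable]
  have "(\<integral>x. (P \<phi> x)\<^sup>2 \<partial>\<mu>) = (\<integral>x. (P \<phi>0 x + m)\<^sup>2 \<partial>\<mu>)"
    by (rule integral_cong_AE) (use ae in auto)
  also have "\<dots> = (\<integral>x. (P \<phi>0 x)\<^sup>2 + 2 * m * P \<phi>0 x + m\<^sup>2 \<partial>\<mu>)"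
    by (simp add: power2_sum mult_ac add_ac)
  also have "\<dots> = (L2_norm \<mu> (P \<phi>0))\<^sup>2 + 2 * m * (\<integral>x. P \<phi>0 x \<partial>\<mu>) + m\<^sup>2"
    using L2_square_integrable[OF LP(1)] L2_integrable[OF LP(1)] by (simp add: prob_space L2_norm_power2)
  also have "(\<integral>x. P \<phi>0 x \<partial>\<mu>) = 0" using transfer_integral[OF L2_integrable[OF L0]] m0 by simp
  also have "(L2_norm \<mu> (P \<phi>0))\<^sup>2 \<le> (\<gamma> * L2_norm \<mu> \<phi>0)\<^sup>2"
    by (intro power_mono gap L0 m0) simp
  also have "(\<gamma> * L2_norm \<mu> \<phi>0)\<^sup>2 = \<gamma>\<^sup>2 * ((\<integral>x. (\<phi> x)\<^sup>2 \<partial>\<mu>) - m\<^sup>2)"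
    using L2_centered_square[OF \<phi>] by (simp add: power_mult_distrib L2_norm_power2 \<phi>0_def m_def)
  finally show ?thesis by (simp add: m_def)
qed

lemma variance_nonneg: "\<phi> \<in> L2 \<mu> \<Longrightarrow> 0 \<le> (\<integral>x. (\<phi> x)\<^sup>2 \<partial>\<mu>) - (\<integral>x. \<phi> x \<partial>\<mu>)\<^sup>2"
  using L2_centered_square[symmetric] by simp

lemma P_contraction:
  assumes \<phi>: "\<phi> \<in> L2 \<mu>"
  shows "L2_norm \<mu> (P \<phi>) \<le> L2_norm \<mu> \<phi>"
proof -
  have "\<gamma>\<^sup>2 \<le> 1" using gamma by (simp add: power_le_one)
  then have "\<gamma>\<^sup>2 * ((\<integral>x. (\<phi> x)\<^sup>2 \<partial>\<mu>) - (\<integral>x. \<phi> x \<partial>\<mu>)\<^sup>2) \<le> 1 * ((\<integral>x. (\<phi> x)\<^sup>2 \<partial>\<mu>) - (\<integral>x. \<phi> x \<partial>\<mu>)\<^sup>2)"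
    by (intro mult_right_mono variance_nonneg \<phi>)
  then show ?thesis using P_square[OF \<phi>] by (simp add: L2_norm_def)
qed

text \<open>The integral of the derivative of a periodic function over a period vanishes.\<close>

lemma has_weak_deriv_const: "has_weak_deriv (\<lambda>_. c) (\<lambda>_. 0)"
  unfolding has_weak_deriv_def
proof (intro conjI allI impI)
  fix \<tau> assume \<tau>: "test_function1 \<tau>"
  note c = test_function1_cont[OF \<tau>]
  have "(\<integral>x. deriv \<tau> x \<partial>circle) = (LBINT x=0..1. deriv \<tau> x)"
    by (rule integral_circle_interval[OF c(2)])
  also have "\<dots> = \<tau> 1 - \<tau> 0"
    using interval_integral_FTC_finite[of 0 1 "deriv \<tau>" \<tau>] c(2)[of "{0..1}"] c(3)
    by (simp add: has_real_derivative_iff_has_vector_derivative has_vector_derivative_at_within zero_ereal_def one_ereal_def)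
  also have "\<dots> = 0" using \<tau> unfolding test_function1_def by (metis add_0 diff_self)
  finally show "(\<integral>x. c * deriv \<tau> x \<partial>circle) = - (\<integral>x. 0 * \<tau> x \<partial>circle)" by simp
qed auto

text \<open>P fixes constants and their derivative is zero, so D sees only the centered part and the
  variance replaces the norm. This gain makes the gradient bound uniform in N: the variance is what
  the gap lets one application of P pay for.\<close>

lemma D_square:
  assumes \<phi>: "\<phi> \<in> L2 \<mu>"
  shows "(\<integral>x. (D \<phi> x)\<^sup>2 \<partial>\<mu>) \<le> C\<^sup>2 * ((\<integral>x. (\<phi> x)\<^sup>2 \<partial>\<mu>) - (\<integral>x. \<phi> x \<partial>\<mu>)\<^sup>2)"
proof -
  define m where "m = (\<integral>x. \<phi> x \<partial>\<mu>)"
  define \<phi>0 where "\<phi>0 x = 1 * \<phi> x + (- m) * 1" for x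
  have L0: "\<phi>0 \<in> L2 \<mu>" unfolding \<phi>0_def[abs_def] by (intro L2_add L2_cmult \<phi> const_L2)
  have L1: "(\<lambda>_. 1) \<in> L2 \<mu>" by (rule const_L2)
  \<comment> \<open>P 1 equals 1 almost everywhere and the constant has weak derivative 0;
    uniqueness passes this to the chosen derivative D 1.\<close>
  have D1: "AE x in circle. D (\<lambda>_. 1) x = 0"
  proof (rule weak_deriv_unique[OF _ has_weak_deriv_const[of 1]])
    show "has_weak_deriv (\<lambda>_. 1) (D (\<lambda>_. 1))"
      by (rule has_weak_deriv_cong[OF D(1)[OF L1]]) (use transfer_const[of 1] in \<open>auto simp: AE_mu_iff\<close>)
  qed
  have "AE x in circle. D \<phi>0 x = 1 * D \<phi> x + (- m) * D (\<lambda>_. 1) x"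
    unfolding \<phi>0_def[abs_def] by (intro D_linear \<phi> L1)
  then have ae: "AE x in \<mu>. D \<phi> x = D \<phi>0 x"
    using D1 unfolding AE_mu_iff by eventually_elim simp
  note [measurable] = D(2)[OF \<phi>, THEN L2_measurable] D(2)[OF L0, THEN L2_measurable]
  have "(\<integral>x. (D \<phi> x)\<^sup>2 \<partial>\<mu>) = (L2_norm \<mu> (D \<phi>0))\<^sup>2"
    unfolding L2_norm_power2 by (rule integral_cong_AE) (use ae in auto)
  also have "\<dots> \<le> (C * L2_norm \<mu> \<phi>0)\<^sup>2"
    by (intro power_mono D(3) L0) simp
  also have "\<dots> = C\<^sup>2 * ((\<integral>x. (\<phi> x)\<^sup>2 \<partial>\<mu>) - m\<^sup>2)"
    using L2_centered_square[OF \<phi>] by (simp add: power_mult_distrib L2_norm_power2 \<phi>0_def m_def)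
  finally show ?thesis by (simp add: m_def)
qed

lemma density_real:
  obtains \<rho> where "\<rho> \<in> borel_measurable circle" "\<And>x. 0 \<le> \<rho> x" "\<mu> = density circle (\<lambda>x. ennreal (\<rho> x))"
    "AE x in circle. 0 < \<rho> x"
proof -
  let ?R = "RN_deriv circle \<mu>"
  have R: "density circle ?R = \<mu>" by (rule circle.density_RN_deriv[OF ac(1) sets_mu])
  have "AE x in circle. ?R x \<noteq> \<infinity>"
    by (rule circle.RN_deriv_finite[OF prob_space_imp_sigma_finite[OF prob_space_axioms] ac(1) sets_mu])
  then have R': "AE x in circle. ?R x = ennreal (enn2real (?R x))"
    by eventually_elim (simp add: ennreal_enn2real_if)
  have "density circle ?R = density circle (\<lambda>x. ennreal (enn2real (?R x)))"
    by (rule density_cong[OF _ _ R']) auto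
  with R have dens: "\<mu> = density circle (\<lambda>x. ennreal (enn2real (?R x)))" by simp
  have "AE x in \<mu>. 0 < ?R x"
    by (subst R[symmetric], subst AE_density) auto
  then have "AE x in circle. 0 < enn2real (?R x)"
    unfolding AE_mu_iff using \<open>AE x in circle. ?R x \<noteq> \<infinity>\<close>
    by eventually_elim (simp add: enn2real_positive_iff less_top)
  then show thesis by (intro that[of "\<lambda>x. enn2real (?R x)", OF _ _ dens]) auto
qed

text \<open>On the set where (M + 1) \<rho> >= 1, Lebesgue measure is at most M + 1 times \<mu>.
  These sets exhaust the circle up to a null set because \<rho> > 0 almost everywhere. They stand in
  for a lower bound of the density.\<close>

lemma truncated_bound:
  "\<exists>A. (\<forall>M::nat. A M \<in> sets circle) \<and> (\<forall>M. \<forall>f\<in>L2 \<mu>. integrable circle f \<longrightarrow>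
      (\<integral>x. \<bar>f x\<bar> * indicator (A M) x \<partial>circle) \<le> real (Suc M) * L2_norm \<mu> f) \<and>
    (\<forall>f :: real \<Rightarrow> real. integrable circle f \<longrightarrow> (\<lambda>M. \<integral>x. \<bar>f x\<bar> * indicator (A M) x \<partial>circle) \<longlonglongrightarrow> (\<integral>x. \<bar>f x\<bar> \<partial>circle))"
proof -
  obtain \<rho> where \<rho> [measurable]: "\<rho> \<in> borel_measurable circle" and \<rho>0: "\<And>x. 0 \<le> \<rho> x"
    and dens: "\<mu> = density circle (\<lambda>x. ennreal (\<rho> x))" and pos: "AE x in circle. 0 < \<rho> x"
    using density_real by blast
  define A where "A M = {x \<in> space circle. 1 \<le> real (Suc M) * \<rho> x}" for M
  have A [measurable]: "A M \<in> sets circle" for M unfolding A_def by measurable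
  have 1: "(\<integral>x. \<bar>f x\<bar> * indicator (A M) x \<partial>circle) \<le> real (Suc M) * L2_norm \<mu> f"
    if f: "f \<in> L2 \<mu>" "integrable circle f" for M f
  proof -
    note [measurable] = borel_measurable_integrable[OF f(2)]
    have i: "integrable \<mu> (\<lambda>x. \<bar>f x\<bar>)" using L2_integrable[OF f(1)] by simp
    then have i': "integrable circle (\<lambda>x. \<rho> x * \<bar>f x\<bar>)"
      unfolding dens by (subst (asm) integrable_density) (auto simp: \<rho>0)
    have "(\<integral>x. \<bar>f x\<bar> * indicator (A M) x \<partial>circle) \<le> (\<integral>x. real (Suc M) * (\<rho> x * \<bar>f x\<bar>) \<partial>circle)"
    proof (rule integral_mono)
      show "integrable circle (\<lambda>x. \<bar>f x\<bar> * indicator (A M) x)"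
        using f(2) by (intro integrable_real_mult_indicator A) simp
      show "integrable circle (\<lambda>x. real (Suc M) * (\<rho> x * \<bar>f x\<bar>))" using i' by simp
      show "\<bar>f x\<bar> * indicator (A M) x \<le> real (Suc M) * (\<rho> x * \<bar>f x\<bar>)" for x
      proof (cases "x \<in> A M")
        case True
        then have "1 * \<bar>f x\<bar> \<le> (real (Suc M) * \<rho> x) * \<bar>f x\<bar>" by (intro mult_right_mono) (auto simp: A_def)
        then show ?thesis using True by (simp add: mult_ac)
      qed (simp add: \<rho>0)
    qed
    also have "\<dots> = real (Suc M) * (\<integral>x. \<bar>f x\<bar> \<partial>\<mu>)"
      unfolding dens by (subst integral_density) (auto simp: \<rho>0)
    also have "\<dots> \<le> real (Suc M) * L2_norm \<mu> f"
      by (intro mult_left_mono L2_abs_integral_le f) auto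
    finally show ?thesis .
  qed
  have 2: "(\<lambda>M. \<integral>x. \<bar>f x\<bar> * indicator (A M) x \<partial>circle) \<longlonglongrightarrow> (\<integral>x. \<bar>f x\<bar> \<partial>circle)"
    if f: "integrable circle f" for f :: "real \<Rightarrow> real"
  proof -
    note [measurable] = borel_measurable_integrable[OF f]
    show ?thesis
    proof (rule integral_dominated_convergence[where w="\<lambda>x. \<bar>f x\<bar>"])
      show "AE x in circle. (\<lambda>M. \<bar>f x\<bar> * indicator (A M) x) \<longlonglongrightarrow> \<bar>f x\<bar>"
        using pos AE_space
      proof eventually_elim
        case (elim x)
        obtain m :: nat where m: "1 / \<rho> x < real m" using reals_Archimedean2 by blast
        have "eventually (\<lambda>M. \<bar>f x\<bar> * indicator (A M) x = \<bar>f x\<bar>) sequentially"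
          using eventually_ge_at_top[of m]
        proof eventually_elim
          case (elim M)
          then have "1 / \<rho> x \<le> real (Suc M)" using m by linarith
          then have "x \<in> A M"
            using \<open>0 < \<rho> x\<close> \<open>x \<in> space circle\<close> by (simp add: A_def divide_le_eq del: space_circle)
          then show ?case by simp
        qed
        then show ?case by (rule tendsto_eventually)
      qed
    qed (use f in \<open>auto simp: indicator_def\<close>)
  qed
  show ?thesis using A 1 2 by (intro exI[of _ A]) blast
qed

text \<open>
  Uniform boundedness for the seminorms obtained by truncating the \<open>L\<^sup>1\<close> norm of the derivative to
  the sets where the density of \<open>\<mu>\<close> is not too small, by a gliding hump.
\<close>

lemma D_bounded_L1: "\<exists>K\<ge>0. \<forall>\<phi>\<in>L2 \<mu>. (\<integral>x. \<bar>D \<phi> x\<bar> \<partial>circle) \<le> K * L2_norm \<mu> \<phi>"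
proof (rule ccontr)
  assume neg: "\<not> ?thesis"
  obtain A where A: "\<And>M::nat. A M \<in> sets circle"
    and A1: "\<And>M f. f \<in> L2 \<mu> \<Longrightarrow> integrable circle f \<Longrightarrow> (\<integral>x. \<bar>f x\<bar> * indicator (A M) x \<partial>circle) \<le> real (Suc M) * L2_norm \<mu> f"
    and A2: "\<And>f :: real \<Rightarrow> real. integrable circle f \<Longrightarrow> (\<lambda>M. \<integral>x. \<bar>f x\<bar> * indicator (A M) x \<partial>circle) \<longlonglongrightarrow> (\<integral>x. \<bar>f x\<bar> \<partial>circle)"
    using truncated_bound by blast
  \<comment> \<open>For each M a seminorm in \<phi> that is bounded on \<open>L2 \<mu>\<close>, with
    a constant growing with M; for fixed \<phi> it tends to the Lebesgue L1 norm of D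
    \<phi>.\<close>
  define G where "G M \<phi> = (\<integral>x. \<bar>D \<phi> x\<bar> * indicator (A M) x \<partial>circle)" for M \<phi>
  have int: "integrable circle (\<lambda>x. \<bar>D \<phi> x\<bar> * indicator (A M) x)" if "\<phi> \<in> L2 \<mu>" for \<phi> M
    using D_integrable[OF that] by (intro integrable_real_mult_indicator A) simp
  have G_le: "G M \<phi> \<le> real (Suc M) * (C * L2_norm \<mu> \<phi>)" if \<phi>: "\<phi> \<in> L2 \<mu>" for M \<phi>
    unfolding G_def using A1[OF D(2)[OF \<phi>] D_integrable[OF \<phi>], of M] mult_left_mono[OF D(3)[OF \<phi>], of "real (Suc M)"]
    by linarith
  have G_full: "G M \<phi> \<le> (\<integral>x. \<bar>D \<phi> x\<bar> \<partial>circle)" if \<phi>: "\<phi> \<in> L2 \<mu>" for M \<phi>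
    unfolding G_def using D_integrable[OF \<phi>] by (intro integral_mono int \<phi>) (auto simp: indicator_def)
  have G_diff: "G M \<psi> - G M (\<lambda>x. \<psi> x - \<phi> x) \<le> G M \<phi>" if L: "\<phi> \<in> L2 \<mu>" "\<psi> \<in> L2 \<mu>" for M \<phi> \<psi>
  proof -
    have L': "(\<lambda>x. \<psi> x - \<phi> x) \<in> L2 \<mu>" by (intro L2_diff L)
    have "AE x in circle. D (\<lambda>x. \<psi> x - \<phi> x) x = D \<psi> x - D \<phi> x"
      using D_linear[OF L(2,1), of 1 "-1"] by simp
    then have "G M \<psi> \<le> (\<integral>x. \<bar>D \<phi> x\<bar> * indicator (A M) x + \<bar>D (\<lambda>x. \<psi> x - \<phi> x) x\<bar> * indicator (A M) x \<partial>circle)"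
      unfolding G_def using int[OF L(1)] int[OF L(2)] int[OF L']
      by (intro integral_mono_AE) (auto elim!: eventually_mono simp: indicator_def)
    then show ?thesis unfolding G_def using int[OF L(1)] int[OF L'] by simp
  qed
  \<comment> \<open>If no uniform bound exists, the seminorms are unbounded on every ball:
    arbitrarily close to S there is an S' at which some truncation is as large as desired.\<close>
  have step: "\<exists>S' M. S' \<in> L2 \<mu> \<and> L2_norm \<mu> (\<lambda>x. S' x - S x) \<le> \<delta> \<and> B \<le> G M S'"
    if S: "S \<in> L2 \<mu>" and \<delta>: "0 < \<delta>" for S \<delta> B
  proof -
    define I where "I = (\<integral>x. \<bar>D S x\<bar> \<partial>circle)"
    have I0: "0 \<le> I" by (simp add: I_def)
    \<comment> \<open>The hump added to S is t times \<phi>, of norm \<delta>. This K makes the L1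
      norm of its derivative exceed |B| + I + 1, so that more than B remains after the contribution
      I of S is subtracted.\<close>
    define K where "K = (\<bar>B\<bar> + I + 1) / \<delta>"
    have "0 \<le> K" using I0 \<delta> by (simp add: K_def)
    then have "\<not> (\<forall>\<phi>\<in>L2 \<mu>. (\<integral>x. \<bar>D \<phi> x\<bar> \<partial>circle) \<le> K * L2_norm \<mu> \<phi>)" using neg by blast
    then obtain \<phi> where \<phi>: "\<phi> \<in> L2 \<mu>" "K * L2_norm \<mu> \<phi> < (\<integral>x. \<bar>D \<phi> x\<bar> \<partial>circle)"
      by (auto simp: not_le)
    \<comment> \<open>Functions of norm zero must be excluded before dividing: all their truncated
      seminorms vanish by \<open>G_le\<close>, hence so does the full L1 norm of the
      derivative.\<close>
    have n0: "L2_norm \<mu> \<phi> \<noteq> 0"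
    proof
      assume "L2_norm \<mu> \<phi> = 0"
      then have "G M \<phi> \<le> 0" for M using G_le[OF \<phi>(1), of M] by simp
      then have "(\<integral>x. \<bar>D \<phi> x\<bar> \<partial>circle) \<le> 0"
        using LIMSEQ_le_const2[OF A2[OF D_integrable[OF \<phi>(1)]], of 0] by (auto simp: G_def)
      with \<phi>(2) \<open>L2_norm \<mu> \<phi> = 0\<close> show False by simp
    qed
    then have n: "0 < L2_norm \<mu> \<phi>" using L2_norm_nonneg[of \<mu> \<phi>] by linarith
    define t where "t = \<delta> / L2_norm \<mu> \<phi>"
    have t: "0 < t" using n \<delta> by (simp add: t_def)
    define S' where "S' x = 1 * S x + t * \<phi> x" for x
    have L': "S' \<in> L2 \<mu>" unfolding S'_def[abs_def] by (intro L2_add L2_cmult S \<phi>)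
    have norm: "L2_norm \<mu> (\<lambda>x. S' x - S x) = \<delta>"
      using n t \<delta> by (simp add: S'_def L2_norm_cmult) (simp add: t_def)
    have "AE x in circle. D S' x = 1 * D S x + t * D \<phi> x"
      unfolding S'_def[abs_def] by (intro D_linear S \<phi>)
    then have ae: "AE x in circle. t * \<bar>D \<phi> x\<bar> \<le> \<bar>D S' x\<bar> + \<bar>D S x\<bar>"
    proof eventually_elim
      case (elim x)
      have "t * \<bar>D \<phi> x\<bar> = \<bar>t * D \<phi> x\<bar>" using t by (simp add: abs_mult)
      also have "t * D \<phi> x = D S' x - D S x" using elim by simp
      finally show ?case by linarith
    qed
    have "\<bar>B\<bar> + I + 1 = t * (K * L2_norm \<mu> \<phi>)"
      using n \<delta> by (simp add: t_def K_def)
    also have "\<dots> < t * (\<integral>x. \<bar>D \<phi> x\<bar> \<partial>circle)" using \<phi>(2) t by (intro mult_strict_left_mono)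
    also have "\<dots> = (\<integral>x. t * \<bar>D \<phi> x\<bar> \<partial>circle)" by simp
    also have "\<dots> \<le> (\<integral>x. \<bar>D S' x\<bar> + \<bar>D S x\<bar> \<partial>circle)"
      using ae D_integrable[OF \<phi>(1)] D_integrable[OF L'] D_integrable[OF S] by (intro integral_mono_AE) auto
    also have "\<dots> = (\<integral>x. \<bar>D S' x\<bar> \<partial>circle) + I"
      using D_integrable[OF L'] D_integrable[OF S] by (simp add: I_def)
    finally have "B < (\<integral>x. \<bar>D S' x\<bar> \<partial>circle)" by linarith
    from order_tendstoD(1)[OF A2[OF D_integrable[OF L']] this] obtain M where "B < G M S'"
      unfolding G_def by (auto simp: eventually_sequentially)
    then show ?thesis using L' norm by (intro exI[of _ S'] exI[of _ M]) auto
  qed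
  \<comment> \<open>In a state (S, M, \<delta>) the tolerance \<delta> is so small that moving S by
    at most \<delta> lowers the M-th seminorm by at most 1.\<close>
  define good where "good n s \<longleftrightarrow> (case s of (S, M, \<delta>) \<Rightarrow> S \<in> L2 \<mu> \<and> 0 < \<delta> \<and> real n \<le> G M S \<and> real (Suc M) * (C * \<delta>) \<le> 1)"
    for n :: nat and s :: "(real \<Rightarrow> real) \<times> nat \<times> real"
  \<comment> \<open>Moving by half the tolerance and halving it at each hop keeps the sum of all
    later moves within the current tolerance.\<close>
  define hop where "hop s s' \<longleftrightarrow> L2_norm \<mu> (\<lambda>x. fst s' x - fst s x) \<le> snd (snd s) / 2 \<and> snd (snd s') \<le> snd (snd s) / 2"
    for s s' :: "(real \<Rightarrow> real) \<times> nat \<times> real"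
  have "\<exists>f. \<forall>n. good n (f n) \<and> hop (f n) (f (Suc n))"
  proof (rule dependent_nat_choice)
    have "0 \<le> G 0 (\<lambda>_. 0)" unfolding G_def by (intro Bochner_Integration.integral_nonneg) auto
    then show "\<exists>s. good 0 s"
      using C_pos by (intro exI[of _ "(\<lambda>_. 0, 0, 1 / C)"]) (simp add: good_def)
  next
    fix s n assume "good n s"
    then obtain S M \<delta> where s: "s = (S, M, \<delta>)" "S \<in> L2 \<mu>" "0 < \<delta>" by (cases s) (auto simp: good_def)
    obtain S' M' where S': "S' \<in> L2 \<mu>" "L2_norm \<mu> (\<lambda>x. S' x - S x) \<le> \<delta> / 2" "real (Suc n) \<le> G M' S'"
      using step[OF s(2), of "\<delta> / 2" "real (Suc n)"] s(3) by auto
    define \<delta>' where "\<delta>' = min (\<delta> / 2) (1 / (real (Suc M') * C))"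
    have "0 < \<delta>'" using s(3) C_pos by (simp add: \<delta>'_def)
    moreover have "real (Suc M') * (C * \<delta>') \<le> 1"
    proof -
      have "real (Suc M') * C * \<delta>' \<le> real (Suc M') * C * (1 / (real (Suc M') * C))"
        using C_pos by (intro mult_left_mono) (auto simp: \<delta>'_def)
      also have "\<dots> = 1" using C_pos by simp
      finally show ?thesis by (simp only: mult.assoc)
    qed
    ultimately show "\<exists>s'. good (Suc n) s' \<and> hop s s'"
      using S' s(1) by (intro exI[of _ "(S', M', \<delta>')"]) (simp add: good_def hop_def \<delta>'_def)
  qed
  then obtain f where f: "\<And>n. good n (f n)" "\<And>n. hop (f n) (f (Suc n))" by blast
  define S where "S n = fst (f n)" for n
  define M where "M n = fst (snd (f n))" for n
  define \<delta> where "\<delta> n = snd (snd (f n))" for n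
  have g: "S n \<in> L2 \<mu>" "0 < \<delta> n" "real n \<le> G (M n) (S n)" "real (Suc (M n)) * (C * \<delta> n) \<le> 1" for n
    using f(1)[of n] by (auto simp: good_def S_def M_def \<delta>_def split: prod.splits)
  have nx: "L2_norm \<mu> (\<lambda>x. S (Suc n) x - S n x) \<le> \<delta> n / 2" "\<delta> (Suc n) \<le> \<delta> n / 2" for n
    using f(2)[of n] by (auto simp: hop_def S_def \<delta>_def)
  have decay: "\<delta> (k + n) \<le> \<delta> n * (1 / 2) ^ k" for k n
  proof (induction k)
    case (Suc k)
    then show ?case using nx(2)[of "k + n"] by simp
  qed simp
  have sm: "summable (\<lambda>k. \<delta> n / 2 * (1 / 2) ^ k)" for n
    by (intro summable_mult summable_geometric) simp
  have "summable (\<lambda>n. \<delta> n / 2)"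
    by (rule summable_comparison_test'[OF sm[of 0], of 0]) (use decay[of _ 0] g(2) in \<open>auto simp: less_imp_le\<close>)
  from L2_complete[OF g(1) nx(1) this] obtain h where h: "h \<in> L2 \<mu>"
    "\<And>n. L2_norm \<mu> (\<lambda>x. S n x - h x) \<le> (\<Sum>k. \<delta> (k + n) / 2)" by blast
  have tail: "L2_norm \<mu> (\<lambda>x. S n x - h x) \<le> \<delta> n" for n
  proof -
    have "(\<Sum>k. \<delta> (k + n) / 2) \<le> (\<Sum>k. \<delta> n / 2 * (1 / 2) ^ k)"
    proof (rule suminf_le[OF _ _ sm])
      show "\<delta> (k + n) / 2 \<le> \<delta> n / 2 * (1 / 2) ^ k" for k using decay[of k n] by simp
      show "summable (\<lambda>k. \<delta> (k + n) / 2)"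
        using \<open>summable (\<lambda>n. \<delta> n / 2)\<close> by (subst summable_iff_shift[of "\<lambda>k. \<delta> k / 2" n])
    qed
    also have "\<dots> = \<delta> n" by (subst suminf_mult) (auto simp: suminf_geometric summable_geometric)
    finally show ?thesis using h(2)[of n] by linarith
  qed
  \<comment> \<open>The limit h lies within the tolerance of every state, so its seminorm of index
    \<open>M n\<close>, and with it the L1 norm of D h, is at least n - 1 for every n. This is the
    contradiction.\<close>
  have "real n - 1 \<le> (\<integral>x. \<bar>D h x\<bar> \<partial>circle)" for n
  proof -
    have "G (M n) (\<lambda>x. S n x - h x) \<le> real (Suc (M n)) * (C * L2_norm \<mu> (\<lambda>x. S n x - h x))"
      by (intro G_le L2_diff g h)
    also have "\<dots> \<le> real (Suc (M n)) * (C * \<delta> n)"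
      using tail[of n] C_pos by (intro mult_left_mono) auto
    also have "\<dots> \<le> 1" by (rule g(4))
    finally show ?thesis
      using G_diff[OF h(1) g(1)[of n], of "M n"] g(3)[of n] G_full[OF h(1), of "M n"] by linarith
  qed
  moreover obtain n :: nat where "(\<integral>x. \<bar>D h x\<bar> \<partial>circle) + 1 < real n" using reals_Archimedean2 by blast
  ultimately show False by (metis add_diff_cancel_right' diff_strict_right_mono not_le)
qed

text \<open>\<open>weak_deriv_bound\<close> controls P \<phi> up to its Lebesgue mean c. The mean is
  controlled in turn by integrating the resulting bound on |c| against \<mu>, where the contraction
  property of P applies. The Lebesgue L1 norm of P \<phi> is thus never estimated directly.\<close>

lemma P_bounded: "\<exists>K>0. \<forall>\<phi>\<in>L2 \<mu>. AE x in circle. \<bar>P \<phi> x\<bar> \<le> K * L2_norm \<mu> \<phi>"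
proof -
  obtain K where K: "0 \<le> K" "\<And>\<phi>. \<phi> \<in> L2 \<mu> \<Longrightarrow> (\<integral>x. \<bar>D \<phi> x\<bar> \<partial>circle) \<le> K * L2_norm \<mu> \<phi>"
    using D_bounded_L1 by blast
  have "AE x in circle. \<bar>P \<phi> x\<bar> \<le> (1 + 4 * K) * L2_norm \<mu> \<phi>" if \<phi>: "\<phi> \<in> L2 \<mu>" for \<phi>
  proof -
    define c where "c = (\<integral>x. P \<phi> x \<partial>circle)"
    have b: "AE x in circle. \<bar>P \<phi> x - c\<bar> \<le> 2 * K * L2_norm \<mu> \<phi>"
      using weak_deriv_bound[OF D(1)[OF \<phi>]]
      by eventually_elim (use K(2)[OF \<phi>] in \<open>simp add: c_def\<close>)
    then have b': "AE x in \<mu>. \<bar>c\<bar> \<le> \<bar>P \<phi> x\<bar> + 2 * K * L2_norm \<mu> \<phi>"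
      unfolding AE_mu_iff by eventually_elim linarith
    have i: "integrable \<mu> (\<lambda>x. \<bar>P \<phi> x\<bar>)" using L2_integrable[OF transfer_L2[OF \<phi>]] by simp
    have "(\<integral>x. \<bar>c\<bar> \<partial>\<mu>) \<le> (\<integral>x. \<bar>P \<phi> x\<bar> + 2 * K * L2_norm \<mu> \<phi> \<partial>\<mu>)"
      using b' i by (intro integral_mono_AE) auto
    then have "\<bar>c\<bar> \<le> (\<integral>x. \<bar>P \<phi> x\<bar> \<partial>\<mu>) + 2 * K * L2_norm \<mu> \<phi>" using i by (simp add: prob_space)
    also have "(\<integral>x. \<bar>P \<phi> x\<bar> \<partial>\<mu>) \<le> L2_norm \<mu> \<phi>"
      using L2_abs_integral_le[OF transfer_L2[OF \<phi>]] P_contraction[OF \<phi>] by linarith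
    finally have c: "\<bar>c\<bar> \<le> L2_norm \<mu> \<phi> + 2 * K * L2_norm \<mu> \<phi>" by simp
    show ?thesis
      using b by eventually_elim (use c in \<open>simp add: algebra_simps\<close>)
  qed
  then show ?thesis using K(1) by (intro exI[of _ "1 + 4 * K"]) auto
qed

text \<open>The sup bound, weakened to a quadratic inequality, so that Gram matrices for Lebesgue
  measure can be compared with Gram matrices for \<mu>.\<close>

lemma P_bounded_L2: "\<exists>K>0. \<forall>\<phi>\<in>L2 \<mu>. P \<phi> \<in> L2 circle \<and> (\<integral>x. (P \<phi> x)\<^sup>2 \<partial>circle) \<le> K\<^sup>2 * (\<integral>x. (\<phi> x)\<^sup>2 \<partial>\<mu>)"
proof -
  obtain K where K: "0 < K" "\<And>\<phi>. \<phi> \<in> L2 \<mu> \<Longrightarrow> AE x in circle. \<bar>P \<phi> x\<bar> \<le> K * L2_norm \<mu> \<phi>"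
    using P_bounded by blast
  have "P \<phi> \<in> L2 circle \<and> (\<integral>x. (P \<phi> x)\<^sup>2 \<partial>circle) \<le> K\<^sup>2 * (\<integral>x. (\<phi> x)\<^sup>2 \<partial>\<mu>)" if \<phi>: "\<phi> \<in> L2 \<mu>" for \<phi>
  proof -
    note [measurable] = borel_measurable_integrable[OF P_integrable_circle[OF \<phi>]]
    have b: "AE x in circle. (P \<phi> x)\<^sup>2 \<le> (K * L2_norm \<mu> \<phi>)\<^sup>2"
      using K(2)[OF \<phi>]
    proof eventually_elim
      case (elim x)
      from power_mono[OF this abs_ge_zero, of 2] show ?case by simp
    qed
    have i: "integrable circle (\<lambda>x. (P \<phi> x)\<^sup>2)"
      by (rule circle.integrable_const_bound[where B="(K * L2_norm \<mu> \<phi>)\<^sup>2"]) (use b in auto)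
    then have L: "P \<phi> \<in> L2 circle" by (intro L2I) auto
    have "(\<integral>x. (P \<phi> x)\<^sup>2 \<partial>circle) \<le> (\<integral>x. (K * L2_norm \<mu> \<phi>)\<^sup>2 \<partial>circle)"
      by (intro integral_mono_AE i b) auto
    also have "\<dots> = K\<^sup>2 * (\<integral>x. (\<phi> x)\<^sup>2 \<partial>\<mu>)"
      using circle.prob_space by (simp add: power_mult_distrib L2_norm_power2)
    finally show ?thesis using L by blast
  qed
  then show ?thesis using K(1) by blast
qed

end


section \<open>Independent copies of the chain\<close>

definition gram :: "'a measure \<Rightarrow> (nat \<Rightarrow> 'a \<Rightarrow> real) \<Rightarrow> nat \<Rightarrow> nat \<Rightarrow> real" where
  "gram M f j k = (\<integral>x. f j x * f k x \<partial>M)"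

text \<open>Reads the form of a Gram matrix as the squared norm of a linear combination.
  Inequalities for single functions thereby become inequalities in the order given by
  \<open>psd\<close>.\<close>

lemma gram_quadratic:
  assumes f: "\<And>j. j < m \<Longrightarrow> f j \<in> L2 M"
  shows "(\<Sum>j<m. \<Sum>k<m. c j * c k * gram M f j k) = (\<integral>x. (\<Sum>j<m. c j * f j x)\<^sup>2 \<partial>M)"
proof -
  have "(\<integral>x. (\<Sum>j<m. c j * f j x)\<^sup>2 \<partial>M) = (\<integral>x. (\<Sum>j<m. \<Sum>k<m. c j * c k * (f j x * f k x)) \<partial>M)"
    by (simp add: power2_eq_square sum_product mult_ac)
  also have "\<dots> = (\<Sum>j<m. \<integral>x. (\<Sum>k<m. c j * c k * (f j x * f k x)) \<partial>M)"
    using L2_mult_integrable[OF f f]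
    by (intro Bochner_Integration.integral_sum Bochner_Integration.integrable_sum integrable_mult_right) auto
  also have "\<dots> = (\<Sum>j<m. \<Sum>k<m. \<integral>x. c j * c k * (f j x * f k x) \<partial>M)"
    using L2_mult_integrable[OF f f]
    by (intro sum.cong refl Bochner_Integration.integral_sum integrable_mult_right) auto
  finally show ?thesis by (simp add: gram_def)
qed

lemma schur_psd_gram': "(\<And>j. j < m \<Longrightarrow> f j \<in> L2 M) \<Longrightarrow> schur_psd m (gram M f)"
  using schur_psd_gram[of m f M] by (simp add: gram_def[abs_def])

lemma schur_psd_cmult: "schur_psd m K \<Longrightarrow> 0 \<le> a \<Longrightarrow> schur_psd m (\<lambda>j k. a * K j k)"
proof -
  assume K: "schur_psd m K" and a: "0 \<le> a"
  show ?thesis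
    unfolding schur_psd_def
  proof (intro allI impI)
    fix L assume "psd m L"
    from psd_cmult[OF schur_psdD[OF K this] a] show "psd m (\<lambda>j k. a * K j k * L j k)"
      by (simp only: mult.assoc)
  qed
qed

lemma
  fixes c :: "nat \<Rightarrow> real"
  shows quad_form_diff: "(\<Sum>j<m. \<Sum>k<m. c j * c k * (K j k - L j k)) = (\<Sum>j<m. \<Sum>k<m. c j * c k * K j k) - (\<Sum>j<m. \<Sum>k<m. c j * c k * L j k)"
    and quad_form_add: "(\<Sum>j<m. \<Sum>k<m. c j * c k * (K j k + L j k)) = (\<Sum>j<m. \<Sum>k<m. c j * c k * K j k) + (\<Sum>j<m. \<Sum>k<m. c j * c k * L j k)"
    and quad_form_cmult: "(\<Sum>j<m. \<Sum>k<m. c j * c k * (a * K j k)) = a * (\<Sum>j<m. \<Sum>k<m. c j * c k * K j k)"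
    apply (simp only: right_diff_distrib sum_subtractf)
   apply (simp only: distrib_left sum.distrib)
  unfolding sum_distrib_left by (intro sum.cong refl mult.left_commute)

definition mean_product :: "'a measure \<Rightarrow> (nat \<Rightarrow> 'a \<Rightarrow> real) \<Rightarrow> nat \<Rightarrow> nat \<Rightarrow> real" where
  "mean_product M f j k = (\<integral>x. f j x \<partial>M) * (\<integral>x. f k x \<partial>M)"

lemma (in prob_space) mean_product_quadratic:
  assumes "\<And>j. j < m \<Longrightarrow> f j \<in> L2 M"
  shows "(\<Sum>j<m. \<Sum>k<m. c j * c k * mean_product M f j k) = (\<integral>x. (\<Sum>j<m. c j * f j x) \<partial>M)\<^sup>2"
proof -
  have "(\<integral>x. (\<Sum>j<m. c j * f j x) \<partial>M) = (\<Sum>j<m. c j * (\<integral>x. f j x \<partial>M))"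
    using L2_integrable[OF assms] by (subst Bochner_Integration.integral_sum) auto
  then show ?thesis
    by (simp add: mean_product_def power2_eq_square sum_product mult_ac)
qed

text \<open>The covariance matrix is the Gram matrix of the centered functions.\<close>

lemma (in prob_space) schur_psd_covariance:
  assumes f: "\<And>j. j < m \<Longrightarrow> f j \<in> L2 M"
  shows "schur_psd m (\<lambda>j k. gram M f j k - mean_product M f j k)"
proof -
  define h where "h j x = f j x - (\<integral>y. f j y \<partial>M)" for j x
  have "h j \<in> L2 M" if "j < m" for j
    unfolding h_def[abs_def] using f[OF that] L2_const finite_measure_axioms by (intro L2_diff)
  then have "schur_psd m (gram M h)" by (rule schur_psd_gram')
  moreover have "gram M h j k = gram M f j k - mean_product M f j k" if "j < m" "k < m" for j k
  proof -
    let ?a = "\<integral>y. f j y \<partial>M" and ?b = "\<integral>y. f k y \<partial>M"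
    have "gram M h j k = (\<integral>x. f j x * f k x - ?a * f k x - ?b * f j x + ?a * ?b \<partial>M)"
      by (simp add: gram_def h_def algebra_simps)
    also have "\<dots> = gram M f j k - mean_product M f j k"
      using L2_mult_integrable[OF f f, OF that] L2_integrable[OF f[OF that(1)]] L2_integrable[OF f[OF that(2)]]
      by (simp add: gram_def mean_product_def prob_space)
    finally show ?thesis .
  qed
  ultimately show ?thesis
    unfolding schur_psd_def by (metis (no_types, lifting) psd_cong)
qed

text \<open>The operator \<open>A l\<close> may depend on the slot l: it is used with P in every
  slot, and with D in one slot and P in the others.\<close>

lemma tensor_sum_op_lin:
  "a * tensor_sum N m c (\<lambda>j l. A l (\<phi> j l)) x + b * tensor_sum N m' c' (\<lambda>j l. A l (\<phi>' j l)) x =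
   tensor_sum N (m + m') (\<lambda>j. if j < m then a * c j else b * c' (j - m))
     (\<lambda>j l. A l ((if j < m then \<phi> j else \<phi>' (j - m)) l)) x"
proof -
  have "(\<lambda>j. if j < m then (\<lambda>l. A l (\<phi> j l)) else (\<lambda>l. A l (\<phi>' (j - m) l))) =
      (\<lambda>j l. A l ((if j < m then \<phi> j else \<phi>' (j - m)) l))"
    by (intro ext) (simp split: if_split)
  then show ?thesis unfolding tensor_sum_lin by simp
qed

context smoothing_chain
begin

lemma prob_space_power: "prob_space (power_measure \<mu> N)"
  unfolding power_measure_def by (intro prob_space_PiM prob_space_axioms)

lemma sets_power: "sets (power_measure \<mu> N) = sets (torus N)"
  unfolding power_measure_def torus_def by (intro sets_PiM_cong sets_mu refl)

lemma space_power: "space (power_measure \<mu> N) = space (torus N)"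
  by (rule sets_eq_imp_space_eq[OF sets_power])

lemma measurable_power: "borel_measurable (power_measure \<mu> N) = (borel_measurable (torus N) :: ((nat \<Rightarrow> real) \<Rightarrow> real) set)"
  by (rule measurable_cong_sets[OF sets_power refl])

text \<open>The product measure has the density \<open>\<Prod>l<N. \<rho> (x l)\<close> with respect
  to Lebesgue measure, which is positive almost everywhere. Comparing null sets is as far as this
  goes, since \<rho> may come close to 0.\<close>

lemma AE_power_iff: "(AE x in power_measure \<mu> N. Q x) \<longleftrightarrow> (AE x in torus N. Q x)"
proof -
  obtain \<rho> where \<rho>: "\<rho> \<in> borel_measurable circle" and \<rho>0: "\<And>x. 0 \<le> \<rho> x"
    and dens: "\<mu> = density circle (\<lambda>x. ennreal (\<rho> x))" and pos: "AE x in circle. 0 < \<rho> x"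
    using density_real by blast
  let ?d = "\<lambda>x. \<Prod>l<N. ennreal (\<rho> (x l))"
  have d [measurable]: "?d \<in> borel_measurable (torus N)"
    by (intro borel_measurable_prod_ennreal measurable_compose[OF torus_component_measurable]) (use \<rho> in auto)
  interpret PS: product_sigma_finite "\<lambda>_. \<mu>" by unfold_locales
  have "density (torus N) ?d = PiM {..<N} (\<lambda>_. \<mu>)"
  proof (rule PS.PiM_eqI)
    show "sets (density (torus N) ?d) = sets (PiM {..<N} (\<lambda>_. \<mu>))"
      using sets_power[of N] by (simp add: power_measure_def)
    fix A assume "\<And>i. i \<in> {..<N} \<Longrightarrow> A i \<in> sets \<mu>"
    then have A: "A i \<in> sets circle" if "i < N" for i using that sets_mu by auto
    have box: "PiE {..<N} A \<in> sets (torus N)" unfolding torus_def using A by (intro sets_PiM_I_finite) auto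
    have ind: "(indicator (PiE {..<N} A) x :: ennreal) = (\<Prod>l<N. indicator (A l) (x l))" if "x \<in> space (torus N)" for x
      using that by (auto simp: space_torus PiE_iff indicator_def prod_zero_iff intro!: prod.neutral[symmetric])
    have "emeasure (density (torus N) ?d) (PiE {..<N} A) = (\<integral>\<^sup>+x. (\<Prod>l<N. ennreal (\<rho> (x l)) * indicator (A l) (x l)) \<partial>torus N)"
      unfolding emeasure_density[OF d box] by (intro nn_integral_cong) (simp add: ind prod.distrib)
    also have "\<dots> = (\<Prod>l<N. \<integral>\<^sup>+x. ennreal (\<rho> x) * indicator (A l) x \<partial>circle)"
      unfolding torus_def using \<rho> A by (intro circles.product_nn_integral_prod) auto
    also have "\<dots> = (\<Prod>l<N. emeasure \<mu> (A l))"
      using \<rho> A by (intro prod.cong refl) (simp add: dens emeasure_density)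
    finally show "emeasure (density (torus N) ?d) (PiE {..<N} A) = (\<Prod>i<N. emeasure \<mu> (A i))" .
  qed simp
  then have eq: "power_measure \<mu> N = density (torus N) ?d" by (simp add: power_measure_def)
  have "AE x in torus N. \<forall>l\<in>{..<N}. 0 < \<rho> (x l)"
    unfolding torus_def by (intro AE_finite_allI AE_PiM_component prob_space_circle pos) auto
  then have "AE x in torus N. 0 < ?d x"
    by eventually_elim (auto simp: prod_ennreal \<rho>0 intro!: prod_pos)
  then show ?thesis
    unfolding eq AE_density[OF d] by (auto elim: eventually_elim2)
qed

section \<open>The transfer operator of N independent copies\<close>

abbreviation "T N \<equiv> transfer_op_N p \<mu> N"

lemma stationary_kernel_axioms': "stationary_kernel \<mu> p" by unfold_locales

lemma stationary_kernel_N: "stationary_kernel (power_measure \<mu> N) (\<lambda>y. PiM {..<N} (\<lambda>i. p (y i)))"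
  unfolding power_measure_def by (rule stationary_kernel_product[OF stationary_kernel_axioms']) simp

lemma T_tensor_power: "is_tensor_power \<mu> P N (T N)"
  using tensor_power_eq_transfer(1)[OF stationary_kernel_axioms', of N "\<lambda>_. 0"] by (simp add: transfer_op_eq)

lemma T_eq:
  assumes "integrable (power_measure \<mu> N) f"
  shows "AE x in power_measure \<mu> N. T N f x = transfer (\<lambda>y. PiM {..<N} (\<lambda>i. p (y i))) (power_measure \<mu> N) f x"
  by (rule tensor_power_eq_transfer(2)[OF stationary_kernel_axioms' assms])

lemma T_integrable: "integrable (power_measure \<mu> N) f \<Longrightarrow> integrable (power_measure \<mu> N) (T N f)"
  using T_tensor_power[of N, unfolded is_tensor_power_def bounded_linear_L1_def, THEN conjunct1, THEN conjunct1]
  by blast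

lemma T_linear:
  assumes "integrable (power_measure \<mu> N) f" "integrable (power_measure \<mu> N) g"
  shows "AE x in power_measure \<mu> N. T N (\<lambda>y. a * f y + b * g y) x = a * T N f x + b * T N g x"
  using T_tensor_power[of N, unfolded is_tensor_power_def bounded_linear_L1_def, THEN conjunct1, THEN conjunct2,
      THEN conjunct1, rule_format, OF assms] .

lemma T_nonneg:
  assumes "integrable (power_measure \<mu> N) f" "AE x in power_measure \<mu> N. 0 \<le> f x"
  shows "AE x in power_measure \<mu> N. 0 \<le> T N f x"
proof -
  interpret KN: stationary_kernel "power_measure \<mu> N" "\<lambda>y. PiM {..<N} (\<lambda>i. p (y i))" by (rule stationary_kernel_N)
  from T_eq[OF assms(1)] KN.transfer_nonneg[OF assms]
  show ?thesis
  proof eventually_elim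
    case (elim x)
    show ?case unfolding elim(1) by (rule elim(2))
  qed
qed

lemma T_integral:
  assumes f: "integrable (power_measure \<mu> N) f"
  shows "(\<integral>x. T N f x \<partial>power_measure \<mu> N) = (\<integral>x. f x \<partial>power_measure \<mu> N)"
proof -
  note [measurable] = borel_measurable_integrable[OF T_integrable[OF f]]
    borel_measurable_integrable[OF stationary_kernel.transfer_integrable[OF stationary_kernel_N f]]
  have "(\<integral>x. T N f x \<partial>power_measure \<mu> N) =
      (\<integral>x. transfer (\<lambda>y. PiM {..<N} (\<lambda>i. p (y i))) (power_measure \<mu> N) f x \<partial>power_measure \<mu> N)"
    by (rule integral_cong_AE) (use T_eq[OF f] in auto)
  then show ?thesis by (simp add: stationary_kernel.transfer_integral[OF stationary_kernel_N f])
qed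

lemma T_const: "AE x in power_measure \<mu> N. T N (\<lambda>_. c) x = c"
proof -
  interpret M: prob_space "power_measure \<mu> N" by (rule prob_space_power)
  have "integrable (power_measure \<mu> N) (\<lambda>_. c)" by simp
  from T_eq[OF this] stationary_kernel.transfer_const[OF stationary_kernel_N, of N c]
  show ?thesis by eventually_elim simp
qed

lemma T_L1:
  assumes f: "integrable (power_measure \<mu> N) f"
  shows "(\<integral>x. \<bar>T N f x\<bar> \<partial>power_measure \<mu> N) \<le> (\<integral>x. \<bar>f x\<bar> \<partial>power_measure \<mu> N)"
proof -
  note [measurable] = borel_measurable_integrable[OF T_integrable[OF f]]
    borel_measurable_integrable[OF stationary_kernel.transfer_integrable[OF stationary_kernel_N f]]
  have "(\<integral>x. \<bar>T N f x\<bar> \<partial>power_measure \<mu> N) =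
      (\<integral>x. \<bar>transfer (\<lambda>y. PiM {..<N} (\<lambda>i. p (y i))) (power_measure \<mu> N) f x\<bar> \<partial>power_measure \<mu> N)"
    by (rule integral_cong_AE) (use T_eq[OF f] in auto)
  then show ?thesis using stationary_kernel.transfer_L1[OF stationary_kernel_N f] by simp
qed

lemma T_tensor_sum:
  assumes \<phi>: "\<And>j l. l < N \<Longrightarrow> \<phi> j l \<in> L2 \<mu>"
  shows "AE x in power_measure \<mu> N. T N (tensor_sum N m c \<phi>) x = tensor_sum N m c (\<lambda>j l. P (\<phi> j l)) x"
proof (induction m)
  case 0
  show ?case using T_const[of N 0] by (simp add: tensor_sum_def[abs_def])
next
  case (Suc m)
  interpret PS: product_sigma_finite "\<lambda>_. \<mu>" by unfold_locales
  have i1: "integrable (power_measure \<mu> N) (tensor_sum N m c \<phi>)"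
    unfolding power_measure_def using \<phi> by (intro tensor_sum_integral(1) prob_space_axioms L2_integrable) auto
  have i\<phi>: "\<forall>i<N. integrable \<mu> (\<phi> m i)" using \<phi> by (auto intro: L2_integrable)
  have i2: "integrable (power_measure \<mu> N) (\<lambda>y. \<Prod>l<N. \<phi> m l (y l))"
    unfolding power_measure_def using i\<phi> by (intro PS.product_integrable_prod) auto
  have t: "AE x in power_measure \<mu> N. T N (\<lambda>y. \<Prod>l<N. \<phi> m l (y l)) x = (\<Prod>l<N. P (\<phi> m l) (x l))"
    using T_tensor_power[of N, unfolded is_tensor_power_def, THEN conjunct2, THEN spec, of "\<phi> m"] i\<phi> by (rule mp)
  have e: "tensor_sum N (Suc m) c \<phi> = (\<lambda>y. 1 * tensor_sum N m c \<phi> y + c m * (\<Prod>l<N. \<phi> m l (y l)))"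
    by (simp add: tensor_sum_def fun_eq_iff)
  from T_linear[OF i1 i2, of 1 "c m"] t Suc show ?case
    unfolding e by eventually_elim (simp add: tensor_sum_def)
qed

section \<open>Bounds on P and D as inequalities between Gram matrices\<close>

text \<open>At coefficients c this is \<open>P_square\<close> for the combination h of the
  \<open>f j\<close>, because P h is almost everywhere the same combination of the P (f j). The two
  lemmas that follow treat \<open>D_square\<close> and the Lebesgue bound in the same way.\<close>

lemma psd_gap:
  assumes f: "\<And>j. j < m \<Longrightarrow> f j \<in> L2 \<mu>"
  shows "psd m (\<lambda>j k. (\<gamma>\<^sup>2 * (gram \<mu> f j k - mean_product \<mu> f j k) + mean_product \<mu> f j k) - gram \<mu> (\<lambda>j. P (f j)) j k)"
  unfolding psd_def
proof
  fix c :: "nat \<Rightarrow> real"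
  define h where "h x = (\<Sum>j<m. c j * f j x)" for x
  have h: "h \<in> L2 \<mu>" unfolding h_def[abs_def] using f by (intro L2_sum L2_cmult) auto
  have Pf: "P (f j) \<in> L2 \<mu>" if "j < m" for j by (intro transfer_L2 f that)
  have LS: "(\<lambda>x. \<Sum>j<m. c j * P (f j) x) \<in> L2 \<mu>" using Pf by (intro L2_sum L2_cmult) auto
  have "AE x in \<mu>. P h x = (\<Sum>j<m. c j * P (f j) x)"
    unfolding AE_mu_iff h_def[abs_def] by (rule P_sum[OF f])
  then have ae: "AE x in \<mu>. (\<Sum>j<m. c j * P (f j) x)\<^sup>2 = (P h x)\<^sup>2"
    by eventually_elim (simp only:)
  have e: "(\<integral>x. (\<Sum>j<m. c j * P (f j) x)\<^sup>2 \<partial>\<mu>) = (\<integral>x. (P h x)\<^sup>2 \<partial>\<mu>)"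
    by (rule integral_cong_AE[OF _ _ ae]) (intro borel_measurable_power L2_measurable[OF LS] L2_measurable[OF transfer_L2[OF h]])+
  have q: "(\<Sum>j<m. \<Sum>k<m. c j * c k * gram \<mu> f j k) = (\<integral>x. (h x)\<^sup>2 \<partial>\<mu>)"
    unfolding h_def by (rule gram_quadratic) (rule f)
  have qm: "(\<Sum>j<m. \<Sum>k<m. c j * c k * mean_product \<mu> f j k) = (\<integral>x. h x \<partial>\<mu>)\<^sup>2"
    unfolding h_def by (rule mean_product_quadratic) (rule f)
  have q2: "(\<Sum>j<m. \<Sum>k<m. c j * c k * gram \<mu> (\<lambda>j. P (f j)) j k) = (\<integral>x. (P h x)\<^sup>2 \<partial>\<mu>)"
    unfolding e[symmetric] by (rule gram_quadratic) (rule Pf)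
  have "(\<Sum>j<m. \<Sum>k<m. c j * c k * ((\<gamma>\<^sup>2 * (gram \<mu> f j k - mean_product \<mu> f j k) + mean_product \<mu> f j k) - gram \<mu> (\<lambda>j. P (f j)) j k)) =
      \<gamma>\<^sup>2 * ((\<Sum>j<m. \<Sum>k<m. c j * c k * gram \<mu> f j k) - (\<Sum>j<m. \<Sum>k<m. c j * c k * mean_product \<mu> f j k))
      + (\<Sum>j<m. \<Sum>k<m. c j * c k * mean_product \<mu> f j k) - (\<Sum>j<m. \<Sum>k<m. c j * c k * gram \<mu> (\<lambda>j. P (f j)) j k)"
    by (simp only: quad_form_diff quad_form_add quad_form_cmult)
  also have "\<dots> = \<gamma>\<^sup>2 * ((\<integral>x. (h x)\<^sup>2 \<partial>\<mu>) - (\<integral>x. h x \<partial>\<mu>)\<^sup>2) + (\<integral>x. h x \<partial>\<mu>)\<^sup>2 - (\<integral>x. (P h x)\<^sup>2 \<partial>\<mu>)"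
    unfolding q qm q2 ..
  also have "\<dots> \<ge> 0" using P_square[OF h] by simp
  finally show "0 \<le> (\<Sum>j<m. \<Sum>k<m. c j * c k * ((\<gamma>\<^sup>2 * (gram \<mu> f j k - mean_product \<mu> f j k) + mean_product \<mu> f j k) - gram \<mu> (\<lambda>j. P (f j)) j k))" .
qed

lemma psd_derivative:
  assumes f: "\<And>j. j < m \<Longrightarrow> f j \<in> L2 \<mu>"
  shows "psd m (\<lambda>j k. C\<^sup>2 * (gram \<mu> f j k - mean_product \<mu> f j k) - gram \<mu> (\<lambda>j. D (f j)) j k)"
  unfolding psd_def
proof
  fix c :: "nat \<Rightarrow> real"
  define h where "h x = (\<Sum>j<m. c j * f j x)" for x
  have h: "h \<in> L2 \<mu>" unfolding h_def[abs_def] using f by (intro L2_sum L2_cmult) auto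
  have Df: "D (f j) \<in> L2 \<mu>" if "j < m" for j by (intro D(2) f that)
  have LS: "(\<lambda>x. \<Sum>j<m. c j * D (f j) x) \<in> L2 \<mu>" using Df by (intro L2_sum L2_cmult) auto
  have "AE x in \<mu>. D h x = (\<Sum>j<m. c j * D (f j) x)"
    unfolding AE_mu_iff h_def[abs_def] by (rule D_sum[OF f])
  then have ae: "AE x in \<mu>. (\<Sum>j<m. c j * D (f j) x)\<^sup>2 = (D h x)\<^sup>2"
    by eventually_elim (simp only:)
  have e: "(\<integral>x. (\<Sum>j<m. c j * D (f j) x)\<^sup>2 \<partial>\<mu>) = (\<integral>x. (D h x)\<^sup>2 \<partial>\<mu>)"
    by (rule integral_cong_AE[OF _ _ ae]) (intro borel_measurable_power L2_measurable[OF LS] L2_measurable[OF D(2)[OF h]])+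
  have q: "(\<Sum>j<m. \<Sum>k<m. c j * c k * gram \<mu> f j k) = (\<integral>x. (h x)\<^sup>2 \<partial>\<mu>)"
    unfolding h_def by (rule gram_quadratic) (rule f)
  have qm: "(\<Sum>j<m. \<Sum>k<m. c j * c k * mean_product \<mu> f j k) = (\<integral>x. h x \<partial>\<mu>)\<^sup>2"
    unfolding h_def by (rule mean_product_quadratic) (rule f)
  have q2: "(\<Sum>j<m. \<Sum>k<m. c j * c k * gram \<mu> (\<lambda>j. D (f j)) j k) = (\<integral>x. (D h x)\<^sup>2 \<partial>\<mu>)"
    unfolding e[symmetric] by (rule gram_quadratic) (rule Df)
  have "(\<Sum>j<m. \<Sum>k<m. c j * c k * (C\<^sup>2 * (gram \<mu> f j k - mean_product \<mu> f j k) - gram \<mu> (\<lambda>j. D (f j)) j k)) =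
      C\<^sup>2 * ((\<Sum>j<m. \<Sum>k<m. c j * c k * gram \<mu> f j k) - (\<Sum>j<m. \<Sum>k<m. c j * c k * mean_product \<mu> f j k))
      - (\<Sum>j<m. \<Sum>k<m. c j * c k * gram \<mu> (\<lambda>j. D (f j)) j k)"
    by (simp only: quad_form_diff quad_form_cmult)
  also have "\<dots> = C\<^sup>2 * ((\<integral>x. (h x)\<^sup>2 \<partial>\<mu>) - (\<integral>x. h x \<partial>\<mu>)\<^sup>2) - (\<integral>x. (D h x)\<^sup>2 \<partial>\<mu>)"
    unfolding q qm q2 ..
  also have "\<dots> \<ge> 0" using D_square[OF h] by simp
  finally show "0 \<le> (\<Sum>j<m. \<Sum>k<m. c j * c k * (C\<^sup>2 * (gram \<mu> f j k - mean_product \<mu> f j k) - gram \<mu> (\<lambda>j. D (f j)) j k))" .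
qed

lemma psd_lebesgue:
  assumes K: "\<And>\<phi>. \<phi> \<in> L2 \<mu> \<Longrightarrow> P \<phi> \<in> L2 circle" "\<And>\<phi>. \<phi> \<in> L2 \<mu> \<Longrightarrow> (\<integral>x. (P \<phi> x)\<^sup>2 \<partial>circle) \<le> K\<^sup>2 * (\<integral>x. (\<phi> x)\<^sup>2 \<partial>\<mu>)"
    and f: "\<And>j. j < m \<Longrightarrow> f j \<in> L2 \<mu>"
  shows "psd m (\<lambda>j k. K\<^sup>2 * gram \<mu> f j k - gram circle (\<lambda>j. P (f j)) j k)"
  unfolding psd_def
proof
  fix c :: "nat \<Rightarrow> real"
  define h where "h x = (\<Sum>j<m. c j * f j x)" for x
  have h: "h \<in> L2 \<mu>" unfolding h_def[abs_def] using f by (intro L2_sum L2_cmult) auto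
  have Pf: "P (f j) \<in> L2 circle" if "j < m" for j by (intro K(1) f that)
  have LS: "(\<lambda>x. \<Sum>j<m. c j * P (f j) x) \<in> L2 circle" using Pf by (intro L2_sum L2_cmult) auto
  have "AE x in circle. P h x = (\<Sum>j<m. c j * P (f j) x)"
    unfolding h_def[abs_def] by (rule P_sum[OF f])
  then have ae: "AE x in circle. (\<Sum>j<m. c j * P (f j) x)\<^sup>2 = (P h x)\<^sup>2"
    by eventually_elim (simp only:)
  have e: "(\<integral>x. (\<Sum>j<m. c j * P (f j) x)\<^sup>2 \<partial>circle) = (\<integral>x. (P h x)\<^sup>2 \<partial>circle)"
    by (rule integral_cong_AE[OF _ _ ae]) (intro borel_measurable_power L2_measurable[OF LS] L2_measurable[OF K(1)[OF h]])+
  have q: "(\<Sum>j<m. \<Sum>k<m. c j * c k * gram \<mu> f j k) = (\<integral>x. (h x)\<^sup>2 \<partial>\<mu>)"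
    unfolding h_def by (rule gram_quadratic) (rule f)
  have q2: "(\<Sum>j<m. \<Sum>k<m. c j * c k * gram circle (\<lambda>j. P (f j)) j k) = (\<integral>x. (P h x)\<^sup>2 \<partial>circle)"
    unfolding e[symmetric] by (rule gram_quadratic) (rule Pf)
  have "(\<Sum>j<m. \<Sum>k<m. c j * c k * (K\<^sup>2 * gram \<mu> f j k - gram circle (\<lambda>j. P (f j)) j k)) =
      K\<^sup>2 * (\<Sum>j<m. \<Sum>k<m. c j * c k * gram \<mu> f j k) - (\<Sum>j<m. \<Sum>k<m. c j * c k * gram circle (\<lambda>j. P (f j)) j k)"
    by (simp only: quad_form_diff quad_form_cmult)
  also have "\<dots> = K\<^sup>2 * (\<integral>x. (h x)\<^sup>2 \<partial>\<mu>) - (\<integral>x. (P h x)\<^sup>2 \<partial>circle)"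
    unfolding q q2 ..
  also have "\<dots> \<ge> 0" using K(2)[OF h] by simp
  finally show "0 \<le> (\<Sum>j<m. \<Sum>k<m. c j * c k * (K\<^sup>2 * gram \<mu> f j k - gram circle (\<lambda>j. P (f j)) j k))" .
qed

end


section \<open>Spectral gap and gradient bound for finite sums of tensors\<close>

context smoothing_chain
begin

text \<open>The i-th weak partial derivative of the image of the tensor sum: D acts in slot i and P
  in all others (\<open>tensor_weak_gradient\<close>).\<close>

definition derivative_sum :: "nat \<Rightarrow> nat \<Rightarrow> (nat \<Rightarrow> real) \<Rightarrow> (nat \<Rightarrow> nat \<Rightarrow> real \<Rightarrow> real) \<Rightarrow> nat \<Rightarrow> (nat \<Rightarrow> real) \<Rightarrow> real" where
  "derivative_sum N m c \<phi> i = tensor_sum N m c (\<lambda>j l. (if l = i then D else P) (\<phi> j l))"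

context
  fixes N m :: nat and c :: "nat \<Rightarrow> real" and \<phi> :: "nat \<Rightarrow> nat \<Rightarrow> real \<Rightarrow> real"
  assumes \<phi>: "\<And>j l. l < N \<Longrightarrow> \<phi> j l \<in> L2 \<mu>"
begin

definition "G l = gram \<mu> (\<lambda>j. \<phi> j l)"
definition "E l = mean_product \<mu> (\<lambda>j. \<phi> j l)"
definition "R l = gram \<mu> (\<lambda>j. P (\<phi> j l))"

lemma schur_GER:
  assumes "l < N"
  shows "schur_psd m (G l)" "schur_psd m (E l)" "schur_psd m (R l)" "schur_psd m (\<lambda>j k. G l j k - E l j k)"
proof -
  show "schur_psd m (G l)" unfolding G_def by (rule schur_psd_gram') (rule \<phi>[OF assms])
  show "schur_psd m (E l)" unfolding E_def mean_product_def[abs_def] by (rule schur_psd_rank1)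
  show "schur_psd m (R l)" unfolding R_def by (rule schur_psd_gram') (rule transfer_L2[OF \<phi>[OF assms]])
  show "schur_psd m (\<lambda>j k. G l j k - E l j k)"
    unfolding G_def E_def by (rule schur_psd_covariance) (rule \<phi>[OF assms])
qed

lemma tensor_norm: "(L2_norm (power_measure \<mu> N) (tensor_sum N m c \<phi>))\<^sup>2 = (\<Sum>j<m. \<Sum>k<m. c j * c k * (\<Prod>l<N. G l j k))"
  unfolding power_measure_def G_def gram_def by (rule tensor_sum_L2(2)) (use \<phi> prob_space_axioms in auto)

lemma tensor_mean: "(\<integral>x. tensor_sum N m c \<phi> x \<partial>power_measure \<mu> N)\<^sup>2 = (\<Sum>j<m. \<Sum>k<m. c j * c k * (\<Prod>l<N. E l j k))"
proof -
  have "(\<integral>x. tensor_sum N m c \<phi> x \<partial>power_measure \<mu> N) = (\<Sum>j<m. c j * (\<Prod>l<N. \<integral>x. \<phi> j l x \<partial>\<mu>))"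
    unfolding power_measure_def by (rule tensor_sum_integral(2)) (use \<phi> prob_space_axioms L2_integrable in auto)
  then show ?thesis
    by (simp add: E_def mean_product_def power2_eq_square sum_product prod.distrib mult_ac)
qed

lemma tensor_P_norm:
  "(L2_norm (power_measure \<mu> N) (tensor_sum N m c (\<lambda>j l. P (\<phi> j l))))\<^sup>2 = (\<Sum>j<m. \<Sum>k<m. c j * c k * (\<Prod>l<N. R l j k))"
  unfolding power_measure_def R_def gram_def by (rule tensor_sum_L2(2)) (use \<phi> prob_space_axioms transfer_L2 in auto)

lemma gap_GER: "l < N \<Longrightarrow> psd m (\<lambda>j k. (\<gamma>\<^sup>2 * (G l j k - E l j k) + E l j k) - R l j k)"
  unfolding G_def E_def R_def by (rule psd_gap) (use \<phi> in auto)

lemma gamma_square: "0 \<le> \<gamma>\<^sup>2" "\<gamma>\<^sup>2 \<le> 1" "0 < 1 - \<gamma>\<^sup>2"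
  using gamma by (auto simp: power_le_one power_less_one_iff)

lemma contraction_GR: "l < N \<Longrightarrow> psd m (\<lambda>j k. G l j k - R l j k)"
proof -
  assume l: "l < N"
  have "psd m (\<lambda>j k. (1 - \<gamma>\<^sup>2) * (G l j k - E l j k))"
    using gamma_square by (intro psd_cmult schur_psd_imp_psd schur_GER l) auto
  from psd_add[OF this gap_GER[OF l]] show ?thesis by (simp add: algebra_simps)
qed

lemma tensor_gap:
  "(L2_norm (power_measure \<mu> N) (tensor_sum N m c (\<lambda>j l. P (\<phi> j l))))\<^sup>2 \<le>
     \<gamma>\<^sup>2 * (L2_norm (power_measure \<mu> N) (tensor_sum N m c \<phi>))\<^sup>2 + (1 - \<gamma>\<^sup>2) * (\<integral>x. tensor_sum N m c \<phi> x \<partial>power_measure \<mu> N)\<^sup>2"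
proof -
  have "psd m (\<lambda>j k. (\<gamma>\<^sup>2 * (\<Prod>l<N. G l j k) + (1 - \<gamma>\<^sup>2) * (\<Prod>l<N. E l j k)) - (\<Prod>l<N. R l j k))"
    using gamma_square by (intro psd_prod_gap schur_GER gap_GER) auto
  then have "0 \<le> (\<Sum>j<m. \<Sum>k<m. c j * c k * ((\<gamma>\<^sup>2 * (\<Prod>l<N. G l j k) + (1 - \<gamma>\<^sup>2) * (\<Prod>l<N. E l j k)) - (\<Prod>l<N. R l j k)))"
    by (simp add: psd_def)
  also have "\<dots> = \<gamma>\<^sup>2 * (\<Sum>j<m. \<Sum>k<m. c j * c k * (\<Prod>l<N. G l j k)) +
      (1 - \<gamma>\<^sup>2) * (\<Sum>j<m. \<Sum>k<m. c j * c k * (\<Prod>l<N. E l j k)) - (\<Sum>j<m. \<Sum>k<m. c j * c k * (\<Prod>l<N. R l j k))"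
    by (simp only: quad_form_diff quad_form_add quad_form_cmult)
  finally show ?thesis unfolding tensor_norm tensor_mean tensor_P_norm by simp
qed

abbreviation "V \<equiv> derivative_sum N m c \<phi>"

lemma V_L2: "i < N \<Longrightarrow> V i \<in> L2 (power_measure \<mu> N)"
  unfolding power_measure_def derivative_sum_def by (rule tensor_sum_L2(1)) (use \<phi> prob_space_axioms transfer_L2 D(2) in auto)

text \<open>Slot i carries the Gram matrix of the derivatives, the other slots carry the matrices
  \<open>R l\<close>. With the product of these \<open>R l\<close> as a multiplier, slot i is
  bounded by C^2 times the covariance; this is the form that can be summed over i.\<close>

lemma V_norm:
  assumes i: "i < N"
  shows "(L2_norm (power_measure \<mu> N) (V i))\<^sup>2 \<le> C\<^sup>2 * (\<Sum>j<m. \<Sum>k<m. c j * c k * ((G i j k - E i j k) * (\<Prod>l\<in>{..<N} - {i}. R l j k)))"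
proof -
  let ?X = "\<lambda>j k. \<Prod>l\<in>{..<N} - {i}. R l j k"
  let ?d = "gram \<mu> (\<lambda>j. D (\<phi> j i))"
  have "(L2_norm (power_measure \<mu> N) (V i))\<^sup>2 = (\<Sum>j<m. \<Sum>k<m. c j * c k * (\<Prod>l<N. \<integral>x. (if l = i then D else P) (\<phi> j l) x * (if l = i then D else P) (\<phi> k l) x \<partial>\<mu>))"
    unfolding power_measure_def derivative_sum_def by (rule tensor_sum_L2(2)) (use \<phi> prob_space_axioms transfer_L2 D(2) in auto)
  also have "\<dots> = (\<Sum>j<m. \<Sum>k<m. c j * c k * (?d j k * ?X j k))"
  proof (intro sum.cong refl arg_cong2[where f="(*)"])
    fix j k
    have "(\<Prod>l<N. \<integral>x. (if l = i then D else P) (\<phi> j l) x * (if l = i then D else P) (\<phi> k l) x \<partial>\<mu>) =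
        (\<integral>x. D (\<phi> j i) x * D (\<phi> k i) x \<partial>\<mu>) * (\<Prod>l\<in>{..<N} - {i}. \<integral>x. (if l = i then D else P) (\<phi> j l) x * (if l = i then D else P) (\<phi> k l) x \<partial>\<mu>)"
      using i by (subst prod.remove[of _ i]) auto
    also have "(\<Prod>l\<in>{..<N} - {i}. \<integral>x. (if l = i then D else P) (\<phi> j l) x * (if l = i then D else P) (\<phi> k l) x \<partial>\<mu>) = ?X j k"
      by (intro prod.cong) (auto simp: R_def gram_def)
    finally show "(\<Prod>l<N. \<integral>x. (if l = i then D else P) (\<phi> j l) x * (if l = i then D else P) (\<phi> k l) x \<partial>\<mu>) = ?d j k * ?X j k"
      by (simp add: gram_def)
  qed
  also have "\<dots> \<le> (\<Sum>j<m. \<Sum>k<m. c j * c k * (C\<^sup>2 * (G i j k - E i j k) * ?X j k))"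
  proof -
    have "psd m (\<lambda>j k. C\<^sup>2 * (G i j k - E i j k) - ?d j k)"
      unfolding G_def E_def by (rule psd_derivative) (use \<phi> i in auto)
    moreover have "schur_psd m ?X" by (intro schur_psd_prod schur_GER) auto
    ultimately have "psd m (\<lambda>j k. ?X j k * (C\<^sup>2 * (G i j k - E i j k)) - ?X j k * ?d j k)"
      by (intro schur_psd_mono)
    then have "0 \<le> (\<Sum>j<m. \<Sum>k<m. c j * c k * (?X j k * (C\<^sup>2 * (G i j k - E i j k)) - ?X j k * ?d j k))"
      by (simp add: psd_def)
    also have "\<dots> = (\<Sum>j<m. \<Sum>k<m. c j * c k * (C\<^sup>2 * (G i j k - E i j k) * ?X j k)) - (\<Sum>j<m. \<Sum>k<m. c j * c k * (?d j k * ?X j k))"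
    proof -
      have comm: "?X j k * (C\<^sup>2 * (G i j k - E i j k)) = C\<^sup>2 * (G i j k - E i j k) * ?X j k"
        "?X j k * ?d j k = ?d j k * ?X j k" for j k by (rule mult.commute)+
      show ?thesis unfolding comm quad_form_diff ..
    qed
    finally show ?thesis by simp
  qed
  also have "\<dots> = C\<^sup>2 * (\<Sum>j<m. \<Sum>k<m. c j * c k * ((G i j k - E i j k) * ?X j k))"
    by (simp only: mult.assoc[of "C\<^sup>2"] quad_form_cmult)
  finally show ?thesis .
qed

lemma V_sum_norm:
  "(\<Sum>i<N. (L2_norm (power_measure \<mu> N) (V i))\<^sup>2) \<le> C\<^sup>2 / (1 - \<gamma>\<^sup>2) * (L2_norm (power_measure \<mu> N) (tensor_sum N m c \<phi>))\<^sup>2"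
proof -
  let ?S = "\<lambda>j k. \<Sum>i<N. (G i j k - E i j k) * (\<Prod>l\<in>{..<N} - {i}. R l j k)"
  have tel: "psd m (\<lambda>j k. ((\<Prod>l<N. G l j k) - (\<Prod>l<N. R l j k)) - (1 - \<gamma>\<^sup>2) * ?S j k)"
  proof (rule psd_prod_telescope[THEN conjunct2])
    show "0 \<le> 1 - \<gamma>\<^sup>2" "1 - \<gamma>\<^sup>2 \<le> 1" using gamma_square by simp_all
    fix i assume i: "i < N"
    show "schur_psd m (R i)" "schur_psd m (G i)" "schur_psd m (\<lambda>j k. G i j k - E i j k)"
      using i by (rule schur_GER)+
    show "psd m (\<lambda>j k. G i j k - R i j k)" using i by (rule contraction_GR)
    \<comment> \<open>This is \<open>gap_GER\<close> rearranged: one application of P loses at least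
      the share 1 - \<gamma>^2 of the covariance.\<close>
    show "psd m (\<lambda>j k. (G i j k - R i j k) - (1 - \<gamma>\<^sup>2) * (G i j k - E i j k))"
      using gap_GER[OF i] by (simp add: algebra_simps)
  qed
  \<comment> \<open>Adding this positive form removes the product of the \<open>R l\<close> from the
    telescoped inequality.\<close>
  have "psd m (\<lambda>j k. \<Prod>l<N. R l j k)" by (intro schur_psd_imp_psd schur_psd_prod schur_GER) auto
  from psd_add[OF tel this] have "psd m (\<lambda>j k. (\<Prod>l<N. G l j k) - (1 - \<gamma>\<^sup>2) * ?S j k)" by simp
  then have "0 \<le> (\<Sum>j<m. \<Sum>k<m. c j * c k * ((\<Prod>l<N. G l j k) - (1 - \<gamma>\<^sup>2) * ?S j k))" by (simp add: psd_def)
  also have "\<dots> = (L2_norm (power_measure \<mu> N) (tensor_sum N m c \<phi>))\<^sup>2 - (1 - \<gamma>\<^sup>2) * (\<Sum>j<m. \<Sum>k<m. c j * c k * ?S j k)"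
    unfolding tensor_norm by (simp only: quad_form_diff quad_form_cmult)
  finally have le: "(\<Sum>j<m. \<Sum>k<m. c j * c k * ?S j k) \<le> (L2_norm (power_measure \<mu> N) (tensor_sum N m c \<phi>))\<^sup>2 / (1 - \<gamma>\<^sup>2)"
    using gamma_square(3) by (simp add: pos_le_divide_eq mult.commute)
  have "(\<Sum>i<N. (L2_norm (power_measure \<mu> N) (V i))\<^sup>2) \<le>
      (\<Sum>i<N. C\<^sup>2 * (\<Sum>j<m. \<Sum>k<m. c j * c k * ((G i j k - E i j k) * (\<Prod>l\<in>{..<N} - {i}. R l j k))))"
    by (intro sum_mono V_norm) auto
  also have "\<dots> = C\<^sup>2 * (\<Sum>i<N. \<Sum>j<m. \<Sum>k<m. c j * c k * ((G i j k - E i j k) * (\<Prod>l\<in>{..<N} - {i}. R l j k)))"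
    by (simp add: sum_distrib_left)
  also have "(\<Sum>i<N. \<Sum>j<m. \<Sum>k<m. c j * c k * ((G i j k - E i j k) * (\<Prod>l\<in>{..<N} - {i}. R l j k))) =
      (\<Sum>j<m. \<Sum>k<m. c j * c k * ?S j k)"
  proof -
    let ?F = "\<lambda>i j k. c j * c k * ((G i j k - E i j k) * (\<Prod>l\<in>{..<N} - {i}. R l j k))"
    have "(\<Sum>i<N. \<Sum>j<m. \<Sum>k<m. ?F i j k) = (\<Sum>j<m. \<Sum>i<N. \<Sum>k<m. ?F i j k)" by (rule sum.swap)
    also have "\<dots> = (\<Sum>j<m. \<Sum>k<m. \<Sum>i<N. ?F i j k)" by (intro sum.cong refl sum.swap)
    finally show ?thesis by (simp only: sum_distrib_left)
  qed
  also have "C\<^sup>2 * (\<Sum>j<m. \<Sum>k<m. c j * c k * ?S j k) \<le> C\<^sup>2 * ((L2_norm (power_measure \<mu> N) (tensor_sum N m c \<phi>))\<^sup>2 / (1 - \<gamma>\<^sup>2))"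
    by (rule mult_left_mono[OF le]) simp
  finally show ?thesis by simp
qed

lemma tensor_weak_gradient: "has_weak_gradient N (tensor_sum N m c (\<lambda>j l. P (\<phi> j l))) V"
proof -
  have 1: "has_weak_gradient N (\<lambda>x. c j * (\<Prod>l<N. P (\<phi> j l) (x l)))
      (\<lambda>i x. c j * (\<Prod>l<N. (if l = i then D else P) (\<phi> j l) (x l)))" for j
  proof -
    have "has_weak_gradient N (\<lambda>x. \<Prod>l<N. P (\<phi> j l) (x l)) (\<lambda>i x. \<Prod>l<N. ((\<lambda>l. P (\<phi> j l))(i := D (\<phi> j i))) l (x l))"
      using D(1) \<phi> by (intro has_weak_gradient_tensor) auto
    from has_weak_gradient_linear[OF this has_weak_gradient_zero, of "c j" 0]
    have "has_weak_gradient N (\<lambda>x. c j * (\<Prod>l<N. P (\<phi> j l) (x l))) (\<lambda>i x. c j * (\<Prod>l<N. ((\<lambda>l. P (\<phi> j l))(i := D (\<phi> j i))) l (x l)))"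
      by simp
    moreover have "(\<Prod>l<N. ((\<lambda>l. P (\<phi> j l))(i := D (\<phi> j i))) l (x l)) = (\<Prod>l<N. (if l = i then D else P) (\<phi> j l) (x l))" for i x
      by (intro prod.cong) auto
    ultimately show ?thesis by simp
  qed
  have "has_weak_gradient N (\<lambda>x. \<Sum>j<m. c j * (\<Prod>l<N. P (\<phi> j l) (x l)))
      (\<lambda>i x. \<Sum>j<m. c j * (\<Prod>l<N. (if l = i then D else P) (\<phi> j l) (x l)))"
    by (rule has_weak_gradient_sum) (rule 1)
  then show ?thesis by (simp add: tensor_sum_def[abs_def] derivative_sum_def[abs_def])
qed

text \<open>The Lebesgue norm of the image is compared with the \<open>power_measure\<close> norm of
  the argument factor by factor, which costs K in each coordinate. The bound identifies limits for
  fixed N and does not enter the final constants.\<close>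

lemma tensor_P_L1:
  assumes K: "\<And>\<phi>. \<phi> \<in> L2 \<mu> \<Longrightarrow> P \<phi> \<in> L2 circle" "\<And>\<phi>. \<phi> \<in> L2 \<mu> \<Longrightarrow> (\<integral>x. (P \<phi> x)\<^sup>2 \<partial>circle) \<le> K\<^sup>2 * (\<integral>x. (\<phi> x)\<^sup>2 \<partial>\<mu>)" "0 < K"
  shows "(\<integral>x. \<bar>tensor_sum N m c (\<lambda>j l. P (\<phi> j l)) x\<bar> \<partial>torus N) \<le> K ^ N * L2_norm (power_measure \<mu> N) (tensor_sum N m c \<phi>)"
proof -
  let ?U = "tensor_sum N m c (\<lambda>j l. P (\<phi> j l))"
  let ?Q = "\<lambda>l. gram circle (\<lambda>j. P (\<phi> j l))"
  interpret torus: prob_space "torus N" by (rule prob_space_torus)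
  have U: "?U \<in> L2 (torus N)" "(L2_norm (torus N) ?U)\<^sup>2 = (\<Sum>j<m. \<Sum>k<m. c j * c k * (\<Prod>l<N. ?Q l j k))"
    unfolding torus_def gram_def using prob_space_circle \<phi> K(1)
    by (intro tensor_sum_L2(1) tensor_sum_L2(2); simp)+
  have "psd m (\<lambda>j k. (\<Prod>l<N. K\<^sup>2 * G l j k) - (\<Prod>l<N. ?Q l j k))"
  proof (rule psd_prod_mono)
    fix l assume "l \<in> {..<N}"
    then have l: "l < N" by simp
    show "schur_psd m (?Q l)" by (intro schur_psd_gram' K(1) \<phi> l)
    show "schur_psd m (\<lambda>j k. K\<^sup>2 * G l j k)" by (intro schur_psd_cmult schur_GER l) simp
    show "psd m (\<lambda>j k. K\<^sup>2 * G l j k - ?Q l j k)"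
      unfolding G_def by (rule psd_lebesgue[OF K(1,2)]) (use \<phi> l in auto)
  qed simp
  then have "0 \<le> (\<Sum>j<m. \<Sum>k<m. c j * c k * ((\<Prod>l<N. K\<^sup>2 * G l j k) - (\<Prod>l<N. ?Q l j k)))" by (simp add: psd_def)
  also have "\<dots> = (K\<^sup>2) ^ N * (L2_norm (power_measure \<mu> N) (tensor_sum N m c \<phi>))\<^sup>2 - (L2_norm (torus N) ?U)\<^sup>2"
    unfolding tensor_norm U(2) by (simp only: quad_form_diff quad_form_cmult prod.distrib prod_constant card_lessThan)
  also have "(K\<^sup>2) ^ N * (L2_norm (power_measure \<mu> N) (tensor_sum N m c \<phi>))\<^sup>2 = (K ^ N * L2_norm (power_measure \<mu> N) (tensor_sum N m c \<phi>))\<^sup>2"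
    by (simp add: power_mult_distrib power_mult[symmetric] mult.commute)
  finally have "L2_norm (torus N) ?U \<le> K ^ N * L2_norm (power_measure \<mu> N) (tensor_sum N m c \<phi>)"
    using K(3) by (intro power2_le_imp_le[of "L2_norm (torus N) ?U"]) auto
  then show ?thesis using torus.L2_abs_integral_le[OF U(1)] by linarith
qed

text \<open>D is bounded into L1 of the circle only, and such a bound cannot be expressed by Gram
  matrices. Coordinate i is therefore integrated first: with the other coordinates x fixed, the
  slice of V i is D h for a single function h depending on x, of L1 norm at most K' times the norm
  of h. The other coordinates are then handled in L2, as in \<open>tensor_P_L1\<close>.\<close>

lemma V_L1:
  assumes K: "\<And>\<phi>. \<phi> \<in> L2 \<mu> \<Longrightarrow> P \<phi> \<in> L2 circle" "\<And>\<phi>. \<phi> \<in> L2 \<mu> \<Longrightarrow> (\<integral>x. (P \<phi> x)\<^sup>2 \<partial>circle) \<le> K\<^sup>2 * (\<integral>x. (\<phi> x)\<^sup>2 \<partial>\<mu>)" "0 < K"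
    and K': "0 \<le> K'" "\<And>\<phi>. \<phi> \<in> L2 \<mu> \<Longrightarrow> (\<integral>x. \<bar>D \<phi> x\<bar> \<partial>circle) \<le> K' * L2_norm \<mu> \<phi>"
    and i: "i < N"
  shows "(\<integral>x. \<bar>V i x\<bar> \<partial>torus N) \<le> K' * (K ^ card ({..<N} - {i}) * L2_norm (power_measure \<mu> N) (tensor_sum N m c \<phi>))"
proof -
  let ?I = "{..<N} - {i}"
  let ?Q = "\<lambda>l. gram circle (\<lambda>j. P (\<phi> j l))"
  let ?PC = "PiM ?I (\<lambda>_. circle)"
  interpret PC: prob_space ?PC by (intro prob_space_PiM prob_space_circle)
  define \<Phi> where "\<Phi> j x = (\<Prod>l\<in>?I. P (\<phi> j l) (x l))" for j and x :: "nat \<Rightarrow> real"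
  \<comment> \<open>\<open>S x\<close> is the squared norm of the function h that belongs to x,
    written as a quadratic form so that it can be integrated over x.\<close>
  define S where "S x = (\<Sum>j<m. \<Sum>k<m. c j * c k * G i j k * (\<Phi> j x * \<Phi> k x))" for x
  have Vsplit: "V i (x(i := t)) = (\<Sum>j<m. c j * \<Phi> j x * D (\<phi> j i) t)" for x t
  proof -
    have "(\<Prod>l<N. (if l = i then D else P) (\<phi> j l) ((x(i := t)) l)) = D (\<phi> j i) t * \<Phi> j x" for j
    proof -
      have "(\<Prod>l<N. (if l = i then D else P) (\<phi> j l) ((x(i := t)) l)) = D (\<phi> j i) t * (\<Prod>l\<in>?I. (if l = i then D else P) (\<phi> j l) (x l))"
        using prod_upd_split[OF i, of "\<lambda>l. (if l = i then D else P) (\<phi> j l)" x t] by simp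
      also have "(\<Prod>l\<in>?I. (if l = i then D else P) (\<phi> j l) (x l)) = \<Phi> j x"
        unfolding \<Phi>_def by (intro prod.cong) auto
      finally show ?thesis .
    qed
    then show ?thesis by (simp add: derivative_sum_def tensor_sum_def mult_ac)
  qed
  have VI: "integrable (torus N) (V i)"
    using tensor_weak_gradient i by (auto simp: has_weak_gradient_def)
  have slice: "(\<integral>t. \<bar>V i (x(i := t))\<bar> \<partial>circle) \<le> K' * sqrt (S x)" "0 \<le> S x" for x
  proof -
    define h where "h y = (\<Sum>j<m. (c j * \<Phi> j x) * \<phi> j i y)" for y
    have h: "h \<in> L2 \<mu>" unfolding h_def[abs_def] using \<phi> i by (intro L2_sum L2_cmult) auto
    have "S x = (\<Sum>j<m. \<Sum>k<m. (c j * \<Phi> j x) * (c k * \<Phi> k x) * gram \<mu> (\<lambda>j. \<phi> j i) j k)"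
      unfolding S_def G_def by (simp add: mult_ac)
    also have "\<dots> = (\<integral>y. (h y)\<^sup>2 \<partial>\<mu>)"
      unfolding h_def
      by (rule gram_quadratic[where c="\<lambda>j. c j * \<Phi> j x" and f="\<lambda>j. \<phi> j i"]) (rule \<phi>[OF i])
    finally have Sx: "S x = (\<integral>y. (h y)\<^sup>2 \<partial>\<mu>)" .
    then show "0 \<le> S x" by simp
    have "AE t in circle. D h t = (\<Sum>j<m. (c j * \<Phi> j x) * D (\<phi> j i) t)"
      unfolding h_def[abs_def]
      by (rule D_sum[where c="\<lambda>j. c j * \<Phi> j x" and \<phi>="\<lambda>j. \<phi> j i"]) (rule \<phi>[OF i])
    then have "AE t in circle. \<bar>V i (x(i := t))\<bar> = \<bar>D h t\<bar>"
      unfolding Vsplit by eventually_elim (simp only:)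
    moreover have "(\<lambda>t. \<bar>V i (x(i := t))\<bar>) \<in> borel_measurable circle"
      unfolding Vsplit using borel_measurable_integrable[OF D_integrable[OF \<phi>[OF i]]]
      by (intro borel_measurable_abs borel_measurable_sum borel_measurable_times borel_measurable_const)
    moreover have "(\<lambda>t. \<bar>D h t\<bar>) \<in> borel_measurable circle"
      using borel_measurable_integrable[OF D_integrable[OF h]] by (rule borel_measurable_abs)
    ultimately have "(\<integral>t. \<bar>V i (x(i := t))\<bar> \<partial>circle) = (\<integral>t. \<bar>D h t\<bar> \<partial>circle)"
      by (intro integral_cong_AE)
    also have "\<dots> \<le> K' * L2_norm \<mu> h" by (rule K'(2)[OF h])
    finally show "(\<integral>t. \<bar>V i (x(i := t))\<bar> \<partial>circle) \<le> K' * sqrt (S x)" by (simp add: L2_norm_def Sx)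
  qed
  have KI: "P (\<phi> j l) \<in> L2 circle" if "l \<in> ?I" for j l using that by (intro K(1) \<phi>) simp
  note sq = tensor_sum_square[where \<nu>="\<lambda>_. circle" and I="?I" and m=m and \<phi>="\<lambda>j l. P (\<phi> j l)"
      and K="\<lambda>j k. c j * c k * G i j k", OF prob_space_circle _ KI]
  have Sint: "integrable ?PC S" "(\<integral>x. S x \<partial>?PC) = (\<Sum>j<m. \<Sum>k<m. c j * c k * G i j k * (\<Prod>l\<in>?I. ?Q l j k))"
    unfolding S_def[abs_def] \<Phi>_def gram_def by (rule sq; simp)+
  have [measurable]: "S \<in> borel_measurable ?PC" using Sint(1) by auto
  have sqL: "(\<lambda>x. sqrt (S x)) \<in> L2 ?PC"
    using Sint(1) slice(2) by (intro L2I) simp_all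
  have "psd m (\<lambda>j k. (\<Prod>l\<in>?I. K\<^sup>2 * G l j k) - (\<Prod>l\<in>?I. ?Q l j k))"
  proof (rule psd_prod_mono)
    fix l assume "l \<in> ?I"
    then have l: "l < N" by simp
    show "schur_psd m (?Q l)" by (intro schur_psd_gram' K(1) \<phi> l)
    show "schur_psd m (\<lambda>j k. K\<^sup>2 * G l j k)" by (intro schur_psd_cmult schur_GER l) simp
    show "psd m (\<lambda>j k. K\<^sup>2 * G l j k - ?Q l j k)"
      unfolding G_def by (rule psd_lebesgue[OF K(1,2)]) (use \<phi> l in auto)
  qed simp
  \<comment> \<open>Multiplication by \<open>G i\<close> supplies the missing coordinate, so that
    the right-hand side becomes the norm of the whole tensor sum.\<close>
  from schur_psd_mono[OF schur_GER(1)[OF i] this]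
  have "0 \<le> (\<Sum>j<m. \<Sum>k<m. c j * c k * (G i j k * (\<Prod>l\<in>?I. K\<^sup>2 * G l j k) - G i j k * (\<Prod>l\<in>?I. ?Q l j k)))"
    by (simp add: psd_def)
  also have "\<dots> = (\<Sum>j<m. \<Sum>k<m. c j * c k * ((K\<^sup>2) ^ card ?I * (\<Prod>l<N. G l j k))) - (\<integral>x. S x \<partial>?PC)"
  proof -
    have "G i j k * (\<Prod>l\<in>?I. K\<^sup>2 * G l j k) = (K\<^sup>2) ^ card ?I * (\<Prod>l<N. G l j k)" for j k
      using i by (subst (2) prod.remove[of _ i]) (auto simp: prod.distrib mult_ac)
    moreover have "(\<integral>x. S x \<partial>?PC) = (\<Sum>j<m. \<Sum>k<m. c j * c k * (G i j k * (\<Prod>l\<in>?I. ?Q l j k)))"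
      unfolding Sint(2) by (simp only: mult.assoc)
    ultimately show ?thesis by (simp only: quad_form_diff)
  qed
  also have "(\<Sum>j<m. \<Sum>k<m. c j * c k * ((K\<^sup>2) ^ card ?I * (\<Prod>l<N. G l j k))) = (K ^ card ?I * L2_norm (power_measure \<mu> N) (tensor_sum N m c \<phi>))\<^sup>2"
    unfolding power_mult_distrib tensor_norm quad_form_cmult
    by (simp add: power_mult[symmetric] mult.commute)
  finally have "L2_norm ?PC (\<lambda>x. sqrt (S x)) \<le> K ^ card ?I * L2_norm (power_measure \<mu> N) (tensor_sum N m c \<phi>)"
    using K(3) slice(2) by (subst L2_norm_le_iff) auto
  then have sq: "(\<integral>x. \<bar>sqrt (S x)\<bar> \<partial>?PC) \<le> K ^ card ?I * L2_norm (power_measure \<mu> N) (tensor_sum N m c \<phi>)"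
    using PC.L2_abs_integral_le[OF sqL] by linarith
  have "(\<integral>x. \<bar>V i x\<bar> \<partial>torus N) = (\<integral>x. (\<integral>t. \<bar>V i (x(i := t))\<bar> \<partial>circle) \<partial>?PC)"
    using VI by (intro integral_torus_slice i) simp
  also have "\<dots> \<le> (\<integral>x. K' * \<bar>sqrt (S x)\<bar> \<partial>?PC)"
    using slice PC.L2_integrable[OF sqL] K'(1) by (intro integral_mono') auto
  also have "\<dots> \<le> K' * (K ^ card ?I * L2_norm (power_measure \<mu> N) (tensor_sum N m c \<phi>))"
    using sq K'(1) by (simp add: mult_left_mono)
  finally show ?thesis .
qed

end

end


section \<open>Spectral gap and gradient bound on the torus\<close>

context smoothing_chain
begin

text \<open>The difference of two tensor sums is a tensor sum on which P and D act term by term.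
  Bounds for single sums thus become Cauchy estimates.\<close>

lemma tensor_diff_bounds:
  assumes \<phi>: "\<And>j l. l < N \<Longrightarrow> \<phi> j l \<in> L2 \<mu>" and \<phi>': "\<And>j l. l < N \<Longrightarrow> \<phi>' j l \<in> L2 \<mu>"
    and K: "\<And>\<phi>. \<phi> \<in> L2 \<mu> \<Longrightarrow> P \<phi> \<in> L2 circle" "\<And>\<phi>. \<phi> \<in> L2 \<mu> \<Longrightarrow> (\<integral>x. (P \<phi> x)\<^sup>2 \<partial>circle) \<le> K\<^sup>2 * (\<integral>x. (\<phi> x)\<^sup>2 \<partial>\<mu>)" "0 < K"
    and K': "0 \<le> K'" "\<And>\<phi>. \<phi> \<in> L2 \<mu> \<Longrightarrow> (\<integral>x. \<bar>D \<phi> x\<bar> \<partial>circle) \<le> K' * L2_norm \<mu> \<phi>"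
  shows "(\<integral>x. \<bar>tensor_sum N m c (\<lambda>j l. P (\<phi> j l)) x - tensor_sum N m' c' (\<lambda>j l. P (\<phi>' j l)) x\<bar> \<partial>torus N) \<le>
      K ^ N * L2_norm (power_measure \<mu> N) (\<lambda>x. tensor_sum N m c \<phi> x - tensor_sum N m' c' \<phi>' x)"
    and "i < N \<Longrightarrow> (\<integral>x. \<bar>derivative_sum N m c \<phi> i x - derivative_sum N m' c' \<phi>' i x\<bar> \<partial>torus N) \<le>
      K' * (K ^ card ({..<N} - {i}) * L2_norm (power_measure \<mu> N) (\<lambda>x. tensor_sum N m c \<phi> x - tensor_sum N m' c' \<phi>' x))"
proof -
  define c2 where "c2 j = (if j < m then 1 * c j else (-1) * c' (j - m))" for j
  define \<phi>2 where "\<phi>2 j = (if j < m then \<phi> j else \<phi>' (j - m))" for j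
  have \<phi>2: "\<phi>2 j l \<in> L2 \<mu>" if "l < N" for j l using \<phi>[OF that] \<phi>'[OF that] by (simp add: \<phi>2_def)
  have 1: "tensor_sum N m c \<phi> x - tensor_sum N m' c' \<phi>' x = tensor_sum N (m + m') c2 \<phi>2 x" for x
    using tensor_sum_lin[of 1 N m c \<phi> x "-1" m' c' \<phi>'] by (simp add: c2_def[abs_def] \<phi>2_def[abs_def])
  have 2: "tensor_sum N m c (\<lambda>j l. A l (\<phi> j l)) x - tensor_sum N m' c' (\<lambda>j l. A l (\<phi>' j l)) x =
      tensor_sum N (m + m') c2 (\<lambda>j l. A l (\<phi>2 j l)) x" for A :: "nat \<Rightarrow> (real \<Rightarrow> real) \<Rightarrow> real \<Rightarrow> real" and x
    using tensor_sum_op_lin[of 1 N m c A \<phi> x "-1" m' c' \<phi>'] by (simp add: c2_def[abs_def] \<phi>2_def[abs_def])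
  show "(\<integral>x. \<bar>tensor_sum N m c (\<lambda>j l. P (\<phi> j l)) x - tensor_sum N m' c' (\<lambda>j l. P (\<phi>' j l)) x\<bar> \<partial>torus N) \<le>
      K ^ N * L2_norm (power_measure \<mu> N) (\<lambda>x. tensor_sum N m c \<phi> x - tensor_sum N m' c' \<phi>' x)"
    unfolding 1 2[of "\<lambda>_. P"] by (rule tensor_P_L1[OF \<phi>2 K])
  show "(\<integral>x. \<bar>derivative_sum N m c \<phi> i x - derivative_sum N m' c' \<phi>' i x\<bar> \<partial>torus N) \<le>
      K' * (K ^ card ({..<N} - {i}) * L2_norm (power_measure \<mu> N) (\<lambda>x. tensor_sum N m c \<phi> x - tensor_sum N m' c' \<phi>' x))" if i: "i < N"
  proof -
    have "derivative_sum N m c \<phi> i x - derivative_sum N m' c' \<phi>' i x = derivative_sum N (m + m') c2 \<phi>2 i x" for x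
      unfolding derivative_sum_def by (rule 2[of "\<lambda>l. if l = i then D else P"])
    then have "(\<integral>x. \<bar>derivative_sum N m c \<phi> i x - derivative_sum N m' c' \<phi>' i x\<bar> \<partial>torus N) =
        (\<integral>x. \<bar>derivative_sum N (m + m') c2 \<phi>2 i x\<bar> \<partial>torus N)" by simp
    also have "\<dots> \<le> K' * (K ^ card ({..<N} - {i}) * L2_norm (power_measure \<mu> N) (tensor_sum N (m + m') c2 \<phi>2))"
      by (rule V_L1[OF \<phi>2 K K' i])
    finally show ?thesis unfolding 1 .
  qed
qed

lemma T_bounds:
  assumes f: "f \<in> L2 (power_measure \<mu> N)"
  shows "T N f \<in> L2 (power_measure \<mu> N)"
    and "(\<integral>x. (T N f x)\<^sup>2 \<partial>power_measure \<mu> N) \<le>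
      \<gamma>\<^sup>2 * (\<integral>x. (f x)\<^sup>2 \<partial>power_measure \<mu> N) + (1 - \<gamma>\<^sup>2) * (\<integral>x. f x \<partial>power_measure \<mu> N)\<^sup>2"
    and "\<exists>g. has_weak_gradient N (T N f) g \<and> (\<forall>i<N. integrable (power_measure \<mu> N) (\<lambda>x. (g i x)\<^sup>2)) \<and>
      (\<Sum>i<N. \<integral>x. (g i x)\<^sup>2 \<partial>power_measure \<mu> N) \<le> C\<^sup>2 / (1 - \<gamma>\<^sup>2) * (\<integral>x. (f x)\<^sup>2 \<partial>power_measure \<mu> N)"
proof -
  let ?M = "power_measure \<mu> N"
  interpret M: prob_space ?M by (rule prob_space_power)
  obtain K where K: "0 < K" "\<And>\<phi>. \<phi> \<in> L2 \<mu> \<Longrightarrow> P \<phi> \<in> L2 circle"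
    "\<And>\<phi>. \<phi> \<in> L2 \<mu> \<Longrightarrow> (\<integral>x. (P \<phi> x)\<^sup>2 \<partial>circle) \<le> K\<^sup>2 * (\<integral>x. (\<phi> x)\<^sup>2 \<partial>\<mu>)"
    using P_bounded_L2 by blast
  obtain K' where K': "0 \<le> K'" "\<And>\<phi>. \<phi> \<in> L2 \<mu> \<Longrightarrow> (\<integral>x. \<bar>D \<phi> x\<bar> \<partial>circle) \<le> K' * L2_norm \<mu> \<phi>"
    using D_bounded_L1 by blast
  have "tensor_approx (\<lambda>_. \<mu>) N f"
    using f unfolding power_measure_def by (rule tensor_approx_L2[OF prob_space_axioms])
  \<comment> \<open>Approximation at the rate 2^-n makes the norms of consecutive differences
    summable, as \<open>L1_limit\<close> requires.\<close>
  then have "\<exists>m c \<phi>. (\<forall>j l. l < N \<longrightarrow> \<phi> j l \<in> L2 \<mu>) \<and> L2_norm ?M (\<lambda>x. f x - tensor_sum N m c \<phi> x) \<le> (1 / 2) ^ n" for n :: nat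
    unfolding tensor_approx_def power_measure_def by (elim conjE allE[of _ "(1 / 2) ^ n"]) simp
  then obtain m c \<phi> where \<phi>': "\<And>n. \<forall>j l. l < N \<longrightarrow> \<phi> n j l \<in> L2 \<mu>"
    and near: "\<And>n. L2_norm ?M (\<lambda>x. f x - tensor_sum N (m n) (c n) (\<phi> n) x) \<le> (1 / 2) ^ n"
    by metis
  have \<phi>: "\<phi> n j l \<in> L2 \<mu>" if "l < N" for n j l using \<phi>' that by blast
  define F where "F n = tensor_sum N (m n) (c n) (\<phi> n)" for n
  define U where "U n = tensor_sum N (m n) (c n) (\<lambda>j l. P (\<phi> n j l))" for n
  define W where "W n = derivative_sum N (m n) (c n) (\<phi> n)" for n
  have F: "F n \<in> L2 ?M" for n
    unfolding F_def power_measure_def using \<phi> by (intro tensor_sum_L2(1) prob_space_axioms)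
  have U: "U n \<in> L2 ?M" for n
    unfolding U_def power_measure_def using \<phi> by (intro tensor_sum_L2(1) prob_space_axioms transfer_L2)
  have W: "W n i \<in> L2 ?M" if "i < N" for n i
    unfolding W_def by (rule V_L2[OF \<phi> that])
  have grad: "has_weak_gradient N (U n) (W n)" for n
    unfolding U_def W_def by (rule tensor_weak_gradient[OF \<phi>])
  have TF: "AE x in ?M. T N (F n) x = U n x" for n
    unfolding F_def U_def by (rule T_tensor_sum[OF \<phi>])
  have nearF: "L2_norm ?M (\<lambda>x. F n x - f x) \<le> (1 / 2) ^ n" for n
    using near[of n] L2_norm_minus_commute[of ?M f "F n"] by (simp add: F_def)
  have step: "L2_norm ?M (\<lambda>x. F (Suc n) x - F n x) \<le> 2 * (1 / 2) ^ n" for n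
  proof -
    have "L2_norm ?M (\<lambda>x. F (Suc n) x - F n x) \<le> L2_norm ?M (\<lambda>x. F (Suc n) x - f x) + L2_norm ?M (\<lambda>x. f x - F n x)"
      by (intro L2_norm_diff_triangle F f)
    also have "\<dots> \<le> (1 / 2) ^ Suc n + (1 / 2) ^ n"
      using nearF[of "Suc n"] near[of n] unfolding F_def by linarith
    also have "\<dots> \<le> 2 * (1 / 2) ^ n" by simp
    finally show ?thesis .
  qed
  have geo: "summable (\<lambda>n. a * (2 * (1 / 2 :: real) ^ n))" for a
    by (intro summable_mult summable_geometric) simp
  have half: "(\<lambda>n. (1 / 2 :: real) ^ n) \<longlonglongrightarrow> 0" by (rule LIMSEQ_power_zero) simp
  have diff: "(\<integral>x. \<bar>U (Suc n) x - U n x\<bar> \<partial>torus N) \<le> K ^ N * L2_norm ?M (\<lambda>x. F (Suc n) x - F n x)"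
    "i < N \<Longrightarrow> (\<integral>x. \<bar>W (Suc n) i x - W n i x\<bar> \<partial>torus N) \<le>
      K' * (K ^ card ({..<N} - {i}) * L2_norm ?M (\<lambda>x. F (Suc n) x - F n x))" for n i
    unfolding U_def W_def F_def
     apply (rule tensor_diff_bounds(1)[OF \<phi>[of _ "Suc n"] \<phi>[of _ n] K(2,3,1) K']; assumption)
    apply (rule tensor_diff_bounds(2)[OF \<phi>[of _ "Suc n"] \<phi>[of _ n] K(2,3,1) K']; assumption)
    done
  have "(\<integral>x. \<bar>U (Suc n) x - U n x\<bar> \<partial>torus N) \<le> K ^ N * (2 * (1 / 2) ^ n)" for n
    using K(1) by (intro order_trans[OF diff(1)] mult_left_mono step) simp
  moreover have "integrable (torus N) (U n)" for n using grad by (auto simp: has_weak_gradient_def)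
  ultimately obtain U' where U': "integrable (torus N) U'" "AE x in torus N. (\<lambda>n. U n x) \<longlonglongrightarrow> U' x"
    "(\<lambda>n. \<integral>x. \<bar>U n x - U' x\<bar> \<partial>torus N) \<longlonglongrightarrow> 0"
    using L1_limit[of "torus N" U "\<lambda>n. K ^ N * (2 * (1 / 2) ^ n)"] geo by blast
  have "\<exists>G. integrable (torus N) G \<and> (AE x in torus N. (\<lambda>n. W n i x) \<longlonglongrightarrow> G x) \<and> (\<lambda>n. \<integral>x. \<bar>W n i x - G x\<bar> \<partial>torus N) \<longlonglongrightarrow> 0"
    if i: "i < N" for i
  proof (rule L1_limit)
    show "integrable (torus N) (W n i)" for n using grad i by (auto simp: has_weak_gradient_def)
    show "(\<integral>x. \<bar>W (Suc n) i x - W n i x\<bar> \<partial>torus N) \<le> (K' * K ^ card ({..<N} - {i})) * (2 * (1 / 2) ^ n)" for n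
      unfolding mult.assoc using K(1) K'(1) by (intro order_trans[OF diff(2)[OF i]] mult_left_mono step) simp_all
    show "summable (\<lambda>n. (K' * K ^ card ({..<N} - {i})) * (2 * (1 / 2 :: real) ^ n))" by (rule geo)
  qed
  then have "\<exists>G. i < N \<longrightarrow> integrable (torus N) G \<and> (AE x in torus N. (\<lambda>n. W n i x) \<longlonglongrightarrow> G x) \<and> (\<lambda>n. \<integral>x. \<bar>W n i x - G x\<bar> \<partial>torus N) \<longlonglongrightarrow> 0" for i
    by (cases "i < N") simp_all
  then have "\<exists>g. \<forall>i. i < N \<longrightarrow> integrable (torus N) (g i) \<and> (AE x in torus N. (\<lambda>n. W n i x) \<longlonglongrightarrow> g i x) \<and> (\<lambda>n. \<integral>x. \<bar>W n i x - g i x\<bar> \<partial>torus N) \<longlonglongrightarrow> 0"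
    by (intro choice allI)
  then obtain g where g: "\<And>i. i < N \<Longrightarrow> integrable (torus N) (g i)"
    "\<And>i. i < N \<Longrightarrow> AE x in torus N. (\<lambda>n. W n i x) \<longlonglongrightarrow> g i x"
    "\<And>i. i < N \<Longrightarrow> (\<lambda>n. \<integral>x. \<bar>W n i x - g i x\<bar> \<partial>torus N) \<longlonglongrightarrow> 0"
    by blast
  have intf: "integrable ?M f" and intF: "integrable ?M (F n)" for n using f F by (auto intro: M.L2_integrable)
  note intTf = T_integrable[OF intf]
  have TfU: "(\<integral>x. \<bar>U n x - T N f x\<bar> \<partial>?M) \<le> (1 / 2) ^ n" for n
  proof -
    have i: "integrable ?M (\<lambda>x. 1 * F n x + (-1) * f x)" using intF intf by simp
    have "AE x in ?M. T N (\<lambda>x. 1 * F n x + (-1) * f x) x = 1 * T N (F n) x + (-1) * T N f x"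
      by (rule T_linear[OF intF intf])
    then have ae: "AE x in ?M. \<bar>U n x - T N f x\<bar> = \<bar>T N (\<lambda>x. 1 * F n x + (-1) * f x) x\<bar>"
      using TF[of n] by eventually_elim simp
    have "(\<integral>x. \<bar>U n x - T N f x\<bar> \<partial>?M) = (\<integral>x. \<bar>T N (\<lambda>x. 1 * F n x + (-1) * f x) x\<bar> \<partial>?M)"
      by (rule integral_cong_AE[OF _ _ ae])
         (intro borel_measurable_abs borel_measurable_diff L2_measurable[OF U] borel_measurable_integrable intTf T_integrable[OF i])+
    also have "\<dots> \<le> (\<integral>x. \<bar>F n x - f x\<bar> \<partial>?M)" using T_L1[OF i] by simp
    also have "\<dots> \<le> L2_norm ?M (\<lambda>x. F n x - f x)" by (intro M.L2_abs_integral_le L2_diff F f)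
    finally show ?thesis using nearF[of n] by linarith
  qed
  have TfU0: "(\<lambda>n. \<integral>x. \<bar>U n x - T N f x\<bar> \<partial>?M) \<longlonglongrightarrow> 0"
    by (rule tendsto_sandwich[OF _ _ tendsto_const half]) (use TfU in auto)
  \<comment> \<open>So far U' is the limit in L1 of Lebesgue measure, and T N f the limit in L1 of
    the product measure. A second use of \<open>L1_limit\<close>, for the product measure, yields
    almost everywhere convergence to T N f as well. Pointwise limits are unique and the null sets
    coincide, so the two limits agree.\<close>
  have U'Tf: "AE x in ?M. U' x = T N f x"
  proof -
    have "(\<integral>x. \<bar>U (Suc n) x - U n x\<bar> \<partial>?M) \<le> 2 * (1 / 2) ^ n" for n
    proof -
      have i: "integrable ?M (U n)" for n by (intro M.L2_integrable U)
      have "(\<integral>x. \<bar>U (Suc n) x - U n x\<bar> \<partial>?M) \<le> (\<integral>x. \<bar>U (Suc n) x - T N f x\<bar> + \<bar>U n x - T N f x\<bar> \<partial>?M)"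
        using i intTf by (intro integral_mono) auto
      also have "\<dots> = (\<integral>x. \<bar>U (Suc n) x - T N f x\<bar> \<partial>?M) + (\<integral>x. \<bar>U n x - T N f x\<bar> \<partial>?M)"
        using i intTf by simp
      also have "\<dots> \<le> (1 / 2) ^ Suc n + (1 / 2) ^ n" by (intro add_mono TfU)
      also have "\<dots> \<le> 2 * (1 / 2) ^ n" by simp
      finally show ?thesis .
    qed
    then obtain U2 where U2: "integrable ?M U2" "AE x in ?M. (\<lambda>n. U n x) \<longlonglongrightarrow> U2 x" "(\<lambda>n. \<integral>x. \<bar>U n x - U2 x\<bar> \<partial>?M) \<longlonglongrightarrow> 0"
      using L1_limit[of ?M U "\<lambda>n. 2 * (1 / 2) ^ n"] M.L2_integrable[OF U] geo[of 1] by auto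
    have "AE x in ?M. U2 x = T N f x"
      by (rule L1_limit_AE_unique[OF M.L2_integrable[OF U] U2(1) intTf U2(3) TfU0])
    moreover have "AE x in ?M. (\<lambda>n. U n x) \<longlonglongrightarrow> U' x" unfolding AE_power_iff by (rule U'(2))
    ultimately show ?thesis
      using U2(2)
    proof eventually_elim
      case (elim x)
      show ?case using LIMSEQ_unique[OF elim(2) elim(3)] elim(1) by (rule trans)
    qed
  qed
  have Tf_meas: "T N f \<in> borel_measurable (torus N)"
    using borel_measurable_integrable[OF intTf] unfolding measurable_power .
  have "has_weak_gradient N U' g"
    by (rule has_weak_gradient_limit[OF grad U'(1) g(1) U'(3) g(3)])
  then have gradT: "has_weak_gradient N (T N f) g"
    by (rule has_weak_gradient_cong[OF _ Tf_meas]) (use U'Tf in \<open>simp add: AE_power_iff\<close>)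
  have normF: "(L2_norm ?M (F n))\<^sup>2 \<le> (L2_norm ?M f + (1 / 2) ^ n)\<^sup>2" for n
    using L2_norm_le_add_diff[OF F f, of n] nearF[of n] by (intro power_mono) auto
  \<comment> \<open>The summand 0 is left in the limit to match what \<open>tendsto_intros\<close>
    produces.\<close>
  have limF: "(\<lambda>n. (L2_norm ?M f + (1 / 2) ^ n)\<^sup>2) \<longlonglongrightarrow> (L2_norm ?M f + 0)\<^sup>2"
    by (intro tendsto_intros half)
  have meanF: "(\<lambda>n. \<integral>x. F n x \<partial>?M) \<longlonglongrightarrow> (\<integral>x. f x \<partial>?M)"
  proof -
    have "\<bar>(\<integral>x. F n x \<partial>?M) - (\<integral>x. f x \<partial>?M)\<bar> \<le> (1 / 2) ^ n" for n
      using M.L2_integral_le[OF L2_diff[OF F f], of n] nearF[of n] intF intf by simp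
    then have "(\<lambda>n. (\<integral>x. F n x \<partial>?M) - (\<integral>x. f x \<partial>?M)) \<longlonglongrightarrow> 0"
      by (intro Lim_null_comparison[OF _ half] always_eventually) simp
    then show ?thesis by (simp add: LIM_zero_iff)
  qed
  have convU: "AE x in ?M. (\<lambda>n. (U n x)\<^sup>2) \<longlonglongrightarrow> (T N f x)\<^sup>2"
  proof -
    have "AE x in ?M. (\<lambda>n. U n x) \<longlonglongrightarrow> U' x" unfolding AE_power_iff by (rule U'(2))
    then show ?thesis using U'Tf
    proof eventually_elim
      case (elim x)
      show ?case using tendsto_power[OF elim(1), of 2] unfolding elim(2) .
    qed
  qed
  have Tf_sq: "(\<lambda>x. (T N f x)\<^sup>2) \<in> borel_measurable ?M"
    by (intro borel_measurable_power borel_measurable_integrable intTf)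
  have bound: "(\<integral>x. (U n x)\<^sup>2 \<partial>?M) \<le> \<gamma>\<^sup>2 * (L2_norm ?M f + (1 / 2) ^ n)\<^sup>2 + (1 - \<gamma>\<^sup>2) * (\<integral>x. F n x \<partial>?M)\<^sup>2" for n
  proof -
    have "(\<integral>x. (U n x)\<^sup>2 \<partial>?M) \<le> \<gamma>\<^sup>2 * (L2_norm ?M (F n))\<^sup>2 + (1 - \<gamma>\<^sup>2) * (\<integral>x. F n x \<partial>?M)\<^sup>2"
      unfolding L2_norm_power2[symmetric] U_def F_def by (rule tensor_gap[OF \<phi>])
    also have "\<dots> \<le> \<gamma>\<^sup>2 * (L2_norm ?M f + (1 / 2) ^ n)\<^sup>2 + (1 - \<gamma>\<^sup>2) * (\<integral>x. F n x \<partial>?M)\<^sup>2"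
      by (intro add_right_mono mult_left_mono normF) simp
    finally show ?thesis .
  qed
  have lim_bound: "(\<lambda>n. \<gamma>\<^sup>2 * (L2_norm ?M f + (1 / 2) ^ n)\<^sup>2 + (1 - \<gamma>\<^sup>2) * (\<integral>x. F n x \<partial>?M)\<^sup>2) \<longlonglongrightarrow>
      \<gamma>\<^sup>2 * (L2_norm ?M f + 0)\<^sup>2 + (1 - \<gamma>\<^sup>2) * (\<integral>x. f x \<partial>?M)\<^sup>2"
    by (intro tendsto_intros limF meanF)
  note Fatou = integral_Fatou_bound[OF L2_square_integrable[OF U] zero_le_power2 Tf_sq convU bound lim_bound]
  show "T N f \<in> L2 ?M"
    using Fatou(1) by (intro L2I borel_measurable_integrable intTf)
  show "(\<integral>x. (T N f x)\<^sup>2 \<partial>?M) \<le> \<gamma>\<^sup>2 * (\<integral>x. (f x)\<^sup>2 \<partial>?M) + (1 - \<gamma>\<^sup>2) * (\<integral>x. f x \<partial>?M)\<^sup>2"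
    using Fatou(2) by (simp add: L2_norm_power2)
  have g_meas: "g i \<in> borel_measurable ?M" if "i < N" for i
    using borel_measurable_integrable[OF g(1)[OF that]] unfolding measurable_power .
  let ?B = "C\<^sup>2 / (1 - \<gamma>\<^sup>2)"
  have B0: "0 \<le> ?B" using gamma by (simp add: power_le_one)
  \<comment> \<open>Fatou's lemma is applied to the sum over all coordinates at once rather than to
    each component, which keeps the constant independent of N.\<close>
  have gsq: "integrable ?M (\<lambda>x. \<Sum>i<N. (g i x)\<^sup>2)" "(\<integral>x. (\<Sum>i<N. (g i x)\<^sup>2) \<partial>?M) \<le> ?B * (L2_norm ?M f + 0)\<^sup>2"
  proof -
    have 1: "integrable ?M (\<lambda>x. \<Sum>i<N. (W n i x)\<^sup>2)" for n
      using W by (intro Bochner_Integration.integrable_sum L2_square_integrable) auto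
    have 2: "(\<lambda>x. \<Sum>i<N. (g i x)\<^sup>2) \<in> borel_measurable ?M"
      using g_meas by (intro borel_measurable_sum borel_measurable_power) auto
    have "AE x in ?M. \<forall>i\<in>{..<N}. (\<lambda>n. W n i x) \<longlonglongrightarrow> g i x"
      unfolding AE_power_iff using g(2) by (intro AE_finite_allI) auto
    then have 3: "AE x in ?M. (\<lambda>n. \<Sum>i<N. (W n i x)\<^sup>2) \<longlonglongrightarrow> (\<Sum>i<N. (g i x)\<^sup>2)"
    proof eventually_elim
      case (elim x)
      then show ?case by (intro tendsto_sum tendsto_power) auto
    qed
    have 4: "(\<integral>x. (\<Sum>i<N. (W n i x)\<^sup>2) \<partial>?M) \<le> ?B * (L2_norm ?M f + (1 / 2) ^ n)\<^sup>2" for n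
    proof -
      have "(\<integral>x. (\<Sum>i<N. (W n i x)\<^sup>2) \<partial>?M) = (\<Sum>i<N. (L2_norm ?M (W n i))\<^sup>2)"
        unfolding L2_norm_power2 using W by (intro Bochner_Integration.integral_sum L2_square_integrable) auto
      also have "\<dots> \<le> ?B * (L2_norm ?M (F n))\<^sup>2"
        unfolding W_def F_def by (rule V_sum_norm[OF \<phi>])
      also have "\<dots> \<le> ?B * (L2_norm ?M f + (1 / 2) ^ n)\<^sup>2"
        by (intro mult_left_mono normF B0)
      finally show ?thesis .
    qed
    have 5: "(\<lambda>n. ?B * (L2_norm ?M f + (1 / 2) ^ n)\<^sup>2) \<longlonglongrightarrow> ?B * (L2_norm ?M f + 0)\<^sup>2"
      by (rule tendsto_mult_left[OF limF])
    note Fatou' = integral_Fatou_bound[where u="\<lambda>n x. \<Sum>i<N. (W n i x)\<^sup>2" and v="\<lambda>x. \<Sum>i<N. (g i x)\<^sup>2", OF 1 _ 2 3 4 5]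
    show "integrable ?M (\<lambda>x. \<Sum>i<N. (g i x)\<^sup>2)" by (rule Fatou'(1)) (simp add: sum_nonneg)
    show "(\<integral>x. (\<Sum>i<N. (g i x)\<^sup>2) \<partial>?M) \<le> ?B * (L2_norm ?M f + 0)\<^sup>2" by (rule Fatou'(2)) (simp add: sum_nonneg)
  qed
  have gi: "integrable ?M (\<lambda>x. (g i x)\<^sup>2)" if i: "i < N" for i
  proof (rule Bochner_Integration.integrable_bound[OF gsq(1)])
    show "(\<lambda>x. (g i x)\<^sup>2) \<in> borel_measurable ?M" by (intro borel_measurable_power g_meas i)
    show "AE x in ?M. norm ((g i x)\<^sup>2) \<le> norm (\<Sum>i<N. (g i x)\<^sup>2)"
    proof (intro AE_I2)
      fix x
      have "(g i x)\<^sup>2 \<le> (\<Sum>i<N. (g i x)\<^sup>2)" using i by (intro member_le_sum) auto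
      then show "norm ((g i x)\<^sup>2) \<le> norm (\<Sum>i<N. (g i x)\<^sup>2)" by (simp add: sum_nonneg)
    qed
  qed
  have "(\<integral>x. (\<Sum>i<N. (g i x)\<^sup>2) \<partial>?M) = (\<Sum>i<N. \<integral>x. (g i x)\<^sup>2 \<partial>?M)"
    by (intro Bochner_Integration.integral_sum gi) auto
  then have "(\<Sum>i<N. \<integral>x. (g i x)\<^sup>2 \<partial>?M) \<le> ?B * (\<integral>x. (f x)\<^sup>2 \<partial>?M)"
    using gsq(2) by (simp add: L2_norm_power2)
  then show "\<exists>g. has_weak_gradient N (T N f) g \<and> (\<forall>i<N. integrable ?M (\<lambda>x. (g i x)\<^sup>2)) \<and>
      (\<Sum>i<N. \<integral>x. (g i x)\<^sup>2 \<partial>?M) \<le> ?B * (\<integral>x. (f x)\<^sup>2 \<partial>?M)"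
    using gradT gi by blast
qed

end


section \<open>The fixed point\<close>

context prob_space
begin

context
  fixes T :: "('a \<Rightarrow> real) \<Rightarrow> 'a \<Rightarrow> real" and \<gamma> c h :: real and H :: "'a set"
  assumes linear: "\<And>f g a b. f \<in> L2 M \<Longrightarrow> g \<in> L2 M \<Longrightarrow> AE x in M. T (\<lambda>y. a * f y + b * g y) x = a * T f x + b * T g x"
    and one: "AE x in M. T (\<lambda>_. 1) x = 1"
    and T_L2: "\<And>f. f \<in> L2 M \<Longrightarrow> T f \<in> L2 M"
    and nonneg: "\<And>f. f \<in> L2 M \<Longrightarrow> AE x in M. 0 \<le> f x \<Longrightarrow> AE x in M. 0 \<le> T f x"
    and integral: "\<And>f. f \<in> L2 M \<Longrightarrow> (\<integral>x. T f x \<partial>M) = (\<integral>x. f x \<partial>M)"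
    and gap: "\<And>f. f \<in> L2 M \<Longrightarrow> (\<integral>x. f x \<partial>M) = 0 \<Longrightarrow> L2_norm M (T f) \<le> \<gamma> * L2_norm M f"
    and \<gamma>: "0 < \<gamma>" "\<gamma> < 1" and c: "c = 2 / (1 - \<gamma>)"
    and H: "H \<in> sets M" and h: "h = measure M H" and h_small: "4 * (c * (c + 1) * h) \<le> 1"
begin

text \<open>The indicator of the complement of H: the weight carried by the points that have not
  entered the hole.\<close>

private definition "hole = (\<lambda>x. indicator (space M - H) x :: real)"
private definition "mass \<psi> = (\<integral>x. \<psi> x * hole x \<partial>M)"
text \<open>The decomposition of the surviving part of \<psi> into a centered function and the
  constant \<open>mass \<psi>\<close> lets the gap act on the former and T 1 = 1 on the
  latter.\<close>

private definition "centered \<psi> x = \<psi> x * hole x - mass \<psi>"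
private definition "step \<psi> x = T (\<lambda>y. \<psi> y * hole y) x / mass \<psi>"
text \<open>The radius is proportional to sqrt h, the L2 norm of the perturbation
  \<open>1 - hole\<close>.\<close>

private definition "candidates = {\<psi> \<in> L2 M. (AE x in M. 0 \<le> \<psi> x) \<and> (\<integral>x. \<psi> x \<partial>M) = 1 \<and>
  L2_norm M (\<lambda>x. \<psi> x - 1) \<le> c * sqrt h}"

private lemma one_L2: "(\<lambda>_. a) \<in> L2 M"
  by (rule L2_const[OF finite_measure_axioms])

private lemma hole_measurable [measurable]: "hole \<in> borel_measurable M"
  using H by (simp add: hole_def)

private lemma hole_le: "\<bar>hole x\<bar> \<le> 1" "0 \<le> hole x"
  by (auto simp: hole_def indicator_def)

private lemma hole_L2: "f \<in> L2 M \<Longrightarrow> (\<lambda>x. f x * hole x) \<in> L2 M"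
  and hole_norm: "f \<in> L2 M \<Longrightarrow> L2_norm M (\<lambda>x. f x * hole x) \<le> L2_norm M f"
  using L2_bounded_mult[of f M hole] hole_le by auto

private lemma complement_L2: "(\<lambda>x. 1 - hole x) \<in> L2 M"
  using L2_diff[OF one_L2[of 1] hole_L2[OF one_L2[of 1]]] by simp

private lemma complement_norm: "L2_norm M (\<lambda>x. 1 - hole x) = sqrt h"
proof -
  have "(\<integral>x. (1 - hole x)\<^sup>2 \<partial>M) = (\<integral>x. indicator H x \<partial>M)"
    by (rule Bochner_Integration.integral_cong) (auto simp: hole_def indicator_def)
  then show ?thesis using H sets.sets_into_space[OF H] by (simp add: L2_norm_def h Int_absorb2)
qed

private lemma h_nonneg: "0 \<le> h" by (simp add: h)

private lemma c_gt: "2 < c" "\<gamma> * c = c - 2"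
proof -
  have "2 * (1 - \<gamma>) < 2 * 1" using \<gamma> by (intro mult_strict_left_mono) auto
  then show "2 < c" using \<gamma> by (simp add: c field_simps)
  show "\<gamma> * c = c - 2" using \<gamma> by (simp add: c field_simps)
qed

text \<open>Cauchy-Schwarz against the indicator of H, whose norm is sqrt h.\<close>

private lemma complement_integral:
  assumes "f \<in> L2 M"
  shows "\<bar>(\<integral>x. f x \<partial>M) - mass f\<bar> \<le> sqrt h * L2_norm M f"
proof -
  have "(\<integral>x. f x \<partial>M) - mass f = (\<integral>x. f x * (1 - hole x) \<partial>M)"
    unfolding mass_def using L2_integrable[OF assms] L2_integrable[OF hole_L2[OF assms]]
    by (subst Bochner_Integration.integral_diff[symmetric]) (auto simp: algebra_simps)
  then show ?thesis
    using L2_Cauchy_Schwarz[OF assms complement_L2] by (simp add: complement_norm mult.commute)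
qed

private lemma mass_diff:
  assumes "f \<in> L2 M" "g \<in> L2 M"
  shows "mass (\<lambda>x. f x - g x) = mass f - mass g"
  unfolding mass_def using L2_integrable[OF hole_L2] assms
  by (subst Bochner_Integration.integral_diff[symmetric]) (auto simp: algebra_simps)

private lemma mass_one: "mass (\<lambda>_. 1) = 1 - h"
  using H unfolding mass_def by (simp add: hole_def h prob_compl)

private lemma centered_L2: "\<psi> \<in> L2 M \<Longrightarrow> centered \<psi> \<in> L2 M"
  unfolding centered_def[abs_def] by (intro L2_diff hole_L2 one_L2)

private lemma centered_integral: "\<psi> \<in> L2 M \<Longrightarrow> (\<integral>x. centered \<psi> x \<partial>M) = 0"
  using L2_integrable[OF hole_L2] by (simp add: centered_def[abs_def] mass_def prob_space)

text \<open>Subtracting the mean is an orthogonal projection.\<close>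

private lemma centered_norm_le:
  assumes "u \<in> L2 M"
  shows "L2_norm M (\<lambda>x. u x - (\<integral>y. u y \<partial>M)) \<le> L2_norm M u"
  unfolding L2_norm_def using L2_centered_square[OF assms] by simp

private lemma centered_diff_norm:
  assumes "\<psi> \<in> L2 M" "\<eta> \<in> L2 M"
  shows "L2_norm M (\<lambda>x. centered \<psi> x - centered \<eta> x) \<le> L2_norm M (\<lambda>x. \<psi> x - \<eta> x)"
proof -
  have d: "(\<lambda>x. \<psi> x - \<eta> x) \<in> L2 M" using assms by (rule L2_diff)
  have "(\<lambda>x. centered \<psi> x - centered \<eta> x) = (\<lambda>x. (\<psi> x - \<eta> x) * hole x - (\<integral>y. (\<psi> y - \<eta> y) * hole y \<partial>M))"
    using mass_diff[OF assms] by (auto simp: centered_def mass_def algebra_simps)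
  then show ?thesis using centered_norm_le[OF hole_L2[OF d]] hole_norm[OF d] by simp
qed

private lemma T_hole:
  assumes "\<psi> \<in> L2 M"
  shows "AE x in M. T (\<lambda>y. \<psi> y * hole y) x = T (centered \<psi>) x + mass \<psi>"
  using linear[OF centered_L2[OF assms] one_L2[of 1], of 1 "mass \<psi>"] one
proof eventually_elim
  case (elim x)
  then show ?case by (simp add: centered_def)
qed

context
  fixes \<psi> assumes \<psi>: "\<psi> \<in> candidates"
begin

lemma candidate_L2: "\<psi> \<in> L2 M"
  and candidate_nonneg: "AE x in M. 0 \<le> \<psi> x"
    and candidate_integral: "(\<integral>x. \<psi> x \<partial>M) = 1" and candidate_norm: "L2_norm M (\<lambda>x. \<psi> x - 1) \<le> c * sqrt h"
  using \<psi> by (auto simp: candidates_def)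

text \<open>The constant 1 loses exactly the mass h. The deviation \<psi> - 1 has mean zero and norm
  at most c * sqrt h, and integrating it over the hole costs another sqrt h. The product of the two
  square roots gives order h, which becomes the linear eigenvalue bound.\<close>

lemma mass_bound: "\<bar>mass \<psi> - 1\<bar> \<le> (1 + c) * h"
proof -
  let ?f = "\<lambda>x. \<psi> x - 1"
  have f: "?f \<in> L2 M" by (intro L2_diff candidate_L2 one_L2)
  have "(\<integral>x. ?f x \<partial>M) = 0" using L2_integrable[OF candidate_L2] candidate_integral by (simp add: prob_space)
  then have "\<bar>mass \<psi> - (1 - h)\<bar> \<le> sqrt h * L2_norm M ?f"
    using complement_integral[OF f] mass_diff[OF candidate_L2 one_L2[of 1]] mass_one by simp
  also have "\<dots> \<le> sqrt h * (c * sqrt h)" by (intro mult_left_mono candidate_norm) (simp add: h_nonneg)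
  also have "\<dots> = c * h" using h_nonneg by (simp add: algebra_simps)
  finally show ?thesis using h_nonneg by (simp add: algebra_simps)
qed

text \<open>The smallness of h gives c (c + 1) h <= 1/4, and c > 2 then gives (c + 1) h <= 1/8. The
  second claim expresses that one step maps the ball of radius c * sqrt h into itself: \<gamma> (c +
  1) = c - 2 + \<gamma> stays below c - 1/4, which is at most c times the mass.\<close>

lemma mass_lower: "1 / 2 \<le> mass \<psi>" "\<gamma> * (c + 1) \<le> c * mass \<psi>" "0 < mass \<psi>"
proof -
  have 1: "c * ((1 + c) * h) \<le> 1 / 4" using h_small by (simp add: algebra_simps)
  have 2: "c * (1 - (1 + c) * h) \<le> c * mass \<psi>" using mass_bound c_gt(1) by (intro mult_left_mono) auto
  have "c * 1 \<ge> 2 * 1" "(1 + c) * h * 2 \<le> (1 + c) * h * c"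
    using c_gt(1) h_nonneg by (simp, intro mult_left_mono) simp_all
  then have 3: "(1 + c) * h \<le> 1 / 8" using 1 by (simp add: mult.commute)
  show 4: "1 / 2 \<le> mass \<psi>" using mass_bound 3 by linarith
  then show "0 < mass \<psi>" by simp
  have "c * (1 - (1 + c) * h) = c - c * ((1 + c) * h)" by (simp add: algebra_simps)
  moreover have "\<gamma> * (c + 1) = c - 2 + \<gamma>" using c_gt(2) by (simp add: algebra_simps)
  ultimately show "\<gamma> * (c + 1) \<le> c * mass \<psi>" using 1 2 \<gamma> by linarith
qed

text \<open>Up to its mean, \<open>centered \<psi>\<close> equals (\<psi> - 1) * hole - (1 - hole).
  The first term has norm at most c * sqrt h, the second has norm sqrt h, and removing the mean does
  not increase the norm.\<close>

lemma centered_norm: "L2_norm M (centered \<psi>) \<le> (c + 1) * sqrt h"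
proof -
  let ?u = "\<lambda>x. \<psi> x * hole x - 1" and ?f = "\<lambda>x. \<psi> x - 1"
  have f: "?f \<in> L2 M" by (intro L2_diff candidate_L2 one_L2)
  have u: "?u \<in> L2 M" by (intro L2_diff candidate_L2 hole_L2 one_L2)
  have "(\<integral>x. ?u x \<partial>M) = mass \<psi> - 1"
    using L2_integrable[OF hole_L2[OF candidate_L2]] by (simp add: mass_def prob_space)
  then have "centered \<psi> = (\<lambda>x. ?u x - (\<integral>y. ?u y \<partial>M))" by (auto simp: centered_def)
  then have "L2_norm M (centered \<psi>) \<le> L2_norm M ?u" using centered_norm_le[OF u] by simp
  also have "?u = (\<lambda>x. ?f x * hole x + (-1) * (1 - hole x))" by (auto simp: algebra_simps)
  also have "L2_norm M \<dots> \<le> L2_norm M (\<lambda>x. ?f x * hole x) + L2_norm M (\<lambda>x. (-1) * (1 - hole x))"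
    by (intro L2_norm_triangle hole_L2 f L2_cmult complement_L2)
  also have "L2_norm M (\<lambda>x. (-1) * (1 - hole x)) = sqrt h"
    unfolding L2_norm_cmult complement_norm by simp
  also have "L2_norm M (\<lambda>x. ?f x * hole x) \<le> c * sqrt h"
    using hole_norm[OF f] candidate_norm by linarith
  finally show ?thesis by (simp add: algebra_simps)
qed

lemma step_eq: "AE x in M. step \<psi> x - 1 = (1 / mass \<psi>) * T (centered \<psi>) x"
  using T_hole[OF candidate_L2]
proof eventually_elim
  case (elim x)
  then show ?case using mass_lower(3) by (simp add: step_def field_simps)
qed

lemma T_centered_norm: "L2_norm M (T (centered \<psi>)) \<le> \<gamma> * ((c + 1) * sqrt h)"
  using gap[OF centered_L2[OF candidate_L2] centered_integral[OF candidate_L2]] mult_left_mono[OF centered_norm, of \<gamma>] \<gamma>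
  by linarith

lemma step_L2: "step \<psi> \<in> L2 M"
  using L2_cmult[OF T_L2[OF hole_L2[OF candidate_L2]], of "1 / mass \<psi>"] by (simp add: step_def[abs_def])

lemma step_candidate: "step \<psi> \<in> candidates"
proof -
  let ?g = "\<lambda>x. (1 / mass \<psi>) * T (centered \<psi>) x"
  have g: "?g \<in> L2 M" by (intro L2_cmult T_L2 centered_L2 candidate_L2)
  have "AE x in M. 0 \<le> \<psi> x * hole x" using candidate_nonneg by eventually_elim (simp add: hole_le)
  from nonneg[OF hole_L2[OF candidate_L2] this]
  have "AE x in M. 0 \<le> step \<psi> x" by eventually_elim (use mass_lower(3) in \<open>simp add: step_def\<close>)
  moreover have "(\<integral>x. step \<psi> x \<partial>M) = 1"
    using integral[OF hole_L2[OF candidate_L2]] mass_lower(3) by (simp add: step_def[abs_def] mass_def[symmetric])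
  moreover have "L2_norm M (\<lambda>x. step \<psi> x - 1) = L2_norm M ?g"
    using step_eq by (intro L2_cong_AE(2)[OF g] borel_measurable_diff L2_measurable[OF step_L2]) auto
  moreover have "L2_norm M ?g \<le> c * sqrt h"
  proof -
    have "L2_norm M ?g = (1 / mass \<psi>) * L2_norm M (T (centered \<psi>))"
      unfolding L2_norm_cmult using mass_lower(3) by simp
    also have "\<dots> \<le> (1 / mass \<psi>) * (\<gamma> * ((c + 1) * sqrt h))"
      using mass_lower(3) by (intro mult_left_mono T_centered_norm) simp
    also have "\<dots> = (\<gamma> * (c + 1) / mass \<psi>) * sqrt h" by simp
    also have "\<dots> \<le> c * sqrt h"
      using mass_lower h_nonneg by (intro mult_right_mono) (simp_all add: field_simps)
    finally show ?thesis .
  qed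
  ultimately show ?thesis using step_L2 by (simp add: candidates_def)
qed

end

text \<open>Of the gain 1 / (c + 1) in the linear part of \<open>step\<close>, half is given up to
  absorb the change of the normalizing mass.\<close>

private definition "\<theta> = 1 - 1 / (2 * (c + 1))"

text \<open>The difference of the two steps splits in two. T (centered \<psi> - centered \<eta>) /
  mass \<psi> is contracted by \<gamma> / mass \<psi> <= c / (c + 1). In (1 / mass \<psi> - 1 / mass
  \<eta>) T (centered \<eta>) one factor sqrt h comes from the change of mass and one from the norm
  of \<open>centered \<eta>\<close>, which yields 2 c h; the assumption on h makes this at most 1 /
  (2 (c + 1)).\<close>

private lemma step_contraction:
  assumes \<psi>: "\<psi> \<in> candidates" and \<eta>: "\<eta> \<in> candidates"
  shows "L2_norm M (\<lambda>x. step \<psi> x - step \<eta> x) \<le> \<theta> * L2_norm M (\<lambda>x. \<psi> x - \<eta> x)"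
proof -
  note L = candidate_L2[OF \<psi>] candidate_L2[OF \<eta>]
  let ?a = "1 / mass \<psi>" and ?b = "1 / mass \<psi> - 1 / mass \<eta>" and ?d = "L2_norm M (\<lambda>x. \<psi> x - \<eta> x)"
  let ?v = "\<lambda>x. centered \<psi> x - centered \<eta> x"
  have v: "?v \<in> L2 M" by (intro L2_diff centered_L2 L)
  have v0: "(\<integral>x. ?v x \<partial>M) = 0"
    using L by (simp add: Bochner_Integration.integral_diff L2_integrable centered_L2 centered_integral)
  have "AE x in M. T (\<lambda>y. 1 * centered \<psi> y + (-1) * centered \<eta> y) x = 1 * T (centered \<psi>) x + (-1) * T (centered \<eta>) x"
    by (intro linear centered_L2 L)
  then have eq: "AE x in M. ?a * T ?v x + ?b * T (centered \<eta>) x = step \<psi> x - step \<eta> x"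
    using step_eq[OF \<psi>] step_eq[OF \<eta>]
  proof eventually_elim
    case (elim x)
    have "T ?v x = T (centered \<psi>) x - T (centered \<eta>) x" using elim(1) by simp
    then have "?a * T ?v x + ?b * T (centered \<eta>) x = (step \<psi> x - 1) - (step \<eta> x - 1)"
      unfolding elim(2,3) by (simp only: left_diff_distrib right_diff_distrib)
    then show ?case by simp
  qed
  have tv: "T ?v \<in> L2 M" "T (centered \<eta>) \<in> L2 M" by (intro T_L2 v centered_L2 L)+
  note m = mass_lower[OF \<psi>] mass_lower[OF \<eta>]
  have d0: "0 \<le> ?d" by simp
  have "L2_norm M (\<lambda>x. step \<psi> x - step \<eta> x) = L2_norm M (\<lambda>x. ?a * T ?v x + ?b * T (centered \<eta>) x)"
    by (intro L2_cong_AE(2)[OF _ _ eq] L2_add L2_cmult tv borel_measurable_diff L2_measurable[OF step_L2] \<psi> \<eta>)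
  also have "\<dots> \<le> L2_norm M (\<lambda>x. ?a * T ?v x) + L2_norm M (\<lambda>x. ?b * T (centered \<eta>) x)"
    by (intro L2_norm_triangle L2_cmult tv)
  also have "\<dots> = ?a * L2_norm M (T ?v) + \<bar>?b\<bar> * L2_norm M (T (centered \<eta>))"
    unfolding L2_norm_cmult using m by simp
  also have "?a * L2_norm M (T ?v) \<le> c / (c + 1) * ?d"
  proof -
    have "L2_norm M (T ?v) \<le> \<gamma> * ?d"
      using gap[OF v v0] mult_left_mono[OF centered_diff_norm[OF L], of \<gamma>] \<gamma> by linarith
    then have "?a * L2_norm M (T ?v) \<le> ?a * (\<gamma> * ?d)" using m by (intro mult_left_mono) auto
    also have "\<dots> = (\<gamma> / mass \<psi>) * ?d" by simp
    also have "\<dots> \<le> c / (c + 1) * ?d"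
      using m(2,3) c_gt(1) by (intro mult_right_mono d0) (simp add: field_simps)
    finally show ?thesis .
  qed
  also have "\<bar>?b\<bar> * L2_norm M (T (centered \<eta>)) \<le> 2 * c * h * ?d"
  proof -
    have "(\<integral>x. \<psi> x - \<eta> x \<partial>M) = 0"
      using L2_integrable L candidate_integral[OF \<psi>] candidate_integral[OF \<eta>] by simp
    then have 1: "\<bar>mass \<eta> - mass \<psi>\<bar> \<le> sqrt h * ?d"
      using complement_integral[OF L2_diff[OF L]] mass_diff[OF L] by simp
    have "?b = (mass \<eta> - mass \<psi>) / (mass \<psi> * mass \<eta>)" using m by (simp add: field_simps)
    then have b: "\<bar>?b\<bar> = \<bar>mass \<eta> - mass \<psi>\<bar> * (1 / (mass \<psi> * mass \<eta>))" using m by (simp add: abs_mult)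
    have "\<bar>?b\<bar> * L2_norm M (T (centered \<eta>)) \<le> (sqrt h * ?d * (1 / (mass \<psi> * mass \<eta>))) * (\<gamma> * ((c + 1) * sqrt h))"
      unfolding b using m 1 h_nonneg by (intro mult_mono mult_right_mono T_centered_norm[OF \<eta>]) simp_all
    also have "\<dots> = (sqrt h * sqrt h) * (\<gamma> * (c + 1) / mass \<eta>) * (1 / mass \<psi>) * ?d" by (simp add: mult_ac)
    also have "\<dots> \<le> h * c * 2 * ?d"
    proof (intro mult_right_mono mult_mono d0)
      show "sqrt h * sqrt h \<le> h" using h_nonneg by simp
      show "\<gamma> * (c + 1) / mass \<eta> \<le> c" using m(5,6) by (simp add: field_simps)
      show "1 / mass \<psi> \<le> 2" using m(1,3) by (simp add: field_simps)
    qed (use m h_nonneg c_gt(1) \<gamma> in simp_all)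
    finally show ?thesis by (simp add: mult_ac)
  qed
  also have "c / (c + 1) * ?d + 2 * c * h * ?d = (c / (c + 1) + 2 * c * h) * ?d" by (rule distrib_right[symmetric])
  also have "\<dots> \<le> \<theta> * ?d"
  proof (rule mult_right_mono[OF _ d0])
    define t where "t = 1 / (c + 1)"
    have "2 * c * h \<le> t / 2" "c / (c + 1) = 1 - t" "\<theta> = 1 - t / 2"
      using h_small c_gt(1) by (simp_all add: t_def \<theta>_def field_simps)
    then show "c / (c + 1) + 2 * c * h \<le> \<theta>" by linarith
  qed
  finally show ?thesis by simp
qed

private lemma \<theta>_bounds: "0 \<le> \<theta>" "\<theta> < 1"
  using c_gt(1) by (simp_all add: \<theta>_def field_simps)

private definition "iterate n = (step ^^ n) (\<lambda>_. 1)"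

private lemma iterate_Suc: "iterate (Suc n) = step (iterate n)"
  by (simp add: iterate_def)

private lemma iterate_candidate: "iterate n \<in> candidates"
proof (induction n)
  case 0
  show ?case using c_gt(1) h_nonneg one_L2[of 1] by (simp add: iterate_def candidates_def L2_norm_def prob_space)
qed (simp add: iterate_Suc step_candidate)

text \<open>Banach iteration from the constant 1, for functions instead of classes. Nonnegativity
  passes to the almost everywhere limit, the mean and the radius to the limit in L2; the contraction
  property then makes the limit fixed almost everywhere.\<close>

private lemma candidates_fixed_point: "\<exists>\<psi>\<in>candidates. AE x in M. step \<psi> x = \<psi> x"
proof -
  let ?F = iterate
  define K where "K = L2_norm M (\<lambda>x. ?F (Suc 0) x - ?F 0 x)"
  have F: "?F n \<in> L2 M" for n using candidate_L2[OF iterate_candidate] .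
  have diff: "L2_norm M (\<lambda>x. ?F (Suc n) x - ?F n x) \<le> K * \<theta> ^ n" for n
  proof (induction n)
    case 0
    show ?case by (simp add: K_def)
  next
    case (Suc n)
    have "L2_norm M (\<lambda>x. ?F (Suc (Suc n)) x - ?F (Suc n) x) \<le> \<theta> * L2_norm M (\<lambda>x. ?F (Suc n) x - ?F n x)"
      using step_contraction[OF iterate_candidate iterate_candidate, of "Suc n" n] by (simp only: iterate_Suc)
    also have "\<dots> \<le> \<theta> * (K * \<theta> ^ n)" by (rule mult_left_mono[OF Suc \<theta>_bounds(1)])
    finally show ?case by (simp add: mult_ac)
  qed
  have sm: "summable (\<lambda>n. K * \<theta> ^ n)" using \<theta>_bounds by (intro summable_mult summable_geometric) simp
  obtain \<psi> where \<psi>: "\<psi> \<in> L2 M" "AE x in M. (\<lambda>n. ?F n x) \<longlonglongrightarrow> \<psi> x"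
    and near: "\<And>n. L2_norm M (\<lambda>x. ?F n x - \<psi> x) \<le> (\<Sum>k. K * \<theta> ^ (k + n))"
    using L2_complete[OF F diff sm] by blast
  define e where "e n = (\<Sum>k. K * \<theta> ^ (k + n))" for n
  have e: "e \<longlonglongrightarrow> 0" unfolding e_def[abs_def] using suminf_exist_split2[OF sm] .
  have near: "L2_norm M (\<lambda>x. ?F n x - \<psi> x) \<le> e n" for n using near by (simp add: e_def)
  have cand: "\<psi> \<in> candidates"
  proof -
    have "AE x in M. \<forall>n. 0 \<le> ?F n x"
      unfolding AE_all_countable using candidate_nonneg[OF iterate_candidate] by blast
    with \<psi>(2) have "AE x in M. 0 \<le> \<psi> x"
      by eventually_elim (rule LIMSEQ_le_const, auto)
    moreover have "(\<integral>x. \<psi> x \<partial>M) = 1"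
    proof -
      have "\<bar>1 - (\<integral>x. \<psi> x \<partial>M)\<bar> \<le> e n" for n
        using L2_integral_le[OF L2_diff[OF F[of n] \<psi>(1)]] near[of n] L2_integrable[OF F[of n]] L2_integrable[OF \<psi>(1)]
          candidate_integral[OF iterate_candidate[of n]] by simp
      then have "\<bar>1 - (\<integral>x. \<psi> x \<partial>M)\<bar> \<le> 0" by (intro LIMSEQ_le_const[OF e]) auto
      then show ?thesis by simp
    qed
    moreover have "L2_norm M (\<lambda>x. \<psi> x - 1) \<le> c * sqrt h + 0"
    proof (rule LIMSEQ_le_const[OF tendsto_add[OF tendsto_const e]], intro exI allI impI)
      fix n
      show "L2_norm M (\<lambda>x. \<psi> x - 1) \<le> c * sqrt h + e n"
        using L2_norm_diff_triangle[OF \<psi>(1) F[of n] one_L2[of 1]] near[of n] candidate_norm[OF iterate_candidate[of n]]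
        unfolding L2_norm_minus_commute[of M \<psi>] by linarith
    qed
    ultimately show ?thesis using \<psi>(1) by (simp add: candidates_def)
  qed
  have "L2_norm M (\<lambda>x. step \<psi> x - \<psi> x) \<le> \<theta> * 0 + 0"
  proof (rule LIMSEQ_le_const[OF tendsto_add[OF tendsto_mult_left[OF e] LIMSEQ_Suc[OF e]]], intro exI allI impI)
    fix n
    have "L2_norm M (\<lambda>x. step \<psi> x - \<psi> x) \<le>
        L2_norm M (\<lambda>x. step \<psi> x - ?F (Suc n) x) + L2_norm M (\<lambda>x. ?F (Suc n) x - \<psi> x)"
      by (intro L2_norm_diff_triangle step_L2 cand F \<psi>)
    moreover have "L2_norm M (\<lambda>x. step \<psi> x - ?F (Suc n) x) \<le> \<theta> * L2_norm M (\<lambda>x. \<psi> x - ?F n x)"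
      unfolding iterate_Suc by (rule step_contraction[OF cand iterate_candidate])
    moreover have "\<theta> * L2_norm M (\<lambda>x. \<psi> x - ?F n x) \<le> \<theta> * e n"
      unfolding L2_norm_minus_commute[of M \<psi>] by (rule mult_left_mono[OF near \<theta>_bounds(1)])
    ultimately show "L2_norm M (\<lambda>x. step \<psi> x - \<psi> x) \<le> \<theta> * e n + e (Suc n)" using near[of "Suc n"] by linarith
  qed
  then have "L2_norm M (\<lambda>x. step \<psi> x - \<psi> x) = 0" using L2_norm_nonneg[of M "\<lambda>x. step \<psi> x - \<psi> x"] by linarith
  then have "(\<integral>x. (step \<psi> x - \<psi> x)\<^sup>2 \<partial>M) = 0" by (simp add: L2_norm_def)
  then have "AE x in M. (step \<psi> x - \<psi> x)\<^sup>2 = 0"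
    using integral_nonneg_eq_0_iff_AE[OF L2_square_integrable[OF L2_diff[OF step_L2[OF cand] \<psi>(1)]]] by simp
  then have "AE x in M. step \<psi> x = \<psi> x" by eventually_elim simp
  with cand show ?thesis by blast
qed

text \<open>The eigenvalue l is the surviving mass of \<psi>, because one step divides by it. The
  function w is \<open>centered \<psi>\<close>; it is exported to show that \<psi> - 1 is a multiple
  of an image under T, where derivatives are available.\<close>

lemma quasi_stationary_fixed_point:
  "\<exists>\<psi> l w. \<psi> \<in> L2 M \<and> (AE x in M. 0 \<le> \<psi> x) \<and> (\<integral>x. \<psi> x \<partial>M) = 1 \<and>
    L2_norm M (\<lambda>x. \<psi> x - 1) \<le> c * sqrt h \<and> 1 / 2 \<le> l \<and> \<bar>l - 1\<bar> \<le> (1 + c) * h \<and>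
    (AE x in M. T (\<lambda>y. \<psi> y * indicator (space M - H) y) x = l * \<psi> x) \<and>
    w \<in> L2 M \<and> L2_norm M w \<le> (c + 1) * sqrt h \<and> (AE x in M. (1 / l) * T w x = \<psi> x - 1)"
proof -
  obtain \<psi> where \<psi>: "\<psi> \<in> candidates" and fix_pt: "AE x in M. step \<psi> x = \<psi> x"
    using candidates_fixed_point by blast
  have 1: "AE x in M. T (\<lambda>y. \<psi> y * indicator (space M - H) y) x = mass \<psi> * \<psi> x"
    using fix_pt
  proof eventually_elim
    case (elim x)
    then show ?case using mass_lower(3)[OF \<psi>] by (simp add: step_def hole_def field_simps)
  qed
  have 2: "AE x in M. (1 / mass \<psi>) * T (centered \<psi>) x = \<psi> x - 1"
    using fix_pt step_eq[OF \<psi>] by eventually_elim simp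
  show ?thesis
    by (intro exI[of _ \<psi>] exI[of _ "mass \<psi>"] exI[of _ "centered \<psi>"] conjI candidate_L2 candidate_nonneg
        candidate_integral candidate_norm mass_lower(1) mass_bound centered_norm centered_L2 \<psi> 1 2)
qed

end

end


section \<open>Quasi-stationary densities\<close>

context smoothing_chain
begin

text \<open>\<open>weak_gradient\<close> is an arbitrary choice. By uniqueness it agrees almost
  everywhere with the gradient g at hand, so the norm can be computed from g.\<close>

lemma W12_weak_gradient:
  assumes f: "f \<in> L2 (power_measure \<mu> N)" and g: "has_weak_gradient N f g"
    and int: "\<And>i. i < N \<Longrightarrow> integrable (power_measure \<mu> N) (\<lambda>x. (g i x)\<^sup>2)"
    and B: "(\<Sum>i<N. \<integral>x. (g i x)\<^sup>2 \<partial>power_measure \<mu> N) \<le> B\<^sup>2" "0 \<le> B"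
  shows "f \<in> W12 \<mu> N" "W12_norm \<mu> N f \<le> L2_norm (power_measure \<mu> N) f + B"
proof -
  let ?M = "power_measure \<mu> N"
  have w: "has_weak_gradient N f (weak_gradient N f)"
    unfolding weak_gradient_def by (rule someI[of "has_weak_gradient N f", OF g])
  have meas: "weak_gradient N f i \<in> borel_measurable ?M" if "i < N" for i
    using w that unfolding measurable_power by (auto simp: has_weak_gradient_def)
  have "AE x in ?M. \<forall>i\<in>{..<N}. weak_gradient N f i x = g i x"
    unfolding AE_power_iff using weak_gradient_unique[OF w g] by (intro AE_finite_allI) auto
  then have ae: "AE x in ?M. (\<Sum>i<N. (g i x)\<^sup>2) = (gradient_norm N f x)\<^sup>2"
  proof eventually_elim
    case (elim x)
    then show ?case by (simp add: gradient_norm_def L2_set_def sum_nonneg)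
  qed
  have gm: "gradient_norm N f \<in> borel_measurable ?M"
    unfolding gradient_norm_def[abs_def] L2_set_def using meas
    by (intro measurable_compose[OF _ borel_measurable_sqrt] borel_measurable_sum borel_measurable_power) auto
  have sum: "integrable ?M (\<lambda>x. \<Sum>i<N. (g i x)\<^sup>2)" using int by (intro Bochner_Integration.integrable_sum) auto
  have sq: "integrable ?M (\<lambda>x. (gradient_norm N f x)\<^sup>2)"
    using ae by (intro integrable_cong_AE_imp[OF sum] borel_measurable_power gm) auto
  have "(\<integral>x. (gradient_norm N f x)\<^sup>2 \<partial>?M) = (\<integral>x. (\<Sum>i<N. (g i x)\<^sup>2) \<partial>?M)"
    using ae by (intro integral_cong_AE borel_measurable_integrable sum sq) auto
  also have "\<dots> = (\<Sum>i<N. \<integral>x. (g i x)\<^sup>2 \<partial>?M)" using int by (intro Bochner_Integration.integral_sum) auto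
  finally have "(\<integral>x. (gradient_norm N f x)\<^sup>2 \<partial>?M) \<le> B\<^sup>2" using B(1) by simp
  then have "L2_norm ?M (gradient_norm N f) \<le> B" using B(2) by (simp add: L2_norm_le_iff)
  then show "W12_norm \<mu> N f \<le> L2_norm ?M f + B" by (simp add: W12_norm_def)
  show "f \<in> W12 \<mu> N" using f g gm sq unfolding W12_def by (auto intro: L2I)
qed

text \<open>In K the factor C / sqrt (1 - \<gamma>^2) is the gradient constant of
  \<open>T_bounds\<close> and 2 bounds 1 / l. In the final constant the summand c comes from the
  norm of \<psi> - 1, and the factor c + 1 next to K from the norm of w.\<close>

lemma quasi_stationary_density_near_one:
  fixes N H
  defines "c \<equiv> 2 / (1 - \<gamma>)" and "h \<equiv> measure (power_measure \<mu> N) H"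
    and "K \<equiv> 2 * (C / sqrt (1 - \<gamma>\<^sup>2))"
  assumes H: "H \<in> sets (torus N)" and h: "4 * (c * (c + 1) * h) \<le> 1"
  shows "\<exists>\<psi> l. quasi_stationary_density p \<mu> N H \<psi> l \<and> (\<lambda>x. \<psi> x - 1) \<in> W12 \<mu> N \<and>
    W12_norm \<mu> N (\<lambda>x. \<psi> x - 1) \<le> (c + K * (c + 1)) * sqrt h \<and> \<bar>l - 1\<bar> \<le> (1 + c) * h"
proof -
  let ?M = "power_measure \<mu> N"
  interpret M: prob_space ?M by (rule prob_space_power)
  have HM: "H \<in> sets ?M" using H by (simp add: sets_power)
  \<comment> \<open>For mean zero the second term of \<open>T_bounds(2)\<close> vanishes, so N
    copies have the same gap \<gamma> as one.\<close>
  have gapN: "L2_norm ?M (T N f) \<le> \<gamma> * L2_norm ?M f" if f: "f \<in> L2 ?M" and f0: "(\<integral>x. f x \<partial>?M) = 0" for f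
    using T_bounds(2)[OF f] gamma(1) unfolding f0
    by (subst L2_norm_le_iff) (simp_all add: power_mult_distrib L2_norm_power2)
  have "\<exists>\<psi> l w. \<psi> \<in> L2 ?M \<and> (AE x in ?M. 0 \<le> \<psi> x) \<and> (\<integral>x. \<psi> x \<partial>?M) = 1 \<and>
    L2_norm ?M (\<lambda>x. \<psi> x - 1) \<le> c * sqrt h \<and> 1 / 2 \<le> l \<and> \<bar>l - 1\<bar> \<le> (1 + c) * h \<and>
    (AE x in ?M. T N (\<lambda>y. \<psi> y * indicator (space ?M - H) y) x = l * \<psi> x) \<and>
    w \<in> L2 ?M \<and> L2_norm ?M w \<le> (c + 1) * sqrt h \<and> (AE x in ?M. (1 / l) * T N w x = \<psi> x - 1)"
  proof (rule M.quasi_stationary_fixed_point[where T="T N" and \<gamma>=\<gamma> and c=c and h=h and H=H])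
    show "AE x in ?M. T N (\<lambda>y. a * f y + b * g y) x = a * T N f x + b * T N g x" if "f \<in> L2 ?M" "g \<in> L2 ?M" for f g a b
      using that by (intro T_linear M.L2_integrable)
    show "AE x in ?M. 0 \<le> T N f x" if "f \<in> L2 ?M" "AE x in ?M. 0 \<le> f x" for f
      by (rule T_nonneg[OF M.L2_integrable[OF that(1)] that(2)])
    show "(\<integral>x. T N f x \<partial>?M) = (\<integral>x. f x \<partial>?M)" if "f \<in> L2 ?M" for f
      by (rule T_integral[OF M.L2_integrable[OF that]])
  qed (fact T_const T_bounds(1) gapN gamma c_def[THEN meta_eq_to_obj_eq] h_def[THEN meta_eq_to_obj_eq] HM h)+
  then obtain \<psi> l w where \<psi>: "\<psi> \<in> L2 ?M" "AE x in ?M. 0 \<le> \<psi> x" "(\<integral>x. \<psi> x \<partial>?M) = 1"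
    and near: "L2_norm ?M (\<lambda>x. \<psi> x - 1) \<le> c * sqrt h" and l: "1 / 2 \<le> l" "\<bar>l - 1\<bar> \<le> (1 + c) * h"
    and eig: "AE x in ?M. T N (\<lambda>y. \<psi> y * indicator (space ?M - H) y) x = l * \<psi> x"
    and w: "w \<in> L2 ?M" "L2_norm ?M w \<le> (c + 1) * sqrt h" and Tw: "AE x in ?M. (1 / l) * T N w x = \<psi> x - 1"
    by blast
  obtain g where g: "has_weak_gradient N (T N w) g" "\<And>i. i < N \<Longrightarrow> integrable ?M (\<lambda>x. (g i x)\<^sup>2)"
    "(\<Sum>i<N. \<integral>x. (g i x)\<^sup>2 \<partial>?M) \<le> C\<^sup>2 / (1 - \<gamma>\<^sup>2) * (\<integral>x. (w x)\<^sup>2 \<partial>?M)"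
    using T_bounds(3)[OF w(1)] by blast
  have qsd: "quasi_stationary_density p \<mu> N H \<psi> l"
    using \<psi> l(1) eig M.L2_integrable[OF \<psi>(1)]
    by (simp add: quasi_stationary_density_def transfer_op_hole_def space_power)
  have \<gamma>2: "0 < 1 - \<gamma>\<^sup>2" using gamma by (simp add: power_less_one_iff)
  have f: "(\<lambda>x. \<psi> x - 1) \<in> L2 ?M" by (intro L2_diff \<psi> L2_const M.finite_measure_axioms)
  have grad: "has_weak_gradient N (\<lambda>x. \<psi> x - 1) (\<lambda>i x. (1 / l) * g i x)"
  proof (rule has_weak_gradient_cong)
    show "has_weak_gradient N (\<lambda>x. (1 / l) * T N w x) (\<lambda>i x. (1 / l) * g i x)"
      using has_weak_gradient_linear[OF g(1) has_weak_gradient_zero, of "1 / l" 0] by simp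
    show "(\<lambda>x. \<psi> x - 1) \<in> borel_measurable (torus N)" using L2_measurable[OF f] unfolding measurable_power .
    show "AE x in torus N. (1 / l) * T N w x = \<psi> x - 1" using Tw unfolding AE_power_iff .
  qed
  have int: "integrable ?M (\<lambda>x. ((1 / l) * g i x)\<^sup>2)" if "i < N" for i
    unfolding power_mult_distrib by (intro integrable_mult_right g(2) that)
  let ?B = "K * ((c + 1) * sqrt h)"
  have c0: "0 < c" using gamma by (simp add: c_def)
  have B0: "0 \<le> ?B" using c0 C_pos \<gamma>2 by (simp add: K_def h_def)
  have bound: "(\<Sum>i<N. \<integral>x. ((1 / l) * g i x)\<^sup>2 \<partial>?M) \<le> ?B\<^sup>2"
  proof -
    have "(\<Sum>i<N. \<integral>x. ((1 / l) * g i x)\<^sup>2 \<partial>?M) = (1 / l)\<^sup>2 * (\<Sum>i<N. \<integral>x. (g i x)\<^sup>2 \<partial>?M)"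
      unfolding power_mult_distrib sum_distrib_left by simp
    also have "\<dots> \<le> 2\<^sup>2 * (C\<^sup>2 / (1 - \<gamma>\<^sup>2) * ((c + 1) * sqrt h)\<^sup>2)"
    proof (rule mult_mono)
      show "(1 / l)\<^sup>2 \<le> 2\<^sup>2" using l(1) by (intro power_mono) (simp_all add: field_simps)
      have "(\<integral>x. (w x)\<^sup>2 \<partial>?M) \<le> ((c + 1) * sqrt h)\<^sup>2"
        using w(2) unfolding L2_norm_power2[symmetric] by (intro power_mono) auto
      then have "C\<^sup>2 / (1 - \<gamma>\<^sup>2) * (\<integral>x. (w x)\<^sup>2 \<partial>?M) \<le> C\<^sup>2 / (1 - \<gamma>\<^sup>2) * ((c + 1) * sqrt h)\<^sup>2"
        using \<gamma>2 by (intro mult_left_mono) simp_all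
      with g(3) show "(\<Sum>i<N. \<integral>x. (g i x)\<^sup>2 \<partial>?M) \<le> C\<^sup>2 / (1 - \<gamma>\<^sup>2) * ((c + 1) * sqrt h)\<^sup>2" by linarith
    qed (simp_all add: sum_nonneg)
    also have "\<dots> = ?B\<^sup>2" using \<gamma>2 by (simp add: K_def power_mult_distrib power_divide)
    finally show ?thesis .
  qed
  have "W12_norm \<mu> N (\<lambda>x. \<psi> x - 1) \<le> L2_norm ?M (\<lambda>x. \<psi> x - 1) + ?B"
    by (rule W12_weak_gradient(2)[OF f grad int bound B0])
  with near have W: "W12_norm \<mu> N (\<lambda>x. \<psi> x - 1) \<le> (c + K * (c + 1)) * sqrt h" by (simp add: algebra_simps)
  show ?thesis
    using qsd W12_weak_gradient(1)[OF f grad int bound B0] W l(2) by blast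
qed

end

theorem theorem2p2:
  fixes p :: "real \<Rightarrow> real measure" and \<mu> :: "real measure"
    and H :: "nat \<Rightarrow> (nat \<Rightarrow> real) set"
  assumes kernel: "p \<in> circle \<rightarrow>\<^sub>M prob_algebra circle"
    and stat: "stationary p \<mu>"
    and equiv: "absolutely_continuous circle \<mu>" "absolutely_continuous \<mu> circle"
    and gap: "\<exists>\<gamma>. 0 < \<gamma> \<and> \<gamma> < 1 \<and>
      (\<forall>\<phi>\<in>L2 \<mu>. (\<integral>x. \<phi> x \<partial>\<mu>) = 0 \<longrightarrow>
         transfer_op p \<mu> \<phi> \<in> L2 \<mu> \<and> L2_norm \<mu> (transfer_op p \<mu> \<phi>) \<le> \<gamma> * L2_norm \<mu> \<phi>)"
    and regular: "\<exists>C>0. \<forall>\<phi>\<in>L2 \<mu>. transfer_op p \<mu> \<phi> \<in> L2 \<mu> \<and>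
      (\<exists>g. has_weak_deriv (transfer_op p \<mu> \<phi>) g \<and> g \<in> L2 \<mu> \<and> L2_norm \<mu> g \<le> C * L2_norm \<mu> \<phi>)"
    and holes: "\<And>N. N \<ge> 1 \<Longrightarrow> H N \<in> sets (torus N)"
    and small: "(\<lambda>N. measure (power_measure \<mu> N) (H N)) \<longlonglongrightarrow> 0"
  shows "\<exists>(N0::nat) (D0::real). D0 > 0 \<and> (\<forall>N\<ge>N0. \<exists>\<psi> l.
      quasi_stationary_density p \<mu> N (H N) \<psi> l \<and>
      (\<lambda>x. \<psi> x - 1) \<in> W12 \<mu> N \<and>
      W12_norm \<mu> N (\<lambda>x. \<psi> x - 1) \<le> D0 * sqrt (measure (power_measure \<mu> N) (H N)) \<and>
      \<bar>l - 1\<bar> \<le> (1 + D0) * measure (power_measure \<mu> N) (H N))"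
proof -
  obtain \<gamma> where \<gamma>: "0 < \<gamma>" "\<gamma> < 1" and g: "\<And>\<phi>. \<phi> \<in> L2 \<mu> \<Longrightarrow> (\<integral>x. \<phi> x \<partial>\<mu>) = 0 \<Longrightarrow>
      L2_norm \<mu> (transfer_op p \<mu> \<phi>) \<le> \<gamma> * L2_norm \<mu> \<phi>"
    using gap by blast
  obtain C where C: "0 < C" and r: "\<And>\<phi>. \<phi> \<in> L2 \<mu> \<Longrightarrow> transfer_op p \<mu> \<phi> \<in> L2 \<mu>"
    "\<And>\<phi>. \<phi> \<in> L2 \<mu> \<Longrightarrow> \<exists>g. has_weak_deriv (transfer_op p \<mu> \<phi>) g \<and> g \<in> L2 \<mu> \<and> L2_norm \<mu> g \<le> C * L2_norm \<mu> \<phi>"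
    using regular by blast
  have st: "prob_space \<mu>" "sets \<mu> = sets circle" "\<mu> \<bind> p = \<mu>" using stat by (auto simp: stationary_def)
  \<comment> \<open>The kernel is given over the Lebesgue circle, while the locale takes it over
    \<mu>; both have the same sigma-algebra.\<close>
  have "prob_algebra \<mu> = prob_algebra circle"
    unfolding prob_algebra_def subprob_algebra_cong[OF st(2)] ..
  then have p: "p \<in> \<mu> \<rightarrow>\<^sub>M prob_algebra \<mu>" using kernel unfolding measurable_cong_sets[OF st(2) refl] by simp
  interpret smoothing_chain p \<mu> \<gamma> C
    by (intro smoothing_chain.intro stationary_kernel.intro stationary_kernel_axioms.intro smoothing_chain_axioms.intro
        st p equiv \<gamma> C g[unfolded transfer_op_eq] r[unfolded transfer_op_eq])
  define c K D0 where "c = 2 / (1 - \<gamma>)" "K = 2 * (C / sqrt (1 - \<gamma>\<^sup>2))" "D0 = c + K * (c + 1)"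
  have c: "0 < c" using \<gamma> by (simp add: c_K_D0_def)
  have K: "0 \<le> K" using \<gamma> C by (simp add: c_K_D0_def power_le_one)
  \<comment> \<open>The threshold is the smallness condition of the fixed point solved for h. It
    depends on \<gamma> only.\<close>
  have "0 < 1 / (4 * (c * (c + 1)))" using c by simp
  from order_tendstoD(2)[OF small this]
  obtain N1 where N1: "\<And>N. N1 \<le> N \<Longrightarrow> measure (power_measure \<mu> N) (H N) < 1 / (4 * (c * (c + 1)))"
    by (auto simp: eventually_sequentially)
  show ?thesis
  \<comment> \<open>The maximum with 1 is taken because the holes are assumed measurable from N = 1
    on.\<close>
  proof (intro exI[of _ "max 1 N1"] exI[of _ D0] conjI allI impI)
    have le: "c \<le> D0" using c K by (simp add: c_K_D0_def(3))
    then show "0 < D0" using c by simp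
    fix N assume N: "max 1 N1 \<le> N"
    let ?h = "measure (power_measure \<mu> N) (H N)"
    have "?h * (4 * (c * (c + 1))) < 1"
      using N1[of N] N c by (subst pos_less_divide_eq[symmetric]) auto
    then have "4 * (c * (c + 1) * ?h) \<le> 1" by (intro less_imp_le) (simp only: mult_ac)
    from quasi_stationary_density_near_one[OF holes, of N, folded c_K_D0_def(1,2), OF _ this]
    obtain \<psi> l where 1: "quasi_stationary_density p \<mu> N (H N) \<psi> l" "(\<lambda>x. \<psi> x - 1) \<in> W12 \<mu> N"
      "W12_norm \<mu> N (\<lambda>x. \<psi> x - 1) \<le> D0 * sqrt ?h" and l: "\<bar>l - 1\<bar> \<le> (1 + c) * ?h"
      using N unfolding c_K_D0_def(3) by auto
    \<comment> \<open>The eigenvalue bound holds with the smaller constant c; it is relaxed to D0 so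
      that one constant serves both estimates.\<close>
    have "(1 + c) * ?h \<le> (1 + D0) * ?h" using le by (intro mult_right_mono) auto
    with l have "\<bar>l - 1\<bar> \<le> (1 + D0) * ?h" by linarith
    with 1 show "\<exists>\<psi> l. quasi_stationary_density p \<mu> N (H N) \<psi> l \<and> (\<lambda>x. \<psi> x - 1) \<in> W12 \<mu> N \<and>
      W12_norm \<mu> N (\<lambda>x. \<psi> x - 1) \<le> D0 * sqrt ?h \<and> \<bar>l - 1\<bar> \<le> (1 + D0) * ?h" by blast
  qed
qed

end
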